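(* Suppose that the sequence of base structures $(\mathcal{B}_n : n \in \mathbb{N}^+)$ satisfies the following: (1) $\lim_{n\to\infty}|B_n| = \infty$; (2) there is $\Delta \in \mathbb{N}$ such that every $\mathcal{B}_n$ has (Gaifman) degree at most $\Delta$; (3) there is a polynomial $P$ with $|B_n| \leq P(n)$ for all $n$; (4) for every $\lambda \in \mathbb{N}$ and every complete $(\tau,\lambda)$-neighbourhood type $p(x_1,\ldots,x_k)$ all of whose variables lie in one $\sim_p$-class, either there is $m_p$ with $|p(\mathcal{B}_n)| \leq m_p$ for all $n$, or there is $f_p:\mathbb{N}\to\mathbb{R}$ with $\lim_{n\to\infty}(f_p(n)-\alpha\ln n)=\infty$ for all $\alpha\in\mathbb{R}$ and $|p(\mathcal{B}_n)| \geq f_p(n)$ for all sufficiently large $n$. Suppose that for every $R \in \sigma \setminus \tau$ and every subformula of $\theta_R$ of the form \[ F\big(\varphi_1(\bar{y}, \bar{z}), \ldots, \varphi_m(\bar{y}, \bar{z}) : \bar{z} : \chi_1(\bar{y}, \bar{z}), \ldots, \chi_m(\bar{y}, \bar{z})\big) \] it holds that, for all $i = 1, \ldots, m$, $\chi_i(\bar{y}, \bar{z})$ is a strongly $\bar{z}$-unbounded and $\bar{z}$-positive $(\sigma, 0)$-closure type and $F$ is continuous. Let $\varphi(\bar{x}) \in PLA^*(\sigma)$ and suppose that for every subformula of $\varphi(\bar{x})$ of the form $F\big(\varphi_1(\bar{y}, \bar{z}), \ldots, \varphi_m(\bar{y}, \bar{z}) : \bar{z} : \chi_1(\bar{y}, \bar{z}),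 \ldots, \chi_m(\bar{y}, \bar{z})\big)$ it likewise holds that each $\chi_i(\bar{y}, \bar{z})$ is a strongly $\bar{z}$-unbounded and $\bar{z}$-positive $(\sigma, 0)$-closure type and $F$ is continuous. Then: (i) $\varphi(\bar{x})$ is asymptotically equivalent to a $(\sigma, 0)$-basic formula. (ii) For every complete $(\tau, 0)$-closure type $p(\bar{x})$ there are $k \in \mathbb{N}^+$, $c_1, \ldots, c_k \in [0, 1]$, and $\beta_1, \ldots, \beta_k \in [0, 1]$ such that for every $\varepsilon > 0$ there is $n_0$ such that if $n \geq n_0$ and $\mathcal{B}_n \models p(\bar{a})$ then \begin{align*} &\mathbb{P}_n \Big( \big\{ \mathcal{A} \in \mathbf{W}_n : \mathcal{A}(\varphi(\bar{a})) \in \bigcup_{i = 1}^k [c_i - \varepsilon, c_i + \varepsilon] \big\}\Big) \geq 1 - \varepsilon \text{ and, for all $i = 1, \ldots, k$,} \\ &\mathbb{P}_n\big(\{\mathcal{A} \in \mathbf{W}_n : \mathcal{A}(\varphi(\bar{a})) \in [c_i - \varepsilon, c_i + \varepsilon] \}\big) \in [\beta_i - \varepsilon, \beta_i + \varepsilon]. \end{align*}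
   Context: $\tau \subseteq \sigma$ are finite relational signatures. $(\mathcal{B}_n : n \in \mathbb{N}^+)$ is a sequence of finite $\tau$-structures (base structures) with domains $B_n$. $\mathbf{W}_n$ is the set of all $\sigma$-structures expanding $\mathcal{B}_n$. A $PLA^*(\sigma)$-network based on $\tau$ consists of a DAG with vertex set $\sigma\setminus\tau$ and, for each $R \in \sigma\setminus\tau$ of arity $k_R$, a formula $\theta_R(\bar{x}) \in PLA^*(\mathrm{par}(R)\cup\tau)$ ($\mathrm{par}(R)$ the parents of $R$); $\mathbb{P}_n$ is the induced distribution $\mathbb{P}_n(\mathcal{A}) = \prod_{R}\prod_{\bar{a}\in R^{\mathcal{A}}}\mathcal{A}(\theta_R(\bar{a}))\prod_{\bar{a}\notin R^{\mathcal{A}}}(1-\mathcal{A}(\theta_R(\bar{a})))$ on $\mathbf{W}_n$. $PLA^*(\sigma)$ is the $[0,1]$-valued logic with continuous connectives and aggregations $F(\varphi_1,\ldots,\varphi_m : \bar{y} : \chi_1,\ldots,\chi_m)$, where $F$ aggregates the values of $\varphi_i$ over tuples $\bar{y}$ with $\chi_i$ true (value 0 if some such set is empty). Distances are in the Gaifman graph of the $\tau$-reduct; an element is $\lambda$-rare if its complete $(\tau,\lambda)$-neighbourhood type has boundedly many realizations in all $\mathcal{B}_n$; the $\lambda$-closure of $\bar{a}$ is the $\lambda$-neighbourhood of $\bar{a}$ together with all $\lambda$-rare elements; a (complete) $(\sigma,\lambda)$-closure type describes (completely) the structure on the $\lambda$-closure. $x_i\sim_p x_j$ is the transitive closure of "$p$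 implies $\mathrm{dist}(x_i,x_j)\le 2\lambda$". A complete closure type $p(\bar{x},\bar{y})$ is strongly $\bar{y}$-unbounded if for every subsequence $\bar{y}'$ of $\bar{y}$, the restriction of $p$ to $\bar{x}\bar{y}'$ is uniformly $\bar{y}'$-unbounded (cofinally satisfiable and, whenever nonempty, the number of realizations of $\bar{y}'$ over any $\bar{a}$ is at least $f(n)$ with $f(n)-\alpha\ln n\to\infty$ for all $\alpha>0$); for $\sigma$-types this refers to the $\tau$-restriction. A $(\sigma,\lambda)$-closure type $p(\bar{x},\bar{y})$ is $\bar{y}$-positive if $p\upharpoonright\tau$ is cofinally satisfiable and for some $\gamma$, for every complete $(\sigma,\gamma)$-closure type $q(\bar{x})$ with $p\wedge q$ cofinally satisfiable, the triple $(p, p\upharpoonright\tau, q)$ is $\alpha$-balanced for some $\alpha>0$ (i.e. with probability tending to 1, for all $\bar{a}$ satisfying $q$, the proportion of $\bar{b}$ satisfying $p$ among those satisfying $p\upharpoonright\tau$ is within $\varepsilon$ of $\alpha$). A $(\sigma,\lambda)$-basic formula is $\bigwedge_{i=1}^k(\varphi_i(\bar{x})\to c_i)$ with $c_i\in[0,1]$ and each $\varphi_i$ a complete $(\sigma,\lambda_i)$-closure type, $\lambda_i\le\lambda$. Two formulas are asymptotically equivalent if for every $\varepsilon>0$ the probability that some tuple gives values differing by more than $\varepsilon$ tends to 0. An aggregation function is continuous if it is ct-continuous with respect to all parameters (e.g. arithmetic mean, geometric mean).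
   Formalization: In (ii) the second line (probability of [c_i−ε, c_i+ε] lying in [β_i−ε, β_i+ε]) is claimed only for all ε below some ε_0>0 depending on p, c, β, since for large ε the intervals overlap and the literal claim fails; the first line is kept for every ε>0. *)

theory Defs
  imports "HOL-Analysis.Analysis" "HOL-Computational_Algebra.Polynomial" "HOL-Library.Multiset"
begin

section \<open>Finite relational structures\<close>

record ('a, 'r) struc =
  dom :: "'a set"
  rel :: "'r \<Rightarrow> 'a list set"

definition tuples :: "'a set \<Rightarrow> nat \<Rightarrow> 'a list set" where
  "tuples D k = {as. length as = k \<and> set as \<subseteq> D}"

text \<open>Symbols outside the signature are interpreted by the empty set, so that distinct records are
  distinct structures and the set of expansions of a finite structure is finite.\<close>

definition is_struc :: "('r \<Rightarrow> nat) \<Rightarrow> 'r set \<Rightarrow> ('a, 'r) struc \<Rightarrow> bool" where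
  "is_struc ar \<rho> A \<longleftrightarrow> finite (dom A) \<and>
     (\<forall>R\<in>\<rho>. rel A R \<subseteq> tuples (dom A) (ar R)) \<and> (\<forall>R. R \<notin> \<rho> \<longrightarrow> rel A R = {})"

definition induced :: "('a, 'r) struc \<Rightarrow> 'a set \<Rightarrow> ('a, 'r) struc" where
  "induced A S = \<lparr>dom = dom A \<inter> S, rel = (\<lambda>R. {xs \<in> rel A R. set xs \<subseteq> S})\<rparr>"

text \<open>\<open>f\<close> is an isomorphism between the \<open>\<rho>\<close>-reducts of \<open>D\<close> and \<open>A\<close> that sends the tuple \<open>ds\<close>
  to \<open>as\<close>.\<close>

definition pointed_iso ::
  "'r set \<Rightarrow> ('b \<Rightarrow> 'a) \<Rightarrow> ('b, 'r) struc \<Rightarrow> 'b list \<Rightarrow> ('a, 'r) struc \<Rightarrow> 'a list \<Rightarrow> bool" where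
  "pointed_iso \<rho> f D ds A as \<longleftrightarrow> bij_betw f (dom D) (dom A) \<and> map f ds = as \<and>
     (\<forall>R\<in>\<rho>. \<forall>xs. set xs \<subseteq> dom D \<longrightarrow> (xs \<in> rel D R \<longleftrightarrow> map f xs \<in> rel A R))"

definition gaifman :: "'r set \<Rightarrow> ('a, 'r) struc \<Rightarrow> ('a \<times> 'a) set" where
  "gaifman \<tau> A = {(a, b). a \<noteq> b \<and> (\<exists>R\<in>\<tau>. \<exists>xs\<in>rel A R. a \<in> set xs \<and> b \<in> set xs)}"

definition dist_le :: "'r set \<Rightarrow> ('a, 'r) struc \<Rightarrow> nat \<Rightarrow> 'a \<Rightarrow> 'a \<Rightarrow> bool" where
  "dist_le \<tau> A l a b \<longleftrightarrow> (\<exists>j\<le>l. (a, b) \<in> gaifman \<tau> A ^^ j)"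

definition nbhd :: "'r set \<Rightarrow> ('a, 'r) struc \<Rightarrow> nat \<Rightarrow> 'a list \<Rightarrow> 'a set" where
  "nbhd \<tau> A l as = {b \<in> dom A. \<exists>a\<in>set as. dist_le \<tau> A l a b}"


section \<open>The logic PLA*\<close>

text \<open>An \<open>m\<close>-ary aggregation function is a symmetric function of \<open>m\<close> finite nonempty sequences;
  symmetry is built in by letting it act on multisets. \<open>Agg F \<phi>s ys \<kappa>s\<close> stands for
  \<open>F(\<phi>\<^sub>1,\<dots>,\<phi>\<^sub>m : ys : \<kappa>\<^sub>1,\<dots>,\<kappa>\<^sub>m)\<close>.\<close>

datatype 'r pla =
    Const real
  | Eq nat nat
  | Rel 'r "nat list"
  | Conn "real list \<Rightarrow> real" "'r pla list"
  | Agg "real multiset list \<Rightarrow> real" "'r pla list" "nat list" "'r pla list"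

primrec fv :: "'r pla \<Rightarrow> nat set" where
  "fv (Const c) = {}"
| "fv (Eq x y) = {x, y}"
| "fv (Rel R xs) = set xs"
| "fv (Conn C \<phi>s) = \<Union>(set (map fv \<phi>s))"
| "fv (Agg F \<phi>s ys \<kappa>s) = (\<Union>(set (map fv \<phi>s)) \<union> \<Union>(set (map fv \<kappa>s))) - set ys"

text \<open>A connective of arity \<open>m\<close> is a continuous function on the cube, the argument list being
  read off from an element of the product space of functions on the naturals.\<close>

definition is_connective :: "nat \<Rightarrow> (real list \<Rightarrow> real) \<Rightarrow> bool" where
  "is_connective m C \<longleftrightarrow> m \<ge> 1 \<and>
     (\<forall>x \<in> {..<m} \<rightarrow> {0..1}. C (map x [0..<m]) \<in> {0..1}) \<and>
     continuous_on ({..<m} \<rightarrow> {0..1}) (\<lambda>x. C (map x [0..<m]))"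

definition is_aggregation :: "nat \<Rightarrow> (real multiset list \<Rightarrow> real) \<Rightarrow> bool" where
  "is_aggregation m F \<longleftrightarrow> m \<ge> 1 \<and>
     (\<forall>rs. length rs = m \<and> (\<forall>r\<in>set rs. r \<noteq> {#} \<and> set_mset r \<subseteq> {0..1}) \<longrightarrow> F rs \<in> {0..1})"

primrec is_pla :: "('r \<Rightarrow> nat) \<Rightarrow> 'r set \<Rightarrow> 'r pla \<Rightarrow> bool" where
  "is_pla ar \<rho> (Const c) \<longleftrightarrow> c \<in> {0..1}"
| "is_pla ar \<rho> (Eq x y) \<longleftrightarrow> True"
| "is_pla ar \<rho> (Rel R xs) \<longleftrightarrow> R \<in> \<rho> \<and> length xs = ar R"
| "is_pla ar \<rho> (Conn C \<phi>s) \<longleftrightarrow> is_connective (length \<phi>s) C \<and> list_all (\<lambda>b. b) (map (is_pla ar \<rho>) \<phi>s)"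
| "is_pla ar \<rho> (Agg F \<phi>s ys \<kappa>s) \<longleftrightarrow>
     is_aggregation (length \<phi>s) F \<and> length \<kappa>s = length \<phi>s \<and> distinct ys \<and> ys \<noteq> [] \<and>
     list_all (\<lambda>b. b) (map (is_pla ar \<rho>) \<phi>s) \<and> list_all (\<lambda>b. b) (map (is_pla ar \<rho>) \<kappa>s)"

definition upd :: "(nat \<Rightarrow> 'a) \<Rightarrow> nat list \<Rightarrow> 'a list \<Rightarrow> nat \<Rightarrow> 'a" where
  "upd s xs as v = (case map_of (zip xs as) v of Some a \<Rightarrow> a | None \<Rightarrow> s v)"

text \<open>A conditioning formula counts as true when its value is 1.\<close>

primrec eval :: "('a, 'r) struc \<Rightarrow> 'r pla \<Rightarrow> (nat \<Rightarrow> 'a) \<Rightarrow> real" where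
  "eval A (Const c) s = c"
| "eval A (Eq x y) s = of_bool (s x = s y)"
| "eval A (Rel R xs) s = of_bool (map s xs \<in> rel A R)"
| "eval A (Conn C \<phi>s) s = C (map (\<lambda>v. v s) (map (eval A) \<phi>s))"
| "eval A (Agg F \<phi>s ys \<kappa>s) s =
     (let T = (\<lambda>c. {bs \<in> tuples (dom A) (length ys). c (upd s ys bs) = 1});
          vs = map (eval A) \<phi>s;
          cs = map (eval A) \<kappa>s
      in if \<exists>c\<in>set cs. T c = {} then 0
         else F (map2 (\<lambda>v c. image_mset (\<lambda>bs. v (upd s ys bs)) (mset_set (T c))) vs cs))"

definition asg :: "nat list \<Rightarrow> 'a list \<Rightarrow> nat \<Rightarrow> 'a" where
  "asg xs as = upd (\<lambda>_. undefined) xs as"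

text \<open>Conditioning formulas are not entered: the hypotheses placed on them below say that they are
  closure types, which are first-order formulas whose quantifiers describe the rare elements.\<close>

primrec subformulas :: "'r pla \<Rightarrow> 'r pla set" where
  "subformulas (Const c) = {Const c}"
| "subformulas (Eq x y) = {Eq x y}"
| "subformulas (Rel R xs) = {Rel R xs}"
| "subformulas (Conn C \<phi>s) = insert (Conn C \<phi>s) (\<Union>(set (map subformulas \<phi>s)))"
| "subformulas (Agg F \<phi>s ys \<kappa>s) = insert (Agg F \<phi>s ys \<kappa>s) (\<Union>(set (map subformulas \<phi>s)))"


section \<open>Continuous aggregation functions\<close>

text \<open>A parameter list consists of pairs \<open>(c\<^sub>j, \<alpha>\<^sub>j)\<close> with distinct \<open>c\<^sub>j\<close> (repetitions would
  leave no disjoint family of intervals to test); \<open>\<alpha>\<^sub>j = 0\<close> is allowed.\<close>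

definition ct_params :: "(real \<times> real) list \<Rightarrow> bool" where
  "ct_params ps \<longleftrightarrow> ps \<noteq> [] \<and> distinct (map fst ps) \<and> set ps \<subseteq> {0..1} \<times> {0..1}"

definition convergence_testing :: "(real \<times> real) list \<Rightarrow> (nat \<Rightarrow> real multiset) \<Rightarrow> bool" where
  "convergence_testing ps r \<longleftrightarrow>
     (\<forall>n. r n \<noteq> {#} \<and> set_mset (r n) \<subseteq> {0..1} \<and> size (r n) < size (r (Suc n))) \<and>
     (\<forall>I :: nat \<Rightarrow> real set.
        (\<forall>j<length ps. openin (top_of_set {0..1}) (I j) \<and> is_interval (I j) \<and> fst (ps ! j) \<in> I j) \<and>
        disjoint_family_on I {..<length ps} \<longrightarrow>
        (\<forall>\<^sub>F n in sequentially. set_mset (r n) \<subseteq> (\<Union>j<length ps. I j)) \<and>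
        (\<forall>j<length ps.
          (\<lambda>n. real (size (filter_mset (\<lambda>x. x \<in> I j) (r n))) / real (size (r n)))
            \<longlonglongrightarrow> snd (ps ! j)))"

definition ct_continuous :: "(real \<times> real) list list \<Rightarrow> (real multiset list \<Rightarrow> real) \<Rightarrow> bool" where
  "ct_continuous pss F \<longleftrightarrow>
     (\<forall>r q :: nat \<Rightarrow> real multiset list.
        (\<forall>n. length (r n) = length pss \<and> length (q n) = length pss) \<and>
        (\<forall>i<length pss. convergence_testing (pss ! i) (\<lambda>n. r n ! i) \<and>
                         convergence_testing (pss ! i) (\<lambda>n. q n ! i)) \<longrightarrow>
        (\<lambda>n. \<bar>F (r n) - F (q n)\<bar>) \<longlonglongrightarrow> 0)"

definition continuous_aggregation :: "nat \<Rightarrow> (real multiset list \<Rightarrow> real) \<Rightarrow> bool" where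
  "continuous_aggregation m F \<longleftrightarrow>
     (\<forall>pss. length pss = m \<and> (\<forall>ps\<in>set pss. ct_params ps) \<longrightarrow> ct_continuous pss F)"


section \<open>Networks over a sequence of base structures\<close>

text \<open>\<open>base N n\<close> is meaningful for \<open>n \<ge> 1\<close> only. The free variables of \<open>theta N R\<close> are, in order,
  \<open>0, \<dots>, arity N R - 1\<close>.\<close>

record ('a, 'r) net =
  arity :: "'r \<Rightarrow> nat"
  sigma :: "'r set"
  tau :: "'r set"
  base :: "nat \<Rightarrow> ('a, 'r) struc"
  par :: "'r \<Rightarrow> 'r set"
  theta :: "'r \<Rightarrow> 'r pla"

definition is_net :: "('a, 'r) net \<Rightarrow> bool" where
  "is_net N \<longleftrightarrow>
     finite (sigma N) \<and> tau N \<subseteq> sigma N \<and>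
     (\<forall>n\<ge>1. is_struc (arity N) (tau N) (base N n)) \<and>
     (\<forall>R \<in> sigma N - tau N. par N R \<subseteq> sigma N - tau N) \<and>
     acyclic {(S, R). R \<in> sigma N - tau N \<and> S \<in> par N R} \<and>
     (\<forall>R \<in> sigma N - tau N.
        is_pla (arity N) (par N R \<union> tau N) (theta N R) \<and> fv (theta N R) \<subseteq> {..<arity N R})"

definition worlds :: "('a, 'r) net \<Rightarrow> nat \<Rightarrow> ('a, 'r) struc set" where
  "worlds N n = {A. is_struc (arity N) (sigma N) A \<and> dom A = dom (base N n) \<and>
                    (\<forall>R\<in>tau N. rel A R = rel (base N n) R)}"

definition world_prob :: "('a, 'r) net \<Rightarrow> ('a, 'r) struc \<Rightarrow> real" where
  "world_prob N A = (\<Prod>R \<in> sigma N - tau N.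
     (\<Prod>as \<in> rel A R. eval A (theta N R) (asg [0..<arity N R] as)) *
     (\<Prod>as \<in> tuples (dom A) (arity N R) - rel A R. 1 - eval A (theta N R) (asg [0..<arity N R] as)))"

definition prob :: "('a, 'r) net \<Rightarrow> nat \<Rightarrow> (('a, 'r) struc \<Rightarrow> bool) \<Rightarrow> real" where
  "prob N n E = (\<Sum>A \<in> {A \<in> worlds N n. E A}. world_prob N A)"

definition asymp_equiv :: "('a, 'r) net \<Rightarrow> nat list \<Rightarrow> 'r pla \<Rightarrow> 'r pla \<Rightarrow> bool" where
  "asymp_equiv N xs \<phi> \<psi> \<longleftrightarrow> (\<forall>\<epsilon>>0.
     (\<lambda>n. prob N n (\<lambda>A. \<exists>as \<in> tuples (dom A) (length xs).
         \<bar>eval A \<phi> (asg xs as) - eval A \<psi> (asg xs as)\<bar> > \<epsilon>)) \<longlonglongrightarrow> 0)"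


section \<open>Neighbourhood types\<close>

text \<open>A complete \<open>(\<tau>,l)\<close>-neighbourhood type is given by a finite pointed structure with domain in the
  naturals, and it holds of \<open>as\<close> if the pointed structure induced on the \<open>l\<close>-neighbourhood of \<open>as\<close> is
  isomorphic to it. Pointed structures which never arise in this way are unrealized types.\<close>

type_synonym 'r ntype = "(nat, 'r) struc \<times> nat list"

definition is_ntype :: "('a, 'r) net \<Rightarrow> nat \<Rightarrow> 'r ntype \<Rightarrow> bool" where
  "is_ntype N k p \<longleftrightarrow> is_struc (arity N) (tau N) (fst p) \<and> snd p \<in> tuples (dom (fst p)) k"

definition ntype_sat :: "('a, 'r) net \<Rightarrow> nat \<Rightarrow> 'r ntype \<Rightarrow> nat \<Rightarrow> 'a list \<Rightarrow> bool" where
  "ntype_sat N l p n as \<longleftrightarrow>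
     (\<exists>f. pointed_iso (tau N) f (fst p) (snd p) (induced (base N n) (nbhd (tau N) (base N n) l as)) as)"

definition ntype_set :: "('a, 'r) net \<Rightarrow> nat \<Rightarrow> 'r ntype \<Rightarrow> nat \<Rightarrow> 'a list set" where
  "ntype_set N l p n = {as \<in> tuples (dom (base N n)) (length (snd p)). ntype_sat N l p n as}"

definition bounded_ntype :: "('a, 'r) net \<Rightarrow> nat \<Rightarrow> 'r ntype \<Rightarrow> bool" where
  "bounded_ntype N l p \<longleftrightarrow> (\<exists>m. \<forall>n\<ge>1. card (ntype_set N l p n) \<le> m)"

definition near_vars :: "('a, 'r) net \<Rightarrow> nat \<Rightarrow> 'r ntype \<Rightarrow> (nat \<times> nat) set" where
  "near_vars N l p = {(i, j). i < length (snd p) \<and> j < length (snd p) \<and>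
     (\<forall>n\<ge>1. \<forall>as \<in> ntype_set N l p n. dist_le (tau N) (base N n) (2 * l) (as ! i) (as ! j))}"

definition one_class :: "('a, 'r) net \<Rightarrow> nat \<Rightarrow> 'r ntype \<Rightarrow> bool" where
  "one_class N l p \<longleftrightarrow> (\<forall>i<length (snd p). \<forall>j<length (snd p). (i, j) \<in> (near_vars N l p)\<^sup>+)"

definition rare :: "('a, 'r) net \<Rightarrow> nat \<Rightarrow> nat \<Rightarrow> 'a \<Rightarrow> bool" where
  "rare N l n a \<longleftrightarrow> a \<in> dom (base N n) \<and>
     (\<exists>p. is_ntype N 1 p \<and> ntype_sat N l p n [a] \<and> bounded_ntype N l p)"

definition superlog :: "(nat \<Rightarrow> real) \<Rightarrow> bool" where
  "superlog f \<longleftrightarrow> (\<forall>\<alpha>::real. filterlim (\<lambda>n. f n - \<alpha> * ln (real n)) at_top sequentially)"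


section \<open>Closure types\<close>

text \<open>The neighbourhood is taken around the tuple only. Taking it around the rare elements as well
  gives the same set for \<open>l = 0\<close>, the only radius at which closures enter the theorem except for the
  radius \<open>g\<close> in the definition of positivity below, which is quantified existentially.\<close>

definition closure_set :: "('a, 'r) net \<Rightarrow> nat \<Rightarrow> nat \<Rightarrow> 'a list \<Rightarrow> 'a set" where
  "closure_set N l n as = nbhd (tau N) (base N n) l as \<union> {b. rare N l n b}"

text \<open>A \<open>(\<rho>,l)\<close>-closure type, where \<open>\<tau> \<subseteq> \<rho> \<subseteq> \<sigma>\<close>, fixes the \<open>\<tau>\<close>-structure on the \<open>l\<close>-closure up to
  isomorphism over the tuple and specifies, in the form of signed atoms, some of the other relations
  on it; it is complete if all of them are specified. Its restriction to \<open>\<tau>\<close> drops the atoms.\<close>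

record 'r ctype =
  ct_struc :: "(nat, 'r) struc"
  ct_pts :: "nat list"
  ct_lits :: "('r \<times> nat list \<times> bool) set"

definition is_ctype :: "('a, 'r) net \<Rightarrow> 'r set \<Rightarrow> nat \<Rightarrow> 'r ctype \<Rightarrow> bool" where
  "is_ctype N \<rho> k p \<longleftrightarrow>
     is_struc (arity N) (tau N) (ct_struc p) \<and> ct_pts p \<in> tuples (dom (ct_struc p)) k \<and>
     (\<forall>(R, xs, b) \<in> ct_lits p. R \<in> \<rho> - tau N \<and> xs \<in> tuples (dom (ct_struc p)) (arity N R)) \<and>
     (\<forall>R xs. \<not> ((R, xs, True) \<in> ct_lits p \<and> (R, xs, False) \<in> ct_lits p))"

definition is_complete_ctype :: "('a, 'r) net \<Rightarrow> 'r set \<Rightarrow> nat \<Rightarrow> 'r ctype \<Rightarrow> bool" where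
  "is_complete_ctype N \<rho> k p \<longleftrightarrow> is_ctype N \<rho> k p \<and>
     (\<forall>R \<in> \<rho> - tau N. \<forall>xs \<in> tuples (dom (ct_struc p)) (arity N R). \<exists>b. (R, xs, b) \<in> ct_lits p)"

definition ct_sat ::
  "('a, 'r) net \<Rightarrow> nat \<Rightarrow> 'r ctype \<Rightarrow> nat \<Rightarrow> ('a, 'r) struc \<Rightarrow> 'a list \<Rightarrow> bool" where
  "ct_sat N l p n A as \<longleftrightarrow>
     (\<exists>f. pointed_iso (tau N) f (ct_struc p) (ct_pts p) (induced A (closure_set N l n as)) as \<and>
          (\<forall>(R, xs, b) \<in> ct_lits p. (map f xs \<in> rel A R) = b))"

definition ct_tau :: "'r ctype \<Rightarrow> 'r ctype" where
  "ct_tau p = p\<lparr>ct_lits := {}\<rparr>"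

definition tau_cofinal :: "('a, 'r) net \<Rightarrow> nat \<Rightarrow> 'r ctype \<Rightarrow> bool" where
  "tau_cofinal N l p \<longleftrightarrow>
     (\<exists>\<^sub>F n in sequentially. \<exists>as \<in> tuples (dom (base N n)) (length (ct_pts p)). ct_sat N l p n (base N n) as)"

text \<open>In the next four definitions \<open>p(xs,ys)\<close> has \<open>k + m\<close> variables, the first \<open>k\<close> of which are \<open>xs\<close>.\<close>

definition uniformly_unbounded :: "('a, 'r) net \<Rightarrow> nat \<Rightarrow> nat \<Rightarrow> nat \<Rightarrow> 'r ctype \<Rightarrow> bool" where
  "uniformly_unbounded N l k m p \<longleftrightarrow> tau_cofinal N l p \<and>
     (\<exists>f. superlog f \<and>
        (\<forall>n\<ge>1. \<forall>as \<in> tuples (dom (base N n)) k.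
           let S = {bs \<in> tuples (dom (base N n)) m. ct_sat N l p n (base N n) (as @ bs)}
           in S \<noteq> {} \<longrightarrow> f n \<le> real (card S)))"

text \<open>Subsequences of \<open>ys\<close> are given by nonempty sets \<open>J\<close> of positions. As complete types over \<open>\<tau>\<close>
  exclude each other, the restriction of a cofinally satisfiable \<open>p\<close> to the variables in \<open>xs\<close> and
  the subsequence is the complete type implied by \<open>p\<close>.\<close>

definition strongly_unbounded :: "('a, 'r) net \<Rightarrow> nat \<Rightarrow> nat \<Rightarrow> nat \<Rightarrow> 'r ctype \<Rightarrow> bool" where
  "strongly_unbounded N l k m p \<longleftrightarrow> tau_cofinal N l p \<and>
     (\<forall>J \<subseteq> {..<m}. J \<noteq> {} \<longrightarrow>
        (\<exists>p'. is_complete_ctype N (tau N) (k + card J) p' \<and>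
           (\<forall>n\<ge>1. \<forall>as \<in> tuples (dom (base N n)) k. \<forall>bs \<in> tuples (dom (base N n)) m.
              ct_sat N l p n (base N n) (as @ bs) \<longrightarrow> ct_sat N l p' n (base N n) (as @ nths bs J)) \<and>
           uniformly_unbounded N l k (card J) p'))"

text \<open>Balance of \<open>(p, p\<restriction>\<tau>, q)\<close> for an \<open>l\<close>-closure type \<open>p\<close> and a \<open>g\<close>-closure type \<open>q(xs)\<close>; the bounds
  on the proportion are multiplied out, hence vacuous where \<open>p\<restriction>\<tau>\<close> has no realization.\<close>

definition balanced ::
  "('a, 'r) net \<Rightarrow> real \<Rightarrow> nat \<Rightarrow> nat \<Rightarrow> nat \<Rightarrow> 'r ctype \<Rightarrow> nat \<Rightarrow> 'r ctype \<Rightarrow> bool" where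
  "balanced N \<alpha> l k m p g q \<longleftrightarrow> (\<forall>\<epsilon>>0.
     (\<lambda>n. prob N n (\<lambda>A. \<forall>as \<in> tuples (dom A) k. ct_sat N g q n A as \<longrightarrow>
        (let P = {bs \<in> tuples (dom A) m. ct_sat N l p n A (as @ bs)};
             Q = {bs \<in> tuples (dom A) m. ct_sat N l (ct_tau p) n A (as @ bs)}
         in (\<alpha> - \<epsilon>) * real (card Q) \<le> real (card P) \<and> real (card P) \<le> (\<alpha> + \<epsilon>) * real (card Q))))
     \<longlonglongrightarrow> 1)"

definition positive :: "('a, 'r) net \<Rightarrow> nat \<Rightarrow> nat \<Rightarrow> nat \<Rightarrow> 'r ctype \<Rightarrow> bool" where
  "positive N l k m p \<longleftrightarrow> tau_cofinal N l (ct_tau p) \<and>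
     (\<exists>g. \<forall>q. is_complete_ctype N (sigma N) k q \<and>
        (\<exists>\<^sub>F n in sequentially. \<exists>A \<in> worlds N n. \<exists>as \<in> tuples (dom A) k. \<exists>bs \<in> tuples (dom A) m.
            ct_sat N l p n A (as @ bs) \<and> ct_sat N g q n A as) \<longrightarrow>
        (\<exists>\<alpha>>0. balanced N \<alpha> l k m p g q))"

definition expresses :: "('a, 'r) net \<Rightarrow> nat \<Rightarrow> nat list \<Rightarrow> 'r ctype \<Rightarrow> 'r pla \<Rightarrow> bool" where
  "expresses N l xs p \<kappa> \<longleftrightarrow> (\<forall>n\<ge>1. \<forall>A \<in> worlds N n. \<forall>as \<in> tuples (dom A) (length xs).
     eval A \<kappa> (asg xs as) = of_bool (ct_sat N l p n A as))"

text \<open>The conjunction is the minimum and the implication is that of Lukasiewicz.\<close>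

definition is_basic :: "('a, 'r) net \<Rightarrow> nat \<Rightarrow> nat list \<Rightarrow> 'r pla \<Rightarrow> bool" where
  "is_basic N l xs \<psi> \<longleftrightarrow> (\<exists>cs :: ('r pla \<times> real) list. cs \<noteq> [] \<and>
     \<psi> = Conn (\<lambda>vs. Min (set vs))
           (map (\<lambda>(\<kappa>, c). Conn (\<lambda>vs. min 1 (1 - vs ! 0 + vs ! 1)) [\<kappa>, Const c]) cs) \<and>
     (\<forall>(\<kappa>, c) \<in> set cs. c \<in> {0..1} \<and> is_pla (arity N) (sigma N) \<kappa> \<and> fv \<kappa> \<subseteq> set xs \<and>
        (\<exists>l'\<le>l. \<exists>p. is_complete_ctype N (sigma N) (length xs) p \<and> expresses N l' xs p \<kappa>)))"

text \<open>The hypothesis on the aggregations in a formula: in each of them, the variables can be arranged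
  as \<open>ys\<close>, \<open>zs\<close>, where \<open>zs\<close> are those bound by the aggregation, such that the conditions hold.\<close>

definition good_aggregations :: "('a, 'r) net \<Rightarrow> 'r pla \<Rightarrow> bool" where
  "good_aggregations N \<phi> \<longleftrightarrow> (\<forall>F \<phi>s zs \<kappa>s. Agg F \<phi>s zs \<kappa>s \<in> subformulas \<phi> \<longrightarrow>
     continuous_aggregation (length \<phi>s) F \<and>
     (\<exists>ys. distinct (ys @ zs) \<and> (\<Union>\<psi> \<in> set \<phi>s \<union> set \<kappa>s. fv \<psi>) \<subseteq> set (ys @ zs) \<and>
        (\<forall>\<kappa> \<in> set \<kappa>s. \<exists>p. is_ctype N (sigma N) (length (ys @ zs)) p \<and>
           expresses N 0 (ys @ zs) p \<kappa> \<and>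
           strongly_unbounded N 0 (length ys) (length zs) (ct_tau p) \<and>
           positive N 0 (length ys) (length zs) p)))"

end

theory Submission
  imports Defs
begin

text \<open>Extend each tuple by an enumeration of the boundedly many rare elements. Then its \<open>0\<close>-closure is the
  set of its entries, and its closure type amounts to its quantifier-free type. Add the relations of
  \<open>\<sigma> - \<tau>\<close> one at a time along the DAG. Two statements are carried through this induction.

  (a) With high probability, the value of an admissible formula at every tuple is close to a constant which
  depends only on the quantifier-free type of the tuple.

  (b) With high probability, for every tuple \<open>us\<close>, the proportion of those realizations \<open>bs\<close> of a strongly
  unbounded \<open>\<tau>\<close>-type not linked to \<open>us\<close> for which \<open>us @ bs\<close> has a given expanded type is close to a
  constant which depends only on the types.

  Statement (b) yields (a): by (b) the values of the arguments of an aggregation form multisets that converge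
  to a fixed finite distribution, by positivity the conditioning sets make up a positive proportion or are
  empty, and continuity of the aggregation function turns this into convergence of its value.
  Conversely, (a) for \<open>\<theta>\<^sub>R\<close> yields (b) after adding \<open>R\<close>: given the previous relations, the pattern of \<open>R\<close>
  on \<open>us @ bs\<close> has almost constant probability, and patterns for different \<open>bs\<close> are independent unless
  these share an element. Exchanging one connected component of \<open>bs\<close> for another copy of it shows that the
  number of \<open>bs\<close> exceeds the number of such conflicts by any multiple of \<open>ln n\<close>, so that Chernoff bounds
  on the colour classes of the conflict graph beat the union bound over the polynomially many \<open>us\<close>.
  The probability of each expanded type converges by the same induction, which gives part (ii).\<close>

subsection \<open>Codes of tuples\<close>

text \<open>Two mismatches shape the proof. The growth hypothesis speaks of neighbourhood types in
  one class, whereas strong unboundedness only provides, at infinitely many n, many realizations of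
  subtuples. They meet in connected codes: a connected q-tuple lies in the ball of radius q * q
  about any of its entries, so its realizations split into finitely many one-class types of that
  radius; if their number is unbounded, one of these types is unbounded and hence outgrows every
  multiple of ln n at all large n. Subsets of the bound variables matter because each connected
  component must be numerous by itself. Secondly, a limit proportion 0 does not exclude a few
  realizations of a conditioning type, and the aggregation would then range over a small
  uncontrolled set instead of taking its default value 0. Positivity removes this case: a nonempty
  set of realizations is a fixed fraction of all candidates. The union bound costs a power of n
  whose exponent depends on the lengths of the tuples, so no fixed multiple of ln n would do; growth
  beyond all multiples is therefore carried along.\<close>

type_synonym 'r code = "(nat \<times> nat) set \<times> ('r \<times> nat list) set"

text \<open>The code of a tuple is its quantifier-free type, with entries replaced by positions.\<close>

definition tp :: "'r set \<Rightarrow> ('a, 'r) struc \<Rightarrow> 'a list \<Rightarrow> 'r code" where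
  "tp \<rho> A us = ({(i, j). i < length us \<and> j < length us \<and> us ! i = us ! j},
     {(R, is). R \<in> \<rho> \<and> set is \<subseteq> {..<length us} \<and> map ((!) us) is \<in> rel A R})"

text \<open>\<open>js\<close> may omit, permute or repeat positions, so a single operation covers
  subtuples and rearrangements.\<close>

definition sub :: "'r code \<Rightarrow> nat list \<Rightarrow> 'r code" where
  "sub t js = ({(i, j). i < length js \<and> j < length js \<and> (js ! i, js ! j) \<in> fst t},
     {(R, is). set is \<subseteq> {..<length js} \<and> (R, map ((!) js) is) \<in> snd t})"

definition restr :: "'r set \<Rightarrow> 'r code \<Rightarrow> 'r code" where
  "restr \<rho> t = (fst t, {(R, is) \<in> snd t. R \<in> \<rho>})"

text \<open>Tuples of relations that leave \<open>us\<close> and \<open>bs\<close> may still link them, as they do not affect the code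
  of \<open>us @ bs\<close>.\<close>

definition wfree :: "'r set \<Rightarrow> ('a, 'r) struc \<Rightarrow> 'a list \<Rightarrow> 'a list \<Rightarrow> bool" where
  "wfree \<tau> B us bs \<longleftrightarrow> set us \<inter> set bs = {} \<and>
     (\<forall>R\<in>\<tau>. \<forall>xs\<in>rel B R. set xs \<subseteq> set us \<union> set bs \<longrightarrow> set xs \<subseteq> set us \<or> set xs \<subseteq> set bs)"

lemma restr_tp: "\<rho> \<subseteq> \<rho>' \<Longrightarrow> restr \<rho> (tp \<rho>' A us) = tp \<rho> A us"
  by (auto simp: restr_def tp_def)

lemma map_nth_map: "set is \<subseteq> {..<length js} \<Longrightarrow> map ((!) (map f js)) is = map f (map ((!) js) is)"
  by (induction "is") auto

lemma sub_tp:
  assumes "set js \<subseteq> {..<length us}"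
  shows "tp \<rho> A (map ((!) us) js) = sub (tp \<rho> A us) js"
proof -
  have lt: "js ! i < length us" if "i < length js" for i
    using assms that nth_mem by blast
  have *: "set (map ((!) js) is) \<subseteq> {..<length us}" if "set is \<subseteq> {..<length js}" for "is"
    using that lt by auto
  show ?thesis
    using lt * by (auto simp: tp_def sub_def map_nth_map map_nth_map[of _ js "(!) us"] simp del: map_map)
qed

lemma tp_nth_eq: "tp \<rho> A us = tp \<rho>' A' us' \<Longrightarrow> i < length us \<Longrightarrow> j < length us \<Longrightarrow>
    us ! i = us ! j \<longleftrightarrow> us' ! i = us' ! j \<and> i < length us' \<and> j < length us'"
  unfolding tp_def prod.inject set_eq_iff by blast

text \<open>The equality pattern contains every pair (i, i) with i a position, so its diagonal
  remembers the length.\<close>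

lemma tp_length:
  assumes "tp \<rho> A us = tp \<rho>' A' us'"
  shows "length us = length us'"
proof -
  have "{i. i < length us} = {i. (i, i) \<in> fst (tp \<rho> A us)}" by (auto simp: tp_def)
  also have "\<dots> = {i. i < length us'}" unfolding assms by (auto simp: tp_def)
  finally have "{..<length us} = {..<length us'}" by (simp add: lessThan_def)
  then show ?thesis by simp
qed

lemma in_tp_eq: "(i, j) \<in> fst (tp \<rho> A us) \<longleftrightarrow> i < length us \<and> j < length us \<and> us ! i = us ! j"
  by (simp add: tp_def)

lemma in_tp_rel: "(R, is) \<in> snd (tp \<rho> A us) \<longleftrightarrow> R \<in> \<rho> \<and> set is \<subseteq> {..<length us} \<and> map ((!) us) is \<in> rel A R"
  by (simp add: tp_def)

lemma tp_sub_cong: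
  assumes "tp \<rho> A us = tp \<rho> A' us'" "set js \<subseteq> {..<length us}"
  shows "tp \<rho> A (map ((!) us) js) = tp \<rho> A' (map ((!) us') js)"
  using assms tp_length[OF assms(1)] by (simp add: sub_tp)

lemma tp_take_cong:
  assumes "tp \<rho> A (us @ bs) = tp \<rho> A' (us' @ bs')" "length us = length us'"
  shows "tp \<rho> A us = tp \<rho> A' us'" "tp \<rho> A bs = tp \<rho> A' bs'"
proof -
  have l: "length bs = length bs'" using tp_length[OF assms(1)] assms(2) by simp
  have e: "map ((!) (xs @ ys)) [0..<length xs] = xs" "map ((!) (xs @ ys)) [length xs..<length xs + length ys] = ys"
    for xs ys :: "'x list"
    by (auto intro!: nth_equalityI simp: nth_append)
  show "tp \<rho> A us = tp \<rho> A' us'"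
    using tp_sub_cong[OF assms(1), of "[0..<length us]"] e(1)[of us bs] e(1)[of us' bs'] assms(2)
    by (simp add: subset_iff)
  show "tp \<rho> A bs = tp \<rho> A' bs'"
    using tp_sub_cong[OF assms(1), of "[length us..<length us + length bs]"] e(2)[of us bs] e(2)[of us' bs'] assms(2) l
    by (simp add: subset_iff)
qed

lemma index_list_ex: "set xs \<subseteq> set us \<Longrightarrow> \<exists>is. set is \<subseteq> {..<length us} \<and> map ((!) us) is = xs"
proof (induction xs)
  case (Cons x xs)
  then obtain "is" where *: "set is \<subseteq> {..<length us}" "map ((!) us) is = xs" by auto
  obtain i where "i < length us" "us ! i = x" using Cons.prems by (auto simp: in_set_conv_nth)
  then show ?case using * by (intro exI[of _ "i # is"]) auto
qed auto

text \<open>Sending the i-th entry to the i-th entry is well defined and injective because codes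
  record which entries coincide; every tuple of entries is named by an index list, which transfers
  the relations.\<close>

lemma tp_iso:
  assumes "tp \<rho> A us = tp \<rho> A' us'"
  obtains g where "bij_betw g (set us) (set us')" "map g us = us'"
    "\<And>R xs. R \<in> \<rho> \<Longrightarrow> set xs \<subseteq> set us \<Longrightarrow> xs \<in> rel A R \<longleftrightarrow> map g xs \<in> rel A' R"
proof -
  have l: "length us' = length us" using tp_length[OF assms] by simp
  define g where "g x = us' ! (SOME i. i < length us \<and> us ! i = x)" for x
  have g: "g (us ! i) = us' ! i" if "i < length us" for i
  proof -
    let ?k = "SOME k. k < length us \<and> us ! k = us ! i"
    have "?k < length us \<and> us ! ?k = us ! i" using that by (intro someI_ex[of "\<lambda>k. k < length us \<and> us ! k = us ! i"]) auto
    then show ?thesis unfolding g_def using tp_nth_eq[OF assms, of ?k i] that by auto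
  qed
  have m: "map g us = us'" using g l by (auto intro: nth_equalityI)
  have "inj_on g (set us)"
    using g tp_nth_eq[OF assms] l by (auto simp: inj_on_def in_set_conv_nth)
  then have b: "bij_betw g (set us) (set us')" using m by (auto simp: bij_betw_def)
  have "xs \<in> rel A R \<longleftrightarrow> map g xs \<in> rel A' R" if R: "R \<in> \<rho>" and xs: "set xs \<subseteq> set us" for R xs
  proof -
    obtain "is" where i: "set is \<subseteq> {..<length us}" "map ((!) us) is = xs" using index_list_ex[OF xs] by auto
    have "map g xs = map ((!) us') is" using i g by (auto simp: subset_iff)
    moreover have "(R, is) \<in> snd (tp \<rho> A us) \<longleftrightarrow> (R, is) \<in> snd (tp \<rho> A' us')" using assms by simp
    ultimately show ?thesis using i R l by (simp add: in_tp_rel)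
  qed
  then show ?thesis using that b m by blast
qed

lemma iso_tp:
  assumes "inj_on g (set us)"
    "\<And>R xs. R \<in> \<rho> \<Longrightarrow> set xs \<subseteq> set us \<Longrightarrow> xs \<in> rel A R \<longleftrightarrow> map g xs \<in> rel A' R"
  shows "tp \<rho> A us = tp \<rho> A' (map g us)"
proof -
  have "map ((!) us) is \<in> rel A R \<longleftrightarrow> map ((!) (map g us)) is \<in> rel A' R"
    if "R \<in> \<rho>" "set is \<subseteq> {..<length us}" for R "is"
  proof -
    have "set (map ((!) us) is) \<subseteq> set us" using that(2) by (auto simp: subset_iff)
    then show ?thesis using assms(2)[OF that(1)] map_nth_map[OF that(2), of g] that(2)
      by (metis map_nth_map)
  qed
  moreover have "us ! i = us ! j \<longleftrightarrow> map g us ! i = map g us ! j" if "i < length us" "j < length us" for i j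
    using assms(1) that by (auto simp: inj_on_def)
  ultimately show ?thesis by (auto simp: tp_def)
qed

text \<open>The isomorphisms of the two parts have disjoint domains and disjoint images, so their
  union is injective; by \<open>wfree\<close> on both sides no relation tuple on the union mixes the
  parts, so the relations are preserved as well. This makes the type of a free extension a function
  of the types of its two parts.\<close>

lemma glue:
  assumes us: "tp \<tau> B us = tp \<tau> B' us'" and bs: "tp \<tau> B bs = tp \<tau> B' bs'"
    and w: "wfree \<tau> B us bs" "wfree \<tau> B' us' bs'"
  shows "tp \<tau> B (us @ bs) = tp \<tau> B' (us' @ bs')"
proof -
  obtain g where g: "bij_betw g (set us) (set us')" "map g us = us'"
    "\<And>R xs. R \<in> \<tau> \<Longrightarrow> set xs \<subseteq> set us \<Longrightarrow> xs \<in> rel B R \<longleftrightarrow> map g xs \<in> rel B' R"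
    using tp_iso[OF us] by metis
  obtain h where h: "bij_betw h (set bs) (set bs')" "map h bs = bs'"
    "\<And>R xs. R \<in> \<tau> \<Longrightarrow> set xs \<subseteq> set bs \<Longrightarrow> xs \<in> rel B R \<longleftrightarrow> map h xs \<in> rel B' R"
    using tp_iso[OF bs] by metis
  have d: "set us \<inter> set bs = {}" "set us' \<inter> set bs' = {}" using w by (auto simp: wfree_def)
  define f where "f x = (if x \<in> set us then g x else h x)" for x
  have fu: "map f xs = map g xs" if "set xs \<subseteq> set us" for xs using that by (auto simp: f_def)
  have fb: "map f xs = map h xs" if "set xs \<subseteq> set bs" for xs using that d by (auto simp: f_def)
  have iu: "f ` set us = set us'" and ib: "f ` set bs = set bs'"
    using fu[of us] fb[of bs] g(2) h(2) by (metis order_refl set_map)+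
  have inj: "inj_on f (set us \<union> set bs)"
  proof (rule inj_on_disjoint_Un[where f = f and g = f, simplified])
    show "inj_on f (set us)" using g(1) by (auto simp: f_def bij_betw_def inj_on_def)
    show "inj_on f (set bs)" using h(1) d by (auto simp: f_def bij_betw_def inj_on_def)
    show "f ` set us \<inter> f ` set bs = {}" using iu ib d by simp
  qed
  have "xs \<in> rel B R \<longleftrightarrow> map f xs \<in> rel B' R" if R: "R \<in> \<tau>" and xs: "set xs \<subseteq> set (us @ bs)" for R xs
  proof -
    have s: "set (map f xs) \<subseteq> set us' \<Longrightarrow> set xs \<subseteq> set us" "set (map f xs) \<subseteq> set bs' \<Longrightarrow> set xs \<subseteq> set bs"
      using xs iu ib d by (auto simp: image_subset_iff) blast+
    have "f ` set xs \<subseteq> f ` (set us \<union> set bs)" using xs by auto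
    then have "set (map f xs) \<subseteq> set us' \<union> set bs'" using iu ib by (simp add: image_Un)
    then have 1: "map f xs \<in> rel B' R \<Longrightarrow> set (map f xs) \<subseteq> set us' \<or> set (map f xs) \<subseteq> set bs'"
      using w(2) R unfolding wfree_def by blast
    have 2: "xs \<in> rel B R \<Longrightarrow> set xs \<subseteq> set us \<or> set xs \<subseteq> set bs"
      using w(1) R xs by (auto simp: wfree_def)
    show ?thesis using 1 2 s fu fb g(3)[OF R] h(3)[OF R] by metis
  qed
  then have "tp \<tau> B (us @ bs) = tp \<tau> B' (map f (us @ bs))" using inj by (intro iso_tp) auto
  then show ?thesis using fu[of us] fb[of bs] g h by simp
qed

subsection \<open>Evaluation\<close>

lemma upd_notin: "v \<notin> set xs \<Longrightarrow> upd s xs as v = s v"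
  by (auto simp: upd_def split: option.split dest!: map_of_SomeD set_zip_leftD)

lemma upd_nth: "distinct xs \<Longrightarrow> length as = length xs \<Longrightarrow> i < length xs \<Longrightarrow> upd s xs as (xs ! i) = as ! i"
  by (simp add: upd_def map_of_zip_nth)

lemma asg_nth: "distinct xs \<Longrightarrow> length as = length xs \<Longrightarrow> i < length xs \<Longrightarrow> asg xs as (xs ! i) = as ! i"
  by (simp add: asg_def upd_nth)

lemma eval_fv: "(\<And>v. v \<in> fv \<phi> \<Longrightarrow> s v = s' v) \<Longrightarrow> eval A \<phi> s = eval A \<phi> s'"
proof (induction \<phi> arbitrary: s s')
  case (Rel R xs)
  then have "map s xs = map s' xs" by auto
  then show ?case by (simp only: eval.simps)
next
  case (Conn C \<phi>s)
  have "eval A \<psi> s = eval A \<psi> s'" if "\<psi> \<in> set \<phi>s" for \<psi>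
    using that by (intro Conn.IH Conn.prems) auto
  then have "map (\<lambda>v. v s) (map (eval A) \<phi>s) = map (\<lambda>v. v s') (map (eval A) \<phi>s)" by simp
  then show ?case by (simp only: eval.simps)
next
  case (Agg F \<phi>s ys \<kappa>s)
  have u: "upd s ys bs v = upd s' ys bs v"
    if "length bs = length ys" "v \<in> fv \<psi>" "\<psi> \<in> set \<phi>s \<union> set \<kappa>s" for bs v \<psi>
  proof (cases "v \<in> set ys")
    case True
    then have "v \<in> fst ` set (zip ys bs)" using that(1) by (metis list.set_map map_fst_zip)
    then have "map_of (zip ys bs) v \<noteq> None" by (metis map_of_eq_None_iff)
    then show ?thesis by (auto simp: upd_def split: option.split)
  next
    case False
    then show ?thesis using that Agg.prems by (auto simp: upd_notin)
  qed
  have 1: "eval A \<psi> (upd s ys bs) = eval A \<psi> (upd s' ys bs)" if "\<psi> \<in> set \<phi>s" "bs \<in> tuples (dom A) (length ys)" for \<psi> bs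
    using that u by (intro Agg.IH) (auto simp: tuples_def)
  have 2: "eval A \<psi> (upd s ys bs) = eval A \<psi> (upd s' ys bs)" if "\<psi> \<in> set \<kappa>s" "bs \<in> tuples (dom A) (length ys)" for \<psi> bs
    using that u by (intro Agg.IH) (auto simp: tuples_def)
  have T: "{bs \<in> tuples (dom A) (length ys). eval A \<kappa> (upd s ys bs) = 1} =
    {bs \<in> tuples (dom A) (length ys). eval A \<kappa> (upd s' ys bs) = 1}" if "\<kappa> \<in> set \<kappa>s" for \<kappa>
    using 2[OF that] by auto
  have e: "map2 (\<lambda>v c. image_mset (\<lambda>bs. v (upd s ys bs)) (mset_set {bs \<in> tuples (dom A) (length ys). c (upd s ys bs) = 1}))
     (map (eval A) \<phi>s) (map (eval A) \<kappa>s) =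
    map2 (\<lambda>v c. image_mset (\<lambda>bs. v (upd s' ys bs)) (mset_set {bs \<in> tuples (dom A) (length ys). c (upd s' ys bs) = 1}))
     (map (eval A) \<phi>s) (map (eval A) \<kappa>s)"
  proof (rule nth_equalityI)
    fix i assume "i < length (map2 (\<lambda>v c. image_mset (\<lambda>bs. v (upd s ys bs)) (mset_set {bs \<in> tuples (dom A) (length ys). c (upd s ys bs) = 1}))
     (map (eval A) \<phi>s) (map (eval A) \<kappa>s))"
    then have i: "i < length \<phi>s" "i < length \<kappa>s" by auto
    have "image_mset (\<lambda>bs. eval A (\<phi>s ! i) (upd s ys bs)) (mset_set {bs \<in> tuples (dom A) (length ys). eval A (\<kappa>s ! i) (upd s ys bs) = 1}) =
      image_mset (\<lambda>bs. eval A (\<phi>s ! i) (upd s' ys bs)) (mset_set {bs \<in> tuples (dom A) (length ys). eval A (\<kappa>s ! i) (upd s' ys bs) = 1})"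
      unfolding T[OF nth_mem[OF i(2)]] 
    proof (rule image_mset_cong)
      fix bs assume "bs \<in># mset_set {bs \<in> tuples (dom A) (length ys). eval A (\<kappa>s ! i) (upd s' ys bs) = 1}"
      then have "bs \<in> tuples (dom A) (length ys)"
        by (cases "finite {bs \<in> tuples (dom A) (length ys). eval A (\<kappa>s ! i) (upd s' ys bs) = 1}") auto
      then show "eval A (\<phi>s ! i) (upd s ys bs) = eval A (\<phi>s ! i) (upd s' ys bs)" using 1 i by auto
    qed
    then show "map2 (\<lambda>v c. image_mset (\<lambda>bs. v (upd s ys bs)) (mset_set {bs \<in> tuples (dom A) (length ys). c (upd s ys bs) = 1}))
     (map (eval A) \<phi>s) (map (eval A) \<kappa>s) ! i = map2 (\<lambda>v c. image_mset (\<lambda>bs. v (upd s' ys bs)) (mset_set {bs \<in> tuples (dom A) (length ys). c (upd s' ys bs) = 1}))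
     (map (eval A) \<phi>s) (map (eval A) \<kappa>s) ! i" using i by simp
  qed auto
  have x: "(\<exists>c\<in>set (map (eval A) \<kappa>s). {bs \<in> tuples (dom A) (length ys). c (upd s ys bs) = 1} = {}) \<longleftrightarrow>
    (\<exists>c\<in>set (map (eval A) \<kappa>s). {bs \<in> tuples (dom A) (length ys). c (upd s' ys bs) = 1} = {})"
    using T by (simp del: Collect_empty_eq)
  show ?case unfolding eval.simps Let_def e x ..
qed auto

text \<open>The clause for \<open>Agg\<close> by positions instead of zipped lists, so that the
  aggregated multisets can be treated one conditioning formula at a time.\<close>

lemma eval_Agg:
  assumes "length \<kappa>s = length \<phi>s"
  shows "eval A (Agg F \<phi>s ys \<kappa>s) s =
    (if \<exists>i<length \<phi>s. {bs \<in> tuples (dom A) (length ys). eval A (\<kappa>s ! i) (upd s ys bs) = 1} = {} then 0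
     else F (map (\<lambda>i. image_mset (\<lambda>bs. eval A (\<phi>s ! i) (upd s ys bs))
       (mset_set {bs \<in> tuples (dom A) (length ys). eval A (\<kappa>s ! i) (upd s ys bs) = 1})) [0..<length \<phi>s]))"
proof -
  have 1: "(\<exists>c\<in>set (map (eval A) \<kappa>s). {bs \<in> tuples (dom A) (length ys). c (upd s ys bs) = 1} = {}) \<longleftrightarrow>
     (\<exists>i<length \<phi>s. {bs \<in> tuples (dom A) (length ys). eval A (\<kappa>s ! i) (upd s ys bs) = 1} = {})"
    using assms by (auto simp: in_set_conv_nth simp del: Collect_empty_eq) (metis nth_mem)
  have 2: "map2 (\<lambda>v c. image_mset (\<lambda>bs. v (upd s ys bs)) (mset_set {bs \<in> tuples (dom A) (length ys). c (upd s ys bs) = 1}))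
     (map (eval A) \<phi>s) (map (eval A) \<kappa>s) = map (\<lambda>i. image_mset (\<lambda>bs. eval A (\<phi>s ! i) (upd s ys bs))
       (mset_set {bs \<in> tuples (dom A) (length ys). eval A (\<kappa>s ! i) (upd s ys bs) = 1})) [0..<length \<phi>s]"
    using assms by (intro nth_equalityI) auto
  show ?thesis unfolding eval.simps Let_def 1 2 ..
qed

lemma is_pla_Conn: "is_pla ar \<rho> (Conn C \<phi>s) \<longleftrightarrow> is_connective (length \<phi>s) C \<and> (\<forall>\<phi>\<in>set \<phi>s. is_pla ar \<rho> \<phi>)"
  by (auto simp: list_all_iff)

lemma is_pla_Agg: "is_pla ar \<rho> (Agg F \<phi>s ys \<kappa>s) \<longleftrightarrow>
     is_aggregation (length \<phi>s) F \<and> length \<kappa>s = length \<phi>s \<and> distinct ys \<and> ys \<noteq> [] \<and>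
     (\<forall>\<phi>\<in>set \<phi>s. is_pla ar \<rho> \<phi>) \<and> (\<forall>\<phi>\<in>set \<kappa>s. is_pla ar \<rho> \<phi>)"
  by (auto simp: list_all_iff)

lemma is_pla_mono: "is_pla ar \<rho> \<phi> \<Longrightarrow> \<rho> \<subseteq> \<rho>' \<Longrightarrow> is_pla ar \<rho>' \<phi>"
  by (induction \<phi>) (auto simp: list_all_iff)

text \<open>Its main use: the value of the formula of a relation depends only on the relations of
  its parents and of \<open>\<tau>\<close>.\<close>

lemma eval_reduct:
  "is_pla ar \<rho> \<phi> \<Longrightarrow> dom A = dom A' \<Longrightarrow> (\<And>R. R \<in> \<rho> \<Longrightarrow> rel A R = rel A' R) \<Longrightarrow> eval A \<phi> s = eval A' \<phi> s"
proof (induction \<phi> arbitrary: s)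
  case (Conn C \<phi>s)
  have "map (\<lambda>v. v s) (map (eval A) \<phi>s) = map (\<lambda>v. v s) (map (eval A') \<phi>s)"
    using Conn by (auto simp: list_all_iff)
  then show ?case by (simp only: eval.simps)
next
  case (Agg F \<phi>s ys \<kappa>s)
  have l: "length \<kappa>s = length \<phi>s" using Agg.prems by simp
  have "eval A \<psi> s = eval A' \<psi> s" if "\<psi> \<in> set \<phi>s \<union> set \<kappa>s" for \<psi> s
    using that Agg by (auto simp: list_all_iff)
  then have "eval A (\<phi>s ! i) = eval A' (\<phi>s ! i)" "eval A (\<kappa>s ! i) = eval A' (\<kappa>s ! i)" if "i < length \<phi>s" for i
    using that l by (auto simp: fun_eq_iff)
  then show ?case unfolding eval_Agg[OF l] using Agg.prems(2)
    by (intro if_cong arg_cong[where f = F] map_cong refl arg_cong2[where f = image_mset] ext)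
      (simp_all cong: conj_cong del: Collect_empty_eq)
qed auto

lemma tuples_eq_lists: "tuples D k = {as. set as \<subseteq> D \<and> length as = k}"
  by (auto simp: tuples_def)

lemma finite_tuples: "finite D \<Longrightarrow> finite (tuples D k)"
  by (simp add: tuples_eq_lists finite_lists_length_eq)

lemma card_tuples: "finite D \<Longrightarrow> card (tuples D k) = card D ^ k"
  by (simp add: tuples_eq_lists card_lists_length_eq)

lemma eval_range: "is_pla ar \<rho> \<phi> \<Longrightarrow> finite (dom A) \<Longrightarrow> eval A \<phi> s \<in> {0..1}"
proof (induction \<phi> arbitrary: s)
  case (Conn C \<phi>s)
  have C: "is_connective (length \<phi>s) C" and I: "\<And>\<phi>. \<phi> \<in> set \<phi>s \<Longrightarrow> eval A \<phi> s \<in> {0..1}"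
    using Conn by (auto simp: list_all_iff)
  \<comment> \<open>Padding with 0 beyond the arity, since connectives are specified through
    functions on all naturals.\<close>
  define x where "x i = (if i < length \<phi>s then eval A (\<phi>s ! i) s else 0)" for i
  have "x \<in> {..<length \<phi>s} \<rightarrow> {0..1}" using I by (auto simp: x_def)
  then have "C (map x [0..<length \<phi>s]) \<in> {0..1}" using C unfolding is_connective_def by blast
  moreover have "map x [0..<length \<phi>s] = map (\<lambda>v. v s) (map (eval A) \<phi>s)"
    by (auto intro!: nth_equalityI simp: x_def)
  ultimately show ?case by simp
next
  case (Agg F \<phi>s ys \<kappa>s)
  have l: "length \<kappa>s = length \<phi>s" using Agg.prems by simp
  have I: "\<And>\<phi> s. \<phi> \<in> set \<phi>s \<Longrightarrow> eval A \<phi> s \<in> {0..1}" using Agg by (auto simp: list_all_iff)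
  have F: "F rs \<in> {0..1}" if "length rs = length \<phi>s" "\<forall>r\<in>set rs. r \<noteq> {#} \<and> set_mset r \<subseteq> {0..1}" for rs
    using Agg.prems that by (simp add: is_aggregation_def)
  have fin: "finite {bs \<in> tuples (dom A) (length ys). eval A (\<kappa>s ! i) (upd s ys bs) = 1}" for i
    using finite_tuples[OF Agg.prems(2)] by simp
  let ?T = "\<lambda>i. {bs \<in> tuples (dom A) (length ys). eval A (\<kappa>s ! i) (upd s ys bs) = 1}"
  have "F (map (\<lambda>i. image_mset (\<lambda>bs. eval A (\<phi>s ! i) (upd s ys bs)) (mset_set (?T i))) [0..<length \<phi>s]) \<in> {0..1}"
    if "\<not> (\<exists>i<length \<phi>s. ?T i = {})"
  proof (rule F)
    have "image_mset (\<lambda>bs. eval A (\<phi>s ! i) (upd s ys bs)) (mset_set (?T i)) \<noteq> {#} \<and>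
        set_mset (image_mset (\<lambda>bs. eval A (\<phi>s ! i) (upd s ys bs)) (mset_set (?T i))) \<subseteq> {0..1}"
      if i: "i < length \<phi>s" for i
    proof -
      have "?T i \<noteq> {}" using \<open>\<not> (\<exists>i<length \<phi>s. ?T i = {})\<close> i by blast
      then have "mset_set (?T i) \<noteq> {#}" using fin by (simp only: mset_set_empty_iff) simp
      then show ?thesis using I[OF nth_mem[OF i]] by (simp add: image_subset_iff)
    qed
    then show "\<forall>r\<in>set (map (\<lambda>i. image_mset (\<lambda>bs. eval A (\<phi>s ! i) (upd s ys bs)) (mset_set (?T i))) [0..<length \<phi>s]).
      r \<noteq> {#} \<and> set_mset r \<subseteq> {0..1}" by (simp only: set_map ball_simps) auto
  qed simp
  then show ?case unfolding eval_Agg[OF l] by (cases "\<exists>i<length \<phi>s. ?T i = {}") (simp_all only: if_True if_False not_False_eq_True True_implies_equals, simp)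
qed auto

subsection \<open>Independent events with few conflicts\<close>

text \<open>For independent events with probabilities \<open>\<theta> t\<close>, \<open>bw\<close> is the probability that exactly those in \<open>X\<close>
  occur, and \<open>bex\<close> is the expectation of \<open>f\<close> of the set of those that occur.\<close>

definition bw :: "('t \<Rightarrow> real) \<Rightarrow> 't set \<Rightarrow> 't set \<Rightarrow> real" where
  "bw \<theta> T X = (\<Prod>t\<in>X. \<theta> t) * (\<Prod>t\<in>T - X. 1 - \<theta> t)"

definition bex :: "('t \<Rightarrow> real) \<Rightarrow> 't set \<Rightarrow> ('t set \<Rightarrow> real) \<Rightarrow> real" where
  "bex \<theta> T f = (\<Sum>X\<in>Pow T. bw \<theta> T X * f X)"

lemma bw_nonneg: "(\<And>t. t \<in> T \<Longrightarrow> \<theta> t \<in> {0..1}) \<Longrightarrow> X \<subseteq> T \<Longrightarrow> 0 \<le> bw \<theta> T X"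
  unfolding bw_def by (intro mult_nonneg_nonneg prod_nonneg) (auto simp: subset_iff)

text \<open>The weights are the terms of the expanded product of all
  \<open>\<theta> t + (1 - \<theta> t)\<close>, so their sum is 1.\<close>

lemma bex_const: "finite T \<Longrightarrow> bex \<theta> T (\<lambda>_. c) = c"
  using prod_add[of T \<theta> "\<lambda>t. 1 - \<theta> t"] by (simp add: bex_def bw_def sum_distrib_right[symmetric])

lemma bex_mono:
  "(\<And>t. t \<in> T \<Longrightarrow> \<theta> t \<in> {0..1}) \<Longrightarrow> (\<And>X. X \<subseteq> T \<Longrightarrow> f X \<le> g X) \<Longrightarrow> bex \<theta> T f \<le> bex \<theta> T g"
  unfolding bex_def by (intro sum_mono mult_left_mono bw_nonneg) auto

lemma bex_add: "bex \<theta> T (\<lambda>X. f X + g X) = bex \<theta> T f + bex \<theta> T g"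
  by (simp add: bex_def distrib_left sum.distrib)

lemma bex_cmult: "bex \<theta> T (\<lambda>X. c * f X) = c * bex \<theta> T f"
  by (simp add: bex_def sum_distrib_left mult_ac)

lemma bex_sum: "bex \<theta> T (\<lambda>X. \<Sum>i\<in>I. f i X) = (\<Sum>i\<in>I. bex \<theta> T (f i))"
  unfolding bex_def sum_distrib_left by (rule sum.swap)

lemma bex_cong: "(\<And>X. X \<subseteq> T \<Longrightarrow> f X = g X) \<Longrightarrow> bex \<theta> T f = bex \<theta> T g"
  unfolding bex_def by (intro sum.cong) auto

lemma bex_single: "finite T \<Longrightarrow> Y \<subseteq> T \<Longrightarrow> bex \<theta> T (\<lambda>X. of_bool (X = Y)) = bw \<theta> T Y"
  by (simp add: bex_def of_bool_def if_distrib[of "\<lambda>x. _ * x"] sum.delta cong: if_cong)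

text \<open>Independence of what happens inside and outside \<open>S\<close>: the weight of a set is
  the product of the weights of its two traces.\<close>

lemma bex_Un:
  assumes "finite T" "S \<subseteq> T"
  shows "bex \<theta> T (\<lambda>X. f (X \<inter> S) * g (X - S)) = bex \<theta> S f * bex \<theta> (T - S) g"
proof -
  have fin: "finite S" using assms by (rule finite_subset[rotated])
  have "bex \<theta> S f * bex \<theta> (T - S) g =
      (\<Sum>(X, Y)\<in>Pow S \<times> Pow (T - S). bw \<theta> S X * f X * (bw \<theta> (T - S) Y * g Y))"
    unfolding bex_def sum_product by (rule sum.cartesian_product)
  also have "\<dots> = (\<Sum>X\<in>Pow T. bw \<theta> T X * (f (X \<inter> S) * g (X - S)))"
  proof (rule sum.reindex_bij_witness[of _ "\<lambda>X. (X \<inter> S, X - S)" "\<lambda>(X, Y). X \<union> Y"])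
    fix p assume "p \<in> Pow S \<times> Pow (T - S)"
    then obtain X Y where p: "p = (X, Y)" "X \<subseteq> S" "Y \<subseteq> T - S" by auto
    then have e: "(X \<union> Y) \<inter> S = X" "(X \<union> Y) - S = Y" by auto
    show "(\<lambda>X. (X \<inter> S, X - S)) ((\<lambda>(X, Y). X \<union> Y) p) = p" using p e by simp
    show "(\<lambda>(X, Y). X \<union> Y) p \<in> Pow T" using p assms by auto
    have d: "X \<inter> Y = {}" "finite X" "finite Y" using p fin assms(1) by (auto intro: finite_subset)
    have c: "T - (X \<union> Y) = (S - X) \<union> (T - S - Y)" "(S - X) \<inter> (T - S - Y) = {}" using p assms by auto
    have "bw \<theta> T (X \<union> Y) = bw \<theta> S X * bw \<theta> (T - S) Y"
      unfolding bw_def c(1) using d c(2) fin assms(1) by (simp add: prod.union_disjoint mult_ac)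
    then show "bw \<theta> T ((\<lambda>(X, Y). X \<union> Y) p) * (f ((\<lambda>(X, Y). X \<union> Y) p \<inter> S) * g ((\<lambda>(X, Y). X \<union> Y) p - S)) =
      (case p of (X, Y) \<Rightarrow> bw \<theta> S X * f X * (bw \<theta> (T - S) Y * g Y))"
      using p(1) e by simp
  qed (use assms in auto)
  finally show ?thesis by (simp add: bex_def)
qed

lemma bex_local:
  assumes "finite T" "S \<subseteq> T"
  shows "bex \<theta> T (\<lambda>X. f (X \<inter> S)) = bex \<theta> S f"
  using bex_Un[OF assms, of \<theta> f "\<lambda>_. 1"] assms by (simp add: bex_const)

lemma bex_prod:
  assumes "finite I" "finite T" "\<And>i. i \<in> I \<Longrightarrow> S i \<subseteq> T" "disjoint_family_on S I"
  shows "bex \<theta> T (\<lambda>X. \<Prod>i\<in>I. f i (X \<inter> S i)) = (\<Prod>i\<in>I. bex \<theta> (S i) (f i))"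
  using assms
proof (induction I arbitrary: T rule: finite_induct)
  case (insert j I)
  have d: "S i \<subseteq> T - S j" if "i \<in> I" for i
    using insert.prems that insert.hyps by (auto simp: disjoint_family_on_def)
  have "bex \<theta> T (\<lambda>X. \<Prod>i\<in>insert j I. f i (X \<inter> S i)) =
      bex \<theta> T (\<lambda>X. f j (X \<inter> S j) * (\<Prod>i\<in>I. f i ((X - S j) \<inter> S i)))"
  proof (rule bex_cong)
    fix X
    have "(X - S j) \<inter> S i = X \<inter> S i" if "i \<in> I" for i using d[OF that] by auto
    then show "(\<Prod>i\<in>insert j I. f i (X \<inter> S i)) = f j (X \<inter> S j) * (\<Prod>i\<in>I. f i ((X - S j) \<inter> S i))"
      using insert.hyps by simp
  qed
  also have "\<dots> = bex \<theta> (S j) (f j) * bex \<theta> (T - S j) (\<lambda>X. \<Prod>i\<in>I. f i (X \<inter> S i))"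
    using insert.prems by (intro bex_Un) auto
  also have "bex \<theta> (T - S j) (\<lambda>X. \<Prod>i\<in>I. f i (X \<inter> S i)) = (\<Prod>i\<in>I. bex \<theta> (S i) (f i))"
    using insert.prems d by (intro insert.IH) (auto simp: disjoint_family_on_def)
  finally show ?case using insert.hyps by simp
qed (simp add: bex_const)

text \<open>Meant for the moment generating functions in \<open>chernoff\<close>, where the linear
  terms cancel in expectation and only the square remains.\<close>

lemma exp_le_quadratic: "\<bar>x\<bar> \<le> 1 \<Longrightarrow> exp x \<le> 1 + x + x\<^sup>2" for x :: real
proof (cases "x \<ge> 0")
  case True
  assume "\<bar>x\<bar> \<le> 1"
  then show ?thesis using True exp_bound[of x] by simp
next
  case False
  assume "\<bar>x\<bar> \<le> 1"
  define y where "y = - x"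
  have y: "0 \<le> y" "y \<le> 1" using False \<open>\<bar>x\<bar> \<le> 1\<close> by (auto simp: y_def)
  \<comment> \<open>The claim for -y amounts to \<open>1 \<le> (1 - y + y\<^sup>2) * exp y\<close>,
    for which the quadratic Taylor polynomial of \<open>exp\<close> is enough.\<close>
  have q: "1 + y + y\<^sup>2 / 2 \<le> exp y" using exp_lower_Taylor_quadratic[OF y(1)] by simp
  have p: "0 < 1 - y + y\<^sup>2" using y by (smt (verit) zero_less_power zero_le_power2)
  have "1 \<le> 1 + y\<^sup>2 / 2 + y ^ 3 / 2 + y ^ 4 / 2" using y by simp
  also have "\<dots> = (1 - y + y\<^sup>2) * (1 + y + y\<^sup>2 / 2)" by (simp add: field_simps power2_eq_square power3_eq_cube power4_eq_xxxx)
  also have "\<dots> \<le> (1 - y + y\<^sup>2) * exp y" using q p by (intro mult_left_mono) auto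
  finally have "exp (- y) \<le> 1 - y + y\<^sup>2" by (simp add: exp_minus field_simps)
  then show ?thesis by (simp add: y_def)
qed

text \<open>Exponential Markov inequality for both signs. Deviations of indicators from their means
  are at most 1 in absolute value, so each has moment generating function at most
  \<open>exp (s\<^sup>2)\<close>, and disjointness of the sets \<open>S i\<close> lets these factors
  multiply.\<close>

lemma chernoff:
  fixes \<theta> :: "'t \<Rightarrow> real" and \<delta> :: real
  assumes fin: "finite I" "finite T" and \<theta>: "\<And>t. t \<in> T \<Longrightarrow> \<theta> t \<in> {0..1}"
    and S: "\<And>i. i \<in> I \<Longrightarrow> S i \<subseteq> T" "\<And>i. i \<in> I \<Longrightarrow> Y i \<subseteq> S i" and disj: "disjoint_family_on S I"
    and \<delta>: "0 < \<delta>" "\<delta> \<le> 1"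
  shows "bex \<theta> T (\<lambda>X. of_bool (\<bar>\<Sum>i\<in>I. of_bool (X \<inter> S i = Y i) - bw \<theta> (S i) (Y i)\<bar> > \<delta> * card I))
    \<le> 2 * exp (- (\<delta>\<^sup>2 * card I / 4))"
proof -
  define Z where "Z i X = (of_bool (X = Y i) :: real)" for i X
  define \<mu> where "\<mu> i = bw \<theta> (S i) (Y i)" for i
  have finS: "finite (S i)" if "i \<in> I" for i using S(1)[OF that] fin by (auto intro: finite_subset)
  have \<mu>: "bex \<theta> (S i) (Z i) = \<mu> i" if "i \<in> I" for i
    unfolding \<mu>_def Z_def using bex_single[OF finS S(2)] that by simp
  have \<theta>S: "\<theta> t \<in> {0..1}" if "i \<in> I" "t \<in> S i" for t i using S(1) \<theta> that by blast
  have \<mu>01: "0 \<le> \<mu> i" "\<mu> i \<le> 1" if "i \<in> I" for i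
  proof -
    show "0 \<le> \<mu> i" unfolding \<mu>_def using \<theta>S[OF that] S(2)[OF that] by (intro bw_nonneg) auto
    have "bex \<theta> (S i) (Z i) \<le> bex \<theta> (S i) (\<lambda>_. 1)" using \<theta>S[OF that] by (intro bex_mono) (auto simp: Z_def)
    then show "\<mu> i \<le> 1" using \<mu>[OF that] finS[OF that] by (simp add: bex_const)
  qed
  have mgf1: "bex \<theta> (S i) (\<lambda>X. exp (s * (Z i X - \<mu> i))) \<le> exp (s\<^sup>2)" if i: "i \<in> I" and s: "\<bar>s\<bar> \<le> 1" for i s
  proof -
    have "bex \<theta> (S i) (\<lambda>X. exp (s * (Z i X - \<mu> i))) \<le> bex \<theta> (S i) (\<lambda>X. (1 + s\<^sup>2 - s * \<mu> i) + s * Z i X)"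
    proof (rule bex_mono[OF \<theta>S[OF i]])
      fix X
      have a: "\<bar>Z i X - \<mu> i\<bar> \<le> 1" using \<mu>01[OF i] by (auto simp: Z_def)
      have b: "\<bar>s * (Z i X - \<mu> i)\<bar> \<le> 1" unfolding abs_mult using a s by (intro mult_le_one) auto
      have "(s * (Z i X - \<mu> i))\<^sup>2 \<le> s\<^sup>2 * 1" unfolding power_mult_distrib
        using a by (intro mult_left_mono) (auto simp: abs_square_le_1)
      then show "exp (s * (Z i X - \<mu> i)) \<le> (1 + s\<^sup>2 - s * \<mu> i) + s * Z i X"
        using exp_le_quadratic[OF b] by (simp add: algebra_simps)
    qed auto
    also have "\<dots> = 1 + s\<^sup>2" using \<mu>[OF i] finS[OF i] by (simp add: bex_add bex_cmult bex_const)
    also have "\<dots> \<le> exp (s\<^sup>2)" using exp_ge_add_one_self by simp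
    finally show ?thesis .
  qed
  have mgf: "bex \<theta> T (\<lambda>X. exp (s * (\<Sum>i\<in>I. Z i (X \<inter> S i) - \<mu> i))) \<le> exp (s\<^sup>2 * card I)" if s: "\<bar>s\<bar> \<le> 1" for s
  proof -
    have "bex \<theta> T (\<lambda>X. exp (s * (\<Sum>i\<in>I. Z i (X \<inter> S i) - \<mu> i))) =
        bex \<theta> T (\<lambda>X. \<Prod>i\<in>I. exp (s * (Z i (X \<inter> S i) - \<mu> i)))"
      by (simp add: exp_sum[OF fin(1), symmetric] sum_distrib_left)
    also have "\<dots> = (\<Prod>i\<in>I. bex \<theta> (S i) (\<lambda>X. exp (s * (Z i X - \<mu> i))))"
      using fin S(1) disj by (intro bex_prod) auto
    also have "\<dots> \<le> (\<Prod>i\<in>I. exp (s\<^sup>2))"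
    proof (intro prod_mono conjI mgf1 s)
      fix i assume i: "i \<in> I"
      have "bex \<theta> (S i) (\<lambda>_. 0) \<le> bex \<theta> (S i) (\<lambda>X. exp (s * (Z i X - \<mu> i)))"
        using \<theta>S[OF i] by (intro bex_mono) auto
      then show "0 \<le> bex \<theta> (S i) (\<lambda>X. exp (s * (Z i X - \<mu> i)))" using finS[OF i] by (simp add: bex_const)
    qed
    also have "\<dots> = exp (s\<^sup>2 * card I)" by (simp add: exp_of_nat_mult[symmetric] mult.commute)
    finally show ?thesis .
  qed
  let ?D = "\<lambda>X. \<Sum>i\<in>I. Z i (X \<inter> S i) - \<mu> i"
  \<comment> \<open>The minimizer of \<open>s\<^sup>2 - s * \<delta>\<close>; the minimum is
    \<open>- \<delta>\<^sup>2 / 4\<close>.\<close>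
  define s where "s = \<delta> / 2"
  have s: "\<bar>s\<bar> \<le> 1" "\<bar>- s\<bar> \<le> 1" using \<delta> by (auto simp: s_def)
  have "bex \<theta> T (\<lambda>X. of_bool (\<bar>?D X\<bar> > \<delta> * card I)) \<le>
      bex \<theta> T (\<lambda>X. exp (- (s * \<delta> * card I)) * (exp (s * ?D X) + exp (- s * ?D X)))"
  proof (rule bex_mono[OF \<theta>])
    fix X
    have "1 \<le> exp (- (s * \<delta> * card I)) * (exp (s * ?D X) + exp (- s * ?D X))" if "\<bar>?D X\<bar> > \<delta> * card I"
    proof -
      have "s * \<delta> * card I \<le> s * \<bar>?D X\<bar>" unfolding mult.assoc using that \<delta> by (intro mult_left_mono) (auto simp: s_def)
      then have "1 \<le> exp (- (s * \<delta> * card I) + s * \<bar>?D X\<bar>)" by simp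
      also have "\<dots> = exp (- (s * \<delta> * card I)) * exp (s * \<bar>?D X\<bar>)" by (rule exp_add)
      also have "\<dots> \<le> exp (- (s * \<delta> * card I)) * (exp (s * ?D X) + exp (- s * ?D X))"
        by (intro mult_left_mono) (auto simp: abs_if)
      finally show ?thesis .
    qed
    moreover have "0 \<le> exp (- (s * \<delta> * card I)) * (exp (s * ?D X) + exp (- s * ?D X))"
      by (intro mult_nonneg_nonneg add_nonneg_nonneg) auto
    ultimately show "of_bool (\<bar>?D X\<bar> > \<delta> * card I) \<le> exp (- (s * \<delta> * card I)) * (exp (s * ?D X) + exp (- s * ?D X))"
      by (cases "\<bar>?D X\<bar> > \<delta> * card I") auto
  qed auto
  also have "\<dots> = exp (- (s * \<delta> * card I)) * (bex \<theta> T (\<lambda>X. exp (s * ?D X)) + bex \<theta> T (\<lambda>X. exp (- s * ?D X)))"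
    by (simp only: bex_cmult bex_add)
  also have "\<dots> \<le> exp (- (s * \<delta> * card I)) * (exp (s\<^sup>2 * card I) + exp (s\<^sup>2 * card I))"
    using mgf[OF s(1)] mgf[OF s(2)] by (intro mult_left_mono add_mono) auto
  also have "\<dots> = 2 * exp (- (\<delta>\<^sup>2 * card I / 4))"
  proof -
    have e: "- (s * \<delta> * card I) + s\<^sup>2 * card I = - (\<delta>\<^sup>2 * card I / 4)"
      by (simp add: s_def power2_eq_square)
    have "exp (- (s * \<delta> * card I)) * (exp (s\<^sup>2 * card I) + exp (s\<^sup>2 * card I)) =
        2 * exp (- (s * \<delta> * card I) + s\<^sup>2 * card I)" unfolding exp_add by simp
    then show ?thesis unfolding e .
  qed
  finally show ?thesis by (simp add: Z_def \<mu>_def)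
qed

text \<open>When a vertex is added, fewer than \<open>D\<close> colours are blocked by its
  neighbours.\<close>

lemma greedy_colouring:
  assumes "finite U" "\<And>u. u \<in> U \<Longrightarrow> card {v \<in> U. v \<noteq> u \<and> E u v} < D" "\<And>u v. E u v \<Longrightarrow> E v u"
  shows "\<exists>c. (\<forall>u\<in>U. c u < (D::nat)) \<and> (\<forall>u\<in>U. \<forall>v\<in>U. u \<noteq> v \<and> E u v \<longrightarrow> c u \<noteq> c v)"
  using assms(1,2)
proof (induction U rule: finite_induct)
  case (insert w U)
  have ih: "card {v \<in> U. v \<noteq> u \<and> E u v} < D" if "u \<in> U" for u
  proof -
    have "card {v \<in> U. v \<noteq> u \<and> E u v} \<le> card {v \<in> insert w U. v \<noteq> u \<and> E u v}"
      using insert.hyps by (intro card_mono) auto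
    then show ?thesis using insert.prems[of u] that by simp
  qed
  obtain c where c: "\<forall>u\<in>U. c u < D" "\<forall>u\<in>U. \<forall>v\<in>U. u \<noteq> v \<and> E u v \<longrightarrow> c u \<noteq> c v"
    using insert.IH[OF ih, simplified] by (elim exE conjE) (rule that)
  let ?N = "{v \<in> insert w U. v \<noteq> w \<and> E w v}"
  have finN: "finite ?N" using insert.hyps by simp
  have "card (c ` ?N) < D" using card_image_le[OF finN, of c] insert.prems[OF insertI1] by (rule le_less_trans)
  moreover have "D \<le> card (c ` ?N)" if "{..<D} \<subseteq> c ` ?N"
    using card_mono[OF finite_imageI[OF finN] that] by simp
  ultimately obtain k where k: "k < D" "k \<notin> c ` ?N" by fastforce
  show ?case
  proof (intro exI[of _ "c(w := k)"] conjI ballI impI)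
    fix u v assume uv: "u \<in> insert w U" "v \<in> insert w U" "u \<noteq> v \<and> E u v"
    show "(c(w := k)) u \<noteq> (c(w := k)) v"
    proof (cases "u = w \<or> v = w")
      case True
      then show ?thesis using uv k(2) assms(3) by (auto simp: image_iff)
    next
      case False
      then show ?thesis using uv c(2) by auto
    qed
  qed (use c k in auto)
qed simp

text \<open>Each colour class of the conflict graph consists of independent events. Classes smaller than
  \<open>\<delta> * M / D\<close> contribute at most \<open>\<delta> * M\<close> together, and the Chernoff bound applies to the others.\<close>

lemma concentration:
  fixes \<theta> :: "'t \<Rightarrow> real" and \<delta> M :: real
  assumes fin: "finite U" "finite T" and \<theta>: "\<And>t. t \<in> T \<Longrightarrow> \<theta> t \<in> {0..1}"
    and S: "\<And>u. u \<in> U \<Longrightarrow> S u \<subseteq> T" "\<And>u. u \<in> U \<Longrightarrow> Y u \<subseteq> S u"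
    and D: "\<And>u. u \<in> U \<Longrightarrow> card {v \<in> U. v \<noteq> u \<and> S u \<inter> S v \<noteq> {}} < D" "D \<ge> 1"
    and \<delta>: "0 < \<delta>" "\<delta> \<le> 1" and M: "card U \<le> M" "0 < M"
  shows "bex \<theta> T (\<lambda>X. of_bool (\<bar>\<Sum>u\<in>U. of_bool (X \<inter> S u = Y u) - bw \<theta> (S u) (Y u)\<bar> > 2 * \<delta> * M))
    \<le> 2 * D * exp (- (\<delta> ^ 3 * M / (4 * D)))"
proof -
  obtain c where c: "\<And>u. u \<in> U \<Longrightarrow> c u < D" "\<And>u v. u \<in> U \<Longrightarrow> v \<in> U \<Longrightarrow> u \<noteq> v \<Longrightarrow> S u \<inter> S v \<noteq> {} \<Longrightarrow> c u \<noteq> c v"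
    using greedy_colouring[OF fin(1) D(1)] by (metis Int_commute)
  define I where "I j = {u \<in> U. c u = j}" for j
  have Isub: "I j \<subseteq> U" and finI: "finite (I j)" for j using fin by (auto simp: I_def)
  have disj: "disjoint_family_on S (I j)" for j
    using c(2) by (auto simp: disjoint_family_on_def I_def)
  define big where "big = {j. j < D \<and> \<delta> * M / D \<le> card (I j)}"
  define E where "E X u = of_bool (X \<inter> S u = Y u) - bw \<theta> (S u) (Y u)" for X u
  have E1: "\<bar>E X u\<bar> \<le> 1" if "u \<in> U" for X u
  proof -
    have "0 \<le> bw \<theta> (S u) (Y u)" using S \<theta> that by (intro bw_nonneg) blast+
    moreover have "bw \<theta> (S u) (Y u) = bex \<theta> (S u) (\<lambda>X. of_bool (X = Y u))"
      using S[OF that] fin by (intro bex_single[symmetric]) (auto intro: finite_subset)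
    moreover have "\<dots> \<le> bex \<theta> (S u) (\<lambda>_. 1)" using S \<theta> that by (intro bex_mono) (auto dest!: S(1))
    moreover have "\<dots> = 1" using S(1)[OF that] fin by (intro bex_const) (auto intro: finite_subset)
    ultimately show ?thesis by (auto simp: E_def)
  qed
  have bound: "\<bar>\<Sum>u\<in>U. E X u\<bar> \<le> 2 * \<delta> * M" if X: "\<forall>j\<in>big. \<not> \<bar>\<Sum>u\<in>I j. E X u\<bar> > \<delta> * card (I j)" for X
  proof -
    have "(\<Sum>u\<in>U. E X u) = (\<Sum>j<D. \<Sum>u\<in>I j. E X u)"
      unfolding I_def using fin c(1) by (intro sum.group[symmetric]) auto
    then have "\<bar>\<Sum>u\<in>U. E X u\<bar> \<le> (\<Sum>j<D. \<bar>\<Sum>u\<in>I j. E X u\<bar>)" by (simp add: sum_abs)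
    also have "\<dots> \<le> (\<Sum>j<D. \<delta> * card (I j) + \<delta> * M / D)"
    proof (rule sum_mono)
      fix j assume j: "j \<in> {..<D}"
      show "\<bar>\<Sum>u\<in>I j. E X u\<bar> \<le> \<delta> * card (I j) + \<delta> * M / D"
      proof (cases "j \<in> big")
        case True
        then have "\<bar>\<Sum>u\<in>I j. E X u\<bar> \<le> \<delta> * card (I j)" using X by force
        moreover have "0 \<le> \<delta> * M / D" using \<delta> M by simp
        ultimately show ?thesis by linarith
      next
        case False
        have "\<bar>\<Sum>u\<in>I j. E X u\<bar> \<le> (\<Sum>u\<in>I j. \<bar>E X u\<bar>)" by (rule sum_abs)
        also have "\<dots> \<le> (\<Sum>u\<in>I j. 1)" using E1 Isub by (intro sum_mono) blast
        also have "\<dots> \<le> \<delta> * M / D" using False j by (simp add: big_def)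
        finally show ?thesis using \<delta> by (simp add: add_increasing)
      qed
    qed
    also have "\<dots> = \<delta> * (\<Sum>j<D. card (I j)) + \<delta> * M"
      using D(2) by (simp add: sum.distrib sum_distrib_left)
    also have "(\<Sum>j<D. card (I j)) = card U"
    proof -
      have "(\<Sum>j<D. card (I j)) = (\<Sum>j<D. \<Sum>u\<in>I j. 1)" by simp
      also have "\<dots> = (\<Sum>u\<in>U. 1)" unfolding I_def using fin c(1) by (intro sum.group) auto
      finally show ?thesis by simp
    qed
    also have "\<delta> * card U + \<delta> * M \<le> 2 * \<delta> * M" using M(1) \<delta> by simp
    finally show ?thesis .
  qed
  have "bex \<theta> T (\<lambda>X. of_bool (\<bar>\<Sum>u\<in>U. E X u\<bar> > 2 * \<delta> * M)) \<le>
      bex \<theta> T (\<lambda>X. \<Sum>j\<in>big. of_bool (\<bar>\<Sum>u\<in>I j. E X u\<bar> > \<delta> * card (I j)))"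
  proof (rule bex_mono[OF \<theta>])
    fix X
    show "of_bool (\<bar>\<Sum>u\<in>U. E X u\<bar> > 2 * \<delta> * M) \<le> (\<Sum>j\<in>big. of_bool (\<bar>\<Sum>u\<in>I j. E X u\<bar> > \<delta> * card (I j)) :: real)"
    proof (cases "\<forall>j\<in>big. \<not> \<bar>\<Sum>u\<in>I j. E X u\<bar> > \<delta> * card (I j)")
      case True
      then show ?thesis using bound[OF True] by (simp add: sum_nonneg)
    next
      case False
      then obtain j where j: "j \<in> big" "\<bar>\<Sum>u\<in>I j. E X u\<bar> > \<delta> * card (I j)" by blast
      have "(1::real) \<le> (\<Sum>j\<in>{j}. of_bool (\<bar>\<Sum>u\<in>I j. E X u\<bar> > \<delta> * card (I j)))" using j by simp
      also have "\<dots> \<le> (\<Sum>j\<in>big. of_bool (\<bar>\<Sum>u\<in>I j. E X u\<bar> > \<delta> * card (I j)))"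
        using j by (intro sum_mono2) (auto simp: big_def)
      finally show ?thesis by (smt (verit) of_bool_def)
    qed
  qed auto
  also have "\<dots> = (\<Sum>j\<in>big. bex \<theta> T (\<lambda>X. of_bool (\<bar>\<Sum>u\<in>I j. E X u\<bar> > \<delta> * card (I j))))"
    by (rule bex_sum)
  also have "\<dots> \<le> (\<Sum>j\<in>big. 2 * exp (- (\<delta> ^ 3 * M / (4 * D))))"
  proof (rule sum_mono)
    fix j assume j: "j \<in> big"
    have "bex \<theta> T (\<lambda>X. of_bool (\<bar>\<Sum>u\<in>I j. E X u\<bar> > \<delta> * card (I j))) \<le> 2 * exp (- (\<delta>\<^sup>2 * card (I j) / 4))"
      unfolding E_def using S Isub by (intro chernoff fin \<theta> disj \<delta> finI) blast+
    \<comment> \<open>A big class has at least \<open>\<delta> * M / D\<close> members, which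
      explains the third power of \<delta> and the denominator \<open>D\<close> in the
      exponent.\<close>
    also have "\<dots> \<le> 2 * exp (- (\<delta> ^ 3 * M / (4 * D)))"
    proof -
      have "\<delta>\<^sup>2 * (\<delta> * M / D) \<le> \<delta>\<^sup>2 * card (I j)" using j by (intro mult_left_mono) (auto simp: big_def)
      then show ?thesis by (simp add: power2_eq_square power3_eq_cube mult_ac)
    qed
    finally show "bex \<theta> T (\<lambda>X. of_bool (\<bar>\<Sum>u\<in>I j. E X u\<bar> > \<delta> * card (I j))) \<le> 2 * exp (- (\<delta> ^ 3 * M / (4 * D)))" .
  qed
  also have "\<dots> \<le> D * (2 * exp (- (\<delta> ^ 3 * M / (4 * D))))"
  proof -
    have "card big \<le> card {..<D}" by (intro card_mono) (auto simp: big_def)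
    then show ?thesis by (simp add: mult_right_mono)
  qed
  finally show ?thesis by (simp add: E_def)
qed

subsection \<open>Networks restricted to an initial set of relations\<close>

text \<open>Only the signature shrinks, so all other data of the network are literally shared. The
  construction is applied to sets closed under parents.\<close>

definition subnet :: "('a, 'r) net \<Rightarrow> 'r set \<Rightarrow> ('a, 'r) net" where
  "subnet N L = N\<lparr>sigma := tau N \<union> L\<rparr>"

text \<open>The initial segments of the DAG. On them the induced distribution is the marginal of the
  full one, see \<open>expect_red\<close>.\<close>

definition initial :: "('a, 'r) net \<Rightarrow> 'r set \<Rightarrow> bool" where
  "initial N L \<longleftrightarrow> L \<subseteq> sigma N - tau N \<and> (\<forall>R\<in>L. par N R \<subseteq> L)"

definition expect :: "('a, 'r) net \<Rightarrow> nat \<Rightarrow> (('a, 'r) struc \<Rightarrow> real) \<Rightarrow> real" where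
  "expect N n g = (\<Sum>A\<in>worlds N n. world_prob N A * g A)"

definition ins :: "('a, 'r) struc \<Rightarrow> 'r \<Rightarrow> 'a list set \<Rightarrow> ('a, 'r) struc" where
  "ins A R X = A\<lparr>rel := (rel A)(R := X)\<rparr>"

definition red :: "'r set \<Rightarrow> ('a, 'r) struc \<Rightarrow> ('a, 'r) struc" where
  "red \<rho> A = A\<lparr>rel := \<lambda>R. if R \<in> \<rho> then rel A R else {}\<rparr>"

definition th :: "('a, 'r) net \<Rightarrow> ('a, 'r) struc \<Rightarrow> 'r \<Rightarrow> 'a list \<Rightarrow> real" where
  "th N A R t = eval A (theta N R) (asg [0..<arity N R] t)"

text \<open>Stated through the probability of failure, which adds up in finite conjunctions; the
  event may vary with \<open>n\<close>.\<close>

definition whp :: "('a, 'r) net \<Rightarrow> 'r set \<Rightarrow> (nat \<Rightarrow> ('a, 'r) struc \<Rightarrow> bool) \<Rightarrow> bool" where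
  "whp N L E \<longleftrightarrow> (\<forall>\<epsilon>>0. \<forall>\<^sub>F n in sequentially. prob (subnet N L) n (\<lambda>A. \<not> E n A) \<le> \<epsilon>)"

lemma subnet_simps [simp]:
  "sigma (subnet N L) = tau N \<union> L" "tau (subnet N L) = tau N" "arity (subnet N L) = arity N"
  "base (subnet N L) = base N" "par (subnet N L) = par N" "theta (subnet N L) = theta N"
  by (auto simp: subnet_def)

lemma ins_simps [simp]: "dom (ins A R X) = dom A" "rel (ins A R X) = (rel A)(R := X)"
  by (auto simp: ins_def)

lemma red_simps [simp]: "dom (red \<rho> A) = dom A" "rel (red \<rho> A) R = (if R \<in> \<rho> then rel A R else {})"
  by (auto simp: red_def)

lemma struc_eqI: "dom A = dom A' \<Longrightarrow> (\<And>R. rel A R = rel A' R) \<Longrightarrow> A = (A' :: ('a, 'r) struc)"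
  by (intro struc.equality) auto

locale network =
  fixes N :: "('a, 'r) net"
  assumes net: "is_net N"
begin

abbreviation "\<tau> \<equiv> tau N"
abbreviation "\<sigma> \<equiv> sigma N"
abbreviation "ar \<equiv> arity N"
abbreviation "B \<equiv> base N"
abbreviation "Dm n \<equiv> dom (base N n)"

lemma finite_sigma: "finite \<sigma>" and tau_sub: "\<tau> \<subseteq> \<sigma>"
  and base_struc: "n \<ge> 1 \<Longrightarrow> is_struc ar \<tau> (B n)"
  and par_sub: "R \<in> \<sigma> - \<tau> \<Longrightarrow> par N R \<subseteq> \<sigma> - \<tau>"
  and acyc: "acyclic {(S, R). R \<in> \<sigma> - \<tau> \<and> S \<in> par N R}"
  and theta_pla: "R \<in> \<sigma> - \<tau> \<Longrightarrow> is_pla ar (par N R \<union> \<tau>) (theta N R)"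
  and theta_fv: "R \<in> \<sigma> - \<tau> \<Longrightarrow> fv (theta N R) \<subseteq> {..<ar R}"
  using net by (simp_all add: is_net_def)

lemma finite_Dm: "n \<ge> 1 \<Longrightarrow> finite (Dm n)"
  using base_struc by (auto simp: is_struc_def)

lemma finite_tau: "finite \<tau>"
  using finite_sigma tau_sub by (rule finite_subset[rotated])

lemma initialD:
  assumes "initial N L"
  shows "L \<subseteq> \<sigma> - \<tau>" "L \<inter> \<tau> = {}" "finite L"
    "\<And>R. R \<in> L \<Longrightarrow> par N R \<subseteq> L" "\<tau> \<union> L - \<tau> = L" "\<tau> \<union> L \<subseteq> \<sigma>"
  using assms finite_sigma tau_sub by (auto simp: initial_def intro: finite_subset)

lemma initial_full: "initial N (\<sigma> - \<tau>)"
  using par_sub by (auto simp: initial_def)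

lemma initial_empty: "initial N {}"
  by (auto simp: initial_def)

lemma subnet_full: "subnet N (\<sigma> - \<tau>) = N"
  using tau_sub by (simp add: subnet_def Un_absorb1)

text \<open>Among the relations of \<open>L - L0\<close> pick one that is a parent of no other one
  there, which exists by acyclicity; as \<open>L0\<close> is closed under parents, it is no parent
  of a relation in \<open>L0\<close> either, so removing it keeps \<open>L\<close> closed.\<close>

lemma initial_remove:
  assumes L: "initial N L" and L0: "initial N L0" "L0 \<subset> L"
  obtains R where "R \<in> L - L0" "initial N (L - {R})" "par N R \<subseteq> L - {R}"
proof -
  define r where "r = {(S, R). R \<in> \<sigma> - \<tau> \<and> S \<in> par N R}"
  have "finite r"
    by (rule finite_subset[of _ "\<sigma> \<times> \<sigma>"]) (use finite_sigma par_sub in \<open>auto simp: r_def\<close>)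
  then have "wf (r\<inverse>)" using acyc unfolding r_def by (rule finite_acyclic_wf_converse)
  then obtain R where R: "R \<in> L - L0" "\<And>S. (S, R) \<in> r\<inverse> \<Longrightarrow> S \<notin> L - L0"
    using L0(2) by (metis Diff_eq_empty_iff all_not_in_conv psubset_eq subset_antisym wfE_min)
  have nopar: "R \<notin> par N S" if "S \<in> L" for S
  proof (cases "S \<in> L0")
    case True
    then show ?thesis using initialD(4)[OF L0(1) True] R by auto
  next
    case False
    then show ?thesis using R(2)[of S] that initialD(1)[OF L] by (auto simp: r_def)
  qed
  show ?thesis
  proof
    show "initial N (L - {R})" using L nopar by (auto simp: initial_def)
    show "par N R \<subseteq> L - {R}" using nopar[of R] R initialD(4)[OF L, of R] by auto
  qed (use R in auto)
qed

lemma initial_induct [consumes 1, case_names empty insert]: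
  assumes "initial N L" "P {}"
    "\<And>R L. R \<notin> L \<Longrightarrow> initial N L \<Longrightarrow> initial N (insert R L) \<Longrightarrow> par N R \<subseteq> L \<Longrightarrow> P L \<Longrightarrow> P (insert R L)"
  shows "P L"
  using initialD(3)[OF assms(1)] assms(1)
proof (induction L rule: finite_psubset_induct)
  case (psubset L)
  show ?case
  proof (cases "L = {}")
    case False
    then obtain R where R: "R \<in> L - {}" "initial N (L - {R})" "par N R \<subseteq> L - {R}"
      using initial_remove[OF psubset.prems initial_empty] by auto
    have "P (L - {R})" using R by (intro psubset.IH) auto
    then have "P (insert R (L - {R}))" using R psubset.prems by (intro assms(3)) (auto simp: insert_absorb)
    then show ?thesis using R by (simp add: insert_absorb)
  qed (use assms in auto)
qed

section \<open>Worlds of subnetworks\<close>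

lemma worlds_iff: "A \<in> worlds (subnet N L) n \<longleftrightarrow> dom A = Dm n \<and> finite (Dm n) \<and>
    (\<forall>R. rel A R \<subseteq> tuples (Dm n) (ar R)) \<and> (\<forall>R\<in>\<tau>. rel A R = rel (B n) R) \<and> (\<forall>R. R \<notin> \<tau> \<union> L \<longrightarrow> rel A R = {})"
    (is "?l \<longleftrightarrow> ?r")
proof
  assume ?l
  then have 1: "dom A = Dm n" "finite (dom A)" "\<forall>R\<in>\<tau>. rel A R = rel (B n) R"
    "\<forall>R\<in>\<tau> \<union> L. rel A R \<subseteq> tuples (dom A) (ar R)" "\<forall>R. R \<notin> \<tau> \<union> L \<longrightarrow> rel A R = {}"
    unfolding worlds_def is_struc_def subnet_simps mem_Collect_eq by blast+
  have "\<forall>R. rel A R \<subseteq> tuples (dom A) (ar R)" using 1(4,5) by (metis empty_subsetI)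
  then show ?r using 1 by simp
next
  assume ?r
  then show ?l unfolding worlds_def is_struc_def by simp
qed

lemma world:
  assumes "A \<in> worlds (subnet N L) n"
  shows "dom A = Dm n" "R \<in> \<tau> \<Longrightarrow> rel A R = rel (B n) R" "R \<notin> \<tau> \<union> L \<Longrightarrow> rel A R = {}"
    "rel A R \<subseteq> tuples (Dm n) (ar R)"
  using assms unfolding worlds_iff by blast+

lemma world_sub: "A \<in> worlds (subnet N L) n \<Longrightarrow> L \<subseteq> L' \<Longrightarrow> A \<in> worlds (subnet N L') n"
  unfolding worlds_iff by blast

lemma world_N: "A \<in> worlds (subnet N L) n \<Longrightarrow> L \<subseteq> \<sigma> - \<tau> \<Longrightarrow> A \<in> worlds N n"
  using world_sub[of A L n "\<sigma> - \<tau>"] by (simp add: subnet_full)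

lemma worldN:
  assumes "A \<in> worlds N n"
  shows "dom A = Dm n" "R \<in> \<tau> \<Longrightarrow> rel A R = rel (B n) R" "R \<notin> \<sigma> \<Longrightarrow> rel A R = {}"
    "rel A R \<subseteq> tuples (Dm n) (ar R)"
  using world(1)[of A "\<sigma> - \<tau>" n] world(2-4)[of A "\<sigma> - \<tau>" n R] assms tau_sub
  unfolding subnet_full by blast+

lemma base_rel: "n \<ge> 1 \<Longrightarrow> rel (B n) R \<subseteq> tuples (Dm n) (ar R)"
  using base_struc[of n] unfolding is_struc_def by (cases "R \<in> \<tau>") auto

lemma base_world: "n \<ge> 1 \<Longrightarrow> B n \<in> worlds (subnet N L) n"
  using base_struc[of n] base_rel[of n] unfolding worlds_iff is_struc_def by auto

lemma worlds_empty: "n \<ge> 1 \<Longrightarrow> worlds (subnet N {}) n = {B n}"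
proof -
  assume n: "n \<ge> 1"
  have "A = B n" if "A \<in> worlds (subnet N {}) n" for A
  proof (rule struc_eqI)
    show "dom A = Dm n" using world(1)[OF that] .
    fix R show "rel A R = rel (B n) R"
      using world(2,3)[OF that, of R] world(3)[OF base_world[OF n, of "{}"], of R] by (cases "R \<in> \<tau>") auto
  qed
  then show ?thesis using base_world[OF n, of "{}"] by blast
qed

lemma red_world: "A \<in> worlds (subnet N L) n \<Longrightarrow> L0 \<subseteq> L \<Longrightarrow> red (\<tau> \<union> L0) A \<in> worlds (subnet N L0) n"
  unfolding worlds_iff by auto

lemma finite_worlds:
  assumes "n \<ge> 1" "finite L"
  shows "finite (worlds (subnet N L) n)"
proof (rule finite_subset)
  let ?F = "PiE (\<tau> \<union> L) (\<lambda>R. Pow (tuples (Dm n) (ar R)))"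
  show "worlds (subnet N L) n \<subseteq> (\<lambda>f. \<lparr>dom = Dm n, rel = (\<lambda>R. if R \<in> \<tau> \<union> L then f R else {})\<rparr>) ` ?F"
  proof
    fix A assume A: "A \<in> worlds (subnet N L) n"
    have "A = \<lparr>dom = Dm n, rel = (\<lambda>R. if R \<in> \<tau> \<union> L then restrict (rel A) (\<tau> \<union> L) R else {})\<rparr>"
      using world[OF A] by (intro struc_eqI) auto
    moreover have "restrict (rel A) (\<tau> \<union> L) \<in> ?F" using world(4)[OF A] by auto
    ultimately show "A \<in> (\<lambda>f. \<lparr>dom = Dm n, rel = (\<lambda>R. if R \<in> \<tau> \<union> L then f R else {})\<rparr>) ` ?F" by blast
  qed
  show "finite ((\<lambda>f. \<lparr>dom = Dm n, rel = (\<lambda>R. if R \<in> \<tau> \<union> L then f R else {})\<rparr>) ` ?F)"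
    using assms finite_tau finite_tuples[OF finite_Dm[OF assms(1)]] by (intro finite_imageI finite_PiE) auto
qed

lemma th_range: "R \<in> \<sigma> - \<tau> \<Longrightarrow> finite (dom A) \<Longrightarrow> th N A R t \<in> {0..1}"
  unfolding th_def using theta_pla eval_range by blast

lemma th_cong:
  assumes "initial N L" "R \<in> \<sigma> - \<tau>" "par N R \<subseteq> L" "dom A = dom A'" "\<And>S. S \<in> \<tau> \<union> L \<Longrightarrow> rel A S = rel A' S"
  shows "th N A R t = th N A' R t"
  unfolding th_def using assms theta_pla[of R] by (intro eval_reduct[of ar "par N R \<union> \<tau>"]) auto

lemma world_prob_eq:
  assumes L: "initial N L" and A: "A \<in> worlds (subnet N L) n" and n: "n \<ge> 1"
  shows "world_prob (subnet N L) A = (\<Prod>R\<in>L. bw (th N A R) (tuples (Dm n) (ar R)) (rel A R))"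
  using initialD(5)[OF L] world(1)[OF A] by (simp add: world_prob_def bw_def th_def)

lemma world_prob_nonneg:
  assumes L: "initial N L" and A: "A \<in> worlds (subnet N L) n" and n: "n \<ge> 1"
  shows "0 \<le> world_prob (subnet N L) A"
  unfolding world_prob_eq[OF assms] using world[OF A] finite_Dm[OF n] initialD(1)[OF L]
  by (intro prod_nonneg bw_nonneg th_range) auto

text \<open>Conditioning on the relations in \<open>L\<close>: the tuples of \<open>R\<close> are
  then independent with probabilities \<open>th N A R\<close>, because the formula of
  \<open>R\<close> reads only relations from \<open>L\<close> and \<open>\<tau>\<close>. Every step
  that adds a relation rests on this identity.\<close>

lemma expect_insert:
  assumes L: "initial N L" "initial N (insert R L)" "R \<notin> L" "par N R \<subseteq> L" and n: "n \<ge> 1"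
  shows "expect (subnet N (insert R L)) n g =
    expect (subnet N L) n (\<lambda>A. bex (th N A R) (tuples (Dm n) (ar R)) (\<lambda>X. g (ins A R X)))"
proof -
  let ?T = "tuples (Dm n) (ar R)"
  have R: "R \<in> \<sigma> - \<tau>" "R \<notin> \<tau>" using initialD(1)[OF L(2)] by auto
  have "expect (subnet N L) n (\<lambda>A. bex (th N A R) ?T (\<lambda>X. g (ins A R X))) =
      (\<Sum>A\<in>worlds (subnet N L) n. \<Sum>X\<in>Pow ?T. world_prob (subnet N L) A * (bw (th N A R) ?T X * g (ins A R X)))"
    by (simp add: expect_def bex_def sum_distrib_left)
  also have "\<dots> = (\<Sum>(A, X)\<in>worlds (subnet N L) n \<times> Pow ?T.
      world_prob (subnet N L) A * (bw (th N A R) ?T X * g (ins A R X)))"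
    by (rule sum.cartesian_product)
  also have "\<dots> = (\<Sum>A\<in>worlds (subnet N (insert R L)) n. world_prob (subnet N (insert R L)) A * g A)"
  proof (rule sum.reindex_bij_witness[of _ "\<lambda>A. (red (\<tau> \<union> L) A, rel A R)" "\<lambda>(A, X). ins A R X"])
    fix p assume "p \<in> worlds (subnet N L) n \<times> Pow ?T"
    then obtain A X where p: "p = (A, X)" and A: "A \<in> worlds (subnet N L) n" and X: "X \<subseteq> ?T" by auto
    have "red (\<tau> \<union> L) (ins A R X) = A"
      using world(3)[OF A] R L(3) by (intro struc_eqI) auto
    then show "(red (\<tau> \<union> L) ((\<lambda>(A, X). ins A R X) p), rel ((\<lambda>(A, X). ins A R X) p) R) = p" by (simp add: p)
    have A': "ins A R X \<in> worlds (subnet N (insert R L)) n"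
    proof -
      have "rel (ins A R X) S \<subseteq> tuples (Dm n) (ar S)" for S using world(4)[OF A] X by simp
      then show ?thesis using A R unfolding worlds_iff by (metis Un_insert_right fun_upd_other ins_simps insert_iff)
    qed
    then show "(\<lambda>(A, X). ins A R X) p \<in> worlds (subnet N (insert R L)) n" by (simp add: p)
    \<comment> \<open>No relation in \<open>insert R L\<close> has \<open>R\<close> as a parent, so
      inserting \<open>X\<close> changes none of the probabilities.\<close>
    have t: "th N (ins A R X) S = th N A S" if "S \<in> insert R L" for S
    proof (rule ext, rule th_cong[OF L(1)])
      show "par N S \<subseteq> L" using that L(4) initialD(4)[OF L(1)] by auto
      show "S \<in> \<sigma> - \<tau>" using that initialD(1)[OF L(2)] by auto
      show "rel (ins A R X) S' = rel A S'" if "S' \<in> \<tau> \<union> L" for S' using that R L(3) by auto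
    qed simp
    have "world_prob (subnet N (insert R L)) (ins A R X) =
        bw (th N A R) ?T X * (\<Prod>S\<in>L. bw (th N A S) (tuples (Dm n) (ar S)) (rel (ins A R X) S))"
      unfolding world_prob_eq[OF L(2) A' n] using L(3) initialD(3)[OF L(1)] t by simp
    also have "(\<Prod>S\<in>L. bw (th N A S) (tuples (Dm n) (ar S)) (rel (ins A R X) S)) = world_prob (subnet N L) A"
      unfolding world_prob_eq[OF L(1) A n] using L(3) by (intro prod.cong) auto
    finally show "world_prob (subnet N (insert R L)) ((\<lambda>(A, X). ins A R X) p) * g ((\<lambda>(A, X). ins A R X) p) =
      (case p of (A, X) \<Rightarrow> world_prob (subnet N L) A * (bw (th N A R) ?T X * g (ins A R X)))"
      by (simp add: p mult_ac)
  next
    fix A assume A: "A \<in> worlds (subnet N (insert R L)) n"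
    show "(\<lambda>(A, X). ins A R X) (red (\<tau> \<union> L) A, rel A R) = A"
    proof (simp, rule struc_eqI)
      fix S show "rel (ins (red (\<tau> \<union> L) A) R (rel A R)) S = rel A S"
        using world(3)[OF A, of S] by (cases "S = R") auto
    qed simp
    show "(red (\<tau> \<union> L) A, rel A R) \<in> worlds (subnet N L) n \<times> Pow ?T"
      using red_world[OF A] world(4)[OF A] by auto
  qed
  finally show ?thesis by (simp add: expect_def)
qed

section \<open>Expectations and probabilities in subnetworks\<close>

lemma expect_cong: "(\<And>A. A \<in> worlds (subnet N L) n \<Longrightarrow> f A = g A) \<Longrightarrow> expect (subnet N L) n f = expect (subnet N L) n g"
  by (simp add: expect_def)

text \<open>Relations outside \<open>L0\<close> are summed out one at a time, each time one that no
  remaining formula reads; their conditional weights sum to 1. Hence events about the reduct have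
  the same probability in the large network and in the small one.\<close>

lemma expect_red:
  assumes "initial N L" "initial N L0" "L0 \<subseteq> L" "n \<ge> 1"
  shows "expect (subnet N L) n (\<lambda>A. g (red (\<tau> \<union> L0) A)) = expect (subnet N L0) n g"
  using initialD(3)[OF assms(1)] assms
proof (induction L rule: finite_psubset_induct)
  case (psubset L)
  show ?case
  proof (cases "L0 = L")
    case True
    have "red (\<tau> \<union> L0) A = A" if "A \<in> worlds (subnet N L) n" for A
      using world(3)[OF that] True by (intro struc_eqI) auto
    then show ?thesis using True by (auto intro: expect_cong)
  next
    case False
    then obtain R where R: "R \<in> L - L0" "initial N (L - {R})" "par N R \<subseteq> L - {R}"
      using initial_remove[OF psubset.prems(1,2)] psubset.prems(3) by auto
    have L: "insert R (L - {R}) = L" using R by auto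
    have "R \<notin> \<tau>" using R initialD(1)[OF psubset.prems(1)] by auto
    then have r: "red (\<tau> \<union> L0) (ins A R X) = red (\<tau> \<union> L0) A" for A X
      using R by (intro struc_eqI) auto
    have "expect (subnet N L) n (\<lambda>A. g (red (\<tau> \<union> L0) A)) =
        expect (subnet N (L - {R})) n (\<lambda>A. g (red (\<tau> \<union> L0) A))"
      using expect_insert[of "L - {R}" R n "\<lambda>A. g (red (\<tau> \<union> L0) A)"] R psubset.prems L
      by (simp add: r bex_const finite_tuples finite_Dm)
    also have "\<dots> = expect (subnet N L0) n g" using R psubset.prems by (intro psubset.IH) auto
    finally show ?thesis .
  qed
qed

text \<open>Summing out all new relations leaves the single world \<open>B n\<close>, whose weight
  is an empty product.\<close>

lemma expect_one:
  assumes "initial N L" "n \<ge> 1"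
  shows "expect (subnet N L) n (\<lambda>_. c) = c"
  using expect_red[OF assms(1) initial_empty _ assms(2), of "\<lambda>_. c"] assms(2)
  by (simp add: expect_def worlds_empty world_prob_def)

lemma expect_mono:
  assumes "initial N L" "n \<ge> 1" "\<And>A. A \<in> worlds (subnet N L) n \<Longrightarrow> f A \<le> g A"
  shows "expect (subnet N L) n f \<le> expect (subnet N L) n g"
  unfolding expect_def using assms world_prob_nonneg by (intro sum_mono mult_left_mono) auto

lemma expect_add: "expect N' n (\<lambda>A. f A + g A) = expect N' n f + expect N' n g"
  by (simp add: expect_def distrib_left sum.distrib)

lemma expect_cmult: "expect N' n (\<lambda>A. c * g A) = c * expect N' n g"
  by (simp add: expect_def sum_distrib_left mult_ac)

lemma expect_sum: "expect N' n (\<lambda>A. \<Sum>i\<in>I. f i A) = (\<Sum>i\<in>I. expect N' n (f i))"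
  unfolding expect_def sum_distrib_left by (rule sum.swap)

lemma prob_expect:
  assumes "initial N L" "n \<ge> 1"
  shows "prob (subnet N L) n E = expect (subnet N L) n (\<lambda>A. of_bool (E A))"
  using finite_worlds[OF assms(2) initialD(3)[OF assms(1)]]
  by (simp add: prob_def expect_def of_bool_def if_distrib[of "\<lambda>x. _ * x"] sum.inter_filter[symmetric] cong: if_cong)

lemma prob_mono:
  assumes "initial N L" "n \<ge> 1" "\<And>A. A \<in> worlds (subnet N L) n \<Longrightarrow> E A \<Longrightarrow> E' A"
  shows "prob (subnet N L) n E \<le> prob (subnet N L) n E'"
  unfolding prob_expect[OF assms(1,2)] using assms by (intro expect_mono) auto

lemma prob_le_1: "initial N L \<Longrightarrow> n \<ge> 1 \<Longrightarrow> prob (subnet N L) n E \<le> 1"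
  using expect_mono[of L n "\<lambda>A. of_bool (E A)" "\<lambda>_. 1"] by (simp add: prob_expect expect_one)

lemma prob_nonneg: "initial N L \<Longrightarrow> n \<ge> 1 \<Longrightarrow> 0 \<le> prob (subnet N L) n E"
  using expect_mono[of L n "\<lambda>_. 0" "\<lambda>A. of_bool (E A)"] by (simp add: prob_expect expect_one)

lemma prob_disj_le:
  assumes "initial N L" "n \<ge> 1"
  shows "prob (subnet N L) n (\<lambda>A. E A \<or> E' A) \<le> prob (subnet N L) n E + prob (subnet N L) n E'"
  unfolding prob_expect[OF assms] expect_add[symmetric] using assms by (intro expect_mono) auto

lemma prob_not:
  assumes "initial N L" "n \<ge> 1"
  shows "prob (subnet N L) n (\<lambda>A. \<not> E A) = 1 - prob (subnet N L) n E"
proof -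
  have "prob (subnet N L) n (\<lambda>A. \<not> E A) + prob (subnet N L) n E = expect (subnet N L) n (\<lambda>_. 1)"
    unfolding prob_expect[OF assms] expect_add[symmetric] by (intro expect_cong) auto
  then show ?thesis using assms by (simp add: expect_one)
qed

lemma prob_red:
  assumes "initial N L" "initial N L0" "L0 \<subseteq> L" "n \<ge> 1"
  shows "prob (subnet N L) n (\<lambda>A. E (red (\<tau> \<union> L0) A)) = prob (subnet N L0) n E"
  using expect_red[OF assms, of "\<lambda>A. of_bool (E A)"] assms by (simp add: prob_expect)

section \<open>Events of high probability\<close>

lemma whp_mono:
  assumes "initial N L" "whp N L E" "\<forall>\<^sub>F n in sequentially. \<forall>A\<in>worlds (subnet N L) n. E n A \<longrightarrow> E' n A"
  shows "whp N L E'"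
  unfolding whp_def
proof (intro allI impI)
  fix \<epsilon> :: real assume "\<epsilon> > 0"
  then have "\<forall>\<^sub>F n in sequentially. prob (subnet N L) n (\<lambda>A. \<not> E n A) \<le> \<epsilon>" using assms(2) by (simp add: whp_def)
  then show "\<forall>\<^sub>F n in sequentially. prob (subnet N L) n (\<lambda>A. \<not> E' n A) \<le> \<epsilon>"
    using assms(3) eventually_ge_at_top[of 1]
  proof eventually_elim
    case (elim n)
    have "prob (subnet N L) n (\<lambda>A. \<not> E' n A) \<le> prob (subnet N L) n (\<lambda>A. \<not> E n A)"
      using elim assms(1) by (intro prob_mono) auto
    then show ?case using elim by simp
  qed
qed

lemma whp_always:
  assumes "initial N L" "\<forall>\<^sub>F n in sequentially. \<forall>A\<in>worlds (subnet N L) n. E n A"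
  shows "whp N L E"
proof -
  have "whp N L (\<lambda>_ _. True)" by (auto simp: whp_def prob_def)
  then show ?thesis using assms by (elim whp_mono[rotated]) auto
qed

lemma whp_conj:
  assumes "initial N L" "whp N L E" "whp N L E'"
  shows "whp N L (\<lambda>n A. E n A \<and> E' n A)"
  unfolding whp_def
proof (intro allI impI)
  fix \<epsilon> :: real assume "\<epsilon> > 0"
  then have "\<forall>\<^sub>F n in sequentially. prob (subnet N L) n (\<lambda>A. \<not> E n A) \<le> \<epsilon> / 2"
    "\<forall>\<^sub>F n in sequentially. prob (subnet N L) n (\<lambda>A. \<not> E' n A) \<le> \<epsilon> / 2"
    using assms(2,3) half_gt_zero unfolding whp_def by blast+
  then show "\<forall>\<^sub>F n in sequentially. prob (subnet N L) n (\<lambda>A. \<not> (E n A \<and> E' n A)) \<le> \<epsilon>"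
    using eventually_ge_at_top[of 1]
  proof eventually_elim
    case (elim n)
    then show ?case using prob_disj_le[OF assms(1), of n "\<lambda>A. \<not> E n A" "\<lambda>A. \<not> E' n A"] by simp
  qed
qed

lemma whp_ball:
  assumes "initial N L" "finite I" "\<And>i. i \<in> I \<Longrightarrow> whp N L (E i)"
  shows "whp N L (\<lambda>n A. \<forall>i\<in>I. E i n A)"
  using assms(2,3)
proof (induction I rule: finite_induct)
  case empty
  then show ?case using assms(1) by (intro whp_always) auto
next
  case (insert i I)
  then show ?case using whp_conj[OF assms(1), of "E i" "\<lambda>n A. \<forall>i\<in>I. E i n A"] by auto
qed

lemma whp_red:
  assumes "initial N L" "initial N L0" "L0 \<subseteq> L" "whp N L0 E"
  shows "whp N L (\<lambda>n A. E n (red (\<tau> \<union> L0) A))"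
  unfolding whp_def
proof (intro allI impI)
  fix \<epsilon> :: real assume "\<epsilon> > 0"
  then have "\<forall>\<^sub>F n in sequentially. prob (subnet N L0) n (\<lambda>A. \<not> E n A) \<le> \<epsilon>" using assms(4) by (simp add: whp_def)
  then show "\<forall>\<^sub>F n in sequentially. prob (subnet N L) n (\<lambda>A. \<not> E n (red (\<tau> \<union> L0) A)) \<le> \<epsilon>"
    using eventually_ge_at_top[of 1]
  proof eventually_elim
    case (elim n)
    then show ?case using prob_red[OF assms(1-3), of n "\<lambda>A. \<not> E n A"] by simp
  qed
qed

end

subsection \<open>Closure types and codes\<close>

lemma pointed_iso_inv:
  assumes "pointed_iso \<rho> f D ds A as" "set ds \<subseteq> dom D"
  shows "pointed_iso \<rho> (inv_into (dom D) f) A as D ds"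
proof -
  let ?h = "inv_into (dom D) f"
  have b: "bij_betw f (dom D) (dom A)" and m: "map f ds = as"
    and r: "\<And>R xs. R \<in> \<rho> \<Longrightarrow> set xs \<subseteq> dom D \<Longrightarrow> xs \<in> rel D R \<longleftrightarrow> map f xs \<in> rel A R"
    using assms(1) by (auto simp: pointed_iso_def)
  have h: "?h (f x) = x" if "x \<in> dom D" for x using b that by (simp add: bij_betw_def)
  have fh: "f (?h y) = y" "?h y \<in> dom D" if "y \<in> dom A" for y
    using b that by (auto simp: bij_betw_def f_inv_into_f inv_into_into)
  have "map ?h as = ds" unfolding m[symmetric] map_map using h assms(2) by (intro map_idI) auto
  moreover have "xs \<in> rel A R \<longleftrightarrow> map ?h xs \<in> rel D R" if "R \<in> \<rho>" "set xs \<subseteq> dom A" for R xs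
  proof -
    have "map f (map ?h xs) = xs" unfolding map_map using fh that(2) by (intro map_idI) auto
    then show ?thesis using r[OF that(1), of "map ?h xs"] fh(2) that(2) by auto
  qed
  ultimately show ?thesis using bij_betw_inv_into[OF b] by (auto simp: pointed_iso_def)
qed

lemma pointed_iso_comp:
  assumes "pointed_iso \<rho> f D ds A as" "pointed_iso \<rho> g A as C cs"
  shows "pointed_iso \<rho> (g \<circ> f) D ds C cs"
proof -
  have "set (map f xs) \<subseteq> dom A" if "set xs \<subseteq> dom D" for xs
    using assms(1) that by (auto simp: pointed_iso_def bij_betw_def)
  then show ?thesis using assms by (auto simp: pointed_iso_def intro: bij_betw_trans)
qed

lemma induced_simps [simp]: "dom (induced A S) = dom A \<inter> S"
  "xs \<in> rel (induced A S) R \<longleftrightarrow> xs \<in> rel A R \<and> set xs \<subseteq> S"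
  by (auto simp: induced_def)

lemma pointed_iso_induced_cong:
  "dom A = dom A' \<Longrightarrow> (\<And>R. R \<in> \<rho> \<Longrightarrow> rel A R = rel A' R) \<Longrightarrow>
    pointed_iso \<rho> f D ds (induced A S) as \<longleftrightarrow> pointed_iso \<rho> f D ds (induced A' S) as"
  by (simp add: pointed_iso_def)

lemma tp_pointed_iso:
  assumes "tp \<rho> A us = tp \<rho> A' us'" "set us \<subseteq> dom A" "set us' \<subseteq> dom A'"
  obtains g where "pointed_iso \<rho> g (induced A (set us)) us (induced A' (set us')) us'"
    "map g us = us'" "bij_betw g (set us) (set us')"
    "\<And>R xs. R \<in> \<rho> \<Longrightarrow> set xs \<subseteq> set us \<Longrightarrow> xs \<in> rel A R \<longleftrightarrow> map g xs \<in> rel A' R"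
proof -
  obtain g where g: "bij_betw g (set us) (set us')" "map g us = us'"
    "\<And>R xs. R \<in> \<rho> \<Longrightarrow> set xs \<subseteq> set us \<Longrightarrow> xs \<in> rel A R \<longleftrightarrow> map g xs \<in> rel A' R"
    using tp_iso[OF assms(1)] by metis
  have d: "dom A \<inter> set us = set us" "dom A' \<inter> set us' = set us'" using assms by auto
  have "g ` set xs \<subseteq> set us'" if "set xs \<subseteq> set us" for xs
    using that g(1) by (auto simp: bij_betw_def)
  then have "pointed_iso \<rho> g (induced A (set us)) us (induced A' (set us')) us'"
    using g d unfolding pointed_iso_def induced_simps d by (simp add: g(3))
  then show ?thesis using that g by blast
qed

text \<open>Types are given by structures on naturals; transport along an enumeration yields one
  whose domain is an initial segment, so that a bound on \<open>card S\<close> leaves only finitely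
  many candidates.\<close>

lemma canonical_copy:
  assumes "finite S" "S \<subseteq> dom A" "set as \<subseteq> S" "\<And>R. R \<in> \<rho> \<Longrightarrow> rel A R \<subseteq> tuples (dom A) (ar R)"
  obtains D ds f where "dom D = {..<card S}" "is_struc ar \<rho> D" "ds \<in> tuples (dom D) (length as)"
    "pointed_iso \<rho> f D ds (induced A S) as"
proof -
  obtain f where f: "bij_betw f {..<card S} S"
    using ex_bij_betw_nat_finite[OF assms(1)] by (auto simp: atLeast0LessThan)
  define D where "D = \<lparr>dom = {..<card S}, rel = (\<lambda>R. if R \<in> \<rho> then {xs. set xs \<subseteq> {..<card S} \<and> map f xs \<in> rel A R} else {})\<rparr>"
  define ds where "ds = map (inv_into {..<card S} f) as"
  have ds: "map f ds = as" "set ds \<subseteq> {..<card S}"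
    using f assms(3) inv_into_into[of _ f "{..<card S}"]
    by (auto simp: ds_def bij_betw_def f_inv_into_f subset_iff intro!: map_idI)
  have "length xs = ar R" if "map f xs \<in> rel A R" "R \<in> \<rho>" for xs R
    using assms(4)[OF that(2)] that(1) by (force simp: tuples_def)
  then have 1: "is_struc ar \<rho> D" by (auto simp: is_struc_def D_def tuples_def)
  have S: "dom A \<inter> S = S" using assms by auto
  have "set (map f xs) \<subseteq> S" if "set xs \<subseteq> {..<card S}" for xs using f that by (auto simp: bij_betw_def)
  then have 2: "pointed_iso \<rho> f D ds (induced A S) as"
    unfolding pointed_iso_def induced_simps S using f ds by (simp add: D_def)
  show ?thesis
    by (rule that[OF _ 1 _ 2]) (use ds in \<open>auto simp: D_def tuples_def ds_def\<close>)
qed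

lemma finite_strucs:
  assumes "finite \<rho>"
  shows "finite {D :: (nat, 'r) struc. is_struc ar \<rho> D \<and> dom D \<subseteq> {..<K}}"
proof (rule finite_subset)
  let ?F = "PiE \<rho> (\<lambda>R. Pow (tuples {..<K} (ar R)))"
  let ?g = "\<lambda>(S, f). \<lparr>dom = S, rel = (\<lambda>R. if R \<in> \<rho> then f R else {})\<rparr>"
  show "{D :: (nat, 'r) struc. is_struc ar \<rho> D \<and> dom D \<subseteq> {..<K}} \<subseteq> ?g ` (Pow {..<K} \<times> ?F)"
  proof
    fix D :: "(nat, 'r) struc" assume "D \<in> {D. is_struc ar \<rho> D \<and> dom D \<subseteq> {..<K}}"
    then have D: "is_struc ar \<rho> D" "dom D \<subseteq> {..<K}" by auto
    have "D = ?g (dom D, restrict (rel D) \<rho>)" using D by (intro struc_eqI) (auto simp: is_struc_def)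
    moreover have "restrict (rel D) \<rho> \<in> ?F" using D by (fastforce simp: is_struc_def tuples_def)
    ultimately show "D \<in> ?g ` (Pow {..<K} \<times> ?F)" using D(2) by blast
  qed
  show "finite (?g ` (Pow {..<K} \<times> ?F))" using assms finite_tuples
    by (intro finite_imageI finite_cartesian_product finite_PiE) auto
qed

context network
begin

abbreviation "G n \<equiv> gaifman \<tau> (B n)"

definition ball :: "nat \<Rightarrow> nat \<Rightarrow> 'a \<Rightarrow> 'a set" where
  "ball n l x = {b. dist_le \<tau> (B n) l x b}"

definition Rr :: "nat \<Rightarrow> 'a set" where
  "Rr n = {b. rare N 0 n b}"

lemma Rr_sub: "Rr n \<subseteq> Dm n"
  by (auto simp: Rr_def rare_def)

lemma gaifman_sub: "n \<ge> 1 \<Longrightarrow> G n \<subseteq> Dm n \<times> Dm n"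
  using base_rel[of n] unfolding gaifman_def tuples_def by blast

lemma closure_0: "as \<in> tuples (Dm n) k \<Longrightarrow> closure_set N 0 n as = set as \<union> Rr n"
  by (auto simp: closure_set_def Rr_def nbhd_def dist_le_def tuples_def)

lemma nbhd_0: "a \<in> Dm n \<Longrightarrow> nbhd \<tau> (B n) 0 [a] = {a}"
  by (auto simp: nbhd_def dist_le_def)

text \<open>The neighbourhood of radius 0 of an element is the element itself, so its neighbourhood
  type and its code carry the same information; boundedness belongs to the type, not to a single
  structure, and is therefore inherited across different n.\<close>

lemma rare_tp:
  assumes "rare N 0 n a" "tp \<tau> (B n) [a] = tp \<tau> (B n') [a']" "a' \<in> Dm n'"
  shows "rare N 0 n' a'"
proof -
  have a: "a \<in> Dm n" using assms(1) by (simp add: rare_def)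
  obtain p where p: "is_ntype N 1 p" "ntype_sat N 0 p n [a]" "bounded_ntype N 0 p"
    using assms(1) by (auto simp: rare_def)
  then obtain f where f: "pointed_iso \<tau> f (fst p) (snd p) (induced (B n) {a}) [a]"
    using nbhd_0[OF a] by (auto simp: ntype_sat_def)
  obtain g where "pointed_iso \<tau> g (induced (B n) {a}) [a] (induced (B n') {a'}) [a']"
    using tp_pointed_iso[OF assms(2)] a assms(3) by auto
  then have "ntype_sat N 0 p n' [a']"
    using pointed_iso_comp[OF f] nbhd_0[OF assms(3)] by (auto simp: ntype_sat_def)
  then show ?thesis using p assms(3) unfolding rare_def by blast
qed

text \<open>A common realization makes the two pointed structures isomorphic, and isomorphisms
  compose.\<close>

lemma ntype_set_eq:
  assumes "ntype_sat N l p n as" "ntype_sat N l p' n as" "is_ntype N k p" "is_ntype N k p'"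
  shows "ntype_set N l p n' = ntype_set N l p' n'"
proof -
  have *: "ntype_sat N l p' n' as'" if H: "ntype_sat N l p n as" "ntype_sat N l p' n as"
    "ntype_sat N l p n' as'" "is_ntype N k p" "is_ntype N k p'" for as' p p'
  proof -
    obtain f where f: "pointed_iso \<tau> f (fst p) (snd p) (induced (B n) (nbhd \<tau> (B n) l as)) as"
      using H(1) by (auto simp: ntype_sat_def)
    obtain f' where f': "pointed_iso \<tau> f' (fst p') (snd p') (induced (B n) (nbhd \<tau> (B n) l as)) as"
      using H(2) by (auto simp: ntype_sat_def)
    obtain h where h: "pointed_iso \<tau> h (fst p) (snd p) (induced (B n') (nbhd \<tau> (B n') l as')) as'"
      using H(3) by (auto simp: ntype_sat_def)
    have "set (snd p) \<subseteq> dom (fst p)" using H(4) by (auto simp: is_ntype_def tuples_def)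
    from pointed_iso_comp[OF pointed_iso_comp[OF f' pointed_iso_inv[OF f this]] h]
    show ?thesis by (auto simp: ntype_sat_def)
  qed
  have "length (snd p) = length (snd p')" using assms(3,4) by (auto simp: is_ntype_def tuples_def)
  then show ?thesis using *[of p p'] *[of p' p] assms by (auto simp: ntype_set_def)
qed

lemma ct_sat_world_iff:
  assumes "A \<in> worlds N n"
  shows "ct_sat N l p n A as \<longleftrightarrow> (\<exists>f. pointed_iso \<tau> f (ct_struc p) (ct_pts p) (induced (B n) (closure_set N l n as)) as \<and>
          (\<forall>(R, xs, b) \<in> ct_lits p. (map f xs \<in> rel A R) = b))"
  using worldN(1,2)[OF assms] by (simp add: ct_sat_def pointed_iso_induced_cong[of A "B n" \<tau>])

lemma ct_tau_world: "A \<in> worlds N n \<Longrightarrow> ct_sat N l (ct_tau p) n A as \<longleftrightarrow> ct_sat N l (ct_tau p) n (B n) as"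
  unfolding ct_sat_world_iff by (simp add: ct_sat_def ct_tau_def)

lemma ct_sat_tau: "ct_sat N l p n A as \<Longrightarrow> ct_sat N l (ct_tau p) n A as"
  by (auto simp: ct_sat_def ct_tau_def)

lemma base_world_N: "n \<ge> 1 \<Longrightarrow> B n \<in> worlds N n"
  using base_world[of n "\<sigma> - \<tau>"] by (simp add: subnet_full)

text \<open>Two tuples of the same closure type have isomorphic closures; the isomorphism carries rare
  elements to rare elements, since rarity for radius 0 only depends on the type of the element.\<close>

lemma ct_iso:
  assumes s: "ct_sat N 0 p n A as" "ct_sat N 0 p n' A' as'"
    and p: "is_complete_ctype N \<rho> k p" "\<tau> \<subseteq> \<rho>"
    and w: "A \<in> worlds N n" "A' \<in> worlds N n'" "as \<in> tuples (Dm n) k" "as' \<in> tuples (Dm n') k"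
  obtains g where "bij_betw g (set as \<union> Rr n) (set as' \<union> Rr n')" "map g as = as'"
    "\<And>R xs. R \<in> \<rho> \<Longrightarrow> set xs \<subseteq> set as \<union> Rr n \<Longrightarrow> xs \<in> rel A R \<longleftrightarrow> map g xs \<in> rel A' R"
    "g ` Rr n = Rr n'"
proof -
  let ?S = "set as \<union> Rr n" and ?S' = "set as' \<union> Rr n'"
  let ?D = "dom (ct_struc p)"
  have S: "dom A \<inter> ?S = ?S" "dom A' \<inter> ?S' = ?S'"
    using w worldN(1) Rr_sub[of n] Rr_sub[of n'] by (auto simp: tuples_def)
  obtain f where f: "pointed_iso \<tau> f (ct_struc p) (ct_pts p) (induced A ?S) as"
    "\<forall>(R, xs, b) \<in> ct_lits p. (map f xs \<in> rel A R) = b"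
    using s(1) closure_0[OF w(3)] by (auto simp: ct_sat_def)
  obtain f' where f': "pointed_iso \<tau> f' (ct_struc p) (ct_pts p) (induced A' ?S') as'"
    "\<forall>(R, xs, b) \<in> ct_lits p. (map f' xs \<in> rel A' R) = b"
    using s(2) closure_0[OF w(4)] by (auto simp: ct_sat_def)
  have pts: "set (ct_pts p) \<subseteq> ?D" using p by (auto simp: is_complete_ctype_def is_ctype_def tuples_def)
  define h where "h = inv_into ?D f"
  define g where "g = f' \<circ> h"
  have g: "pointed_iso \<tau> g (induced A ?S) as (induced A' ?S') as'"
    unfolding g_def h_def by (rule pointed_iso_comp[OF pointed_iso_inv[OF f(1) pts] f'(1)])
  then have b: "bij_betw g ?S ?S'" "map g as = as'" unfolding pointed_iso_def induced_simps S by auto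
  have fD: "bij_betw f ?D ?S" using f(1) unfolding pointed_iso_def induced_simps S by auto
  have gS: "set (map g xs) \<subseteq> ?S'" if "set xs \<subseteq> ?S" for xs using b(1) that by (auto simp: bij_betw_def)
  have r: "xs \<in> rel A R \<longleftrightarrow> map g xs \<in> rel A' R" if R: "R \<in> \<rho>" and xs: "set xs \<subseteq> ?S" for R xs
  proof (cases "R \<in> \<tau>")
    case True
    then show ?thesis using g xs gS[OF xs] S unfolding pointed_iso_def by auto
  next
    case False
    show ?thesis
    proof (cases "length xs = ar R")
      case l: True
      have fh: "f (h x) = x" "h x \<in> ?D" if "x \<in> ?S" for x
        using fD that by (auto simp: h_def bij_betw_def f_inv_into_f inv_into_into)
      have hx: "map h xs \<in> tuples ?D (ar R)" using fh(2) xs l by (auto simp: tuples_def)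
      then obtain b where b: "(R, map h xs, b) \<in> ct_lits p"
        using p(1) R False unfolding is_complete_ctype_def by blast
      have "map f (map h xs) = xs" unfolding map_map using fh xs by (intro map_idI) auto
      moreover have "map f' (map h xs) = map g xs" by (simp add: g_def)
      ultimately show ?thesis using b f(2) f'(2) by (metis (mono_tags, lifting) case_prodD)
    next
      case False
      then show ?thesis using worldN(4)[OF w(1), of R] worldN(4)[OF w(2), of R] by (auto simp: tuples_def subset_iff)
    qed
  qed
  have rare: "x \<in> Rr n \<longleftrightarrow> g x \<in> Rr n'" if x: "x \<in> ?S" for x
  proof -
    have "set xs \<subseteq> ?S" if "set xs \<subseteq> set [x]" for xs using that x by auto
    then have "tp \<tau> A [x] = tp \<tau> A' (map g [x])"
      using r p(2) b(1) x by (intro iso_tp) auto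
    moreover have "tp \<tau> A [x] = tp \<tau> (B n) [x]" "tp \<tau> A' [g x] = tp \<tau> (B n') [g x]"
      using worldN(2)[OF w(1)] worldN(2)[OF w(2)] by (auto simp: tp_def)
    ultimately have e: "tp \<tau> (B n) [x] = tp \<tau> (B n') [g x]" by simp
    have "x \<in> Dm n" "g x \<in> Dm n'"
      using x gS[of "[x]"] S worldN(1)[OF w(1)] worldN(1)[OF w(2)] by auto
    then show ?thesis using rare_tp[of n x n' "g x"] rare_tp[of n' "g x" n x] e by (auto simp: Rr_def)
  qed
  have "g ` Rr n = Rr n'"
  proof
    show "g ` Rr n \<subseteq> Rr n'" using rare by auto
    show "Rr n' \<subseteq> g ` Rr n"
    proof
      fix y assume y: "y \<in> Rr n'"
      then obtain x where "x \<in> ?S" "y = g x" using b(1) by (auto simp: bij_betw_def)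
      then show "y \<in> g ` Rr n" using rare y by auto
    qed
  qed
  then show ?thesis using that b r by blast
qed

text \<open>The enumeration \<open>rs'\<close> on the other side is the image of \<open>rs\<close>
  under the isomorphism of closures; with an arbitrary enumeration the codes could differ.\<close>

lemma ct_codes:
  assumes s: "ct_sat N 0 p n A as" "ct_sat N 0 p n' A' as'"
    and p: "is_complete_ctype N \<rho> k p" "\<tau> \<subseteq> \<rho>"
    and w: "A \<in> worlds N n" "A' \<in> worlds N n'" "as \<in> tuples (Dm n) k" "as' \<in> tuples (Dm n') k"
    and rs: "set rs = Rr n"
  obtains rs' where "set rs' = Rr n'" "length rs' = length rs" "tp \<rho> A (as @ rs) = tp \<rho> A' (as' @ rs')"
proof -
  obtain g where g: "bij_betw g (set as \<union> Rr n) (set as' \<union> Rr n')" "map g as = as'"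
    "\<And>R xs. R \<in> \<rho> \<Longrightarrow> set xs \<subseteq> set as \<union> Rr n \<Longrightarrow> xs \<in> rel A R \<longleftrightarrow> map g xs \<in> rel A' R"
    "g ` Rr n = Rr n'"
    using ct_iso[OF s p w] by metis
  have "tp \<rho> A (as @ rs) = tp \<rho> A' (map g (as @ rs))"
    using g(1,3) rs by (intro iso_tp) (auto simp: bij_betw_def)
  then show ?thesis using g rs by (intro that[of "map g rs"]) auto
qed

text \<open>Converse to \<open>ct_codes\<close>: \<open>V\<close> lists a whole closure, in any
  order, and \<open>js\<close> locates the tuple in it, so an isomorphism of the listed structures
  is one of closures over the tuples.\<close>

lemma ct_sat_code:
  assumes s: "ct_sat N 0 p n A as" and p: "is_ctype N \<sigma> k p"
    and t: "tp \<sigma> A V = tp \<sigma> A' V'"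
    and w: "A \<in> worlds N n" "A' \<in> worlds N n'" "set V \<subseteq> Dm n" "set V' \<subseteq> Dm n'"
    and V: "set V = set as \<union> Rr n" "set V' = set as' \<union> Rr n'"
    and js: "set js \<subseteq> {..<length V}" "as = map ((!) V) js" "as' = map ((!) V') js"
  shows "ct_sat N 0 p n' A' as'"
proof -
  have len: "length V' = length V" using tp_length[OF t] by simp
  have as: "as \<in> tuples (Dm n) (length as)" "as' \<in> tuples (Dm n') (length as')"
    using V w by (auto simp: tuples_def)
  obtain g where g: "pointed_iso \<sigma> g (induced A (set V)) V (induced A' (set V')) V'"
     "map g V = V'" "bij_betw g (set V) (set V')"
    "\<And>R xs. R \<in> \<sigma> \<Longrightarrow> set xs \<subseteq> set V \<Longrightarrow> xs \<in> rel A R \<longleftrightarrow> map g xs \<in> rel A' R"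
    using tp_pointed_iso[OF t] w(3,4) worldN(1)[OF w(1)] worldN(1)[OF w(2)] by (metis (no_types, lifting))
  have ga: "map g as = as'" unfolding js(2,3) g(2)[symmetric] using js(1) by (auto simp: subset_iff)
  have "pointed_iso \<tau> g (induced A (set V)) as (induced A' (set V')) as'"
    using g(1) ga tau_sub by (auto simp: pointed_iso_def subset_iff)
  moreover obtain f where f: "pointed_iso \<tau> f (ct_struc p) (ct_pts p) (induced A (set V)) as"
    "\<forall>(R, xs, b) \<in> ct_lits p. (map f xs \<in> rel A R) = b"
    using s closure_0[OF as(1)] V(1) by (auto simp: ct_sat_def)
  ultimately have i: "pointed_iso \<tau> (g \<circ> f) (ct_struc p) (ct_pts p) (induced A' (set V')) as'"
    using pointed_iso_comp by blast
  have "(map (g \<circ> f) xs \<in> rel A' R) = b" if l: "(R, xs, b) \<in> ct_lits p" for R xs b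
  proof -
    have R: "R \<in> \<sigma>" "set xs \<subseteq> dom (ct_struc p)" using p l by (auto simp: is_ctype_def tuples_def)
    have "f ` dom (ct_struc p) \<subseteq> set V" using f(1) by (auto simp: pointed_iso_def bij_betw_def)
    then have "set (map f xs) \<subseteq> set V" using R(2) by auto
    then show ?thesis using g(4)[OF R(1)] f(2) l by fastforce
  qed
  then show ?thesis using i closure_0[OF as(2)] V(2) by (auto simp: ct_sat_def)
qed

lemma is_complete_ctype_tau: "is_ctype N \<rho> k p \<Longrightarrow> is_complete_ctype N \<tau> k (ct_tau p)"
  by (auto simp: is_complete_ctype_def is_ctype_def ct_tau_def)

text \<open>The size of the closure bounds the domain of the type, so together with
  \<open>finite_complete_ctypes\<close> a bound on closures leaves finitely many types that cover
  all tuples.\<close>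

lemma complete_copy:
  assumes n: "n \<ge> 1" and A: "A \<in> worlds N n" and as: "as \<in> tuples (Dm n) k"
  obtains q where "is_complete_ctype N \<sigma> k q" "dom (ct_struc q) = {..<card (closure_set N l n as)}"
    "ct_sat N l q n A as"
proof -
  let ?S = "closure_set N l n as"
  have S: "?S \<subseteq> Dm n" by (auto simp: closure_set_def nbhd_def rare_def)
  have asS: "set as \<subseteq> ?S"
  proof
    fix a assume "a \<in> set as"
    moreover have "dist_le \<tau> (B n) l a a" unfolding dist_le_def by (intro exI[of _ 0]) auto
    ultimately show "a \<in> ?S" using as by (auto simp: closure_set_def nbhd_def tuples_def)
  qed
  have d: "dom A = Dm n" using worldN(1)[OF A] .
  obtain D ds f where D: "dom D = {..<card ?S}" "is_struc ar \<tau> D" "ds \<in> tuples (dom D) (length as)"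
    "pointed_iso \<tau> f D ds (induced A ?S) as"
    using canonical_copy[of ?S A as \<tau> ar] worldN(4)[OF A] S asS d finite_subset[OF S finite_Dm[OF n]] by metis
  let ?q = "\<lparr>ct_struc = D, ct_pts = ds, ct_lits = {(R, xs, b). R \<in> \<sigma> - \<tau> \<and> xs \<in> tuples (dom D) (ar R) \<and> b = (map f xs \<in> rel A R)}\<rparr>"
  have "is_complete_ctype N \<sigma> k ?q"
    using D as by (auto simp: is_complete_ctype_def is_ctype_def tuples_def)
  moreover have "ct_sat N l ?q n A as" using D(4) by (auto simp: ct_sat_def)
  ultimately show ?thesis using that D(1) by fastforce
qed

lemma finite_complete_ctypes: "finite {q. is_complete_ctype N \<sigma> k q \<and> dom (ct_struc q) \<subseteq> {..<K}}"
proof (rule finite_subset)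
  let ?T = "\<Union>R\<in>\<sigma>. {R} \<times> tuples {..<K} (ar R) \<times> (UNIV :: bool set)"
  let ?X = "{D :: (nat, 'r) struc. is_struc ar \<tau> D \<and> dom D \<subseteq> {..<K}} \<times> tuples {..<K} k \<times> Pow ?T"
  let ?g = "\<lambda>(D, ds, ls). \<lparr>ct_struc = D, ct_pts = ds, ct_lits = ls\<rparr>"
  show "{q. is_complete_ctype N \<sigma> k q \<and> dom (ct_struc q) \<subseteq> {..<K}} \<subseteq> ?g ` ?X"
  proof
    fix q assume "q \<in> {q. is_complete_ctype N \<sigma> k q \<and> dom (ct_struc q) \<subseteq> {..<K}}"
    then have "(ct_struc q, ct_pts q, ct_lits q) \<in> ?X"
      unfolding is_complete_ctype_def is_ctype_def tuples_def by fastforce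
    moreover have "q = ?g (ct_struc q, ct_pts q, ct_lits q)" by simp
    ultimately show "q \<in> ?g ` ?X" by blast
  qed
  show "finite (?g ` ?X)" using finite_strucs[OF finite_tau] finite_sigma
    by (intro finite_imageI finite_cartesian_product) (auto intro!: finite_tuples finite_cartesian_product)
qed

end

subsection \<open>Connected components of codes\<close>

text \<open>Counterpart of \<open>superlog\<close> for natural-valued counts, in the form used by
  the counting arguments.\<close>

definition slog :: "(nat \<Rightarrow> nat) \<Rightarrow> bool" where
  "slog g \<longleftrightarrow> (\<forall>\<beta>::real. \<forall>\<^sub>F n in sequentially. \<beta> * ln (real n) \<le> real (g n))"

text \<open>A graph on positions that is computable from the code: relation tuples with an entry
  outside the list are invisible, so it may have fewer edges than the Gaifman graph. For codes over
  \<open>\<tau>\<close> each of its edges joins entries at distance at most 1.\<close>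

definition adj :: "'r code \<Rightarrow> (nat \<times> nat) set" where
  "adj c = fst c \<union> {(i, j). \<exists>(R, is)\<in>snd c. i \<in> set is \<and> j \<in> set is}"

text \<open>The diagonal of \<open>fst c\<close> stands for the set of positions.\<close>

definition conn :: "'r code \<Rightarrow> bool" where
  "conn c \<longleftrightarrow> (\<forall>i j. (i, i) \<in> fst c \<and> (j, j) \<in> fst c \<longrightarrow> (i, j) \<in> (adj c)\<^sup>*)"

lemma slogD: "slog g \<Longrightarrow> \<forall>\<^sub>F n in sequentially. \<beta> * ln (real n) \<le> real (g n)"
  by (simp add: slog_def)

lemma eventually_ln_ge: "\<forall>\<^sub>F n in sequentially. c \<le> ln (real n)"
  using filterlim_compose[OF ln_at_top filterlim_real_sequentially] by (simp add: filterlim_at_top)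

lemma superlog_slog:
  assumes "superlog f" "\<forall>\<^sub>F n in sequentially. f n \<le> real (g n)"
  shows "slog g"
  unfolding slog_def
proof
  fix \<beta> :: real
  have "\<forall>\<^sub>F n in sequentially. 0 \<le> f n - \<beta> * ln (real n)"
    using assms(1) unfolding superlog_def filterlim_at_top by blast
  then show "\<forall>\<^sub>F n in sequentially. \<beta> * ln (real n) \<le> real (g n)"
    using assms(2) by eventually_elim simp
qed

lemma superlog_gt: "superlog f \<Longrightarrow> \<forall>\<^sub>F n in sequentially. c < f n"
  unfolding superlog_def by (drule spec[of _ 0]) (auto simp: filterlim_at_top_dense)

lemma adj_sym: "(i, j) \<in> adj (tp \<rho> A us) \<Longrightarrow> (j, i) \<in> adj (tp \<rho> A us)"
  by (auto simp: adj_def in_tp_eq)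

lemma adj_sub: "adj (tp \<rho> A us) \<subseteq> {..<length us} \<times> {..<length us}"
  by (auto simp: adj_def tp_def)

lemma sub_sub: "set js' \<subseteq> {..<length js} \<Longrightarrow> sub (sub t js) js' = sub t (map ((!) js) js')"
  by (auto simp: sub_def map_nth_map subset_iff)

lemma distinct_sorted_lt: "sorted_wrt (<) (js :: nat list) \<Longrightarrow> distinct js"
  using strict_sorted_iff by blast

context network
begin

section \<open>Balls, connected codes and far tuples\<close>

lemma ball_0: "ball n 0 x = {x}"
  by (auto simp: ball_def dist_le_def)

lemma ball_mono: "l \<le> l' \<Longrightarrow> ball n l x \<subseteq> ball n l' x"
  by (auto simp: ball_def dist_le_def) (meson order_trans)

lemma ball_self: "x \<in> ball n l x"
  using ball_mono[of 0 l n x] ball_0 by auto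

lemma ball_Suc: "ball n (Suc l) x \<subseteq> ball n l x \<union> (\<Union>c\<in>ball n l x. {b. (c, b) \<in> G n})"
proof
  fix b assume "b \<in> ball n (Suc l) x"
  then obtain j where j: "j \<le> Suc l" "(x, b) \<in> G n ^^ j" by (auto simp: ball_def dist_le_def)
  show "b \<in> ball n l x \<union> (\<Union>c\<in>ball n l x. {b. (c, b) \<in> G n})"
  proof (cases "j \<le> l")
    case True
    then show ?thesis using j by (auto simp: ball_def dist_le_def)
  next
    case False
    then have "j = Suc l" using j by simp
    then show ?thesis using j by (auto simp: ball_def dist_le_def)
  qed
qed

lemma ball_trans: "y \<in> ball n l x \<Longrightarrow> z \<in> ball n l' y \<Longrightarrow> z \<in> ball n (l + l') x"
proof -
  assume "y \<in> ball n l x" "z \<in> ball n l' y"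
  then obtain j j' where "j \<le> l" "(x, y) \<in> G n ^^ j" "j' \<le> l'" "(y, z) \<in> G n ^^ j'"
    by (auto simp: ball_def dist_le_def)
  then have "j + j' \<le> l + l'" "(x, z) \<in> G n ^^ (j + j')" by (auto simp: relpow_add)
  then show ?thesis unfolding ball_def dist_le_def by blast
qed

lemma ball_G: "x = y \<or> (x, y) \<in> G n \<Longrightarrow> y \<in> ball n 1 x"
  unfolding ball_def dist_le_def by (auto intro: exI[of _ 0] exI[of _ 1])

lemma tuple_G: "R \<in> \<tau> \<Longrightarrow> xs \<in> rel (B n) R \<Longrightarrow> x \<in> set xs \<Longrightarrow> y \<in> set xs \<Longrightarrow> y \<in> ball n 1 x"
  by (rule ball_G) (auto simp: gaifman_def)

text \<open>A path in the graph \<open>adj\<close> can be chosen with at most as many steps as there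
  are edges, hence at most the square of the length, and each step moves by distance at most 1. This
  is the origin of the radius q * q in all later counts.\<close>

lemma conn_ball:
  assumes c: "conn (tp \<tau> (B n) cs)" and i: "i < length cs" "j < length cs"
  shows "cs ! j \<in> ball n (length cs * length cs) (cs ! i)"
proof -
  let ?t = "tp \<tau> (B n) cs"
  have fin: "finite (adj ?t)" using adj_sub by (rule finite_subset) auto
  have "card (adj ?t) \<le> card ({..<length cs} \<times> {..<length cs})" using adj_sub by (rule card_mono[rotated]) auto
  then have cd: "card (adj ?t) \<le> length cs * length cs" by simp
  have "(i, j) \<in> (adj ?t)\<^sup>*" using c i by (simp add: conn_def in_tp_eq)
  then obtain k where k: "k \<le> card (adj ?t)" "(i, j) \<in> adj ?t ^^ k"
    unfolding rtrancl_finite_eq_relpow[OF fin] by auto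
  have "cs ! j \<in> ball n k (cs ! i)" if "(i, j) \<in> adj ?t ^^ k" for j k
    using that
  proof (induction k arbitrary: j)
    case (Suc k)
    then obtain j' where j': "(i, j') \<in> adj ?t ^^ k" "(j', j) \<in> adj ?t" by auto
    have "cs ! j \<in> ball n 1 (cs ! j')"
    proof (cases "(j', j) \<in> fst ?t")
      case True
      then show ?thesis using ball_G by (simp add: in_tp_eq)
    next
      case False
      then obtain R "is" where r: "(R, is) \<in> snd ?t" "j' \<in> set is" "j \<in> set is" using j'(2) by (auto simp: adj_def)
      then have "R \<in> \<tau>" "map ((!) cs) is \<in> rel (B n) R" by (auto simp: in_tp_rel)
      then show ?thesis using r by (intro tuple_G[of R "map ((!) cs) is"]) auto
    qed
    then show ?case using ball_trans[OF Suc.IH[OF j'(1)], of "cs ! j" 1] by simp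
  qed (simp add: ball_0)
  from this[OF k(2)] show ?thesis using ball_mono[of k "length cs * length cs" n] k(1) cd by auto
qed

definition count :: "'r code \<Rightarrow> nat \<Rightarrow> nat \<Rightarrow> nat" where
  "count c q n = card {cs \<in> tuples (Dm n) q. tp \<tau> (B n) cs = c}"

text \<open>What remains of strong unboundedness in the counting arguments. Increasing lists of
  positions correspond to the sets of positions that \<open>nths\<close> selects.\<close>

definition good :: "nat \<Rightarrow> 'r code \<Rightarrow> bool" where
  "good m t \<longleftrightarrow> (\<forall>js. js \<noteq> [] \<and> sorted_wrt (<) js \<and> set js \<subseteq> {..<m} \<and> conn (sub t js) \<longrightarrow>
     slog (count (sub t js) (length js)))"

definition Ext :: "nat \<Rightarrow> nat \<Rightarrow> 'r code \<Rightarrow> 'a list \<Rightarrow> 'a list set" where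
  "Ext n m t us = {bs \<in> tuples (Dm n) m. tp \<tau> (B n) bs = t \<and> wfree \<tau> (B n) us bs}"

text \<open>Stronger than being unlinked, but easy to count, as the exceptions meet a ball of radius
  1.\<close>

definition far :: "nat \<Rightarrow> 'a set \<Rightarrow> 'a list \<Rightarrow> bool" where
  "far n X cs \<longleftrightarrow> (\<forall>x\<in>X. \<forall>c\<in>set cs. c \<notin> ball n 1 x)"

lemma finite_Ext: "n \<ge> 1 \<Longrightarrow> finite (Ext n m t us)"
  using finite_tuples[OF finite_Dm] by (auto simp: Ext_def)

lemma wfree_sub:
  assumes "wfree \<tau> (B n) us bs" "set W \<subseteq> set bs"
  shows "wfree \<tau> (B n) us W"
  unfolding wfree_def
proof (intro conjI ballI impI)
  show "set us \<inter> set W = {}" using assms by (auto simp: wfree_def)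
  fix R xs assume R: "R \<in> \<tau>" "xs \<in> rel (B n) R" "set xs \<subseteq> set us \<union> set W"
  have "set xs \<subseteq> set us \<union> set bs" using R(3) assms(2) by blast
  then have "set xs \<subseteq> set us \<or> set xs \<subseteq> set bs" using assms(1) R(1,2) unfolding wfree_def by blast
  moreover have "set us \<inter> set bs = {}" using assms(1) unfolding wfree_def by blast
  ultimately show "set xs \<subseteq> set us \<or> set xs \<subseteq> set W" using R(3) by blast
qed

text \<open>Entries of one relation tuple are at distance at most 1 from each other, so a tuple on
  these elements that meets \<open>cs\<close> lies entirely in \<open>cs\<close>.\<close>

lemma far_wfree:
  assumes "far n (set us \<union> set W) cs" "wfree \<tau> (B n) us W"
  shows "wfree \<tau> (B n) W cs" "wfree \<tau> (B n) us (W @ cs)"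
proof -
  have d: "(set us \<union> set W) \<inter> set cs = {}" using assms(1) ball_self unfolding far_def by blast
  have *: "set xs \<subseteq> set cs" if "R \<in> \<tau>" "xs \<in> rel (B n) R" "set xs \<subseteq> set us \<union> set W \<union> set cs" "c \<in> set xs" "c \<in> set cs" for R xs c
    using tuple_G[OF that(1,2) _ that(4)] assms(1) that(3,5) unfolding far_def by blast
  show "wfree \<tau> (B n) W cs" unfolding wfree_def
  proof (intro conjI ballI impI)
    show "set W \<inter> set cs = {}" using d by auto
    fix R xs assume "R \<in> \<tau>" "xs \<in> rel (B n) R" "set xs \<subseteq> set W \<union> set cs"
    then show "set xs \<subseteq> set W \<or> set xs \<subseteq> set cs" using *[of R xs] by blast
  qed
  show "wfree \<tau> (B n) us (W @ cs)" unfolding wfree_def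
  proof (intro conjI ballI impI)
    show "set us \<inter> set (W @ cs) = {}" using d assms(2) unfolding wfree_def set_append by blast
    fix R xs assume R: "R \<in> \<tau>" "xs \<in> rel (B n) R" "set xs \<subseteq> set us \<union> set (W @ cs)"
    show "set xs \<subseteq> set us \<or> set xs \<subseteq> set (W @ cs)"
    proof (cases "set xs \<inter> set cs = {}")
      case True
      then have "set xs \<subseteq> set us \<union> set W" using R(3) by auto
      then have "set xs \<subseteq> set us \<or> set xs \<subseteq> set W" using assms(2) R(1,2) unfolding wfree_def by blast
      then show ?thesis by auto
    next
      case False
      then obtain c where "c \<in> set xs" "c \<in> set cs" by blast
      then have "set xs \<subseteq> set cs" using *[OF R(1,2)] R(3) by (simp add: Un_assoc)
      then show ?thesis by auto
    qed
  qed
qed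

end

text \<open>The component of a position \<open>i\<close> in a code \<open>t\<close> of \<open>m\<close>-tuples, its complement, and a list of
  positions which restores the original order from the concatenation of the two parts.\<close>

definition compC :: "nat \<Rightarrow> 'r code \<Rightarrow> nat \<Rightarrow> nat list" where
  "compC m t i = filter (\<lambda>j. (i, j) \<in> (adj t)\<^sup>*) [0..<m]"

definition compU :: "nat \<Rightarrow> 'r code \<Rightarrow> nat \<Rightarrow> nat list" where
  "compU m t i = filter (\<lambda>j. (i, j) \<notin> (adj t)\<^sup>*) [0..<m]"

definition compP :: "nat \<Rightarrow> 'r code \<Rightarrow> nat \<Rightarrow> nat list" where
  "compP m t i = (SOME is. set is \<subseteq> {..<length (compU m t i @ compC m t i)} \<and>
     map ((!) (compU m t i @ compC m t i)) is = [0..<m])"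

lemma comp_basic:
  "set (compC m t i) \<subseteq> {..<m}" "set (compU m t i) \<subseteq> {..<m}"
  "sorted_wrt (<) (compC m t i)" "sorted_wrt (<) (compU m t i)"
  "i < m \<Longrightarrow> i \<in> set (compC m t i)" "length (compC m t i) \<le> m" "length (compU m t i) \<le> m"
  "set (compU m t i @ compC m t i) = {..<m}" "distinct (compU m t i @ compC m t i)"
  by (auto simp: compC_def compU_def sorted_wrt_filter intro: order_trans[OF length_filter_le])

text \<open>The two parts together list each position exactly once, so \<open>compP\<close> and this
  list are mutually inverse permutations.\<close>

lemma comp_perm:
  shows "set (compP m t i) \<subseteq> {..<length (compU m t i @ compC m t i)}"
    "map ((!) (compU m t i @ compC m t i)) (compP m t i) = [0..<m]"
    "map ((!) (compP m t i)) (compU m t i @ compC m t i) = [0..<length (compU m t i @ compC m t i)]"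
proof -
  let ?l = "compU m t i @ compC m t i" and ?p = "compP m t i"
  have "set [0..<m] \<subseteq> set ?l" unfolding comp_basic(8) by auto
  then have "\<exists>is. set is \<subseteq> {..<length ?l} \<and> map ((!) ?l) is = [0..<m]" by (rule index_list_ex)
  then have "set ?p \<subseteq> {..<length ?l} \<and> map ((!) ?l) ?p = [0..<m]" unfolding compP_def by (rule someI_ex)
  then show 1: "set ?p \<subseteq> {..<length ?l}" "map ((!) ?l) ?p = [0..<m]" by (simp_all only:)
  have len: "length ?p = m" using arg_cong[OF 1(2), of length] by (simp only: length_map length_upt diff_zero)
  have "?p ! (?l ! k) = k" if k: "k < length ?l" for k
  proof -
    have lk: "?l ! k < m" using comp_basic(8)[of m t i] k nth_mem by blast
    then have "?l ! (?p ! (?l ! k)) = ?l ! k" using arg_cong[OF 1(2), of "\<lambda>l. l ! (?l ! k)"] lk len by simp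
    have "?p ! (?l ! k) \<in> set ?p" using lk len by (intro nth_mem) (simp only:)
    then have "?p ! (?l ! k) < length ?l" using subsetD[OF 1(1)] by (simp only: lessThan_iff)
    then show ?thesis
      using \<open>?l ! (?p ! (?l ! k)) = ?l ! k\<close> k nth_eq_iff_index_eq[OF comp_basic(9)[of m t i]] by (simp only:)
  qed
  then show "map ((!) ?p) ?l = [0..<length ?l]" by (intro nth_equalityI) (simp_all del: map_append)
qed

lemma comp_restore:
  "length bs = m \<Longrightarrow> map ((!) (map ((!) bs) (compU m t i) @ map ((!) bs) (compC m t i))) (compP m t i) = bs"
  using map_nth_map[OF comp_perm(1)[of m t i], of "(!) bs"] comp_perm(2)[of m t i] map_nth[of bs] by simp

lemma comp_split:
  assumes "length W = length (compU m t i)" "length cs = length (compC m t i)"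
  defines "bs \<equiv> map ((!) (W @ cs)) (compP m t i)"
  shows "map ((!) bs) (compU m t i) = W" "map ((!) bs) (compC m t i) = cs" "set bs = set W \<union> set cs" "length bs = m"
proof -
  let ?l = "compU m t i @ compC m t i" and ?p = "compP m t i"
  have len: "length ?p = m" using arg_cong[OF comp_perm(2)[of m t i], of length] by (simp only: length_map length_upt diff_zero)
  then show 4: "length bs = m" by (simp add: bs_def)
  have "map ((!) bs) ?l = map ((!) (W @ cs)) (map ((!) ?p) ?l)"
    unfolding bs_def using len comp_basic(8)[of m t i] by (intro map_nth_map) auto
  also have "\<dots> = W @ cs"
    unfolding comp_perm(3) using assms(1,2) by (metis length_append map_nth)
  finally have "map ((!) bs) (compU m t i) @ map ((!) bs) (compC m t i) = W @ cs" by simp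
  then show 1: "map ((!) bs) (compU m t i) = W" "map ((!) bs) (compC m t i) = cs" using assms(1,2) by auto
  have "set bs = set (map ((!) bs) ?l)"
    using comp_basic(8)[of m t i] 4 by (auto simp: set_conv_nth[of bs] image_def)
  then show "set bs = set W \<union> set cs" using 1 by simp
qed

text \<open>All positions of a relation tuple that contains a position of the component are adjacent
  to it, hence belong to the component; so every edge of a path survives in the code of the
  component.\<close>

lemma conn_comp:
  fixes us :: "'a list"
  assumes "t = tp \<rho> A us" "m = length us"
  shows "conn (sub t (compC m t i))"
proof -
  let ?C = "compC m t i"
  have Cs: "j \<in> set ?C \<longleftrightarrow> j < m \<and> (i, j) \<in> (adj t)\<^sup>*" for j by (auto simp: compC_def)
  have dC: "distinct ?C" using comp_basic(3) distinct_sorted_lt by blast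
  have sym: "sym ((adj t)\<^sup>*)" using adj_sym unfolding assms(1) by (intro sym_rtrancl) (auto simp: sym_def)
  have step: "\<exists>y<length ?C. ?C ! y = j \<and> (x, y) \<in> (adj (sub t ?C))\<^sup>*"
    if "(?C ! x, j) \<in> (adj t)\<^sup>*" "x < length ?C" for x j
    using that(1)
  proof (induction rule: rtrancl_induct)
    case (step j' j)
    then obtain y' where y': "y' < length ?C" "?C ! y' = j'" "(x, y') \<in> (adj (sub t ?C))\<^sup>*" by auto
    have j'C: "(i, j') \<in> (adj t)\<^sup>*" using y' Cs nth_mem by blast
    have inC: "z \<in> set ?C" if "(j', z) \<in> adj t" for z
      using that j'C adj_sub[of \<rho> A us] Cs assms by (auto intro: rtrancl.rtrancl_into_rtrancl)
    then obtain y where y: "y < length ?C" "?C ! y = j" using step(2) by (auto simp: in_set_conv_nth)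
    have "(y', y) \<in> adj (sub t ?C)"
    proof (cases "(j', j) \<in> fst t")
      case True
      then show ?thesis using y y' by (auto simp: adj_def sub_def)
    next
      case False
      then obtain R "is" where r: "(R, is) \<in> snd t" "j' \<in> set is" "j \<in> set is" using step(2) by (auto simp: adj_def)
      then have "set is \<subseteq> set ?C" using inC by (auto simp: adj_def)
      then obtain is' where is': "set is' \<subseteq> {..<length ?C}" "map ((!) ?C) is' = is" using index_list_ex by blast
      have "z \<in> set is'" if "z < length ?C" "?C ! z \<in> set is" for z
        using that is' dC by (auto simp: nth_eq_iff_index_eq subset_iff)
      then have "y' \<in> set is'" "y \<in> set is'" using y y' r by auto
      then show ?thesis using is' r(1) by (auto simp: adj_def sub_def)
    qed
    then show ?case using y y'(3) by (auto intro: rtrancl.rtrancl_into_rtrancl)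
  qed (use that in auto)
  show ?thesis unfolding conn_def
  proof (intro allI impI)
    fix x y assume "(x, x) \<in> fst (sub t ?C) \<and> (y, y) \<in> fst (sub t ?C)"
    then have xy: "x < length ?C" "y < length ?C" by (auto simp: sub_def)
    then have "(i, ?C ! x) \<in> (adj t)\<^sup>*" "(i, ?C ! y) \<in> (adj t)\<^sup>*" using Cs nth_mem by blast+
    then have "(?C ! x, ?C ! y) \<in> (adj t)\<^sup>*" using sym by (meson rtrancl_trans symD)
    from step[OF this xy(1)] show "(x, y) \<in> (adj (sub t ?C))\<^sup>*"
      using xy dC nth_eq_iff_index_eq by blast
  qed
qed

text \<open>A coincidence or a relation tuple across the two parts would be an edge leaving the
  component.\<close>

lemma wfree_comp:
  assumes "t = tp \<tau> A us" "m = length us"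
  shows "wfree \<tau> A (map ((!) us) (compU m t i)) (map ((!) us) (compC m t i))"
proof -
  let ?C = "compC m t i" and ?U = "compU m t i"
  have no: "(u, c) \<notin> adj t" if "u \<in> set ?U" "c \<in> set ?C" for u c
    using that adj_sym[of u c \<tau> A us] assms(1)
    by (auto simp: compC_def compU_def intro: rtrancl.rtrancl_into_rtrancl)
  have "us ! u \<noteq> us ! c" if "u \<in> set ?U" "c \<in> set ?C" for u c
    using no[OF that] comp_basic(1,2)[of m t i] that assms by (auto simp: adj_def in_tp_eq)
  moreover have "set xs \<subseteq> set (map ((!) us) ?U) \<or> set xs \<subseteq> set (map ((!) us) ?C)"
    if R: "R \<in> \<tau>" "xs \<in> rel A R" "set xs \<subseteq> set (map ((!) us) ?U) \<union> set (map ((!) us) ?C)" for R xs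
  proof -
    have "set xs \<subseteq> set us" using R(3) comp_basic(1,2)[of m t i] assms(2) by (auto simp: subset_iff)
    then obtain "is" where "is": "set is \<subseteq> {..<m}" "map ((!) us) is = xs" using index_list_ex assms(2) by blast
    then have "(R, is) \<in> snd t" using R assms by (auto simp: in_tp_rel)
    then have "\<not> (u \<in> set is \<and> c \<in> set is)" if "u \<in> set ?U" "c \<in> set ?C" for u c
      using no[OF that] by (auto simp: adj_def)
    moreover have "set is \<subseteq> set ?U \<union> set ?C" using "is"(1) comp_basic(8)[of m t i] by auto
    ultimately have "set is \<subseteq> set ?U \<or> set is \<subseteq> set ?C" by blast
    then show ?thesis using "is"(2) by (metis image_mono set_map)
  qed
  moreover have "set (map ((!) us) ?U) \<inter> set (map ((!) us) ?C) = {}" using calculation(1) by auto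
  ultimately show ?thesis unfolding wfree_def by blast
qed

subsection \<open>Counting realizations of types\<close>

text \<open>The polynomial bound is weakened to a power of n for large n, the form in which it
  enters the union bounds.\<close>

locale base_seq = network N for N :: "('a, 'r) net" +
  fixes \<Delta> a :: nat
  assumes size: "filterlim (\<lambda>n. card (dom (base N n))) at_top sequentially"
    and degree: "n \<ge> 1 \<Longrightarrow> x \<in> dom (base N n) \<Longrightarrow> card {b. (x, b) \<in> gaifman (tau N) (base N n)} \<le> \<Delta>"
    and poly: "\<forall>\<^sub>F n in sequentially. card (dom (base N n)) \<le> n ^ a"
    and types: "\<And>l k p. k \<ge> 1 \<Longrightarrow> is_ntype N k p \<Longrightarrow> one_class N l p \<Longrightarrow>
        bounded_ntype N l p \<or>
        (\<exists>f. superlog f \<and> (\<forall>\<^sub>F n in sequentially. f n \<le> real (card (ntype_set N l p n))))"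
begin

lemma nb_card: "n \<ge> 1 \<Longrightarrow> finite {b. (x, b) \<in> G n} \<and> card {b. (x, b) \<in> G n} \<le> \<Delta>"
proof
  assume n: "n \<ge> 1"
  show "finite {b. (x, b) \<in> G n}"
    by (rule finite_subset[OF _ finite_Dm[OF n]]) (use gaifman_sub[OF n] in auto)
  show "card {b. (x, b) \<in> G n} \<le> \<Delta>"
  proof (cases "x \<in> Dm n")
    case False
    then have "{b. (x, b) \<in> G n} = {}" using gaifman_sub[OF n] by auto
    then show ?thesis by simp
  qed (use degree[OF n] in auto)
qed

lemma ball_card: "n \<ge> 1 \<Longrightarrow> finite (ball n l x) \<and> card (ball n l x) \<le> (\<Delta> + 1) ^ l"
proof (induction l)
  case (Suc l)
  then have fin: "finite (ball n l x)" and c: "card (ball n l x) \<le> (\<Delta> + 1) ^ l" by auto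
  let ?Y = "ball n l x \<union> (\<Union>c\<in>ball n l x. {b. (c, b) \<in> G n})"
  have finY: "finite ?Y" using fin nb_card[OF Suc.prems] by auto
  have "card ?Y \<le> card (ball n l x) + card (\<Union>c\<in>ball n l x. {b. (c, b) \<in> G n})" by (rule card_Un_le)
  also have "\<dots> \<le> card (ball n l x) + (\<Sum>c\<in>ball n l x. card {b. (c, b) \<in> G n})"
    using card_UN_le[OF fin] by simp
  also have "\<dots> \<le> card (ball n l x) + card (ball n l x) * \<Delta>"
    using sum_bounded_above[of "ball n l x" "\<lambda>c. card {b. (c, b) \<in> G n}" \<Delta>] nb_card[OF Suc.prems] by simp
  also have "\<dots> \<le> (\<Delta> + 1) ^ Suc l" using c by (simp add: add_mono mult_right_mono mult.commute)
  finally have "card ?Y \<le> (\<Delta> + 1) ^ Suc l" .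
  then show ?case using ball_Suc[of n l x] finY card_mono[OF finY ball_Suc] finite_subset[OF ball_Suc finY] by simp
qed (simp add: ball_0)

lemma nbhd_card:
  assumes "n \<ge> 1"
  shows "finite (nbhd \<tau> (B n) l as)" "card (nbhd \<tau> (B n) l as) \<le> length as * (\<Delta> + 1) ^ l"
proof -
  have s: "nbhd \<tau> (B n) l as \<subseteq> (\<Union>x\<in>set as. ball n l x)" by (auto simp: nbhd_def ball_def)
  have f: "finite (\<Union>x\<in>set as. ball n l x)" using ball_card[OF assms] by auto
  show "finite (nbhd \<tau> (B n) l as)" using s f by (rule finite_subset)
  have "card (nbhd \<tau> (B n) l as) \<le> (\<Sum>x\<in>set as. card (ball n l x))"
    using card_mono[OF f s] card_UN_le[of "set as" "ball n l"] by simp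
  also have "\<dots> \<le> card (set as) * (\<Delta> + 1) ^ l"
    using sum_bounded_above[of "set as" "\<lambda>x. card (ball n l x)"] ball_card[OF assms] by simp
  also have "\<dots> \<le> length as * (\<Delta> + 1) ^ l" by (intro mult_right_mono card_length) auto
  finally show "card (nbhd \<tau> (B n) l as) \<le> length as * (\<Delta> + 1) ^ l" .
qed

text \<open>The bound on the domain is the size of a neighbourhood of k elements, see
  \<open>nbhd_card\<close>, so that these finitely many types cover all tuples.\<close>

definition ntypes :: "nat \<Rightarrow> nat \<Rightarrow> 'r ntype set" where
  "ntypes k l = {p. is_ntype N k p \<and> dom (fst p) \<subseteq> {..<k * (\<Delta> + 1) ^ l}}"

lemma finite_ntypes: "finite (ntypes k l)"
proof (rule finite_subset)
  show "ntypes k l \<subseteq> {D. is_struc ar \<tau> D \<and> dom D \<subseteq> {..<k * (\<Delta> + 1) ^ l}} \<times> tuples {..<k * (\<Delta> + 1) ^ l} k"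
    by (fastforce simp: ntypes_def is_ntype_def tuples_def)
  show "finite ({D :: (nat, 'r) struc. is_struc ar \<tau> D \<and> dom D \<subseteq> {..<k * (\<Delta> + 1) ^ l}} \<times>
      tuples {..<k * (\<Delta> + 1) ^ l} k)"
    by (intro finite_cartesian_product finite_strucs finite_tau finite_tuples) simp
qed

lemma ntype_exists:
  assumes n: "n \<ge> 1" and as: "as \<in> tuples (Dm n) k"
  obtains p where "p \<in> ntypes k l" "ntype_sat N l p n as"
proof -
  let ?S = "nbhd \<tau> (B n) l as"
  have "set as \<subseteq> ?S"
  proof
    fix x assume "x \<in> set as"
    moreover have "dist_le \<tau> (B n) l x x" unfolding dist_le_def by (intro exI[of _ 0]) auto
    ultimately show "x \<in> ?S" using as by (auto simp: nbhd_def tuples_def)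
  qed
  moreover have "?S \<subseteq> Dm n" by (auto simp: nbhd_def)
  ultimately obtain D ds f where D: "dom D = {..<card ?S}" "is_struc ar \<tau> D" "ds \<in> tuples (dom D) (length as)"
    "pointed_iso \<tau> f D ds (induced (B n) ?S) as"
    using canonical_copy[of ?S "B n" as \<tau> ar] nbhd_card(1)[OF n] base_rel[OF n] by metis
  have "length as = k" using as by (auto simp: tuples_def)
  then show ?thesis using D nbhd_card(2)[OF n, of l as]
    by (intro that[of "(D, ds)"]) (auto simp: ntypes_def is_ntype_def ntype_sat_def)
qed

text \<open>Every rare element realizes one of finitely many bounded types, and the bounds of these
  add up.\<close>

lemma rare_bounded: "\<exists>M. \<forall>n\<ge>1. card {b. rare N l n b} \<le> M"
proof -
  define Q where "Q = {p \<in> ntypes 1 l. bounded_ntype N l p}"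
  have finQ: "finite Q" using finite_ntypes by (auto simp: Q_def)
  have "\<forall>p\<in>Q. \<exists>m. \<forall>n\<ge>1. card (ntype_set N l p n) \<le> m" by (auto simp: Q_def bounded_ntype_def)
  then obtain m where m: "\<And>p n. p \<in> Q \<Longrightarrow> n \<ge> 1 \<Longrightarrow> card (ntype_set N l p n) \<le> m p"
    by (auto dest!: bchoice)
  have "card {b. rare N l n b} \<le> (\<Sum>p\<in>Q. m p)" if n: "n \<ge> 1" for n
  proof -
    have "(\<lambda>b. [b]) ` {b. rare N l n b} \<subseteq> (\<Union>p\<in>Q. ntype_set N l p n)"
    proof
      fix bs assume "bs \<in> (\<lambda>b. [b]) ` {b. rare N l n b}"
      then obtain b where b: "bs = [b]" "rare N l n b" by auto
      then have bt: "[b] \<in> tuples (Dm n) 1" by (auto simp: rare_def tuples_def)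
      obtain p where p: "is_ntype N 1 p" "ntype_sat N l p n [b]" "bounded_ntype N l p"
        using b(2) unfolding rare_def by blast
      obtain p' where p': "p' \<in> ntypes 1 l" "ntype_sat N l p' n [b]" using ntype_exists[OF n bt] by blast
      have i: "is_ntype N 1 p'" using p' by (simp add: ntypes_def)
      have "bounded_ntype N l p'"
        using p(3) ntype_set_eq[OF p'(2) p(2) i p(1)] by (simp add: bounded_ntype_def)
      moreover have "[b] \<in> ntype_set N l p' n" using p'(2) i bt by (auto simp: ntype_set_def is_ntype_def tuples_def)
      ultimately show "bs \<in> (\<Union>p\<in>Q. ntype_set N l p n)" using p' b unfolding Q_def by blast
    qed
    moreover have "finite (\<Union>p\<in>Q. ntype_set N l p n)"
      using finQ finite_tuples[OF finite_Dm[OF n]] by (auto simp: ntype_set_def)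
    ultimately have "card ((\<lambda>b. [b]) ` {b. rare N l n b}) \<le> card (\<Union>p\<in>Q. ntype_set N l p n)"
      by (rule card_mono[rotated])
    also have "\<dots> \<le> (\<Sum>p\<in>Q. card (ntype_set N l p n))" by (rule card_UN_le[OF finQ])
    also have "\<dots> \<le> (\<Sum>p\<in>Q. m p)" using m n by (intro sum_mono) auto
    finally show ?thesis by (simp add: card_image inj_on_def)
  qed
  then show ?thesis by blast
qed

text \<open>The place where the growth hypothesis enters. Neighbourhood types of radius
  \<open>q * q\<close> refine \<open>c\<close>, there are finitely many of them, and by
  \<open>conn_ball\<close> each has all its variables in one class. Were all of them bounded, so
  would be the count; an unbounded one grows fast by hypothesis, and its realizations are among
  those counted.\<close>

lemma conn_count_slog:
  assumes q: "q \<ge> 1" and c: "conn c" and unb: "\<And>m. \<exists>n\<ge>1. m < count c q n"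
  shows "slog (count c q)"
proof -
  define l where "l = q * q"
  define Q where "Q = {p \<in> ntypes q l. \<exists>n\<ge>1. \<exists>cs\<in>tuples (Dm n) q. tp \<tau> (B n) cs = c \<and> ntype_sat N l p n cs}"
  have finQ: "finite Q" using finite_ntypes by (auto simp: Q_def)
  have lenp: "length (snd p) = q" if "p \<in> Q" for p using that by (auto simp: Q_def ntypes_def is_ntype_def tuples_def)
  \<comment> \<open>The neighbourhood contains the tuple itself, so an isomorphism of neighbourhoods
    preserves the code; hence one realization with code \<open>c\<close> decides for all.\<close>
  have same: "tp \<tau> (B n) cs = c" if p: "p \<in> Q" and n: "n \<ge> 1" and cs: "cs \<in> ntype_set N l p n" for p n cs
  proof -
    obtain n' cs' where n': "n' \<ge> 1" "cs' \<in> tuples (Dm n') q" "tp \<tau> (B n') cs' = c" "ntype_sat N l p n' cs'"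
      using p by (auto simp: Q_def)
    have pds: "set (snd p) \<subseteq> dom (fst p)" using p by (auto simp: Q_def ntypes_def is_ntype_def tuples_def)
    let ?S = "nbhd \<tau> (B n) l cs" and ?S' = "nbhd \<tau> (B n') l cs'"
    obtain f f' where f: "pointed_iso \<tau> f (fst p) (snd p) (induced (B n) ?S) cs"
       "pointed_iso \<tau> f' (fst p) (snd p) (induced (B n') ?S') cs'"
      using cs n'(4) by (auto simp: ntype_set_def ntype_sat_def)
    obtain g where g: "pointed_iso \<tau> g (induced (B n') ?S') cs' (induced (B n) ?S) cs"
      using pointed_iso_comp[OF pointed_iso_inv[OF f(2) pds] f(1)] by blast
    have S: "Dm n' \<inter> ?S' = ?S'" "Dm n \<inter> ?S = ?S" by (auto simp: nbhd_def)
    have cS: "set cs' \<subseteq> ?S'"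
    proof
      fix x assume "x \<in> set cs'"
      moreover have "dist_le \<tau> (B n') l x x" unfolding dist_le_def by (intro exI[of _ 0]) auto
      ultimately show "x \<in> ?S'" using n'(2) by (auto simp: nbhd_def tuples_def)
    qed
    have b: "bij_betw g ?S' ?S" "map g cs' = cs" using g unfolding pointed_iso_def induced_simps S by auto
    have r: "xs \<in> rel (B n') R \<longleftrightarrow> map g xs \<in> rel (B n) R" if "R \<in> \<tau>" "set xs \<subseteq> set cs'" for R xs
    proof -
      have "set xs \<subseteq> ?S'" using that(2) cS by auto
      moreover then have "set (map g xs) \<subseteq> ?S" using b(1) by (auto simp: bij_betw_def)
      ultimately show ?thesis using g that(1) unfolding pointed_iso_def induced_simps S by simp
    qed
    have "tp \<tau> (B n') cs' = tp \<tau> (B n) (map g cs')"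
      using b(1) cS r by (intro iso_tp) (auto simp: bij_betw_def intro: inj_on_subset)
    then show ?thesis using b(2) n'(3) by simp
  qed
  \<comment> \<open>All realizations have code \<open>c\<close>, hence entries at distance at most
    \<open>l\<close> from each other, so any two variables are related even before the transitive
    closure is taken.\<close>
  have one: "one_class N l p" if p: "p \<in> Q" for p
    unfolding one_class_def
  proof (intro allI impI)
    fix i j assume ij: "i < length (snd p)" "j < length (snd p)"
    have "dist_le \<tau> (B n) (2 * l) (cs ! i) (cs ! j)" if "n \<ge> 1" "cs \<in> ntype_set N l p n" for n cs
    proof -
      have len: "length cs = q" using that(2) lenp[OF p] by (auto simp: ntype_set_def tuples_def)
      have "cs ! j \<in> ball n l (cs ! i)"
        using conn_ball[of n cs i j] same[OF p that] c ij lenp[OF p] len by (simp add: l_def)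
      then have "cs ! j \<in> ball n (2 * l) (cs ! i)" using ball_mono[of l "2 * l"] by auto
      then show ?thesis by (simp add: ball_def)
    qed
    then show "(i, j) \<in> (near_vars N l p)\<^sup>+" using ij by (intro r_into_trancl) (simp add: near_vars_def)
  qed
  have cov: "{cs \<in> tuples (Dm n) q. tp \<tau> (B n) cs = c} \<subseteq> (\<Union>p\<in>Q. ntype_set N l p n)" if n: "n \<ge> 1" for n
  proof
    fix cs assume cs: "cs \<in> {cs \<in> tuples (Dm n) q. tp \<tau> (B n) cs = c}"
    then obtain p where p: "p \<in> ntypes q l" "ntype_sat N l p n cs" using ntype_exists[OF n, of cs q l] by blast
    then have "p \<in> Q" using cs n by (auto simp: Q_def)
    then show "cs \<in> (\<Union>p\<in>Q. ntype_set N l p n)" using p cs lenp by (auto simp: ntype_set_def)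
  qed
  have finN: "finite (ntype_set N l p n)" if "n \<ge> 1" for p n
    using finite_tuples[OF finite_Dm[OF that]] by (auto simp: ntype_set_def)
  have "\<exists>p\<in>Q. \<not> bounded_ntype N l p"
  proof (rule ccontr)
    assume "\<not> (\<exists>p\<in>Q. \<not> bounded_ntype N l p)"
    then obtain m where m: "\<And>p n. p \<in> Q \<Longrightarrow> n \<ge> 1 \<Longrightarrow> card (ntype_set N l p n) \<le> m p"
      unfolding bounded_ntype_def by metis
    have "count c q n \<le> (\<Sum>p\<in>Q. m p)" if n: "n \<ge> 1" for n
    proof -
      have "count c q n \<le> card (\<Union>p\<in>Q. ntype_set N l p n)"
        unfolding count_def using cov[OF n] finQ finN[OF n] by (intro card_mono) auto
      also have "\<dots> \<le> (\<Sum>p\<in>Q. card (ntype_set N l p n))" by (rule card_UN_le[OF finQ])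
      also have "\<dots> \<le> (\<Sum>p\<in>Q. m p)" using m n by (intro sum_mono) auto
      finally show ?thesis .
    qed
    then show False using unb[of "\<Sum>p\<in>Q. m p"] by (meson not_less)
  qed
  then obtain p where p: "p \<in> Q" "\<not> bounded_ntype N l p" by blast
  have "is_ntype N q p" using p by (auto simp: Q_def ntypes_def)
  from types[OF q this one[OF p(1)]] p(2) obtain f where
    f: "superlog f" "\<forall>\<^sub>F n in sequentially. f n \<le> real (card (ntype_set N l p n))" by blast
  show ?thesis
  proof (rule superlog_slog[OF f(1)])
    show "\<forall>\<^sub>F n in sequentially. f n \<le> real (count c q n)"
      using f(2) eventually_ge_at_top[of 1]
    proof eventually_elim
      case (elim n)
      have "ntype_set N l p n \<subseteq> {cs \<in> tuples (Dm n) q. tp \<tau> (B n) cs = c}"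
        using same[OF p(1) elim(2)] lenp[OF p(1)] by (auto simp: ntype_set_def)
      then have "card (ntype_set N l p n) \<le> count c q n"
        unfolding count_def using finite_tuples[OF finite_Dm[OF elim(2)]] by (intro card_mono) auto
      then show ?case using elim by simp
    qed
  qed
qed

text \<open>A copy that is not far has an entry within distance 1 of some element of
  \<open>X\<close>; being connected it then lies in a ball of radius \<open>q * q + 1\<close>, which
  leaves a bounded number of choices.\<close>

lemma far_count:
  assumes n: "n \<ge> 1" and X: "finite X" "card X \<le> K" and c: "conn c" and q: "q \<ge> 1"
  shows "count c q n \<le> card {cs \<in> tuples (Dm n) q. tp \<tau> (B n) cs = c \<and> far n X cs} + K * ((\<Delta> + 1) ^ (q * q + 1)) ^ q"
proof -
  let ?A = "{cs \<in> tuples (Dm n) q. tp \<tau> (B n) cs = c \<and> far n X cs}"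
  let ?Bd = "\<Union>x\<in>X. tuples (ball n (q * q + 1) x) q"
  have sub: "{cs \<in> tuples (Dm n) q. tp \<tau> (B n) cs = c} \<subseteq> ?A \<union> ?Bd"
  proof
    fix cs assume cs: "cs \<in> {cs \<in> tuples (Dm n) q. tp \<tau> (B n) cs = c}"
    then have len: "length cs = q" by (auto simp: tuples_def)
    show "cs \<in> ?A \<union> ?Bd"
    proof (cases "far n X cs")
      case False
      then obtain x y where xy: "x \<in> X" "y \<in> set cs" "y \<in> ball n 1 x" unfolding far_def by blast
      then obtain i where i: "i < q" "cs ! i = y" using len by (auto simp: in_set_conv_nth)
      have "cs ! j \<in> ball n (q * q + 1) x" if "j < q" for j
        using ball_trans[OF xy(3), of "cs ! j" "q * q"] conn_ball[of n cs i j] cs c i that len by (simp add: add.commute)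
      then have "set cs \<subseteq> ball n (q * q + 1) x" using len by (auto simp: in_set_conv_nth)
      then show ?thesis using xy(1) len by (auto simp: tuples_def)
    qed (use cs in auto)
  qed
  have fin: "finite ?A" using finite_tuples[OF finite_Dm[OF n]] by auto
  have ft: "finite (tuples (ball n (q * q + 1) x) q)" "card (tuples (ball n (q * q + 1) x) q) \<le> ((\<Delta> + 1) ^ (q * q + 1)) ^ q" for x
    using finite_tuples ball_card[OF n] by (auto simp del: power_Suc power_add simp: card_tuples power_mono)
  have finB: "finite ?Bd" using ft X(1) by auto
  have "count c q n \<le> card (?A \<union> ?Bd)" unfolding count_def using sub fin finB by (intro card_mono) auto
  also have "\<dots> \<le> card ?A + card ?Bd" by (rule card_Un_le)
  also have "card ?Bd \<le> (\<Sum>x\<in>X. card (tuples (ball n (q * q + 1) x) q))" by (rule card_UN_le[OF X(1)])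
  also have "\<dots> \<le> card X * ((\<Delta> + 1) ^ (q * q + 1)) ^ q"
    using sum_bounded_above[of X "\<lambda>x. card (tuples (ball n (q * q + 1) x) q)"] ft(2) by simp
  also have "\<dots> \<le> K * ((\<Delta> + 1) ^ (q * q + 1)) ^ q" using X(2) by (intro mult_right_mono) auto
  finally show ?thesis by simp
qed

text \<open>Exchange of a component: \<open>W\<close> keeps the other positions, \<open>cs\<close>
  is a far copy of the component, and gluing, compared with the reference realization
  \<open>bs\<close>, shows that the result has type \<open>t\<close> again.\<close>

lemma replace_comp:
  assumes ref: "tp \<tau> A bs = t" "length bs = m"
    and W: "tp \<tau> (B n) W = sub t (compU m t i)" "wfree \<tau> (B n) us W" "set W \<subseteq> Dm n"
    and cs: "tp \<tau> (B n) cs = sub t (compC m t i)" "far n (set us \<union> set W) cs" "set cs \<subseteq> Dm n"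
  defines "bs' \<equiv> map ((!) (W @ cs)) (compP m t i)"
  shows "bs' \<in> Ext n m t us" "map ((!) bs') (compU m t i) = W" "map ((!) bs') (compC m t i) = cs"
proof -
  let ?U = "compU m t i" and ?C = "compC m t i"
  have sU: "set ?U \<subseteq> {..<length bs}" "set ?C \<subseteq> {..<length bs}" using comp_basic(1,2)[of m t i] ref(2) by auto
  have tU: "tp \<tau> A (map ((!) bs) ?U) = sub t ?U" "tp \<tau> A (map ((!) bs) ?C) = sub t ?C"
    using sub_tp[OF sU(1), of \<tau> A] sub_tp[OF sU(2), of \<tau> A] ref(1) by auto
  have len: "length W = length ?U" "length cs = length ?C"
    using tp_length[OF W(1)[folded tU(1)]] tp_length[OF cs(1)[folded tU(2)]] by auto
  have "tp \<tau> (B n) (W @ cs) = tp \<tau> A (map ((!) bs) ?U @ map ((!) bs) ?C)"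
    using W(1) cs(1) tU far_wfree(1)[OF cs(2) W(2)] wfree_comp[of t \<tau> A bs m i] ref by (intro glue) auto
  then have "tp \<tau> (B n) bs' = tp \<tau> A (map ((!) (map ((!) bs) ?U @ map ((!) bs) ?C)) (compP m t i))"
    unfolding bs'_def using comp_perm(1)[of m t i] len by (intro tp_sub_cong) auto
  then have tb: "tp \<tau> (B n) bs' = t" using comp_restore[OF ref(2), of t i] ref(1) by simp
  note s = comp_split[OF len, folded bs'_def]
  show "map ((!) bs') ?U = W" "map ((!) bs') ?C = cs" by (rule s(1), rule s(2))
  have "wfree \<tau> (B n) us bs'"
    by (rule wfree_sub[OF far_wfree(2)[OF cs(2) W(2)]]) (use s(3) in auto)
  then show "bs' \<in> Ext n m t us" using tb s(3,4) W(3) cs(3) by (auto simp: Ext_def tuples_def)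
qed

lemma good_comp:
  assumes "good m t" "i < m" "tp \<tau> A bs = t" "length bs = m"
  shows "conn (sub t (compC m t i))" "slog (count (sub t (compC m t i)) (length (compC m t i)))"
    "length (compC m t i) \<ge> 1"
proof -
  show c: "conn (sub t (compC m t i))" using conn_comp[of t \<tau> A bs m i] assms by auto
  have ne: "compC m t i \<noteq> []" using comp_basic(5)[OF assms(2), of t] by auto
  then show "slog (count (sub t (compC m t i)) (length (compC m t i)))"
    using assms(1) c comp_basic(1,3)[of m t i] unfolding good_def by blast
  show "length (compC m t i) \<ge> 1" using ne by (cases "compC m t i") auto
qed

lemma good_sub: "good m t \<Longrightarrow> set js \<subseteq> {..<m} \<Longrightarrow> sorted_wrt (<) js \<Longrightarrow> good (length js) (sub t js)"
  unfolding good_def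
proof (intro allI impI)
  fix js' assume g: "\<forall>js. js \<noteq> [] \<and> sorted_wrt (<) js \<and> set js \<subseteq> {..<m} \<and> conn (sub t js) \<longrightarrow> slog (count (sub t js) (length js))"
    and js: "set js \<subseteq> {..<m}" "sorted_wrt (<) js"
    and js': "js' \<noteq> [] \<and> sorted_wrt (<) js' \<and> set js' \<subseteq> {..<length js} \<and> conn (sub (sub t js) js')"
  have lt: "js' ! x < length js" if "x < length js'" for x using js' that nth_mem by blast
  have "set (map ((!) js) js') \<subseteq> {..<m}" using js' js(1) by (auto simp: subset_iff)
  moreover have "sorted_wrt (<) (map ((!) js) js')"
    using js js' lt by (auto simp: sorted_wrt_iff_nth_less)
  moreover have "sub (sub t js) js' = sub t (map ((!) js) js')" using js' by (intro sub_sub) auto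
  ultimately show "slog (count (sub (sub t js) js') (length js'))"
    using g[rule_format, of "map ((!) js) js'"] js' by auto
qed

text \<open>Realize the positions outside the component of position 0 first, then add a copy of that
  component far from everything chosen; all but boundedly many copies are far.\<close>

lemma Ext_nonempty:
  assumes "good m t" "m \<ge> 1" "tp \<tau> A bs = t" "length bs = m"
  shows "\<forall>\<^sub>F n in sequentially. \<forall>us\<in>tuples (Dm n) K. Ext n m t us \<noteq> {}"
  using assms
proof (induction m arbitrary: t bs rule: less_induct)
  case (less m t bs)
  let ?C = "compC m t 0" and ?U = "compU m t 0"
  define q where "q = length ?C"
  note gc = good_comp[OF less.prems(1) _ less.prems(3,4), of 0]
  have m0: "0 < m" using less.prems by simp
  \<comment> \<open>At most \<open>K + m\<close> elements have to be avoided; each of them spoils as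
    many copies as \<open>far_count\<close> allows.\<close>
  define K' where "K' = (K + m) * ((\<Delta> + 1) ^ (q * q + 1)) ^ q"
  have ev: "\<forall>\<^sub>F n in sequentially. K' < count (sub t ?C) q n"
  proof -
    have "\<forall>\<^sub>F n in sequentially. 1 * ln (real n) \<le> count (sub t ?C) q n" using gc(2)[OF m0] slogD q_def by blast
    then show ?thesis using eventually_ln_ge[of "K' + 1"] by eventually_elim linarith
  qed
  show ?case
  proof (cases "?U = []")
    case True
    have "?C = [0..<m]"
    proof -
      have "\<forall>j<m. (0, j) \<in> (adj t)\<^sup>*" using True by (simp add: compU_def filter_empty_conv)
      then show ?thesis by (simp add: compC_def filter_id_conv)
    qed
    then have qm: "q = m" and sC: "sub t ?C = t"
      using sub_tp[of "[0..<m]" bs \<tau> A] less.prems(3,4) map_nth[of bs] by (auto simp: q_def subset_iff)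
    show ?thesis using ev eventually_ge_at_top[of 1]
    proof eventually_elim
      case (elim n)
      show ?case
      proof
        fix us assume us: "us \<in> tuples (Dm n) K"
        have cd: "card (set us) \<le> K + m" using card_length[of us] us by (auto simp: tuples_def)
        have "0 < card {cs \<in> tuples (Dm n) q. tp \<tau> (B n) cs = t \<and> far n (set us) cs}"
          using far_count[OF elim(2) _ cd gc(1)[OF m0], of q] elim(1) gc(3)[OF m0] sC by (simp add: K'_def q_def)
        then obtain cs where cs: "cs \<in> tuples (Dm n) q" "tp \<tau> (B n) cs = t" "far n (set us) cs"
          by (auto simp: card_gt_0_iff)
        have "wfree \<tau> (B n) us ([] @ cs)"
          using cs(3) by (intro far_wfree(2)) (auto simp: wfree_def)
        then show "Ext n m t us \<noteq> {}" using cs qm by (auto simp: Ext_def)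
      qed
    qed
  next
    case False
    let ?m = "length ?U"
    have "?U \<noteq> [0..<m]" using comp_basic(9)[of m t 0] comp_basic(5)[OF m0, of t] m0 by auto
    then have lt: "?m < m"
      unfolding compU_def using m0 by (metis (no_types, lifting) length_filter_less length_upt diff_zero filter_True filter_id_conv)
    have sU: "set ?U \<subseteq> {..<length bs}" using comp_basic(2)[of m t 0] less.prems(4) by auto
    have "\<forall>\<^sub>F n in sequentially. \<forall>us\<in>tuples (Dm n) K. Ext n ?m (sub t ?U) us \<noteq> {}"
    proof (rule less.IH[OF lt])
      show "good ?m (sub t ?U)" using less.prems(1) comp_basic(2,4)[of m t 0] by (intro good_sub) auto
      show "?m \<ge> 1" using False by (cases ?U) auto
      show "tp \<tau> A (map ((!) bs) ?U) = sub t ?U" using sub_tp[OF sU, of \<tau> A] less.prems(3) by simp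
    qed simp
    then show ?thesis using ev eventually_ge_at_top[of 1]
    proof eventually_elim
      case (elim n)
      show ?case
      proof
        fix us assume us: "us \<in> tuples (Dm n) K"
        then obtain W where W: "W \<in> Ext n ?m (sub t ?U) us" using elim by blast
        then have lW: "length W = ?m" "set W \<subseteq> Dm n" by (auto simp: Ext_def tuples_def)
        have cd: "card (set us \<union> set W) \<le> K + m"
          using card_length[of us] card_length[of W] card_Un_le[of "set us" "set W"] us lW lt by (auto simp: tuples_def)
        have "0 < card {cs \<in> tuples (Dm n) q. tp \<tau> (B n) cs = sub t ?C \<and> far n (set us \<union> set W) cs}"
          using far_count[OF elim(3) _ cd gc(1)[OF m0], of q] elim(2) gc(3)[OF m0] by (simp add: K'_def q_def)
        then obtain cs where cs: "cs \<in> tuples (Dm n) q" "tp \<tau> (B n) cs = sub t ?C" "far n (set us \<union> set W) cs"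
          by (auto simp: card_gt_0_iff)
        have "map ((!) (W @ cs)) (compP m t 0) \<in> Ext n m t us"
          using W cs lW by (intro replace_comp(1)[OF less.prems(3,4)]) (auto simp: Ext_def tuples_def)
        then show "Ext n m t us \<noteq> {}" by blast
      qed
    qed
  qed
qed

text \<open>Replacing the component of position \<open>i\<close> by any of the many other copies of it shows that only
  a small fraction of the extensions has a given element at position \<open>i\<close>.\<close>

lemma swap:
  fixes \<beta> :: real
  assumes t: "good m t" and i: "i < m"
  shows "\<forall>\<^sub>F n in sequentially. \<forall>us\<in>tuples (Dm n) K. \<forall>b.
    \<beta> * ln (real n) * card {bs \<in> Ext n m t us. bs ! i = b} \<le> card (Ext n m t us)"
proof (cases "\<exists>A :: ('a, 'r) struc. \<exists>bs. tp \<tau> A bs = t \<and> length bs = m")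
  case False
  then have "Ext n m t us = {}" for n us by (auto simp: Ext_def tuples_def)
  then show ?thesis by simp
next
  case True
  then obtain A :: "('a, 'r) struc" and bs0 where ref: "tp \<tau> A bs0 = t" "length bs0 = m" by blast
  let ?C = "compC m t i" and ?U = "compU m t i"
  define q where "q = length ?C"
  note gc = good_comp[OF t i ref, folded q_def]
  \<comment> \<open>\<open>K1\<close> bounds the copies of the component that are not far from the
    parameters and the remaining positions, \<open>K2\<close> the copies that have a given entry at
    position \<open>i\<close>. The summand 1 next to \<open>\<beta> * K2\<close> below pays for
    \<open>K1\<close>.\<close>
  define K1 where "K1 = (K + m) * ((\<Delta> + 1) ^ (q * q + 1)) ^ q"
  define K2 where "K2 = ((\<Delta> + 1) ^ (q * q)) ^ q"
  have K2: "K2 \<ge> 1" by (simp add: K2_def)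
  have "\<forall>\<^sub>F n in sequentially. (\<beta> * K2 + 1) * ln (real n) \<le> count (sub t ?C) q n" using gc(2) slogD by blast
  then show ?thesis using eventually_ln_ge[of K1] eventually_ge_at_top[of 1]
  proof eventually_elim
    case (elim n)
    have M: "\<beta> * K2 * ln (real n) + K1 \<le> count (sub t ?C) q n" using elim(1,2) by (simp add: algebra_simps)
    show ?case
    proof (intro ballI allI)
      fix us b assume us: "us \<in> tuples (Dm n) K"
      define S where "S = Ext n m t us"
      define Sb where "Sb = {bs \<in> S. bs ! i = b}"
      define F where "F bs = {cs \<in> tuples (Dm n) q. tp \<tau> (B n) cs = sub t ?C \<and> far n (set us \<union> set (map ((!) bs) ?U)) cs}" for bs
      have finS: "finite S" using finite_Ext[OF elim(3)] by (simp add: S_def)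
      have finF: "finite (F bs)" for bs using finite_tuples[OF finite_Dm[OF elim(3)]] by (auto simp: F_def)
      have cF: "count (sub t ?C) q n \<le> card (F bs) + K1" for bs
      proof -
        have "card (set us \<union> set (map ((!) bs) ?U)) \<le> K + m"
          using card_length[of us] card_length[of "map ((!) bs) ?U"] card_Un_le[of "set us" "set (map ((!) bs) ?U)"] us
            comp_basic(7)[of m t i] by (auto simp: tuples_def)
        from far_count[OF elim(3) _ this gc(1,3)] show ?thesis by (simp add: F_def K1_def)
      qed
      \<comment> \<open>Takes an extension with \<open>b\<close> at position \<open>i\<close> and a
        far copy of the component, puts the copy in place and remembers the removed component. The
        new extension still shows the other positions and the copy, so the map is injective; the
        removed component contains \<open>b\<close>, so it takes at most \<open>K2\<close>
        values.\<close>
      let ?g = "\<lambda>(bs, cs). (map ((!) (map ((!) bs) ?U @ cs)) (compP m t i), map ((!) bs) ?C)"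
      have pr: "tp \<tau> (B n) (map ((!) bs) ?U) = sub t ?U" "tp \<tau> (B n) (map ((!) bs) ?C) = sub t ?C"
        "wfree \<tau> (B n) us (map ((!) bs) ?U)" "set (map ((!) bs) ?U) \<subseteq> Dm n" "set (map ((!) bs) ?C) \<subseteq> Dm n"
        "length bs = m" if "bs \<in> S" for bs
      proof -
        have b: "tp \<tau> (B n) bs = t" "length bs = m" "set bs \<subseteq> Dm n" "wfree \<tau> (B n) us bs"
          using that by (auto simp: S_def Ext_def tuples_def)
        have sU: "set ?U \<subseteq> {..<length bs}" "set ?C \<subseteq> {..<length bs}" using comp_basic(1,2)[of m t i] b(2) by auto
        show "tp \<tau> (B n) (map ((!) bs) ?U) = sub t ?U" "tp \<tau> (B n) (map ((!) bs) ?C) = sub t ?C"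
          using sub_tp[OF sU(1), of \<tau> "B n"] sub_tp[OF sU(2), of \<tau> "B n"] b(1) by auto
        have "set (map ((!) bs) ?U) \<subseteq> set bs" "set (map ((!) bs) ?C) \<subseteq> set bs" using sU by (auto simp: subset_iff)
        then show "wfree \<tau> (B n) us (map ((!) bs) ?U)" "set (map ((!) bs) ?U) \<subseteq> Dm n" "set (map ((!) bs) ?C) \<subseteq> Dm n"
          using wfree_sub[OF b(4)] b(3) by blast+
        show "length bs = m" by (rule b(2))
      qed
      have rc: "map ((!) (map ((!) bs) ?U @ cs)) (compP m t i) \<in> S"
         "map ((!) (map ((!) (map ((!) bs) ?U @ cs)) (compP m t i))) ?U = map ((!) bs) ?U"
         "map ((!) (map ((!) (map ((!) bs) ?U @ cs)) (compP m t i))) ?C = cs"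
        if "bs \<in> S" "cs \<in> F bs" for bs cs
      proof -
        have "tp \<tau> (B n) cs = sub t ?C" "far n (set us \<union> set (map ((!) bs) ?U)) cs" "set cs \<subseteq> Dm n"
          using that(2) by (simp_all add: F_def tuples_def)
        note r = replace_comp[OF ref pr(1,3,4)[OF that(1)] this]
        show "map ((!) (map ((!) bs) ?U @ cs)) (compP m t i) \<in> S" unfolding S_def by (rule r(1))
        show "map ((!) (map ((!) (map ((!) bs) ?U @ cs)) (compP m t i))) ?U = map ((!) bs) ?U" by (rule r(2))
        show "map ((!) (map ((!) (map ((!) bs) ?U @ cs)) (compP m t i))) ?C = cs" by (rule r(3))
      qed
      have inj: "inj_on ?g (Sigma Sb F)"
      proof (rule inj_onI, clarify)
        fix bs cs bs' cs' assume H: "bs \<in> Sb" "cs \<in> F bs" "bs' \<in> Sb" "cs' \<in> F bs'"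
          and e1: "map ((!) (map ((!) bs) ?U @ cs)) (compP m t i) = map ((!) (map ((!) bs') ?U @ cs')) (compP m t i)"
          and e2: "map ((!) bs) ?C = map ((!) bs') ?C"
        have S: "bs \<in> S" "bs' \<in> S" using H by (auto simp: Sb_def)
        have "map ((!) bs) ?U = map ((!) bs') ?U" using rc(2)[OF S(1) H(2)] rc(2)[OF S(2) H(4)] e1 by simp
        then have "bs = bs'" using comp_restore[of bs m t i] comp_restore[of bs' m t i] e2 pr(6) S by metis
        moreover have "cs = map ((!) (map ((!) (map ((!) bs') ?U @ cs')) (compP m t i))) ?C"
          using rc(3)[OF S(1) H(2)] unfolding e1 by (rule sym)
        ultimately show "bs = bs' \<and> cs = cs'" using rc(3)[OF S(2) H(4)] by (simp only:)
      qed
      have img: "?g ` Sigma Sb F \<subseteq> S \<times> tuples (ball n (q * q) b) q"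
      proof clarify
        fix bs cs assume H: "bs \<in> Sb" "cs \<in> F bs"
        have S: "bs \<in> S" "bs ! i = b" using H by (auto simp: Sb_def)
        let ?cs = "map ((!) bs) ?C"
        obtain z where z: "z < q" "?C ! z = i" using comp_basic(5)[OF i, of t] by (auto simp: in_set_conv_nth q_def)
        have "?cs ! j \<in> ball n (q * q) b" if "j < q" for j
          using conn_ball[of n ?cs z j] pr(2)[OF S(1)] gc(1) z that S(2) by (simp add: q_def)
        then have "set ?cs \<subseteq> ball n (q * q) b" by (fastforce simp: in_set_conv_nth q_def)
        then show "map ((!) (map ((!) bs) ?U @ cs)) (compP m t i) \<in> S \<and> ?cs \<in> tuples (ball n (q * q) b) q"
          using rc(1)[OF S(1) H(2)] by (simp add: tuples_def q_def)
      qed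
      have fT: "finite (tuples (ball n (q * q) b) q)" using ball_card[OF elim(3)] finite_tuples by blast
      have cT: "card (tuples (ball n (q * q) b) q) \<le> K2"
        using ball_card[OF elim(3)] by (simp add: card_tuples K2_def power_mono)
      have "(\<Sum>bs\<in>Sb. card (F bs)) = card (Sigma Sb F)" using finS finF by (simp add: Sb_def)
      also have "\<dots> \<le> card (S \<times> tuples (ball n (q * q) b) q)"
        using card_inj_on_le[OF inj img] finS fT by simp
      also have "\<dots> \<le> card S * K2" using cT by (simp add: card_cartesian_product)
      finally have up: "(\<Sum>bs\<in>Sb. real (card (F bs))) \<le> real (card S) * K2"
        unfolding of_nat_sum[symmetric] of_nat_mult[symmetric] of_nat_le_iff .
      have "real (card Sb) * (\<beta> * K2 * ln (real n)) \<le> (\<Sum>bs\<in>Sb. real (card (F bs)))"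
        by (rule sum_bounded_below) (use M cF in \<open>smt (verit) of_nat_add of_nat_le_iff\<close>)
      then have "K2 * (\<beta> * ln (real n) * card Sb) \<le> K2 * real (card S)" using up by (simp add: mult_ac)
      then show "\<beta> * ln (real n) * card {bs \<in> Ext n m t us. bs ! i = b} \<le> card (Ext n m t us)"
        using K2 by (simp add: Sb_def S_def)
    qed
  qed
qed

text \<open>Two extensions that share an element agree in one of \<open>m * m\<close> pairs of
  positions; \<open>swap\<close> is applied to each pair with a constant larger by this
  factor.\<close>

lemma conflicts:
  fixes \<beta> :: real
  assumes t: "good m t" and \<beta>: "\<beta> \<ge> 0"
  shows "\<forall>\<^sub>F n in sequentially. \<forall>us\<in>tuples (Dm n) K. \<forall>u\<in>Ext n m t us.
    \<beta> * ln (real n) * card {v \<in> Ext n m t us. set u \<inter> set v \<noteq> {}} \<le> card (Ext n m t us)"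
proof -
  define \<beta>' where "\<beta>' = \<beta> * (m * m)"
  have "\<forall>\<^sub>F n in sequentially. \<forall>i\<in>{..<m}. \<forall>us\<in>tuples (Dm n) K. \<forall>b.
    \<beta>' * ln (real n) * card {bs \<in> Ext n m t us. bs ! i = b} \<le> card (Ext n m t us)"
    using swap[OF t] by (intro eventually_ball_finite) auto
  then show ?thesis using eventually_ge_at_top[of 1]
  proof eventually_elim
    case (elim n)
    show ?case
    proof (intro ballI)
      fix us u assume us: "us \<in> tuples (Dm n) K" and u: "u \<in> Ext n m t us"
      let ?S = "Ext n m t us"
      have len: "length v = m" if "v \<in> ?S" for v using that by (auto simp: Ext_def tuples_def)
      have fin: "finite ?S" by (rule finite_Ext[OF elim(2)])
      have m: "m \<ge> 1" if "set u \<inter> set v \<noteq> {}" for v using that len[OF u] by (cases u) auto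
      have "{v \<in> ?S. set u \<inter> set v \<noteq> {}} \<subseteq> (\<Union>(i, j)\<in>{..<m} \<times> {..<m}. {v \<in> ?S. v ! i = u ! j})"
        using len len[OF u] by (fastforce simp: in_set_conv_nth)
      then have "card {v \<in> ?S. set u \<inter> set v \<noteq> {}} \<le> card (\<Union>(i, j)\<in>{..<m} \<times> {..<m}. {v \<in> ?S. v ! i = u ! j})"
        using fin by (intro card_mono) auto
      also have "\<dots> \<le> (\<Sum>(i, j)\<in>{..<m} \<times> {..<m}. card {v \<in> ?S. v ! i = u ! j})"
        using card_UN_le[of "{..<m} \<times> {..<m}" "\<lambda>(i, j). {v \<in> ?S. v ! i = u ! j}"] by (simp add: case_prod_unfold)
      finally have 1: "real (card {v \<in> ?S. set u \<inter> set v \<noteq> {}}) \<le> (\<Sum>(i, j)\<in>{..<m} \<times> {..<m}. real (card {v \<in> ?S. v ! i = u ! j}))"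
        by (metis (mono_tags, lifting) of_nat_le_iff of_nat_sum sum.cong split_beta)
      have "\<beta>' * ln (real n) * real (card {v \<in> ?S. set u \<inter> set v \<noteq> {}}) \<le>
          \<beta>' * ln (real n) * (\<Sum>(i, j)\<in>{..<m} \<times> {..<m}. real (card {v \<in> ?S. v ! i = u ! j}))"
        using 1 \<beta> elim(2) by (intro mult_left_mono) (auto simp: \<beta>'_def)
      also have "\<dots> = (\<Sum>(i, j)\<in>{..<m} \<times> {..<m}. \<beta>' * ln (real n) * real (card {v \<in> ?S. v ! i = u ! j}))"
        by (simp add: sum_distrib_left case_prod_unfold)
      also have "\<dots> \<le> (\<Sum>(i, j)\<in>{..<m} \<times> {..<m}. real (card ?S))"
        using elim(1) us by (intro sum_mono) auto
      also have "\<dots> = (m * m) * real (card ?S)" by (simp add: case_prod_unfold)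
      finally have 2: "real (m * m) * (\<beta> * ln (real n) * real (card {v \<in> ?S. set u \<inter> set v \<noteq> {}})) \<le> real (m * m) * real (card ?S)"
        by (simp add: \<beta>'_def mult_ac)
      show "\<beta> * ln (real n) * card {v \<in> ?S. set u \<inter> set v \<noteq> {}} \<le> card ?S"
      proof (cases "m = 0")
        case True
        then have "{v \<in> ?S. set u \<inter> set v \<noteq> {}} = {}" using m by auto
        then show ?thesis by (simp only: card.empty of_nat_0 mult_zero_right of_nat_0_le_iff)
      next
        case False
        then have "0 < real (m * m)" by simp
        from mult_le_cancel_left_pos[OF this] 2 show ?thesis by blast
      qed
    qed
  qed
qed

end

subsection \<open>Balanced and determined types\<close>

text \<open>Lets a choice of index tuples made for one tuple be reused for all tuples with the same
  equality pattern.\<close>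

lemma map_nth_pattern:
  assumes "fst (tp \<rho> A V) = fst (tp \<rho>' A' V')" "length V = length V'"
    "set is \<subseteq> {..<length V}" "set is' \<subseteq> {..<length V}"
  shows "map ((!) V) is = map ((!) V) is' \<longleftrightarrow> map ((!) V') is = map ((!) V') is'"
proof -
  have e: "V ! i = V ! j \<longleftrightarrow> V' ! i = V' ! j" if "i < length V" "j < length V" for i j
  proof -
    have "(i, j) \<in> fst (tp \<rho> A V) \<longleftrightarrow> (i, j) \<in> fst (tp \<rho>' A' V')" using assms(1) by simp
    then show ?thesis using that assms(2) by (simp add: in_tp_eq)
  qed
  have "map ((!) V) is = map ((!) V) is' \<longleftrightarrow>
      length is = length is' \<and> (\<forall>k<length is. V ! (is ! k) = V ! (is' ! k))"
    by (auto simp: list_eq_iff_nth_eq)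
  also have "\<dots> \<longleftrightarrow> length is = length is' \<and> (\<forall>k<length is. V' ! (is ! k) = V' ! (is' ! k))"
    using e assms(3,4) by (auto simp: subset_iff)
  also have "\<dots> \<longleftrightarrow> map ((!) V') is = map ((!) V') is'" by (auto simp: list_eq_iff_nth_eq)
  finally show ?thesis .
qed

lemma bw_alt: "finite T \<Longrightarrow> X \<subseteq> T \<Longrightarrow> bw \<theta> T X = (\<Prod>t\<in>T. if t \<in> X then \<theta> t else 1 - \<theta> t)"
  by (simp add: bw_def prod.If_cases Int_absorb1 Diff_eq)

lemma bw_reindex:
  assumes "finite P" "inj_on f P" "Y \<subseteq> f ` P"
  shows "bw \<theta> (f ` P) Y = (\<Prod>i\<in>P. if f i \<in> Y then \<theta> (f i) else 1 - \<theta> (f i))"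
  using assms by (simp add: bw_alt prod.reindex)

lemma tp_Un_reduct:
  assumes "\<And>S. S \<in> \<rho> \<Longrightarrow> rel A S = rel A' S"
  shows "tp \<rho> A us = tp \<rho> A' us"
  using assms by (auto simp: tp_def)

lemma tp_red: "tp \<rho> (red \<rho> A) us = tp \<rho> A us"
  by (intro tp_Un_reduct) simp

context base_seq
begin

text \<open>Statement (b) of the overview once the relations in \<open>L\<close> have been added:
  \<alpha> depends on lengths and codes but neither on n nor on the error. The error is measured
  against the number of extensions, so nothing is asserted where there are none.\<close>

definition balance :: "'r set \<Rightarrow> nat \<Rightarrow> 'r code \<Rightarrow> bool" where
  "balance L m t \<longleftrightarrow> (\<forall>K d e. \<exists>\<alpha>\<ge>0::real. \<forall>\<epsilon>>0::real. whp N L (\<lambda>n A. \<forall>us\<in>tuples (Dm n) K. Rr n \<subseteq> set us \<longrightarrow>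
     tp (\<tau> \<union> L) A us = d \<longrightarrow>
     \<bar>real (card {bs \<in> Ext n m t us. tp (\<tau> \<union> L) A (us @ bs) = e}) - \<alpha> * real (card (Ext n m t us))\<bar> \<le> \<epsilon> * real (card (Ext n m t us))))"

text \<open>Statement (a) of the overview. \<open>V\<close> lists the rare elements besides the
  values of the variables, and \<iota> says which entry a variable takes.\<close>

definition determined :: "'r set \<Rightarrow> 'r pla \<Rightarrow> bool" where
  "determined L \<phi> \<longleftrightarrow> (\<forall>K \<iota> e. (\<forall>v\<in>fv \<phi>. \<iota> v < K) \<longrightarrow> (\<exists>c\<in>{0..1}. \<forall>\<epsilon>>0. whp N L (\<lambda>n A.
     \<forall>V\<in>tuples (Dm n) K. Rr n \<subseteq> set V \<longrightarrow> tp (\<tau> \<union> L) A V = e \<longrightarrow> \<bar>eval A \<phi> (\<lambda>v. V ! \<iota> v) - c\<bar> \<le> \<epsilon>)))"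

text \<open>By gluing, the code over \<open>\<tau>\<close> of \<open>us @ bs\<close> is the same for
  all free extensions, so the proportion is exactly 0 or 1.\<close>

lemma balance_empty: "balance {} m t"
  unfolding balance_def
proof (intro allI)
  fix K d e
  let ?P = "\<exists>n us bs. bs \<in> Ext n m t us \<and> tp \<tau> (B n) us = d \<and> tp \<tau> (B n) (us @ bs) = e"
  let ?\<alpha> = "of_bool ?P :: real"
  have "{bs \<in> Ext n m t us. tp \<tau> (B n) (us @ bs) = e} = (if ?P then Ext n m t us else {})"
    if us: "tp \<tau> (B n) us = d" for n us
  proof (cases ?P)
    case True
    then obtain n1 us1 bs1 where 1: "bs1 \<in> Ext n1 m t us1" "tp \<tau> (B n1) us1 = d" "tp \<tau> (B n1) (us1 @ bs1) = e" by blast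
    have "tp \<tau> (B n) (us @ bs) = e" if "bs \<in> Ext n m t us" for bs
      unfolding 1(3)[symmetric] using that 1 us by (intro glue) (auto simp: Ext_def)
    then show ?thesis using True by auto
  next
    case False
    then have "{bs \<in> Ext n m t us. tp \<tau> (B n) (us @ bs) = e} = {}" using us by blast
    then show ?thesis by (simp only: False if_False)
  qed
  note set_eq = this
  have c: "real (card {bs \<in> Ext n m t us. tp \<tau> (B n) (us @ bs) = e}) = ?\<alpha> * real (card (Ext n m t us))"
    if "tp \<tau> (B n) us = d" for n us
    unfolding set_eq[OF that] by (simp only: card.empty of_nat_0 mult_zero_left mult_1_left of_bool_eq split: if_split) simp
  show "\<exists>\<alpha>\<ge>0::real. \<forall>\<epsilon>>0::real. whp N {} (\<lambda>n A. \<forall>us\<in>tuples (Dm n) K. Rr n \<subseteq> set us \<longrightarrow> tp (\<tau> \<union> {}) A us = d \<longrightarrow>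
     \<bar>real (card {bs \<in> Ext n m t us. tp (\<tau> \<union> {}) A (us @ bs) = e}) - \<alpha> * real (card (Ext n m t us))\<bar> \<le> \<epsilon> * real (card (Ext n m t us)))"
  proof (intro exI[of _ ?\<alpha>] conjI allI impI)
    fix \<epsilon> :: real assume \<epsilon>: "\<epsilon> > 0"
    show "whp N {} (\<lambda>n A. \<forall>us\<in>tuples (Dm n) K. Rr n \<subseteq> set us \<longrightarrow> tp (\<tau> \<union> {}) A us = d \<longrightarrow>
     \<bar>real (card {bs \<in> Ext n m t us. tp (\<tau> \<union> {}) A (us @ bs) = e}) - ?\<alpha> * real (card (Ext n m t us))\<bar> \<le> \<epsilon> * real (card (Ext n m t us)))"
    proof (rule whp_always[OF initial_empty])
      show "\<forall>\<^sub>F n in sequentially. \<forall>A\<in>worlds (subnet N {}) n. \<forall>us\<in>tuples (Dm n) K. Rr n \<subseteq> set us \<longrightarrow> tp (\<tau> \<union> {}) A us = d \<longrightarrow>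
        \<bar>real (card {bs \<in> Ext n m t us. tp (\<tau> \<union> {}) A (us @ bs) = e}) - ?\<alpha> * real (card (Ext n m t us))\<bar> \<le> \<epsilon> * real (card (Ext n m t us))"
        using eventually_ge_at_top[of 1]
      proof (eventually_elim, intro ballI impI)
        fix n A us assume n: "(1::nat) \<le> n" and A: "A \<in> worlds (subnet N {}) n" and d: "tp (\<tau> \<union> {}) A us = d"
        have "A = B n" using A worlds_empty[OF n] by simp
        then show "\<bar>real (card {bs \<in> Ext n m t us. tp (\<tau> \<union> {}) A (us @ bs) = e}) - ?\<alpha> * real (card (Ext n m t us))\<bar> \<le> \<epsilon> * real (card (Ext n m t us))"
          using c[of n us] d \<epsilon> by (simp del: of_bool_eq_iff)
      qed
    qed
  qed simp
qed

lemma th_eval: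
  assumes "R \<in> \<sigma> - \<tau>" "length is = ar R"
  shows "eval A (theta N R) (\<lambda>v. V ! (is ! v)) = th N A R (map ((!) V) is)"
  unfolding th_def
proof (rule eval_fv)
  fix v assume "v \<in> fv (theta N R)"
  then have v: "v < ar R" using theta_fv[OF assms(1)] by auto
  then show "V ! (is ! v) = asg [0..<ar R] (map ((!) V) is) v"
    using asg_nth[of "[0..<ar R]" "map ((!) V) is" v] assms(2) by simp
qed

text \<open>Given the relations of \<open>L\<close>, concentration holds for each \<open>us\<close>
  with failure probability a negative power of n, and the union bound covers the polynomially many
  \<open>us\<close>. \<open>U\<close> may depend on the relations of \<open>L\<close>, as these are
  fixed when \<open>R\<close> is drawn.\<close>

lemma concentration_whp:
  fixes \<delta> :: real
  assumes L: "initial N L" "initial N (insert R L)" "R \<notin> L" "par N R \<subseteq> L"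
    and t: "good m t" "m \<ge> 1" and \<delta>: "0 < \<delta>" "\<delta> \<le> 1"
    and U: "\<And>n A us. U n A us \<subseteq> Ext n m t us"
    and NT: "\<And>n us bs. us \<in> tuples (Dm n) K \<Longrightarrow> bs \<in> Ext n m t us \<Longrightarrow> NT us bs \<subseteq> tuples (Dm n) (ar R)"
    and Y: "\<And>us bs. Y us bs \<subseteq> NT us bs"
    and conf: "\<And>n us u v. us \<in> tuples (Dm n) K \<Longrightarrow> u \<in> Ext n m t us \<Longrightarrow> v \<in> Ext n m t us \<Longrightarrow>
      NT us u \<inter> NT us v \<noteq> {} \<Longrightarrow> set u \<inter> set v \<noteq> {}"
  shows "whp N (insert R L) (\<lambda>n A. \<forall>us\<in>tuples (Dm n) K.
    \<bar>\<Sum>bs\<in>U n (red (\<tau> \<union> L) A) us. of_bool (rel A R \<inter> NT us bs = Y us bs) - bw (th N (red (\<tau> \<union> L) A) R) (NT us bs) (Y us bs)\<bar>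
      \<le> 2 * \<delta> * card (Ext n m t us))"
proof -
  \<comment> \<open>\<open>a * m\<close> pays for the factor \<open>D\<close>, which is at most the
    number of extensions, \<open>a * K\<close> for the number of tuples \<open>us\<close>, and 1
    leaves the bound 2 / n. The constant \<beta> makes the exponent in \<open>concentration\<close>
    at least \<open>x * ln n\<close> in absolute value.\<close>
  define x where "x = a * (m + K) + 1"
  define \<beta> where "\<beta> = 4 * real x / \<delta> ^ 3"
  have \<beta>: "\<beta> \<ge> 0" using \<delta> by (simp add: \<beta>_def)
  have R: "R \<in> \<sigma> - \<tau>" "R \<notin> \<tau> \<union> L" using initialD(1)[OF L(2)] L(3) by auto
  define dev where "dev n A X us = \<bar>\<Sum>bs\<in>U n A us. of_bool (X \<inter> NT us bs = Y us bs) - bw (th N A R) (NT us bs) (Y us bs)\<bar>" for n A X us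
  have single: "bex (th N A R) (tuples (Dm n) (ar R)) (\<lambda>X. of_bool (dev n A X us > 2 * \<delta> * card (Ext n m t us)))
      \<le> 2 * (real n ^ (a * m) * (1 / real n ^ x))"
    if n: "n \<ge> 1" and sz: "card (Dm n) \<le> n ^ a" and A: "A \<in> worlds (subnet N L) n" and us: "us \<in> tuples (Dm n) K"
      and cf: "\<forall>us\<in>tuples (Dm n) K. \<forall>u\<in>Ext n m t us. \<beta> * ln (real n) * card {v \<in> Ext n m t us. set u \<inter> set v \<noteq> {}} \<le> card (Ext n m t us)"
    for n A us
  proof (cases "Ext n m t us = {}")
    case True
    then have "U n A us = {}" using U[of n A us] by auto
    then have "bex (th N A R) (tuples (Dm n) (ar R)) (\<lambda>X. of_bool (dev n A X us > 2 * \<delta> * card (Ext n m t us))) = 0"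
      using bex_const[OF finite_tuples[OF finite_Dm[OF n]], of "th N A R" "ar R" 0] by (simp add: dev_def True)
    then show ?thesis by simp
  next
    case False
    let ?S = "Ext n m t us" and ?T = "tuples (Dm n) (ar R)"
    define f where "f u = card {v \<in> ?S. set u \<inter> set v \<noteq> {}}" for u
    have finS: "finite ?S" by (rule finite_Ext[OF n])
    define D where "D = Max (f ` ?S)"
    have fD: "f u \<le> D" if "u \<in> ?S" for u unfolding D_def using finS that by (intro Max_ge) auto
    have "D \<in> f ` ?S" unfolding D_def using finS False by (intro Max_in) auto
    then obtain u0 where u0: "u0 \<in> ?S" "f u0 = D" by blast
    have self: "u \<in> {v \<in> ?S. set u \<inter> set v \<noteq> {}}" if "u \<in> ?S" for u
      using that t(2) by (cases u) (auto simp: Ext_def tuples_def)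
    have fpos: "f u \<ge> 1" if "u \<in> ?S" for u
    proof -
      have "finite {v \<in> ?S. set u \<inter> set v \<noteq> {}}" using finS by simp
      then show ?thesis using self[OF that] unfolding f_def by (metis One_nat_def Suc_leI card_gt_0_iff empty_iff)
    qed
    have D1: "D \<ge> 1" using fpos u0 by auto
    have M: "0 < real (card ?S)" using False finS by (simp add: card_gt_0_iff)
    have cS: "card ?S \<le> n ^ (a * m)"
    proof -
      have "card ?S \<le> card (tuples (Dm n) m)"
        using finite_tuples[OF finite_Dm[OF n]] by (intro card_mono) (auto simp: Ext_def)
      also have "\<dots> = card (Dm n) ^ m" by (simp add: card_tuples finite_Dm[OF n])
      also have "\<dots> \<le> (n ^ a) ^ m" using sz by (intro power_mono) auto
      finally show ?thesis by (simp add: power_mult)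
    qed
    have DS: "D \<le> card ?S" using u0 finS unfolding f_def by (metis (no_types, lifting) card_mono mem_Collect_eq subsetI)
    have \<theta>: "th N A R t \<in> {0..1}" for t using th_range[OF R(1)] world(1)[OF A] finite_Dm[OF n] by simp
    have "bex (th N A R) ?T (\<lambda>X. of_bool (dev n A X us > 2 * \<delta> * card ?S)) \<le> 2 * real D * exp (- (\<delta> ^ 3 * real (card ?S) / (4 * real D)))"
      unfolding dev_def
    proof (rule concentration)
      show "finite (U n A us)" using U finS by (rule finite_subset)
      show "finite ?T" using finite_tuples finite_Dm n by blast
      show "th N A R t \<in> {0..1}" for t by (rule \<theta>)
      show "NT us u \<subseteq> ?T" if "u \<in> U n A us" for u using NT[OF us] U that by blast
      show "Y us u \<subseteq> NT us u" for u by (rule Y)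
      show "card {v \<in> U n A us. v \<noteq> u \<and> NT us u \<inter> NT us v \<noteq> {}} < D" if u: "u \<in> U n A us" for u
      proof -
        have uS: "u \<in> ?S" using u U by blast
        \<comment> \<open>The extension \<open>u\<close> conflicts with itself and is counted in
          \<open>f u\<close>, hence the proper inclusion and the strict bound by
          \<open>D\<close>.\<close>
        have "{v \<in> U n A us. v \<noteq> u \<and> NT us u \<inter> NT us v \<noteq> {}} \<subset> {v \<in> ?S. set u \<inter> set v \<noteq> {}}"
          using conf[OF us uS] U[of n A us] self[OF uS] by blast
        then have "card {v \<in> U n A us. v \<noteq> u \<and> NT us u \<inter> NT us v \<noteq> {}} < f u"
          unfolding f_def using finS by (intro psubset_card_mono) auto
        then show ?thesis using fD[OF uS] by simp
      qed
      show "1 \<le> D" by (rule D1)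
      show "real (card (U n A us)) \<le> real (card ?S)" using card_mono[OF finS U] by simp
    qed (use \<delta> M in auto)
    also have "\<dots> \<le> 2 * (real n ^ (a * m) * (1 / real n ^ x))"
    proof -
      have "\<beta> * ln (real n) * D \<le> card ?S" using cf us u0 by (auto simp: f_def)
      then have "\<delta> ^ 3 * (\<beta> * ln (real n) * D) \<le> \<delta> ^ 3 * card ?S" using \<delta> by (intro mult_left_mono) auto
      moreover have "\<delta> ^ 3 * (\<beta> * ln (real n) * D) = 4 * D * (real x * ln (real n))" using \<delta> by (simp add: \<beta>_def)
      ultimately have "4 * real D * (real x * ln (real n)) \<le> \<delta> ^ 3 * real (card ?S)" by linarith
      then have "real x * ln (real n) \<le> \<delta> ^ 3 * real (card ?S) / (4 * real D)"
        using D1 by (simp add: pos_le_divide_eq mult.commute)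
      then have "exp (- (\<delta> ^ 3 * real (card ?S) / (4 * real D))) \<le> exp (- (real x * ln (real n)))" by simp
      also have "\<dots> = 1 / real n ^ x" using n by (simp add: exp_minus exp_of_nat_mult inverse_eq_divide)
      finally have e: "exp (- (\<delta> ^ 3 * real (card ?S) / (4 * real D))) \<le> 1 / real n ^ x" .
      have "real D \<le> real n ^ (a * m)" using DS cS by (metis (mono_tags) le_trans of_nat_le_iff of_nat_power)
      then have "real D * exp (- (\<delta> ^ 3 * real (card ?S) / (4 * real D))) \<le> real n ^ (a * m) * (1 / real n ^ x)"
        using e by (intro mult_mono) auto
      then show ?thesis by simp
    qed
    finally show ?thesis .
  qed
  show ?thesis unfolding whp_def
  proof (intro allI impI)
    fix \<epsilon> :: real assume \<epsilon>: "\<epsilon> > 0"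
    have "\<forall>\<^sub>F n in sequentially. 2 / \<epsilon> \<le> real n" using filterlim_real_sequentially by (simp add: filterlim_at_top)
    then show "\<forall>\<^sub>F n in sequentially. prob (subnet N (insert R L)) n (\<lambda>A. \<not> (\<forall>us\<in>tuples (Dm n) K.
      \<bar>\<Sum>bs\<in>U n (red (\<tau> \<union> L) A) us. of_bool (rel A R \<inter> NT us bs = Y us bs) - bw (th N (red (\<tau> \<union> L) A) R) (NT us bs) (Y us bs)\<bar>
      \<le> 2 * \<delta> * card (Ext n m t us))) \<le> \<epsilon>"
      using conflicts[OF t(1) \<beta>, of K] poly eventually_ge_at_top[of 1]
    proof eventually_elim
      case (elim n)
      let ?T = "tuples (Dm n) (ar R)"
      have rd: "red (\<tau> \<union> L) (ins A R X) = A" if "A \<in> worlds (subnet N L) n" for A X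
        using world(3)[OF that] R(2) by (intro struc_eqI) auto
      have finK: "finite (tuples (Dm n) K)" using finite_tuples finite_Dm elim by blast
      have "prob (subnet N (insert R L)) n (\<lambda>A. \<not> (\<forall>us\<in>tuples (Dm n) K. dev n (red (\<tau> \<union> L) A) (rel A R) us \<le> 2 * \<delta> * card (Ext n m t us)))
        = expect (subnet N L) n (\<lambda>A. bex (th N A R) ?T (\<lambda>X. of_bool (\<not> (\<forall>us\<in>tuples (Dm n) K. dev n A X us \<le> 2 * \<delta> * card (Ext n m t us)))))"
        unfolding prob_expect[OF L(2) elim(4)] expect_insert[OF L elim(4)]
        by (intro expect_cong) (simp add: rd)
      also have "\<dots> \<le> expect (subnet N L) n (\<lambda>A. 2 / real n)"
      proof (rule expect_mono[OF L(1) elim(4)])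
        fix A assume A: "A \<in> worlds (subnet N L) n"
        have \<theta>: "th N A R t \<in> {0..1}" for t using th_range[OF R(1)] world(1)[OF A] finite_Dm[OF elim(4)] by simp
        have "bex (th N A R) ?T (\<lambda>X. of_bool (\<not> (\<forall>us\<in>tuples (Dm n) K. dev n A X us \<le> 2 * \<delta> * card (Ext n m t us)))) \<le>
          bex (th N A R) ?T (\<lambda>X. \<Sum>us\<in>tuples (Dm n) K. of_bool (dev n A X us > 2 * \<delta> * card (Ext n m t us)))"
        proof (rule bex_mono)
          fix X
          show "of_bool (\<not> (\<forall>us\<in>tuples (Dm n) K. dev n A X us \<le> 2 * \<delta> * card (Ext n m t us))) \<le>
            (\<Sum>us\<in>tuples (Dm n) K. of_bool (dev n A X us > 2 * \<delta> * card (Ext n m t us)) :: real)"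
          proof (cases "\<forall>us\<in>tuples (Dm n) K. dev n A X us \<le> 2 * \<delta> * card (Ext n m t us)")
            case True
            then show ?thesis by (simp add: sum_nonneg)
          next
            case False
            then obtain us where us: "us \<in> tuples (Dm n) K" "dev n A X us > 2 * \<delta> * card (Ext n m t us)" by force
            have "of_bool (dev n A X us > 2 * \<delta> * card (Ext n m t us)) \<le>
              (\<Sum>us\<in>tuples (Dm n) K. of_bool (dev n A X us > 2 * \<delta> * card (Ext n m t us)) :: real)"
              using finK us(1) by (intro member_le_sum) auto
            then show ?thesis using us by simp
          qed
        qed (rule \<theta>)
        also have "\<dots> \<le> (\<Sum>us\<in>tuples (Dm n) K. 2 * (real n ^ (a * m) * (1 / real n ^ x)))"
          unfolding bex_sum using single[OF elim(4,3) A _ elim(2)] by (intro sum_mono) auto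
        also have "\<dots> = real (card (tuples (Dm n) K)) * (2 * (real n ^ (a * m) * (1 / real n ^ x)))" by simp
        also have "\<dots> \<le> real n ^ (a * K) * (2 * (real n ^ (a * m) * (1 / real n ^ x)))"
        proof (intro mult_right_mono)
          have "card (tuples (Dm n) K) \<le> (n ^ a) ^ K"
            using elim(3) by (simp add: card_tuples finite_Dm[OF elim(4)] power_mono)
          then show "real (card (tuples (Dm n) K)) \<le> real n ^ (a * K)"
            by (metis of_nat_le_iff of_nat_power power_mult)
        qed simp
        also have "\<dots> = 2 / real n"
          using elim(4) by (simp add: x_def power_add[symmetric] distrib_left) (simp add: power_add field_simps)
        finally show "bex (th N A R) ?T (\<lambda>X. of_bool (\<not> (\<forall>us\<in>tuples (Dm n) K. dev n A X us \<le> 2 * \<delta> * card (Ext n m t us)))) \<le> 2 / real n" .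
      qed
      also have "\<dots> = 2 / real n" by (rule expect_one[OF L(1) elim(4)])
      also have "\<dots> \<le> \<epsilon>" using elim(1,4) \<epsilon> by (simp add: field_simps)
      finally show ?case by (simp add: dev_def)
    qed
  qed
qed

end

subsection \<open>Adding one relation\<close>

context base_seq
begin

text \<open>Splits the new code into the old code and the pattern of \<open>R\<close> on the index
  tuples in \<open>Pos\<close>; the pattern elsewhere is settled by assumption. Several index tuples
  may name the same tuple, so the equality pattern of \<open>e\<close> is what makes patterns
  comparable as sets of tuples.\<close>

lemma tp_insert_iff:
  assumes e: "e = tp (\<tau> \<union> insert R L) A1 V1" and lV: "length V = length V1"
    and ar1: "rel A1 R \<subseteq> tuples X1 (ar R)" "rel A R \<subseteq> tuples X (ar R)"
    and Pos: "Pos \<subseteq> {is. set is \<subseteq> {..<length V1} \<and> length is = ar R}"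
    and rest: "\<And>is. set is \<subseteq> {..<length V1} \<Longrightarrow> length is = ar R \<Longrightarrow> is \<notin> Pos \<Longrightarrow>
      map ((!) V) is \<in> rel A R \<longleftrightarrow> (R, is) \<in> snd e"
    and R: "R \<notin> \<tau> \<union> L"
  shows "tp (\<tau> \<union> insert R L) A V = e \<longleftrightarrow> tp (\<tau> \<union> L) A V = restr (\<tau> \<union> L) e \<and>
    rel A R \<inter> (\<lambda>is. map ((!) V) is) ` Pos = (\<lambda>is. map ((!) V) is) ` {is \<in> Pos. (R, is) \<in> snd e}"
    (is "?l \<longleftrightarrow> ?r")
proof
  assume l: ?l
  have "tp (\<tau> \<union> L) A V = restr (\<tau> \<union> L) e"
    unfolding l[symmetric] by (intro restr_tp[symmetric]) auto
  moreover have "map ((!) V) is \<in> rel A R \<longleftrightarrow> (R, is) \<in> snd e" if "is \<in> Pos" for "is"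
    using that lV Pos unfolding l[symmetric] by (auto simp: in_tp_rel)
  ultimately show ?r by blast
next
  let ?\<rho> = "\<tau> \<union> insert R L"
  assume r: ?r
  have fe: "fst (tp ?\<rho> A V) = fst e" using r by (auto simp: tp_def restr_def)
  have pat: "map ((!) V) is = map ((!) V) is' \<longleftrightarrow> map ((!) V1) is = map ((!) V1) is'"
    if "is \<in> Pos" "is' \<in> Pos" for "is" is'
    using map_nth_pattern[OF fe[unfolded e] lV, of "is" is'] that lV Pos by auto
  have "(S, is) \<in> snd (tp ?\<rho> A V) \<longleftrightarrow> (S, is) \<in> snd e" for S "is"
  proof (cases "S \<in> \<tau> \<union> L")
    case True
    have "(S, is) \<in> snd (tp ?\<rho> A V) \<longleftrightarrow> (S, is) \<in> snd (tp (\<tau> \<union> L) A V)" using True by (auto simp: in_tp_rel)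
    also have "\<dots> \<longleftrightarrow> (S, is) \<in> snd e" using True r by (auto simp: restr_def)
    finally show ?thesis .
  next
    case nS: False
    show ?thesis
    proof (cases "S = R \<and> set is \<subseteq> {..<length V1} \<and> length is = ar R")
      case False
      then have "(S, is) \<notin> snd e" using nS ar1(1) unfolding e in_tp_rel tuples_def by fastforce
      moreover have "(S, is) \<notin> snd (tp ?\<rho> A V)" using False nS ar1(2) lV unfolding in_tp_rel tuples_def by fastforce
      ultimately show ?thesis by blast
    next
      case True
      then have S: "S = R" and i: "set is \<subseteq> {..<length V1}" "length is = ar R" by auto
      have a: "(S, is) \<in> snd (tp ?\<rho> A V) \<longleftrightarrow> map ((!) V) is \<in> rel A R"
        using S i(1) lV by (simp add: in_tp_rel)
      show ?thesis
      proof (cases "is \<in> Pos")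
        case False
        then show ?thesis using rest[OF i False] a S by simp
      next
        case P: True
        have "map ((!) V) is \<in> rel A R \<longleftrightarrow> map ((!) V) is \<in> rel A R \<inter> (\<lambda>is. map ((!) V) is) ` Pos"
          using P by blast
        also have "\<dots> \<longleftrightarrow> (\<exists>is'\<in>Pos. (R, is') \<in> snd e \<and> map ((!) V) is = map ((!) V) is')"
          using r by (auto simp: image_iff)
        also have "\<dots> \<longleftrightarrow> (\<exists>is'\<in>Pos. (R, is') \<in> snd e \<and> map ((!) V1) is = map ((!) V1) is')" using pat[OF P] by blast
        also have "\<dots> \<longleftrightarrow> (R, is) \<in> snd e"
        proof
          assume "\<exists>is'\<in>Pos. (R, is') \<in> snd e \<and> map ((!) V1) is = map ((!) V1) is'"
          then obtain is' where "is' \<in> Pos" "(R, is') \<in> snd e" "map ((!) V1) is = map ((!) V1) is'" by blast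
          then show "(R, is) \<in> snd e" using i unfolding e in_tp_rel by (simp del: map_eq_conv)
        qed (use P in blast)
        finally show ?thesis using a S by simp
      qed
    qed
  qed
  then show ?l using fe by (intro prod_eqI) auto
qed

lemma prod_diff_le:
  fixes f g :: "'x \<Rightarrow> real" and \<delta> :: real
  assumes "\<And>i. i \<in> I \<Longrightarrow> f i \<in> {0..1}" "\<And>i. i \<in> I \<Longrightarrow> g i \<in> {0..1}" "\<And>i. i \<in> I \<Longrightarrow> \<bar>f i - g i\<bar> \<le> \<delta>"
  shows "\<bar>prod f I - prod g I\<bar> \<le> card I * \<delta>"
proof -
  have "norm (prod f I - prod g I) \<le> (\<Sum>i\<in>I. norm (f i - g i))"
    using assms(1,2) by (intro norm_prod_diff) auto
  also have "\<dots> \<le> card I * \<delta>" using assms(3) sum_bounded_above[of I "\<lambda>i. norm (f i - g i)" \<delta>] by simp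
  finally show ?thesis by simp
qed

text \<open>The probability that the new relation has the prescribed pattern on a given list of index
  tuples is a product of values of \<open>\<theta>\<^sub>R\<close>, hence close to a constant \<open>\<pi>\<close>.\<close>

lemma pattern_weight:
  assumes L: "initial N L" "R \<in> \<sigma> - \<tau>" and det: "determined L (theta N R)"
    and V1: "length V1 = K" and Pos: "Pos \<subseteq> {is. set is \<subseteq> {..<K} \<and> length is = ar R}"
    and E: "E \<subseteq> Pos" "\<And>is is'. is \<in> E \<Longrightarrow> is' \<in> Pos \<Longrightarrow> map ((!) V1) is = map ((!) V1) is' \<Longrightarrow> is' \<in> E"
    and e: "fst (tp \<rho> A1 V1) = fst e"
  obtains \<pi> where "\<pi> \<in> {0..1}" "\<And>\<epsilon>. \<epsilon> > 0 \<Longrightarrow> whp N L (\<lambda>n A. \<forall>V\<in>tuples (Dm n) K. Rr n \<subseteq> set V \<longrightarrow> tp (\<tau> \<union> L) A V = e \<longrightarrow>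
    \<bar>bw (th N A R) ((\<lambda>is. map ((!) V) is) ` Pos) ((\<lambda>is. map ((!) V) is) ` E) - \<pi>\<bar> \<le> \<epsilon>)"
proof -
  let ?f1 = "\<lambda>is. map ((!) V1) is"
  have finP: "finite Pos" by (rule finite_subset[OF Pos], rule finite_subset[OF _ finite_lists_length_eq[of "{..<K}" "ar R"]]) auto
  \<comment> \<open>One index tuple for each named tuple, so that no factor of the product is
    counted twice; the choice is made in \<open>V1\<close> and is valid for every \<open>V\<close>
    with the same equality pattern.\<close>
  obtain Rep where Rep: "Rep \<subseteq> Pos" "inj_on ?f1 Rep" "?f1 ` Rep = ?f1 ` Pos"
    using subset_image_inj[of "?f1 ` Pos" ?f1 Pos] by auto
  have finR: "finite Rep" using Rep(1) finP by (rule finite_subset)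
  define Q where "Q is c \<epsilon> = whp N L (\<lambda>n A. \<forall>V\<in>tuples (Dm n) K. Rr n \<subseteq> set V \<longrightarrow> tp (\<tau> \<union> L) A V = e \<longrightarrow>
     \<bar>eval A (theta N R) (\<lambda>v. V ! (is ! v)) - c\<bar> \<le> \<epsilon>)" for "is" and c \<epsilon> :: real
  have "\<forall>is\<in>Pos. \<exists>c\<in>{0..1}. \<forall>\<epsilon>>0. Q is c \<epsilon>"
  proof
    fix "is" assume "is \<in> Pos"
    then have i: "set is \<subseteq> {..<K}" "length is = ar R" using Pos by auto
    have "is ! v < K" if "v \<in> fv (theta N R)" for v
    proof -
      have "v < length is" using theta_fv[OF L(2)] that i(2) by auto
      then show ?thesis using subsetD[OF i(1) nth_mem] by simp
    qed
    then show "\<exists>c\<in>{0..1}. \<forall>\<epsilon>>0. Q is c \<epsilon>" unfolding Q_def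
      using det[unfolded determined_def, rule_format, of "\<lambda>v. is ! v" K e] by blast
  qed
  then obtain c where c: "\<And>is. is \<in> Pos \<Longrightarrow> c is \<in> {0..1::real}"
    "\<And>is \<epsilon>. is \<in> Pos \<Longrightarrow> \<epsilon> > 0 \<Longrightarrow> Q is (c is) \<epsilon>" by metis
  define pc where "pc is = (if is \<in> E then c is else 1 - c is)" for "is"
  define \<pi> where "\<pi> = (\<Prod>is\<in>Rep. pc is)"
  have pc01: "pc is \<in> {0..1}" if "is \<in> Rep" for "is" using c(1)[of "is"] Rep(1) that by (auto simp: pc_def)
  have \<pi>01: "\<pi> \<in> {0..1}" unfolding \<pi>_def using pc01 by (auto intro!: prod_nonneg prod_le_1)
  show ?thesis
  proof (rule that[OF \<pi>01])
    fix \<epsilon> :: real assume \<epsilon>: "\<epsilon> > 0"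
    define \<delta> where "\<delta> = \<epsilon> / (card Rep + 1)"
    have \<delta>: "\<delta> > 0" "card Rep * \<delta> \<le> \<epsilon>" using \<epsilon> by (auto simp: \<delta>_def field_simps)
    have "whp N L (\<lambda>n A. \<forall>is\<in>Rep. \<forall>V\<in>tuples (Dm n) K. Rr n \<subseteq> set V \<longrightarrow> tp (\<tau> \<union> L) A V = e \<longrightarrow>
     \<bar>eval A (theta N R) (\<lambda>v. V ! (is ! v)) - c is\<bar> \<le> \<delta>)"
      using c(2)[unfolded Q_def] \<delta>(1) Rep(1) by (intro whp_ball[OF L(1) finR]) blast
    then show "whp N L (\<lambda>n A. \<forall>V\<in>tuples (Dm n) K. Rr n \<subseteq> set V \<longrightarrow> tp (\<tau> \<union> L) A V = e \<longrightarrow>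
      \<bar>bw (th N A R) ((\<lambda>is. map ((!) V) is) ` Pos) ((\<lambda>is. map ((!) V) is) ` E) - \<pi>\<bar> \<le> \<epsilon>)"
    proof (rule whp_mono[OF L(1)])
      show "\<forall>\<^sub>F n in sequentially. \<forall>A\<in>worlds (subnet N L) n.
        (\<forall>is\<in>Rep. \<forall>V\<in>tuples (Dm n) K. Rr n \<subseteq> set V \<longrightarrow> tp (\<tau> \<union> L) A V = e \<longrightarrow>
          \<bar>eval A (theta N R) (\<lambda>v. V ! (is ! v)) - c is\<bar> \<le> \<delta>) \<longrightarrow>
        (\<forall>V\<in>tuples (Dm n) K. Rr n \<subseteq> set V \<longrightarrow> tp (\<tau> \<union> L) A V = e \<longrightarrow>
          \<bar>bw (th N A R) ((\<lambda>is. map ((!) V) is) ` Pos) ((\<lambda>is. map ((!) V) is) ` E) - \<pi>\<bar> \<le> \<epsilon>)"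
        using eventually_ge_at_top[of 1]
      proof (eventually_elim, intro ballI impI)
        fix n A V assume n: "(1::nat) \<le> n" and A: "A \<in> worlds (subnet N L) n"
          and H: "\<forall>is\<in>Rep. \<forall>V\<in>tuples (Dm n) K. Rr n \<subseteq> set V \<longrightarrow> tp (\<tau> \<union> L) A V = e \<longrightarrow>
          \<bar>eval A (theta N R) (\<lambda>v. V ! (is ! v)) - c is\<bar> \<le> \<delta>"
          and V: "V \<in> tuples (Dm n) K" "Rr n \<subseteq> set V" "tp (\<tau> \<union> L) A V = e"
        let ?f = "\<lambda>is. map ((!) V) is"
        have lV: "length V = length V1" using V V1 by (simp add: tuples_def)
        have pat: "?f is = ?f is' \<longleftrightarrow> ?f1 is = ?f1 is'" if "is \<in> Pos" "is' \<in> Pos" for "is" is'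
          using map_nth_pattern[of "\<tau> \<union> L" A V \<rho> A1 V1 "is" is'] lV V1 V(3) e that Pos by auto
        have inj: "inj_on ?f Rep" using Rep(1,2) pat unfolding inj_on_def by blast
        have img: "?f ` Pos = ?f ` Rep"
        proof
          show "?f ` Pos \<subseteq> ?f ` Rep"
          proof clarify
            fix "is" assume i: "is \<in> Pos"
            then obtain is' where i': "is' \<in> Rep" "?f1 is = ?f1 is'" using Rep(3) by (metis (no_types, lifting) image_iff)
            then have "?f is = ?f is'" using pat[OF i] Rep(1) by blast
            then show "?f is \<in> ?f ` Rep" using i'(1) by blast
          qed
        qed (use Rep(1) in blast)
        have inE: "?f is \<in> ?f ` E \<longleftrightarrow> is \<in> E" if "is \<in> Pos" for "is"
        proof
          assume "?f is \<in> ?f ` E"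
          then obtain is' where i': "is' \<in> E" "?f is' = ?f is" by (metis (no_types, lifting) image_iff)
          then show "is \<in> E" using E that pat[of is' "is"] by blast
        qed blast
        have "bw (th N A R) (?f ` Pos) (?f ` E) = bw (th N A R) (?f ` Rep) (?f ` E)" by (simp only: img)
        also have "\<dots> = (\<Prod>is\<in>Rep. if ?f is \<in> ?f ` E then th N A R (?f is) else 1 - th N A R (?f is))"
          by (rule bw_reindex[OF finR inj]) (use E(1) img in blast)
        also have "\<dots> = (\<Prod>is\<in>Rep. if is \<in> E then th N A R (?f is) else 1 - th N A R (?f is))"
          by (intro prod.cong refl) (use inE Rep(1) in \<open>simp only: subset_iff\<close>)
        finally have b: "bw (th N A R) (?f ` Pos) (?f ` E) = \<dots>" .
        have th01: "th N A R t \<in> {0..1}" for t using th_range[OF L(2)] world(1)[OF A] finite_Dm[OF n] by simp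
        have d: "\<bar>th N A R (?f is) - c is\<bar> \<le> \<delta>" if r: "is \<in> Rep" for "is"
        proof -
          have "length is = ar R" using r Rep(1) Pos by auto
          from th_eval[OF L(2) this, of A V] show ?thesis using H r V by fastforce
        qed
        have "\<bar>bw (th N A R) (?f ` Pos) (?f ` E) - \<pi>\<bar> \<le> card Rep * \<delta>"
          unfolding b \<pi>_def
        proof (rule prod_diff_le)
          fix "is" assume r: "is \<in> Rep"
          show "pc is \<in> {0..1}" by (rule pc01[OF r])
          show "(if is \<in> E then th N A R (?f is) else 1 - th N A R (?f is)) \<in> {0..1}" using th01[of "?f is"] by simp
          show "\<bar>(if is \<in> E then th N A R (?f is) else 1 - th N A R (?f is)) - pc is\<bar> \<le> \<delta>"
            using d[OF r] by (auto simp: pc_def)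
        qed
        then show "\<bar>bw (th N A R) (?f ` Pos) (?f ` E) - \<pi>\<bar> \<le> \<epsilon>" using \<delta>(2) by linarith
      qed
    qed
  qed
qed

text \<open>The new limit is \<open>\<alpha> * \<pi>\<close>: the proportion of extensions with the
  right old code times the probability that \<open>R\<close> then has the prescribed pattern.
  Concentration shows that the actual number is close to its conditional expectation.\<close>

lemma balance_insert:
  assumes L: "initial N L" "initial N (insert R L)" "R \<notin> L" "par N R \<subseteq> L"
    and t: "good m t" "m \<ge> 1" and bal: "balance L m t" and det: "determined L (theta N R)"
  shows "balance (insert R L) m t"
  unfolding balance_def
proof (intro allI)
  fix K d e
  let ?\<rho> = "\<tau> \<union> L" and ?\<rho>' = "\<tau> \<union> insert R L"
  have R: "R \<in> \<sigma> - \<tau>" "R \<notin> ?\<rho>" using initialD(1)[OF L(2)] L(3) by auto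
  show "\<exists>\<alpha>\<ge>0::real. \<forall>\<epsilon>>0::real. whp N (insert R L) (\<lambda>n A. \<forall>us\<in>tuples (Dm n) K. Rr n \<subseteq> set us \<longrightarrow> tp ?\<rho>' A us = d \<longrightarrow>
     \<bar>real (card {bs \<in> Ext n m t us. tp ?\<rho>' A (us @ bs) = e}) - \<alpha> * real (card (Ext n m t us))\<bar> \<le> \<epsilon> * real (card (Ext n m t us)))"
  proof (cases "\<exists>n A us bs. A \<in> worlds (subnet N (insert R L)) n \<and> us \<in> tuples (Dm n) K \<and>
      bs \<in> Ext n m t us \<and> tp ?\<rho>' A us = d \<and> tp ?\<rho>' A (us @ bs) = e")
    case False
    show ?thesis
    proof (intro exI[of _ 0] conjI allI impI)
      fix \<epsilon> :: real assume \<epsilon>: "\<epsilon> > 0"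
      show "whp N (insert R L) (\<lambda>n A. \<forall>us\<in>tuples (Dm n) K. Rr n \<subseteq> set us \<longrightarrow> tp ?\<rho>' A us = d \<longrightarrow>
     \<bar>real (card {bs \<in> Ext n m t us. tp ?\<rho>' A (us @ bs) = e}) - 0 * real (card (Ext n m t us))\<bar> \<le> \<epsilon> * real (card (Ext n m t us)))"
      proof (intro whp_always[OF L(2)] always_eventually allI ballI impI)
        fix n A us assume "A \<in> worlds (subnet N (insert R L)) n" "us \<in> tuples (Dm n) K" "tp ?\<rho>' A us = d"
        then have "{bs \<in> Ext n m t us. tp ?\<rho>' A (us @ bs) = e} = {}" using False by blast
        then have "card {bs \<in> Ext n m t us. tp ?\<rho>' A (us @ bs) = e} = 0" by (simp only: card.empty)
        then show "\<bar>real (card {bs \<in> Ext n m t us. tp ?\<rho>' A (us @ bs) = e}) - 0 * real (card (Ext n m t us))\<bar> \<le> \<epsilon> * real (card (Ext n m t us))"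
          using \<epsilon> by (simp only: of_nat_0) simp
      qed
    qed simp
  next
    case True
    then obtain n1 A1 us1 bs1 where I: "A1 \<in> worlds (subnet N (insert R L)) n1" "us1 \<in> tuples (Dm n1) K"
      "bs1 \<in> Ext n1 m t us1" "tp ?\<rho>' A1 us1 = d" "tp ?\<rho>' A1 (us1 @ bs1) = e" by blast
    have len1: "length us1 = K" "length bs1 = m" using I by (auto simp: tuples_def Ext_def)
    \<comment> \<open>Index tuples inside the parameters are omitted: their pattern is prescribed by
      \<open>d\<close>. Each remaining one meets \<open>bs\<close>, which confines conflicts to
      extensions that share an element.\<close>
    define Pos where "Pos = {is. set is \<subseteq> {..<length (us1 @ bs1)} \<and> length is = ar R \<and> \<not> set is \<subseteq> {..<length us1}}"
    define E where "E = {is \<in> Pos. (R, is) \<in> snd e}"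
    define NT where "NT us bs = (\<lambda>is. map ((!) (us @ bs)) is) ` Pos" for us bs :: "'a list"
    define Y where "Y us bs = (\<lambda>is. map ((!) (us @ bs)) is) ` E" for us bs :: "'a list"
    have PosK: "Pos \<subseteq> {is. set is \<subseteq> {..<K + m} \<and> length is = ar R}" using len1 by (auto simp: Pos_def)
    have Ecl: "is' \<in> E" if "is \<in> E" "is' \<in> Pos" "map ((!) (us1 @ bs1)) is = map ((!) (us1 @ bs1)) is'" for "is" is'
      using that unfolding E_def I(5)[symmetric] Pos_def by (simp add: in_tp_rel del: map_eq_conv)
    have fe: "fst (tp ?\<rho>' A1 (us1 @ bs1)) = fst (restr ?\<rho> e)" unfolding I(5) by (simp add: restr_def)
    obtain \<pi> where \<pi>: "\<pi> \<in> {0..1}" "\<And>\<epsilon>. \<epsilon> > 0 \<Longrightarrow> whp N L (\<lambda>n A. \<forall>V\<in>tuples (Dm n) (K + m). Rr n \<subseteq> set V \<longrightarrow>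
      tp ?\<rho> A V = restr ?\<rho> e \<longrightarrow> \<bar>bw (th N A R) ((\<lambda>is. map ((!) V) is) ` Pos) ((\<lambda>is. map ((!) V) is) ` E) - \<pi>\<bar> \<le> \<epsilon>)"
    proof (rule pattern_weight[OF L(1) R(1) det _ PosK _ _ fe])
      show "length (us1 @ bs1) = K + m" using len1 by simp
      show "E \<subseteq> Pos" by (auto simp: E_def)
    qed (use Ecl in blast)+
    obtain \<alpha> where \<alpha>: "\<alpha> \<ge> 0" "\<And>\<epsilon>. \<epsilon> > 0 \<Longrightarrow> whp N L (\<lambda>n A. \<forall>us\<in>tuples (Dm n) K. Rr n \<subseteq> set us \<longrightarrow>
      tp ?\<rho> A us = restr ?\<rho> d \<longrightarrow>
      \<bar>real (card {bs \<in> Ext n m t us. tp ?\<rho> A (us @ bs) = restr ?\<rho> e}) - \<alpha> * real (card (Ext n m t us))\<bar> \<le> \<epsilon> * real (card (Ext n m t us)))"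
      using bal[unfolded balance_def, rule_format, of K "restr ?\<rho> d" "restr ?\<rho> e"] by blast
    define U where "U n A us = {bs \<in> Ext n m t us. tp ?\<rho> A (us @ bs) = restr ?\<rho> e}" for n A us
    have touch: "\<exists>x\<in>set s. x \<in> set bs" "set s \<subseteq> set us \<union> set bs"
      if H: "s \<in> NT us bs" "us \<in> tuples (Dm n) K" "bs \<in> Ext n m t us" for s n us bs
    proof -
      obtain "is" where i: "is \<in> Pos" "s = map ((!) (us @ bs)) is" using H(1) by (auto simp: NT_def)
      have l: "length us = K" "length bs = m" using H by (auto simp: tuples_def Ext_def)
      have "x < length (us @ bs)" if "x \<in> set is" for x using that i(1) l len1 by (auto simp: Pos_def)
      then have "set s \<subseteq> set (us @ bs)" unfolding i(2) set_map by (intro image_subsetI nth_mem)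
      then show "set s \<subseteq> set us \<union> set bs" by simp
      obtain k where k: "k \<in> set is" "\<not> k < K" using i(1) len1 by (auto simp: Pos_def)
      then have "k < K + m" using i(1) len1 by (auto simp: Pos_def)
      then have "(us @ bs) ! k \<in> set bs" using k l by (simp add: nth_append)
      then show "\<exists>x\<in>set s. x \<in> set bs" using k i(2) by auto
    qed
    show ?thesis
    proof (intro exI[of _ "\<alpha> * \<pi>"] conjI allI impI)
      show "0 \<le> \<alpha> * \<pi>" using \<alpha>(1) \<pi>(1) by simp
      fix \<epsilon> :: real assume \<epsilon>: "\<epsilon> > 0"
      \<comment> \<open>The total error is \<open>2 * \<delta>\<close> from concentration, \<delta>
        from the pattern probabilities and \<delta> from the old proportion.\<close>
      define \<delta> where "\<delta> = min 1 (\<epsilon> / 4)"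
      have \<delta>: "\<delta> > 0" "\<delta> \<le> 1" "4 * \<delta> \<le> \<epsilon>" using \<epsilon> by (auto simp: \<delta>_def)
      have W3: "whp N (insert R L) (\<lambda>n A. \<forall>us\<in>tuples (Dm n) K.
        \<bar>\<Sum>bs\<in>U n (red ?\<rho> A) us. of_bool (rel A R \<inter> NT us bs = Y us bs) - bw (th N (red ?\<rho> A) R) (NT us bs) (Y us bs)\<bar>
          \<le> 2 * \<delta> * card (Ext n m t us))"
      proof (rule concentration_whp[OF L t \<delta>(1,2)])
        show "U n A us \<subseteq> Ext n m t us" for n A us by (auto simp: U_def)
        show "Y us bs \<subseteq> NT us bs" for us bs by (auto simp: Y_def NT_def E_def)
        show "NT us bs \<subseteq> tuples (Dm n) (ar R)" if "us \<in> tuples (Dm n) K" "bs \<in> Ext n m t us" for n us bs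
        proof
          fix s assume s: "s \<in> NT us bs"
          then have "length s = ar R" by (auto simp: NT_def Pos_def)
          then show "s \<in> tuples (Dm n) (ar R)" using touch(2)[OF s that] that by (auto simp: tuples_def Ext_def)
        qed
        show "set u \<inter> set v \<noteq> {}" if us: "us \<in> tuples (Dm n) K" and u: "u \<in> Ext n m t us" and v: "v \<in> Ext n m t us"
          and ne: "NT us u \<inter> NT us v \<noteq> {}" for n us u v
        proof -
          obtain s where s: "s \<in> NT us u" "s \<in> NT us v" using ne by blast
          obtain x where x: "x \<in> set s" "x \<in> set u" using touch(1)[OF s(1) us u] by blast
          moreover have "x \<in> set us \<union> set v" using touch(2)[OF s(2) us v] x(1) by blast
          moreover have "set us \<inter> set u = {}" using u by (simp add: Ext_def wfree_def)
          ultimately show ?thesis by blast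
        qed
      qed
      have W12: "whp N L (\<lambda>n A. (\<forall>V\<in>tuples (Dm n) (K + m). Rr n \<subseteq> set V \<longrightarrow> tp ?\<rho> A V = restr ?\<rho> e \<longrightarrow>
          \<bar>bw (th N A R) ((\<lambda>is. map ((!) V) is) ` Pos) ((\<lambda>is. map ((!) V) is) ` E) - \<pi>\<bar> \<le> \<delta>) \<and>
        (\<forall>us\<in>tuples (Dm n) K. Rr n \<subseteq> set us \<longrightarrow> tp ?\<rho> A us = restr ?\<rho> d \<longrightarrow>
          \<bar>real (card (U n A us)) - \<alpha> * real (card (Ext n m t us))\<bar> \<le> \<delta> * real (card (Ext n m t us))))"
        unfolding U_def using \<pi>(2)[OF \<delta>(1)] \<alpha>(2)[OF \<delta>(1)] by (rule whp_conj[OF L(1)])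
      show "whp N (insert R L) (\<lambda>n A. \<forall>us\<in>tuples (Dm n) K. Rr n \<subseteq> set us \<longrightarrow> tp ?\<rho>' A us = d \<longrightarrow>
        \<bar>real (card {bs \<in> Ext n m t us. tp ?\<rho>' A (us @ bs) = e}) - \<alpha> * \<pi> * real (card (Ext n m t us))\<bar> \<le> \<epsilon> * real (card (Ext n m t us)))"
      proof (rule whp_mono[OF L(2) whp_conj[OF L(2) whp_red[OF L(2,1) subset_insertI W12] W3]], goal_cases)
        case 1
        show ?case
          using eventually_ge_at_top[of 1]
        proof (eventually_elim, intro ballI impI, elim conjE)
          fix n A us assume n: "(1::nat) \<le> n" and A: "A \<in> worlds (subnet N (insert R L)) n"
            and us: "us \<in> tuples (Dm n) K" "Rr n \<subseteq> set us" "tp ?\<rho>' A us = d"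
            and E1: "\<forall>V\<in>tuples (Dm n) (K + m). Rr n \<subseteq> set V \<longrightarrow> tp ?\<rho> (red ?\<rho> A) V = restr ?\<rho> e \<longrightarrow>
              \<bar>bw (th N (red ?\<rho> A) R) ((\<lambda>is. map ((!) V) is) ` Pos) ((\<lambda>is. map ((!) V) is) ` E) - \<pi>\<bar> \<le> \<delta>"
            and E2: "\<forall>us\<in>tuples (Dm n) K. Rr n \<subseteq> set us \<longrightarrow> tp ?\<rho> (red ?\<rho> A) us = restr ?\<rho> d \<longrightarrow>
              \<bar>real (card (U n (red ?\<rho> A) us)) - \<alpha> * real (card (Ext n m t us))\<bar> \<le> \<delta> * real (card (Ext n m t us))"
            and E3: "\<forall>us\<in>tuples (Dm n) K.
              \<bar>\<Sum>bs\<in>U n (red ?\<rho> A) us. of_bool (rel A R \<inter> NT us bs = Y us bs) - bw (th N (red ?\<rho> A) R) (NT us bs) (Y us bs)\<bar>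
              \<le> 2 * \<delta> * card (Ext n m t us)"
          let ?S = "Ext n m t us" and ?U = "U n (red ?\<rho> A) us"
          have finS: "finite ?S" by (rule finite_Ext[OF n])
          have finU: "finite ?U" "card ?U \<le> card ?S" using finS by (auto simp: U_def intro: card_mono)
          have lus: "length us = length us1" using us len1 by (simp add: tuples_def)
          have set_eq: "{bs \<in> ?S. tp ?\<rho>' A (us @ bs) = e} = {bs \<in> ?U. rel A R \<inter> NT us bs = Y us bs}"
          proof -
            have "tp ?\<rho>' A (us @ bs) = e \<longleftrightarrow> tp ?\<rho> A (us @ bs) = restr ?\<rho> e \<and> rel A R \<inter> NT us bs = Y us bs" if "bs \<in> ?S" for bs
              unfolding NT_def Y_def E_def
            proof (rule tp_insert_iff[OF I(5)[symmetric] _ world(4)[OF I(1)] world(4)[OF A] _ _ R(2)])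
              show "length (us @ bs) = length (us1 @ bs1)" using that lus len1 by (auto simp: Ext_def tuples_def)
              show "Pos \<subseteq> {is. set is \<subseteq> {..<length (us1 @ bs1)} \<and> length is = ar R}" by (auto simp: Pos_def)
              fix "is" assume i: "set is \<subseteq> {..<length (us1 @ bs1)}" "length is = ar R" "is \<notin> Pos"
              then have s: "set is \<subseteq> {..<length us1}" by (simp add: Pos_def)
              have m: "map ((!) (us1 @ bs1)) is = map ((!) us1) is" "map ((!) (us @ bs)) is = map ((!) us) is"
                using s lus by (auto simp: nth_append subset_iff)
              have "(R, is) \<in> snd (tp ?\<rho>' A1 us1) \<longleftrightarrow> (R, is) \<in> snd (tp ?\<rho>' A us)" using us(3) I(4) by simp
              then show "map ((!) (us @ bs)) is \<in> rel A R \<longleftrightarrow> (R, is) \<in> snd e"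
                using s i(1) lus unfolding I(5)[symmetric] in_tp_rel m by auto
            qed
            then show ?thesis by (auto simp: U_def tp_red)
          qed
          have "real (card {bs \<in> ?S. tp ?\<rho>' A (us @ bs) = e}) = (\<Sum>bs\<in>?U. of_bool (rel A R \<inter> NT us bs = Y us bs))"
            unfolding set_eq using finU(1) by (simp add: of_bool_def sum.If_cases Int_def)
          moreover have "\<bar>(\<Sum>bs\<in>?U. of_bool (rel A R \<inter> NT us bs = Y us bs)) - (\<Sum>bs\<in>?U. bw (th N (red ?\<rho> A) R) (NT us bs) (Y us bs))\<bar> \<le> 2 * \<delta> * card ?S"
            using E3 us(1) by (simp add: sum_subtractf)
          moreover have "\<bar>(\<Sum>bs\<in>?U. bw (th N (red ?\<rho> A) R) (NT us bs) (Y us bs)) - \<pi> * card ?U\<bar> \<le> \<delta> * card ?S"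
          proof -
            have "\<bar>bw (th N (red ?\<rho> A) R) (NT us bs) (Y us bs) - \<pi>\<bar> \<le> \<delta>" if "bs \<in> ?U" for bs
            proof -
              have "us @ bs \<in> tuples (Dm n) (K + m)" "Rr n \<subseteq> set (us @ bs)" "tp ?\<rho> (red ?\<rho> A) (us @ bs) = restr ?\<rho> e"
                using that us by (auto simp: U_def Ext_def tuples_def)
              then show ?thesis unfolding NT_def Y_def using E1 by blast
            qed
            then have "(\<Sum>bs\<in>?U. \<bar>bw (th N (red ?\<rho> A) R) (NT us bs) (Y us bs) - \<pi>\<bar>) \<le> card ?U * \<delta>"
              using sum_bounded_above[of ?U "\<lambda>bs. \<bar>bw (th N (red ?\<rho> A) R) (NT us bs) (Y us bs) - \<pi>\<bar>" \<delta>] by simp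
            moreover have "(\<Sum>bs\<in>?U. bw (th N (red ?\<rho> A) R) (NT us bs) (Y us bs)) - \<pi> * card ?U =
                (\<Sum>bs\<in>?U. bw (th N (red ?\<rho> A) R) (NT us bs) (Y us bs) - \<pi>)" by (simp add: sum_subtractf mult.commute)
            moreover have "card ?U * \<delta> \<le> \<delta> * card ?S" using finU(2) \<delta>(1) by (simp add: mult.commute)
            ultimately show ?thesis using sum_abs[of "\<lambda>bs. bw (th N (red ?\<rho> A) R) (NT us bs) (Y us bs) - \<pi>" ?U] by linarith
          qed
          moreover have "\<bar>\<pi> * card ?U - \<alpha> * \<pi> * card ?S\<bar> \<le> \<delta> * card ?S"
          proof -
            have "tp ?\<rho> (red ?\<rho> A) us = restr ?\<rho> d"
              unfolding tp_red us(3)[symmetric] by (intro restr_tp[symmetric]) auto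
            then have 1: "\<bar>real (card ?U) - \<alpha> * real (card ?S)\<bar> \<le> \<delta> * real (card ?S)" using E2 us by blast
            have "\<pi> * card ?U - \<alpha> * \<pi> * card ?S = \<pi> * (real (card ?U) - \<alpha> * real (card ?S))" by (simp add: algebra_simps)
            then have "\<bar>\<pi> * card ?U - \<alpha> * \<pi> * card ?S\<bar> = \<pi> * \<bar>real (card ?U) - \<alpha> * real (card ?S)\<bar>"
              using \<pi>(1) by (simp add: abs_mult)
            also have "\<dots> \<le> 1 * \<bar>real (card ?U) - \<alpha> * real (card ?S)\<bar>" using \<pi>(1) by (intro mult_right_mono) auto
            finally show ?thesis by (rule order_trans) (use 1 in simp)
          qed
          ultimately have "\<bar>real (card {bs \<in> ?S. tp ?\<rho>' A (us @ bs) = e}) - \<alpha> * \<pi> * real (card ?S)\<bar> \<le> (4 * \<delta>) * real (card ?S)" by linarith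
          also have "\<dots> \<le> \<epsilon> * real (card ?S)" using \<delta>(3) by (intro mult_right_mono) auto
          finally show "\<bar>real (card {bs \<in> ?S. tp ?\<rho>' A (us @ bs) = e}) - \<alpha> * \<pi> * real (card ?S)\<bar> \<le> \<epsilon> * real (card ?S)" .
        qed
      qed
    qed
  qed
qed

end

subsection \<open>Continuity of connectives and aggregation functions\<close>

text \<open>A basic open set of the product topology constrains finitely many coordinates, so one
  \<delta> serves them all; coordinates beyond the arity are padded with 0 and never differ.\<close>

lemma connective_continuous:
  assumes C: "is_connective m C" and cs: "length cs = m" "set cs \<subseteq> {0..1}" and \<epsilon>: "\<epsilon> > 0"
  obtains \<delta> where "\<delta> > 0" "\<And>vs. length vs = m \<Longrightarrow> set vs \<subseteq> {0..1} \<Longrightarrow> (\<And>i. i < m \<Longrightarrow> \<bar>vs ! i - cs ! i\<bar> \<le> \<delta>) \<Longrightarrow>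
    \<bar>C vs - C cs\<bar> \<le> \<epsilon>"
proof -
  define ex where "ex vs i = (if i < m then vs ! i else 0)" for vs :: "real list" and i
  have ex: "map (ex vs) [0..<m] = vs" if "length vs = m" for vs
    using that by (auto intro!: nth_equalityI simp: ex_def)
  have exS: "ex vs \<in> {..<m} \<rightarrow> {0..1}" if "length vs = m" "set vs \<subseteq> {0..1}" for vs
  proof (rule Pi_I)
    fix i assume "i \<in> {..<m}"
    then have i: "i < length vs" using that(1) by simp
    then show "ex vs i \<in> {0..1}" using subsetD[OF that(2) nth_mem[OF i]] that(1) by (simp add: ex_def)
  qed
  have "continuous_on ({..<m} \<rightarrow> {0..1}) (\<lambda>x. C (map x [0..<m]))" using C by (simp add: is_connective_def)
  moreover have "open (Elementary_Metric_Spaces.ball (C cs) \<epsilon>)" by simp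
  moreover have "C (map (ex cs) [0..<m]) \<in> Elementary_Metric_Spaces.ball (C cs) \<epsilon>" using ex[OF cs(1)] \<epsilon> by simp
  ultimately obtain A where A: "open A" "ex cs \<in> A"
    "\<And>y. y \<in> {..<m} \<rightarrow> {0..1} \<Longrightarrow> y \<in> A \<Longrightarrow> C (map y [0..<m]) \<in> Elementary_Metric_Spaces.ball (C cs) \<epsilon>"
    unfolding continuous_on_topological using exS[OF cs] by meson
  obtain X where X: "ex cs \<in> PiE UNIV X" "\<And>i. open (X i)" "finite {i. X i \<noteq> UNIV}" "PiE UNIV X \<subseteq> A"
    using product_topology_open_contains_basis[of "\<lambda>_. euclidean" UNIV A "ex cs"] A(1,2)
    by (auto simp: open_fun_def)
  have "\<forall>i. \<exists>d>0. \<forall>y. \<bar>y - ex cs i\<bar> \<le> d \<longrightarrow> y \<in> X i"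
  proof
    fix i
    have "ex cs i \<in> X i" using X(1) by auto
    then obtain d where "d > 0" "cball (ex cs i) d \<subseteq> X i" using X(2) open_contains_cball by blast
    then show "\<exists>d>0. \<forall>y. \<bar>y - ex cs i\<bar> \<le> d \<longrightarrow> y \<in> X i"
      by (intro exI[of _ d]) (auto simp: dist_real_def abs_minus_commute subset_iff)
  qed
  then obtain d where d: "\<And>i. d i > 0" "\<And>i y. \<bar>y - ex cs i\<bar> \<le> d i \<Longrightarrow> y \<in> X i" by metis
  define \<delta> where "\<delta> = Min (insert 1 (d ` {i. X i \<noteq> UNIV}))"
  have \<delta>: "\<delta> > 0" "\<And>i. X i \<noteq> UNIV \<Longrightarrow> \<delta> \<le> d i"
    unfolding \<delta>_def using X(3) d(1) by (auto simp: Min_gr_iff)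
  show ?thesis
  proof (rule that[OF \<delta>(1)])
    fix vs :: "real list" assume vs: "length vs = m" "set vs \<subseteq> {0..1}" "\<And>i. i < m \<Longrightarrow> \<bar>vs ! i - cs ! i\<bar> \<le> \<delta>"
    have "ex vs i \<in> X i" for i
    proof (cases "X i = UNIV")
      case False
      have "\<bar>ex vs i - ex cs i\<bar> \<le> \<delta>" using vs(3)[of i] \<delta>(1) by (auto simp: ex_def)
      then show ?thesis using \<delta>(2)[OF False] by (intro d(2)) simp
    qed simp
    then have "ex vs \<in> A" using X(4) by auto
    from A(3)[OF exS[OF vs(1,2)] this] show "\<bar>C vs - C cs\<bar> \<le> \<epsilon>"
      using ex[OF vs(1)] by (simp add: dist_real_def abs_minus_commute)
  qed
qed

text \<open>The multiset \<open>r\<close> is \<open>\<delta>\<close>-close to the parameters \<open>ps\<close>; the second components of \<open>M\<close> record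
  which \<open>c\<^sub>j\<close> an entry is close to.\<close>

definition ct_close :: "real \<Rightarrow> (real \<times> real) list \<Rightarrow> real multiset \<Rightarrow> bool" where
  "ct_close \<delta> ps r \<longleftrightarrow> 1 / \<delta> \<le> size r \<and> (\<exists>M :: (real \<times> nat) multiset. r = image_mset fst M \<and>
     (\<forall>(x, j)\<in>#M. j < length ps \<and> \<bar>x - fst (ps ! j)\<bar> \<le> \<delta> \<and> x \<in> {0..1}) \<and>
     (\<forall>j<length ps. \<bar>real (size (filter_mset (\<lambda>z. snd z = j) M)) / real (size M) - snd (ps ! j)\<bar> \<le> \<delta>))"

lemma ct_close_mono:
  assumes "ct_close \<delta> ps r" "0 < \<delta>" "\<delta> \<le> \<delta>'"
  shows "ct_close \<delta>' ps r"
proof -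
  have "1 / \<delta>' \<le> 1 / \<delta>" using assms by (intro divide_left_mono) auto
  moreover obtain M where M: "r = image_mset fst M" "\<forall>(x, j)\<in>#M. j < length ps \<and> \<bar>x - fst (ps ! j)\<bar> \<le> \<delta> \<and> x \<in> {0..1}"
     "\<forall>j<length ps. \<bar>real (size (filter_mset (\<lambda>z. snd z = j) M)) / real (size M) - snd (ps ! j)\<bar> \<le> \<delta>"
    using assms(1) by (auto simp: ct_close_def)
  have "\<forall>(x, j)\<in>#M. j < length ps \<and> \<bar>x - fst (ps ! j)\<bar> \<le> \<delta>' \<and> x \<in> {0..1}" using M(2) assms(3) by fastforce
  moreover have "\<forall>j<length ps. \<bar>real (size (filter_mset (\<lambda>z. snd z = j) M)) / real (size M) - snd (ps ! j)\<bar> \<le> \<delta>'"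
    using M(3) assms(3) by fastforce
  moreover have "1 / \<delta> \<le> size r" using assms(1) by (simp add: ct_close_def)
  ultimately have "1 / \<delta>' \<le> size r" "r = image_mset fst M \<and>
     (\<forall>(x, j)\<in>#M. j < length ps \<and> \<bar>x - fst (ps ! j)\<bar> \<le> \<delta>' \<and> x \<in> {0..1}) \<and>
     (\<forall>j<length ps. \<bar>real (size (filter_mset (\<lambda>z. snd z = j) M)) / real (size M) - snd (ps ! j)\<bar> \<le> \<delta>')"
    using M(1) by (linarith, blast)
  then show ?thesis unfolding ct_close_def by blast
qed

text \<open>Once 1 / (n + 1) is small, an entry tagged j lies in the interval \<open>I j\<close>,
  and by disjointness in no other one; so the frequencies of tags are those of the
  intervals.\<close>

lemma ct_close_testing:
  assumes c: "\<And>n. ct_close (1 / (real n + 1)) ps (r n)" and inc: "\<And>n. size (r n) < size (r (Suc n))"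
  shows "convergence_testing ps r"
proof -
  define W where "W n M \<longleftrightarrow> r n = image_mset fst M \<and>
    (\<forall>(x, j)\<in>#M. j < length ps \<and> \<bar>x - fst (ps ! j)\<bar> \<le> 1 / (real n + 1) \<and> x \<in> {0..1}) \<and>
    (\<forall>j<length ps. \<bar>real (size (filter_mset (\<lambda>z. snd z = j) M)) / real (size M) - snd (ps ! j)\<bar> \<le> 1 / (real n + 1))"
    for n M
  have "\<forall>n. \<exists>M. W n M" using c unfolding ct_close_def W_def by blast
  then obtain M where W: "\<And>n. W n (M n)" by metis
  have M: "r n = image_mset fst (M n)"
    "(x, j) \<in># M n \<Longrightarrow> j < length ps \<and> \<bar>x - fst (ps ! j)\<bar> \<le> 1 / (real n + 1) \<and> x \<in> {0..1}"
    "j < length ps \<Longrightarrow> \<bar>real (size (filter_mset (\<lambda>z. snd z = j) (M n))) / real (size (M n)) - snd (ps ! j)\<bar> \<le> 1 / (real n + 1)"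
    for n x j using W[of n] unfolding W_def by blast+
  show ?thesis unfolding convergence_testing_def
proof (intro conjI allI impI)
  fix n
  have "0 < 1 / (1 / (real n + 1))" by simp
  then have "0 < real (size (r n))" using c[of n] unfolding ct_close_def by linarith
  then show "r n \<noteq> {#}" by auto
  show "set_mset (r n) \<subseteq> {0..1}" using M(2)[of _ _ n] by (auto simp: M(1))
  show "size (r n) < size (r (Suc n))" by (rule inc)
next
  fix I :: "nat \<Rightarrow> real set"
  assume I: "(\<forall>j<length ps. openin (top_of_set {0..1}) (I j) \<and> is_interval (I j) \<and> fst (ps ! j) \<in> I j) \<and>
        disjoint_family_on I {..<length ps}"
  have "\<forall>j\<in>{..<length ps}. \<exists>\<eta>>0. \<forall>x\<in>{0..1}. \<bar>x - fst (ps ! j)\<bar> \<le> \<eta> \<longrightarrow> x \<in> I j"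
  proof
    fix j assume "j \<in> {..<length ps}"
    then have "openin (top_of_set {0..1}) (I j)" "fst (ps ! j) \<in> I j" using I by auto
    then obtain \<eta> where "\<eta> > 0" "cball (fst (ps ! j)) \<eta> \<inter> {0..1} \<subseteq> I j" using openin_contains_cball by metis
    then show "\<exists>\<eta>>0. \<forall>x\<in>{0..1}. \<bar>x - fst (ps ! j)\<bar> \<le> \<eta> \<longrightarrow> x \<in> I j"
      by (intro exI[of _ \<eta>]) (auto simp: dist_real_def abs_minus_commute subset_iff)
  qed
  then obtain \<eta> where \<eta>: "\<And>j. j < length ps \<Longrightarrow> \<eta> j > 0"
    "\<And>j x. j < length ps \<Longrightarrow> x \<in> {0..1} \<Longrightarrow> \<bar>x - fst (ps ! j)\<bar> \<le> \<eta> j \<Longrightarrow> x \<in> I j" by (metis lessThan_iff)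
  have lim0: "(\<lambda>n. 1 / (real n + 1)) \<longlonglongrightarrow> 0"
    using LIMSEQ_inverse_real_of_nat by (simp add: inverse_eq_divide add.commute)
  have "\<forall>\<^sub>F n in sequentially. \<forall>j\<in>{..<length ps}. 1 / (real n + 1) < \<eta> j"
    using \<eta>(1) order_tendstoD(2)[OF lim0] by (intro eventually_ball_finite) auto
  then have ev: "\<forall>\<^sub>F n in sequentially. \<forall>(x, j)\<in>#M n. j < length ps \<and> x \<in> I j"
  proof eventually_elim
    case (elim n)
    have "j < length ps \<and> x \<in> I j" if "(x, j) \<in># M n" for x j
    proof -
      note m = M(2)[OF that]
      then have "1 / (real n + 1) < \<eta> j" using elim by simp
      then have "\<bar>x - fst (ps ! j)\<bar> \<le> \<eta> j" using m by linarith
      then show ?thesis using m \<eta>(2) by blast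
    qed
    then show ?case by blast
  qed
  then show "\<forall>\<^sub>F n in sequentially. set_mset (r n) \<subseteq> (\<Union>j<length ps. I j)"
    by eventually_elim (fastforce simp: M(1))
  fix j assume j: "j < length ps"
  have "(\<lambda>n. real (size (filter_mset (\<lambda>z. snd z = j) (M n))) / real (size (M n))) \<longlonglongrightarrow> snd (ps ! j)"
  proof (rule LIM_zero_cancel, rule Lim_null_comparison[OF _ lim0])
    show "\<forall>\<^sub>F n in sequentially. norm (real (size (filter_mset (\<lambda>z. snd z = j) (M n))) / real (size (M n)) - snd (ps ! j)) \<le> 1 / (real n + 1)"
      using M(3)[OF j] by simp
  qed
  moreover have "\<forall>\<^sub>F n in sequentially. real (size (filter_mset (\<lambda>z. snd z = j) (M n))) / real (size (M n)) =
      real (size (filter_mset (\<lambda>x. x \<in> I j) (r n))) / real (size (r n))"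
    using ev
  proof eventually_elim
    case (elim n)
    have "snd z = j \<longleftrightarrow> fst z \<in> I j" if "z \<in># M n" for z
    proof -
      have "snd z < length ps" "fst z \<in> I (snd z)" using elim that by auto
      then show ?thesis using I j by (auto simp: disjoint_family_on_def)
    qed
    then have "filter_mset (\<lambda>z. snd z = j) (M n) = filter_mset (\<lambda>z. fst z \<in> I j) (M n)" by (intro filter_mset_cong) auto
    then show ?case by (simp add: M(1) filter_mset_image_mset comp_def)
  qed
  ultimately show "(\<lambda>n. real (size (filter_mset (\<lambda>x. x \<in> I j) (r n))) / real (size (r n))) \<longlonglongrightarrow> snd (ps ! j)"
    by (rule Lim_transform_eventually)
qed
qed

text \<open>From sequences to a uniform statement: compactness yields a limit value c along one
  sequence of closer and closer families, and a sequence staying away from c would contradict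
  \<open>ct_continuous\<close> applied to the two.\<close>

lemma ct_limit:
  assumes agg: "is_aggregation m F" and cont: "continuous_aggregation m F"
    and pss: "length pss = m" "\<And>ps. ps \<in> set pss \<Longrightarrow> ct_params ps"
  obtains c where "c \<in> {0..1}" "\<And>\<epsilon>. \<epsilon> > 0 \<Longrightarrow> \<exists>\<delta>>0. \<forall>rs. length rs = m \<and> (\<forall>i<m. ct_close \<delta> (pss ! i) (rs ! i)) \<longrightarrow> \<bar>F rs - c\<bar> \<le> \<epsilon>"
proof -
  define P where "P \<delta> rs \<longleftrightarrow> length rs = m \<and> (\<forall>i<m. ct_close \<delta> (pss ! i) (rs ! i))" for \<delta> rs
  have Pmono: "P \<delta>' rs" if "P \<delta> rs" "0 < \<delta>" "\<delta> \<le> \<delta>'" for \<delta> \<delta>' rs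
    using that ct_close_mono by (auto simp: P_def)
  define incr where "incr f \<longleftrightarrow> (\<forall>n. P (1 / (real n + 1)) (f n) \<and> (\<forall>i<m. size (f n ! i) < size (f (Suc n) ! i)))" for f
  \<comment> \<open>Test sequences must have strictly increasing sizes; \<delta>-closeness forces
    size at least 1 / \<delta>, so a small enough \<delta> makes the next family larger.\<close>
  have seq: "\<exists>f. incr f \<and> (\<forall>n. Q (f n))" if Q: "\<And>\<delta>. \<delta> > 0 \<Longrightarrow> \<exists>rs. P \<delta> rs \<and> Q rs" for Q
  proof -
    have "\<exists>f. \<forall>n. (P (1 / (real n + 1)) (f n) \<and> Q (f n)) \<and> (\<forall>i<m. size (f n ! i) < size (f (Suc n) ! i))"
    proof (rule dependent_nat_choice)
      show "\<exists>rs. P (1 / (real 0 + 1)) rs \<and> Q rs" by (rule Q) simp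
      fix rs n assume "P (1 / (real n + 1)) rs \<and> Q rs"
      define s where "s = (\<Sum>i<m. size (rs ! i))"
      define \<delta> where "\<delta> = 1 / (real (Suc n) + 1 + real s)"
      have \<delta>: "\<delta> > 0" "\<delta> \<le> 1 / (real (Suc n) + 1)" by (auto simp: \<delta>_def field_simps)
      obtain rs' where rs': "P \<delta> rs'" "Q rs'" using Q[OF \<delta>(1)] by blast
      have "size (rs ! i) < size (rs' ! i)" if "i < m" for i
      proof -
        have "size (rs ! i) \<le> s" unfolding s_def using that by (intro member_le_sum) auto
        moreover have "real s < 1 / \<delta>" by (simp add: \<delta>_def)
        moreover have "1 / \<delta> \<le> size (rs' ! i)" using rs'(1) that by (simp add: P_def ct_close_def)
        ultimately show ?thesis by linarith
      qed
      then show "\<exists>rs'. (P (1 / (real (Suc n) + 1)) rs' \<and> Q rs') \<and> (\<forall>i<m. size (rs ! i) < size (rs' ! i))"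
        using rs' Pmono[OF rs'(1) \<delta>] by blast
    qed
    then show ?thesis unfolding incr_def by blast
  qed
  have testing: "convergence_testing (pss ! i) (\<lambda>n. f n ! i)" if "incr f" "i < m" for f i
    using that by (intro ct_close_testing) (auto simp: incr_def P_def)
  have F01: "F (f n) \<in> {0..1}" if "incr f" for f n
  proof -
    have "r \<noteq> {#} \<and> set_mset r \<subseteq> {0..1}" if r: "r \<in> set (f n)" for r
    proof -
      obtain i where i: "i < m" "r = f n ! i" using r \<open>incr f\<close> by (auto simp: in_set_conv_nth incr_def P_def)
      then show ?thesis using testing[OF \<open>incr f\<close> i(1)] by (simp add: convergence_testing_def)
    qed
    then show ?thesis using agg \<open>incr f\<close> by (simp add: is_aggregation_def incr_def P_def)
  qed
  show ?thesis
  proof (cases "\<forall>\<delta>>0. \<exists>rs. P \<delta> rs")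
    case False
    then obtain \<delta> where "\<delta> > 0" "\<And>rs. \<not> P \<delta> rs" by blast
    \<comment> \<open>No family is this close, so the claim is vacuous and 0 is an arbitrary
      choice.\<close>
    then show ?thesis using that[of 0] unfolding P_def by (metis atLeastAtMost_iff order_refl zero_le_one)
  next
    case True
    then obtain f where f: "incr f" using seq[of "\<lambda>_. True"] by auto
    have "compact {0..1::real}" by simp
    then obtain c h where c: "c \<in> {0..1}" and h: "strict_mono h" and lim: "((\<lambda>n. F (f n)) \<circ> h) \<longlonglongrightarrow> c"
      using F01[OF f] unfolding compact_eq_seq_compact_metric seq_compact_def by metis
    define r where "r = f \<circ> h"
    have r: "incr r" unfolding incr_def
    proof (intro allI conjI impI)
      fix n
      have "n \<le> h n" using h by (rule seq_suble)
      then have le: "1 / (real (h n) + 1) \<le> 1 / (real n + 1)" by (simp add: field_simps)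
      have "P (1 / (real (h n) + 1)) (f (h n))" using f by (simp add: incr_def)
      from Pmono[OF this _ le] show "P (1 / (real n + 1)) (r n)" by (simp add: r_def)
      fix i assume i: "i < m"
      have "strict_mono (\<lambda>n. size (f n ! i))" using f i by (auto simp: strict_mono_Suc_iff incr_def)
      then show "size (r n ! i) < size (r (Suc n) ! i)"
        using h by (simp add: r_def strict_mono_def)
    qed
    show ?thesis
    proof (rule that[OF c], rule ccontr)
      fix \<epsilon> :: real assume \<epsilon>: "\<epsilon> > 0" and
        "\<not> (\<exists>\<delta>>0. \<forall>rs. length rs = m \<and> (\<forall>i<m. ct_close \<delta> (pss ! i) (rs ! i)) \<longrightarrow> \<bar>F rs - c\<bar> \<le> \<epsilon>)"
      then have "\<exists>rs. P \<delta> rs \<and> \<not> \<bar>F rs - c\<bar> \<le> \<epsilon>" if "\<delta> > 0" for \<delta> using that unfolding P_def by blast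
      then obtain q where q: "incr q" "\<And>n. \<not> \<bar>F (q n) - c\<bar> \<le> \<epsilon>" using seq[of "\<lambda>rs. \<not> \<bar>F rs - c\<bar> \<le> \<epsilon>"] by blast
      have "ct_continuous pss F" using cont pss by (simp add: continuous_aggregation_def)
      then have "(\<lambda>n. \<bar>F (r n) - F (q n)\<bar>) \<longlonglongrightarrow> 0"
        using testing[OF r] testing[OF q(1)] r q(1) pss(1) unfolding ct_continuous_def incr_def P_def by simp
      then have "(\<lambda>n. F (r n) - F (q n)) \<longlonglongrightarrow> 0" by (rule tendsto_rabs_zero_cancel)
      moreover have "(\<lambda>n. F (r n)) \<longlonglongrightarrow> c" using lim by (simp add: r_def comp_def)
      ultimately have "(\<lambda>n. F (r n) - (F (r n) - F (q n))) \<longlonglongrightarrow> c - 0" by (intro tendsto_diff)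
      then have "(\<lambda>n. F (q n)) \<longlonglongrightarrow> c" by simp
      then have "\<forall>\<^sub>F n in sequentially. dist (F (q n)) c < \<epsilon>" using \<epsilon> by (rule tendstoD)
      then obtain n where "dist (F (q n)) c < \<epsilon>" using eventually_happens by force
      then show False using q(2)[of n] by (simp add: dist_real_def)
    qed
  qed
qed

context base_seq
begin

section \<open>Constants, atoms and connectives\<close>

lemma determinedI:
  assumes "initial N L"
    and "\<And>(K :: nat) (\<iota> :: nat \<Rightarrow> nat) e. (\<And>v. v \<in> fv \<phi> \<Longrightarrow> \<iota> v < K) \<Longrightarrow> \<exists>c\<in>{0..1}. \<forall>n\<ge>1. \<forall>A\<in>worlds (subnet N L) n. \<forall>V\<in>tuples (Dm n) K.
      Rr n \<subseteq> set V \<longrightarrow> tp (\<tau> \<union> L) A V = e \<longrightarrow> eval A \<phi> (\<lambda>v. V ! \<iota> v) = c"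
  shows "determined L \<phi>"
  unfolding determined_def
proof (intro allI impI)
  fix K :: nat and \<iota> :: "nat \<Rightarrow> nat" and e assume "\<forall>v\<in>fv \<phi>. \<iota> v < K"
  then obtain c where c: "c \<in> {0..1}" "\<And>n A V. n \<ge> 1 \<Longrightarrow> A \<in> worlds (subnet N L) n \<Longrightarrow> V \<in> tuples (Dm n) K \<Longrightarrow>
      Rr n \<subseteq> set V \<Longrightarrow> tp (\<tau> \<union> L) A V = e \<Longrightarrow> eval A \<phi> (\<lambda>v. V ! \<iota> v) = c" using assms(2)[of \<iota> K e] by blast
  show "\<exists>c\<in>{0..1}. \<forall>\<epsilon>>0. whp N L (\<lambda>n A. \<forall>V\<in>tuples (Dm n) K. Rr n \<subseteq> set V \<longrightarrow> tp (\<tau> \<union> L) A V = e \<longrightarrow>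
    \<bar>eval A \<phi> (\<lambda>v. V ! \<iota> v) - c\<bar> \<le> \<epsilon>)"
  proof (intro bexI[OF _ c(1)] allI impI whp_always[OF assms(1)])
    fix \<epsilon> :: real assume "\<epsilon> > 0"
    show "\<forall>\<^sub>F n in sequentially. \<forall>A\<in>worlds (subnet N L) n. \<forall>V\<in>tuples (Dm n) K. Rr n \<subseteq> set V \<longrightarrow> tp (\<tau> \<union> L) A V = e \<longrightarrow>
      \<bar>eval A \<phi> (\<lambda>v. V ! \<iota> v) - c\<bar> \<le> \<epsilon>"
      using eventually_ge_at_top[of 1]
      by eventually_elim (use c(2) \<open>\<epsilon> > 0\<close> in auto)
  qed
qed

lemma determined_Const: "initial N L \<Longrightarrow> c \<in> {0..1} \<Longrightarrow> determined L (Const c)"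
  by (rule determinedI) auto

lemma determined_Eq: "initial N L \<Longrightarrow> determined L (Eq x y)"
proof (rule determinedI)
  fix K :: nat and \<iota> :: "nat \<Rightarrow> nat" and e assume i: "\<And>v. v \<in> fv (Eq x y) \<Longrightarrow> \<iota> v < K"
  show "\<exists>c\<in>{0..1}. \<forall>n\<ge>1. \<forall>A\<in>worlds (subnet N L) n. \<forall>V\<in>tuples (Dm n) K.
      Rr n \<subseteq> set V \<longrightarrow> tp (\<tau> \<union> L) A V = e \<longrightarrow> eval A (Eq x y) (\<lambda>v. V ! \<iota> v) = c"
    by (rule bexI[of _ "of_bool ((\<iota> x, \<iota> y) \<in> fst e)"]) (use i[of x] i[of y] in \<open>auto simp: in_tp_eq tuples_def\<close>)
qed

lemma determined_Rel: "initial N L \<Longrightarrow> R \<in> \<tau> \<union> L \<Longrightarrow> determined L (Rel R xs)"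
proof (rule determinedI)
  fix K :: nat and \<iota> :: "nat \<Rightarrow> nat" and e assume R: "R \<in> \<tau> \<union> L" and i: "\<And>v. v \<in> fv (Rel R xs) \<Longrightarrow> \<iota> v < K"
  have m: "map (\<lambda>v. V ! \<iota> v) xs = map ((!) V) (map \<iota> xs)" for V :: "'a list" by simp
  have s: "set (map \<iota> xs) \<subseteq> {..<K}" using i by auto
  show "\<exists>c\<in>{0..1}. \<forall>n\<ge>1. \<forall>A\<in>worlds (subnet N L) n. \<forall>V\<in>tuples (Dm n) K.
      Rr n \<subseteq> set V \<longrightarrow> tp (\<tau> \<union> L) A V = e \<longrightarrow> eval A (Rel R xs) (\<lambda>v. V ! \<iota> v) = c"
  proof (intro bexI[of _ "of_bool ((R, map \<iota> xs) \<in> snd e)"] allI ballI impI)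
    fix n A V assume "V \<in> tuples (Dm n) K" "tp (\<tau> \<union> L) A V = e"
    then show "eval A (Rel R xs) (\<lambda>v. V ! \<iota> v) = of_bool ((R, map \<iota> xs) \<in> snd e)"
      unfolding eval.simps m using s R by (auto simp: in_tp_rel tuples_def)
  qed auto
qed

lemma determined_Conn:
  assumes L: "initial N L" and C: "is_connective (length \<phi>s) C"
    and \<phi>s: "\<And>\<phi>. \<phi> \<in> set \<phi>s \<Longrightarrow> determined L \<phi>" "\<And>\<phi>. \<phi> \<in> set \<phi>s \<Longrightarrow> is_pla ar (\<tau> \<union> L) \<phi>"
  shows "determined L (Conn C \<phi>s)"
  unfolding determined_def
proof (intro allI impI)
  fix K :: nat and \<iota> :: "nat \<Rightarrow> nat" and e assume i: "\<forall>v\<in>fv (Conn C \<phi>s). \<iota> v < K"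
  define Q where "Q \<phi> c \<epsilon> \<longleftrightarrow> whp N L (\<lambda>n A. \<forall>V\<in>tuples (Dm n) K. Rr n \<subseteq> set V \<longrightarrow> tp (\<tau> \<union> L) A V = e \<longrightarrow>
    \<bar>eval A \<phi> (\<lambda>v. V ! \<iota> v) - c\<bar> \<le> \<epsilon>)" for \<phi> and c \<epsilon> :: real
  have "\<exists>c\<in>{0..1}. \<forall>\<epsilon>>0. Q \<phi> c \<epsilon>" if "\<phi> \<in> set \<phi>s" for \<phi>
  proof -
    have "\<forall>v\<in>fv \<phi>. \<iota> v < K" using i that by auto
    then show ?thesis using \<phi>s(1)[OF that] unfolding determined_def Q_def by blast
  qed
  then obtain c where c: "\<And>\<phi>. \<phi> \<in> set \<phi>s \<Longrightarrow> c \<phi> \<in> {0..1}" "\<And>\<phi> \<epsilon>. \<phi> \<in> set \<phi>s \<Longrightarrow> \<epsilon> > 0 \<Longrightarrow> Q \<phi> (c \<phi>) \<epsilon>" by metis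
  define cs where "cs = map c \<phi>s"
  have cs: "length cs = length \<phi>s" "set cs \<subseteq> {0..1}" using c(1) by (auto simp: cs_def)
  have "C cs \<in> {0..1}"
  proof -
    have "(\<lambda>i. if i < length \<phi>s then cs ! i else 0) \<in> {..<length \<phi>s} \<rightarrow> {0..1}"
    proof (rule Pi_I)
      fix i assume "i \<in> {..<length \<phi>s}"
      then have i: "i < length cs" using cs(1) by simp
      then show "(if i < length \<phi>s then cs ! i else 0) \<in> {0..1}" using subsetD[OF cs(2) nth_mem[OF i]] cs(1) by simp
    qed
    then have "C (map (\<lambda>i. if i < length \<phi>s then cs ! i else 0) [0..<length \<phi>s]) \<in> {0..1}" using C unfolding is_connective_def by blast
    moreover have "map (\<lambda>i. if i < length \<phi>s then cs ! i else 0) [0..<length \<phi>s] = cs" using cs(1) by (auto intro!: nth_equalityI)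
    ultimately show ?thesis by simp
  qed
  then show "\<exists>c\<in>{0..1}. \<forall>\<epsilon>>0. whp N L (\<lambda>n A. \<forall>V\<in>tuples (Dm n) K. Rr n \<subseteq> set V \<longrightarrow> tp (\<tau> \<union> L) A V = e \<longrightarrow>
    \<bar>eval A (Conn C \<phi>s) (\<lambda>v. V ! \<iota> v) - c\<bar> \<le> \<epsilon>)"
  proof (intro bexI[of _ "C cs"] allI impI)
    fix \<epsilon> :: real assume \<epsilon>: "\<epsilon> > 0"
    obtain \<delta> where \<delta>: "\<delta> > 0" "\<And>vs. length vs = length \<phi>s \<Longrightarrow> set vs \<subseteq> {0..1} \<Longrightarrow>
      (\<And>i. i < length \<phi>s \<Longrightarrow> \<bar>vs ! i - cs ! i\<bar> \<le> \<delta>) \<Longrightarrow> \<bar>C vs - C cs\<bar> \<le> \<epsilon>"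
      using connective_continuous[OF C cs \<epsilon>] by metis
    have "whp N L (\<lambda>n A. \<forall>\<phi>\<in>set \<phi>s. \<forall>V\<in>tuples (Dm n) K. Rr n \<subseteq> set V \<longrightarrow> tp (\<tau> \<union> L) A V = e \<longrightarrow>
      \<bar>eval A \<phi> (\<lambda>v. V ! \<iota> v) - c \<phi>\<bar> \<le> \<delta>)"
      using c(2)[OF _ \<delta>(1)] unfolding Q_def by (intro whp_ball[OF L]) auto
    then show "whp N L (\<lambda>n A. \<forall>V\<in>tuples (Dm n) K. Rr n \<subseteq> set V \<longrightarrow> tp (\<tau> \<union> L) A V = e \<longrightarrow>
      \<bar>eval A (Conn C \<phi>s) (\<lambda>v. V ! \<iota> v) - C cs\<bar> \<le> \<epsilon>)"
    proof (rule whp_mono[OF L], goal_cases)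
      case 1
      show ?case using eventually_ge_at_top[of 1]
      proof (eventually_elim, intro ballI impI)
        fix n A V assume n: "(1::nat) \<le> n" and A: "A \<in> worlds (subnet N L) n"
          and H: "\<forall>\<phi>\<in>set \<phi>s. \<forall>V\<in>tuples (Dm n) K. Rr n \<subseteq> set V \<longrightarrow> tp (\<tau> \<union> L) A V = e \<longrightarrow>
            \<bar>eval A \<phi> (\<lambda>v. V ! \<iota> v) - c \<phi>\<bar> \<le> \<delta>"
          and V: "V \<in> tuples (Dm n) K" "Rr n \<subseteq> set V" "tp (\<tau> \<union> L) A V = e"
        have fin: "finite (dom A)" using world(1)[OF A] finite_Dm[OF n] by simp
        let ?vs = "map (\<lambda>\<phi>. eval A \<phi> (\<lambda>v. V ! \<iota> v)) \<phi>s"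
        have "\<bar>C ?vs - C cs\<bar> \<le> \<epsilon>"
        proof (rule \<delta>(2))
          show "set ?vs \<subseteq> {0..1}" using eval_range[OF \<phi>s(2) fin] by auto
          show "\<bar>?vs ! i - cs ! i\<bar> \<le> \<delta>" if "i < length \<phi>s" for i
            using H nth_mem[OF that] V that by (simp add: cs_def)
        qed simp
        moreover have "eval A (Conn C \<phi>s) (\<lambda>v. V ! \<iota> v) = C ?vs" by (simp add: comp_def)
        ultimately show "\<bar>eval A (Conn C \<phi>s) (\<lambda>v. V ! \<iota> v) - C cs\<bar> \<le> \<epsilon>" by simp
      qed
    qed
  qed
qed

end

subsection \<open>Strongly unbounded closure types\<close>

lemma nths_sorted:
  assumes "sorted_wrt (<) js" "set js \<subseteq> {..<length bs}"
  shows "nths bs (set js) = map ((!) bs) js"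
proof -
  have z: "zip bs [0..<length bs] = map (\<lambda>i. (bs ! i, i)) [0..<length bs]" by (auto intro: nth_equalityI)
  have "nths bs (set js) = map ((!) bs) (filter (\<lambda>i. i \<in> set js) [0..<length bs])"
    by (simp add: nths_def z filter_map comp_def)
  also have "filter (\<lambda>i. i \<in> set js) [0..<length bs] = js"
  proof (rule sorted_distinct_set_unique)
    show "sorted js" "distinct js" using assms(1) strict_sorted_iff by blast+
    show "set (filter (\<lambda>i. i \<in> set js) [0..<length bs]) = set js" using assms(2) by auto
  qed (simp_all add: sorted_filter[of id, simplified])
  finally show ?thesis .
qed

lemma tp_extend:
  assumes "tp \<rho> A V = tp \<rho> A' V'" "\<rho> \<subseteq> \<rho>'" "\<And>R. R \<notin> \<rho> \<Longrightarrow> rel A R = {} \<and> rel A' R = {}"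
  shows "tp \<rho>' A V = tp \<rho>' A' V'"
proof -
  have "tp \<rho>' A V = tp \<rho> A V" "tp \<rho>' A' V' = tp \<rho> A' V'"
    using assms(2,3) by (auto simp: tp_def)
  then show ?thesis using assms(1) by simp
qed

context base_seq
begin

text \<open>Expressed inside the closure of \<open>as @ cs\<close>, so that it is invariant under
  isomorphisms of closures; it confines \<open>cs\<close> to balls of radius 1 about the closure of
  \<open>as\<close>.\<close>

definition nearby :: "nat \<Rightarrow> 'a list \<Rightarrow> 'a list \<Rightarrow> bool" where
  "nearby n as cs \<longleftrightarrow> (\<forall>c\<in>set cs. c \<in> set as \<union> Rr n \<or> (\<exists>R\<in>\<tau>. \<exists>xs\<in>rel (B n) R.
     set xs \<subseteq> set as \<union> set cs \<union> Rr n \<and> c \<in> set xs \<and> set xs \<inter> (set as \<union> Rr n) \<noteq> {}))"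

lemma nearby_ball: "nearby n as cs \<Longrightarrow> set cs \<subseteq> (\<Union>x\<in>set as \<union> Rr n. ball n 1 x)"
proof
  fix c assume n: "nearby n as cs" and c: "c \<in> set cs"
  show "c \<in> (\<Union>x\<in>set as \<union> Rr n. ball n 1 x)"
  proof (cases "c \<in> set as \<union> Rr n")
    case True
    then show ?thesis using ball_self by blast
  next
    case False
    then obtain R xs x where "R \<in> \<tau>" "xs \<in> rel (B n) R" "c \<in> set xs" "x \<in> set xs" "x \<in> set as \<union> Rr n"
      using n c unfolding nearby_def by blast
    then show ?thesis using tuple_G[of R xs n x c] by blast
  qed
qed

lemma nearby_iso:
  assumes g: "bij_betw g (set as1 \<union> set cs1 \<union> Rr n1) (set as \<union> set cs \<union> Rr n)" "map g as1 = as" "map g cs1 = cs"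
    "\<And>R xs. R \<in> \<tau> \<Longrightarrow> set xs \<subseteq> set as1 \<union> set cs1 \<union> Rr n1 \<Longrightarrow> xs \<in> rel (B n1) R \<longleftrightarrow> map g xs \<in> rel (B n) R"
    "g ` Rr n1 = Rr n"
    and n: "nearby n1 as1 cs1"
  shows "nearby n as cs"
  unfolding nearby_def
proof
  fix c assume "c \<in> set cs"
  then obtain c1 where c1: "c1 \<in> set cs1" "c = g c1" unfolding g(3)[symmetric] by auto
  have im: "g ` (set as1 \<union> Rr n1) = set as \<union> Rr n" unfolding image_Un g(5) using g(2) by auto
  have im2: "g ` (set as1 \<union> set cs1 \<union> Rr n1) = set as \<union> set cs \<union> Rr n" using g(1) by (simp add: bij_betw_def)
  show "c \<in> set as \<union> Rr n \<or> (\<exists>R\<in>\<tau>. \<exists>xs\<in>rel (B n) R.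
     set xs \<subseteq> set as \<union> set cs \<union> Rr n \<and> c \<in> set xs \<and> set xs \<inter> (set as \<union> Rr n) \<noteq> {})"
  proof (cases "c1 \<in> set as1 \<union> Rr n1")
    case True
    then show ?thesis using im c1(2) by blast
  next
    case False
    then obtain R xs x where x: "R \<in> \<tau>" "xs \<in> rel (B n1) R" "set xs \<subseteq> set as1 \<union> set cs1 \<union> Rr n1" "c1 \<in> set xs"
      "x \<in> set xs" "x \<in> set as1 \<union> Rr n1"
      using n c1(1) unfolding nearby_def by blast
    have "map g xs \<in> rel (B n) R" using g(4)[OF x(1,3)] x(2) by blast
    moreover have "set (map g xs) \<subseteq> set as \<union> set cs \<union> Rr n" unfolding set_map using x(3) im2 by blast
    moreover have "c \<in> set (map g xs)" using x(4) c1(2) by simp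
    moreover have "g x \<in> set (map g xs) \<inter> (set as \<union> Rr n)" using x(5,6) im by auto
    ultimately show ?thesis using x(1) by blast
  qed
qed

lemma ct_pts_length: "is_ctype N \<rho> k p \<Longrightarrow> length (ct_pts p) = k"
  by (simp add: is_ctype_def tuples_def)

lemma frequently_superlog:
  assumes "frequently P sequentially" "superlog f"
  obtains n where "n \<ge> 1" "P n" "X < f n"
proof -
  have "frequently (\<lambda>n. P n \<and> (n \<ge> 1 \<and> X < f n)) sequentially"
    using frequently_eventually_frequently[OF assms(1)
      eventually_conj[OF eventually_ge_at_top[of 1] superlog_gt[OF assms(2), of X]]] by blast
  then show ?thesis using that frequently_ex by blast
qed

lemma strongD:
  assumes "strongly_unbounded N 0 k m p" "J \<subseteq> {..<m}" "J \<noteq> {}"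
    and i: "n \<ge> 1" "as \<in> tuples (Dm n) k" "bs \<in> tuples (Dm n) m" "ct_sat N 0 p n (B n) (as @ bs)"
  obtains p' where "is_complete_ctype N \<tau> (k + card J) p'" "ct_sat N 0 p' n (B n) (as @ nths bs J)"
    "uniformly_unbounded N 0 k (card J) p'"
proof -
  from assms(1)[unfolded strongly_unbounded_def, THEN conjunct2, rule_format, OF assms(2,3)] obtain p'
    where p': "is_complete_ctype N \<tau> (k + card J) p'" "uniformly_unbounded N 0 k (card J) p'"
      and s: "\<forall>n\<ge>1. \<forall>as\<in>tuples (Dm n) k. \<forall>bs\<in>tuples (Dm n) m.
        ct_sat N 0 p n (B n) (as @ bs) \<longrightarrow> ct_sat N 0 p' n (B n) (as @ nths bs J)"
    by (elim exE conjE)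
  from that[OF p'(1) s[rule_format, OF i] p'(2)] show ?thesis .
qed

text \<open>The bound variables of a strongly unbounded type are neither equal nor adjacent to elements of
  the closure of the parameters, as elements of the latter kind are bounded in number.\<close>

lemma strong_free:
  assumes p: "is_complete_ctype N \<tau> (k + m) p" "strongly_unbounded N 0 k m p"
    and i: "n1 \<ge> 1" "as1 \<in> tuples (Dm n1) k" "bs1 \<in> tuples (Dm n1) m" "ct_sat N 0 p n1 (B n1) (as1 @ bs1)"
    and us: "set us = set as1 \<union> Rr n1"
  shows "wfree \<tau> (B n1) us bs1"
proof (rule ccontr)
  assume nw: "\<not> wfree \<tau> (B n1) us bs1"
  have len: "length bs1 = m" using i by (simp add: tuples_def)
  \<comment> \<open>Either one position with an entry in the closure of the parameters, or all
    positions whose entries occur in a linking tuple: then the whole linking tuple lies within the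
    selected part and that closure.\<close>
  obtain J where J: "J \<subseteq> {..<m}" "J \<noteq> {}" "nearby n1 as1 (nths bs1 J)"
  proof (cases "set us \<inter> set bs1 = {}")
    case False
    then obtain x where x: "x \<in> set us" "x \<in> set bs1" by blast
    then obtain j where j: "j < m" "bs1 ! j \<in> set us" using len by (metis in_set_conv_nth)
    have "set (nths bs1 {j}) = {bs1 ! j}" unfolding set_nths using j len by auto
    then show ?thesis using that[of "{j}"] j us by (auto simp: nearby_def)
  next
    case True
    then obtain R xs where x: "R \<in> \<tau>" "xs \<in> rel (B n1) R" "set xs \<subseteq> set us \<union> set bs1" "\<not> set xs \<subseteq> set us" "\<not> set xs \<subseteq> set bs1"
      using nw unfolding wfree_def by blast
    define J where "J = {j. j < m \<and> bs1 ! j \<in> set xs}"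
    have s: "set (nths bs1 J) = set bs1 \<inter> set xs" unfolding set_nths J_def using len
      by (auto simp: in_set_conv_nth[of _ bs1])
    have "set (nths bs1 J) \<noteq> {}" unfolding s using x(3,4) by blast
    then have "J \<noteq> {}" by auto
    moreover have "nearby n1 as1 (nths bs1 J)"
      unfolding nearby_def s using x(1,2,3,5) us by blast
    ultimately show ?thesis using that[of J] by (auto simp: J_def)
  qed
  obtain p' where p': "is_complete_ctype N \<tau> (k + card J) p'"
    "ct_sat N 0 p' n1 (B n1) (as1 @ nths bs1 J)" "uniformly_unbounded N 0 k (card J) p'"
    by (rule strongD[OF p(2) J(1,2) i])
  have sat1: "ct_sat N 0 p' n1 (B n1) (as1 @ nths bs1 J)" by (rule p'(2))
  have "{i. i < m \<and> i \<in> J} = J" using J(1) by auto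
  then have lJ: "length (nths bs1 J) = card J" using len by (simp add: length_nths)
  have t1: "as1 @ nths bs1 J \<in> tuples (Dm n1) (k + card J)"
    using i lJ set_nths_subset[of bs1 J] by (auto simp: tuples_def)
  obtain f where f: "superlog f" "\<And>n as. n \<ge> 1 \<Longrightarrow> as \<in> tuples (Dm n) k \<Longrightarrow>
      {bs \<in> tuples (Dm n) (card J). ct_sat N 0 p' n (B n) (as @ bs)} \<noteq> {} \<Longrightarrow>
      f n \<le> real (card {bs \<in> tuples (Dm n) (card J). ct_sat N 0 p' n (B n) (as @ bs)})"
    and cof: "tau_cofinal N 0 p'"
    using p'(3) unfolding uniformly_unbounded_def Let_def by blast
  obtain M where M: "\<And>n. n \<ge> 1 \<Longrightarrow> card (Rr n) \<le> M" using rare_bounded[of 0] unfolding Rr_def by blast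
  \<comment> \<open>The closure of the parameters has at most \<open>k + M\<close> elements and each
    ball of radius 1 at most \<open>\<Delta> + 1\<close>, so this bounds the number of nearby
    tuples.\<close>
  define X where "X = ((k + M) * (\<Delta> + 1)) ^ card J"
  have lp: "length (ct_pts p') = k + card J" using p'(1) by (simp add: is_complete_ctype_def ct_pts_length)
  obtain n where n: "n \<ge> 1" "\<exists>as\<in>tuples (Dm n) (k + card J). ct_sat N 0 p' n (B n) as" "real X < f n"
    using frequently_superlog[OF cof[unfolded tau_cofinal_def lp] f(1)] by metis
  then obtain v where v: "v \<in> tuples (Dm n) (k + card J)" "ct_sat N 0 p' n (B n) v" by blast
  define as where "as = take k v"
  have as: "as \<in> tuples (Dm n) k" "drop k v \<in> tuples (Dm n) (card J)" "v = as @ drop k v"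
    using v(1) set_take_subset[of k v] set_drop_subset[of k v] by (auto simp: as_def tuples_def)
  let ?S = "{cs \<in> tuples (Dm n) (card J). ct_sat N 0 p' n (B n) (as @ cs)}"
  let ?Y = "\<Union>x\<in>set as \<union> Rr n. ball n 1 x"
  have "?S \<noteq> {}" using as v by auto
  then have "f n \<le> real (card ?S)" using f(2) n(1) as(1) by blast
  moreover have "card ?S \<le> X"
  proof -
    have "?S \<subseteq> tuples ?Y (card J)"
    proof
      fix cs assume "cs \<in> ?S"
      then have cs: "cs \<in> tuples (Dm n) (card J)" "ct_sat N 0 p' n (B n) (as @ cs)" by auto
      have t: "as @ cs \<in> tuples (Dm n) (k + card J)" using as cs by (auto simp: tuples_def)
      obtain g where g: "bij_betw g (set (as1 @ nths bs1 J) \<union> Rr n1) (set (as @ cs) \<union> Rr n)" "map g (as1 @ nths bs1 J) = as @ cs"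
        "\<And>R xs. R \<in> \<tau> \<Longrightarrow> set xs \<subseteq> set (as1 @ nths bs1 J) \<union> Rr n1 \<Longrightarrow> xs \<in> rel (B n1) R \<longleftrightarrow> map g xs \<in> rel (B n) R"
        "g ` Rr n1 = Rr n"
        using ct_iso[OF sat1 cs(2) p'(1) order_refl base_world_N[OF i(1)] base_world_N[OF n(1)] t1 t] by metis
      have "map g as1 = as" "map g (nths bs1 J) = cs" using g(2) i(2) as(1) by (auto simp: tuples_def)
      from nearby_iso[OF g(1)[unfolded set_append] this g(3)[unfolded set_append] g(4) J(3)] have "nearby n as cs"
        by blast
      then show "cs \<in> tuples ?Y (card J)" using nearby_ball cs(1) by (auto simp: tuples_def)
    qed
    moreover have fin: "finite (set as \<union> Rr n)" using Rr_sub finite_Dm[OF n(1)] by (auto intro: finite_subset)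
    then have finY: "finite ?Y" using ball_card[OF n(1)] by blast
    ultimately have "card ?S \<le> card ?Y ^ card J"
      using card_mono[OF finite_tuples[OF finY]] card_tuples[OF finY] by metis
    also have "card ?Y \<le> (\<Sum>x\<in>set as \<union> Rr n. card (ball n 1 x))" by (rule card_UN_le[OF fin])
    also have "\<dots> \<le> card (set as \<union> Rr n) * (\<Delta> + 1)"
      using sum_bounded_above[of "set as \<union> Rr n" "\<lambda>x. card (ball n 1 x)" "\<Delta> + 1"] ball_card[OF n(1), of 1] by simp
    also have "\<dots> \<le> (k + M) * (\<Delta> + 1)"
      using card_Un_le[of "set as" "Rr n"] card_length[of as] as(1) M[OF n(1)] by (intro mult_right_mono) (auto simp: tuples_def)
    finally show ?thesis unfolding X_def by (auto simp: power_mono)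
  qed
  ultimately show False using n(3) by linarith
qed

text \<open>All realizations of the restriction of \<open>p\<close> to a set of positions have the
  same code there, so they are counted by \<open>count\<close>. Cofinality makes this count exceed
  any bound for some n, and \<open>conn_count_slog\<close> upgrades this to growth at all large
  n.\<close>

lemma strong_good:
  assumes p: "is_complete_ctype N \<tau> (k + m) p" "strongly_unbounded N 0 k m p"
    and i: "n1 \<ge> 1" "as1 \<in> tuples (Dm n1) k" "bs1 \<in> tuples (Dm n1) m" "ct_sat N 0 p n1 (B n1) (as1 @ bs1)"
  shows "good m (tp \<tau> (B n1) bs1)"
  unfolding good_def
proof (intro allI impI, elim conjE)
  fix js :: "nat list"
  let ?t = "tp \<tau> (B n1) bs1"
  assume js: "js \<noteq> []" "sorted_wrt (<) js" "set js \<subseteq> {..<m}" and conn: "conn (sub ?t js)"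
  define J where "J = set js"
  have len: "length bs1 = m" using i by (simp add: tuples_def)
  have cJ: "card J = length js" using js(2) distinct_sorted_lt distinct_card unfolding J_def by blast
  have n1s: "nths bs1 J = map ((!) bs1) js" unfolding J_def using js len by (intro nths_sorted) auto
  have J: "J \<subseteq> {..<m}" "J \<noteq> {}" using js by (auto simp: J_def)
  obtain p' where p': "is_complete_ctype N \<tau> (k + card J) p'"
    "ct_sat N 0 p' n1 (B n1) (as1 @ nths bs1 J)" "uniformly_unbounded N 0 k (card J) p'"
    by (rule strongD[OF p(2) J i])
  have sat1: "ct_sat N 0 p' n1 (B n1) (as1 @ nths bs1 J)" by (rule p'(2))
  have t1: "as1 @ nths bs1 J \<in> tuples (Dm n1) (k + card J)"
    using i cJ n1s set_nths_subset[of bs1 J] by (auto simp: tuples_def)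
  obtain f where f: "superlog f" "\<And>n as. n \<ge> 1 \<Longrightarrow> as \<in> tuples (Dm n) k \<Longrightarrow>
      {bs \<in> tuples (Dm n) (card J). ct_sat N 0 p' n (B n) (as @ bs)} \<noteq> {} \<Longrightarrow>
      f n \<le> real (card {bs \<in> tuples (Dm n) (card J). ct_sat N 0 p' n (B n) (as @ bs)})"
    and cof: "tau_cofinal N 0 p'"
    using p'(3) unfolding uniformly_unbounded_def Let_def by blast
  have lp: "length (ct_pts p') = k + card J" using p'(1) by (simp add: is_complete_ctype_def ct_pts_length)
  obtain rs1 where rs1: "set rs1 = Rr n1"
    using finite_list finite_subset[OF Rr_sub finite_Dm[OF i(1)]] by blast
  show "slog (count (sub ?t js) (length js))"
  proof (rule conn_count_slog[OF _ conn])
    show "length js \<ge> 1" using js(1) by (cases js) auto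
    fix X
    obtain n where n: "n \<ge> 1" "\<exists>as\<in>tuples (Dm n) (k + card J). ct_sat N 0 p' n (B n) as" "real X < f n"
      using frequently_superlog[OF cof[unfolded tau_cofinal_def lp] f(1)] by metis
    then obtain v where v: "v \<in> tuples (Dm n) (k + card J)" "ct_sat N 0 p' n (B n) v" by blast
    define as where "as = take k v"
    have as: "as \<in> tuples (Dm n) k" "drop k v \<in> tuples (Dm n) (card J)" "v = as @ drop k v"
      using v(1) set_take_subset[of k v] set_drop_subset[of k v] by (auto simp: as_def tuples_def)
    let ?S = "{cs \<in> tuples (Dm n) (card J). ct_sat N 0 p' n (B n) (as @ cs)}"
    have "?S \<noteq> {}" using as v by auto
    then have "f n \<le> real (card ?S)" using f(2) n(1) as(1) by blast
    moreover have "card ?S \<le> count (sub ?t js) (length js) n"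
      unfolding count_def
    proof (rule card_mono)
      show "finite {cs \<in> tuples (Dm n) (length js). tp \<tau> (B n) cs = sub ?t js}"
        using finite_tuples[OF finite_Dm[OF n(1)]] by simp
      show "?S \<subseteq> {cs \<in> tuples (Dm n) (length js). tp \<tau> (B n) cs = sub ?t js}"
      proof
        fix cs assume "cs \<in> ?S"
        then have cs: "cs \<in> tuples (Dm n) (card J)" "ct_sat N 0 p' n (B n) (as @ cs)" by auto
        have t: "as @ cs \<in> tuples (Dm n) (k + card J)" using as cs by (auto simp: tuples_def)
        obtain rs where "tp \<tau> (B n1) ((as1 @ nths bs1 J) @ rs1) = tp \<tau> (B n) ((as @ cs) @ rs)"
          using ct_codes[OF sat1 cs(2) p'(1) order_refl base_world_N[OF i(1)] base_world_N[OF n(1)] t1 t rs1] by metis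
        from tp_take_cong(1)[OF this] have "tp \<tau> (B n1) (as1 @ nths bs1 J) = tp \<tau> (B n) (as @ cs)"
          using t t1 by (simp add: tuples_def)
        from tp_take_cong(2)[OF this] have "tp \<tau> (B n1) (nths bs1 J) = tp \<tau> (B n) cs"
          using as(1) i(2) by (simp add: tuples_def)
        moreover have "tp \<tau> (B n1) (nths bs1 J) = sub ?t js" unfolding n1s using js(3) len by (intro sub_tp) auto
        ultimately show "cs \<in> {cs \<in> tuples (Dm n) (length js). tp \<tau> (B n) cs = sub ?t js}" using cs(1) cJ by simp
      qed
    qed
    ultimately show "\<exists>n\<ge>1. X < count (sub ?t js) (length js) n" using n by (intro exI[of _ n]) linarith
  qed
qed

lemma append_positions:
  assumes "length as = k" "length rs = r" "length bs = m"
  shows "as @ bs = map ((!) (as @ rs @ bs)) ([0..<k] @ [k + r..<k + r + m])"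
  using assms by (auto intro!: nth_equalityI simp: nth_append)

text \<open>\<open>ct_sat_code\<close> for parameters, rare elements and bound variables in this
  order; relations outside \<open>\<tau> \<union> L\<close> are empty in these worlds, so the
  smaller code suffices.\<close>

lemma ct_sat_tp:
  assumes p: "is_ctype N \<sigma> (k + m) p" and L: "initial N L"
    and w: "A \<in> worlds (subnet N L) n" "A' \<in> worlds (subnet N L) n'"
    and as: "as \<in> tuples (Dm n) k" "as' \<in> tuples (Dm n') k" and bs: "bs \<in> tuples (Dm n) m" "bs' \<in> tuples (Dm n') m"
    and rs: "set rs = Rr n" "set rs' = Rr n'" "length rs = length rs'"
    and t: "tp (\<tau> \<union> L) A (as @ rs @ bs) = tp (\<tau> \<union> L) A' (as' @ rs' @ bs')"
    and s: "ct_sat N 0 p n A (as @ bs)"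
  shows "ct_sat N 0 p n' A' (as' @ bs')"
proof -
  let ?js = "[0..<k] @ [k + length rs..<k + length rs + m]"
  have l: "length as = k" "length as' = k" "length bs = m" "length bs' = m" using as bs by (auto simp: tuples_def)
  have "tp \<sigma> A (as @ rs @ bs) = tp \<sigma> A' (as' @ rs' @ bs')"
    by (rule tp_extend[OF t initialD(6)[OF L]]) (simp add: world(3)[OF w(1)] world(3)[OF w(2)])
  moreover have "A \<in> worlds N n" "A' \<in> worlds N n'" using world_N w initialD(1)[OF L] by blast+
  ultimately show ?thesis
  proof (rule ct_sat_code[OF s p])
    show "set (as @ rs @ bs) \<subseteq> Dm n" using as bs rs Rr_sub[of n] by (auto simp: tuples_def)
    show "set (as' @ rs' @ bs') \<subseteq> Dm n'" using as bs rs Rr_sub[of n'] by (auto simp: tuples_def)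
    show "as @ bs = map ((!) (as @ rs @ bs)) ?js" using l by (intro append_positions) auto
    show "as' @ bs' = map ((!) (as' @ rs' @ bs')) ?js" using l rs(3) by (intro append_positions) auto
    show "set ?js \<subseteq> {..<length (as @ rs @ bs)}" using l by auto
  qed (use rs in auto)
qed

lemma is_ctype_tau: "is_ctype N \<rho> k p \<Longrightarrow> is_ctype N \<sigma> k (ct_tau p)"
  by (simp add: is_ctype_def ct_tau_def)

text \<open>Realizations are free by \<open>strong_free\<close> and have the right code by
  \<open>ct_codes\<close>; conversely, gluing determines the code of the whole. Thus the candidates
  of a conditioning type are the free extensions to which \<open>balance\<close> applies.\<close>

lemma Ext_eq:
  assumes p: "is_ctype N \<sigma> (k + m) p" "strongly_unbounded N 0 k m (ct_tau p)"
    and i: "n1 \<ge> 1" "as1 \<in> tuples (Dm n1) k" "bs1 \<in> tuples (Dm n1) m" "ct_sat N 0 (ct_tau p) n1 (B n1) (as1 @ bs1)"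
      "set rs1 = Rr n1" "length rs1 = length rs"
    and n: "n \<ge> 1" "as \<in> tuples (Dm n) k" "set rs = Rr n"
    and t: "tp \<tau> (B n) (as @ rs) = tp \<tau> (B n1) (as1 @ rs1)"
  shows "{bs \<in> tuples (Dm n) m. ct_sat N 0 (ct_tau p) n (B n) (as @ bs)} = Ext n m (tp \<tau> (B n1) bs1) (as @ rs)"
proof (intro set_eqI iffI)
  note c = is_complete_ctype_tau[OF p(1)]
  fix bs assume "bs \<in> {bs \<in> tuples (Dm n) m. ct_sat N 0 (ct_tau p) n (B n) (as @ bs)}"
  then have bs: "bs \<in> tuples (Dm n) m" "ct_sat N 0 (ct_tau p) n (B n) (as @ bs)" by auto
  have "wfree \<tau> (B n) (as @ rs) bs" using strong_free[OF c p(2) n(1,2) bs] n(3) by simp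
  moreover have "tp \<tau> (B n) bs = tp \<tau> (B n1) bs1"
  proof -
    have tt: "as1 @ bs1 \<in> tuples (Dm n1) (k + m)" "as @ bs \<in> tuples (Dm n) (k + m)"
      using i n bs by (auto simp: tuples_def)
    obtain rs' where "tp \<tau> (B n) ((as @ bs) @ rs) = tp \<tau> (B n1) ((as1 @ bs1) @ rs')"
      using ct_codes[OF bs(2) i(4) c order_refl base_world_N[OF n(1)] base_world_N[OF i(1)] tt(2,1) n(3)] by metis
    from tp_take_cong(1)[OF this] have "tp \<tau> (B n) (as @ bs) = tp \<tau> (B n1) (as1 @ bs1)"
      using tt by (simp add: tuples_def)
    from tp_take_cong(2)[OF this] show ?thesis using n(2) i(2) by (simp add: tuples_def)
  qed
  ultimately show "bs \<in> Ext n m (tp \<tau> (B n1) bs1) (as @ rs)" using bs(1) by (simp add: Ext_def)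
next
  fix bs assume "bs \<in> Ext n m (tp \<tau> (B n1) bs1) (as @ rs)"
  then have bs: "bs \<in> tuples (Dm n) m" "tp \<tau> (B n) bs = tp \<tau> (B n1) bs1" "wfree \<tau> (B n) (as @ rs) bs"
    by (auto simp: Ext_def)
  have "wfree \<tau> (B n1) (as1 @ rs1) bs1"
    using strong_free[OF is_complete_ctype_tau[OF p(1)] p(2) i(1-4)] i(5) by simp
  from glue[OF t bs(2,3) this] have "tp (\<tau> \<union> {}) (B n1) (as1 @ rs1 @ bs1) = tp (\<tau> \<union> {}) (B n) (as @ rs @ bs)"
    by (simp add: append_assoc)
  from ct_sat_tp[OF is_ctype_tau[OF p(1)] initial_empty base_world[OF i(1)] base_world[OF n(1)] i(2) n(2) i(3) bs(1) i(5) n(3) i(6) this i(4)]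
  show "bs \<in> {bs \<in> tuples (Dm n) m. ct_sat N 0 (ct_tau p) n (B n) (as @ bs)}" using bs(1) by simp
qed

text \<open>Every extension conflicts with itself, so once there is one, \<open>conflicts\<close>
  with constant 1 bounds their number below by ln n.\<close>

lemma Ext_large:
  assumes t: "good m t" "m \<ge> 1" "tp \<tau> A bs = t" "length bs = m"
  shows "\<forall>\<^sub>F n in sequentially. \<forall>us\<in>tuples (Dm n) K. X \<le> real (card (Ext n m t us))"
  using conflicts[OF t(1), of 1 K, simplified] Ext_nonempty[OF t, of K] eventually_ln_ge[of X] eventually_ge_at_top[of 1]
proof eventually_elim
  case (elim n)
  show ?case
  proof
    fix us assume us: "us \<in> tuples (Dm n) K"
    then obtain u where u: "u \<in> Ext n m t us" using elim(2) by blast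
    have "u \<in> {v \<in> Ext n m t us. set u \<inter> set v \<noteq> {}}" using u t(2) by (cases u) (auto simp: Ext_def tuples_def)
    then have "1 \<le> card {v \<in> Ext n m t us. set u \<inter> set v \<noteq> {}}"
      using finite_Ext[OF elim(4), of m t us] by (metis (no_types, lifting) One_nat_def Suc_leI card_gt_0_iff empty_iff finite_subset mem_Collect_eq subsetI)
    then have "ln (real n) * 1 \<le> ln (real n) * card {v \<in> Ext n m t us. set u \<inter> set v \<noteq> {}}"
      using elim(4) by (intro mult_left_mono) auto
    also have "\<dots> \<le> card (Ext n m t us)" using elim(1) us u by blast
    finally show "X \<le> real (card (Ext n m t us))" using elim(3) by simp
  qed
qed

text \<open>Positivity concerns complete types of some radius \<open>g\<close>. Finitely many of
  them cover all parameters; those compatible with \<open>p\<close> only for finitely many n drop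
  out for large n, and the others give a common lower bound on the proportion. As \<kappa> mentions
  only relations from \<open>\<tau> \<union> L\<close>, the statement descends from the full network
  to the subnetwork.\<close>

lemma positive_whp:
  assumes L: "initial N L" and \<kappa>: "is_pla ar (\<tau> \<union> L) \<kappa>" and vars: "length ys = k" "length zs = m"
    and p: "is_ctype N \<sigma> (k + m) p" "expresses N 0 (ys @ zs) p \<kappa>" "positive N 0 k m p"
  obtains \<alpha> where "\<alpha> > 0" "whp N L (\<lambda>n A. \<forall>as\<in>tuples (Dm n) k. {bs \<in> tuples (Dm n) m. ct_sat N 0 p n A (as @ bs)} \<noteq> {} \<longrightarrow>
    \<alpha> * real (card {bs \<in> tuples (Dm n) m. ct_sat N 0 (ct_tau p) n (B n) (as @ bs)}) \<le>
      real (card {bs \<in> tuples (Dm n) m. ct_sat N 0 p n A (as @ bs)}))"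
proof -
  obtain g where g: "\<And>q. is_complete_ctype N \<sigma> k q \<Longrightarrow>
        (\<exists>\<^sub>F n in sequentially. \<exists>A \<in> worlds N n. \<exists>as \<in> tuples (dom A) k. \<exists>bs \<in> tuples (dom A) m.
            ct_sat N 0 p n A (as @ bs) \<and> ct_sat N g q n A as) \<Longrightarrow> \<exists>\<alpha>>0. balanced N \<alpha> 0 k m p g q"
    using p(3) unfolding positive_def by blast
  obtain Mg where Mg: "\<And>n. n \<ge> 1 \<Longrightarrow> card {b. rare N g n b} \<le> Mg" using rare_bounded by blast
  define Q where "Q = {q. is_complete_ctype N \<sigma> k q \<and> dom (ct_struc q) \<subseteq> {..<k * (\<Delta> + 1) ^ g + Mg}}"
  have finQ: "finite Q" unfolding Q_def by (rule finite_complete_ctypes)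
  define hit where "hit q n \<longleftrightarrow> (\<exists>A \<in> worlds N n. \<exists>as \<in> tuples (dom A) k. \<exists>bs \<in> tuples (dom A) m.
            ct_sat N 0 p n A (as @ bs) \<and> ct_sat N g q n A as)" for q n
  define Q1 where "Q1 = {q \<in> Q. \<exists>\<^sub>F n in sequentially. hit q n}"
  have "\<forall>q\<in>Q1. \<exists>\<alpha>>0. balanced N \<alpha> 0 k m p g q" using g unfolding Q1_def Q_def hit_def by blast
  then obtain al where al: "\<And>q. q \<in> Q1 \<Longrightarrow> al q > 0" "\<And>q. q \<in> Q1 \<Longrightarrow> balanced N (al q) 0 k m p g q" by metis
  have finQ1: "finite Q1" using finQ by (simp add: Q1_def)
  \<comment> \<open>Balance is used with half its constant as the error; the 1 keeps the minimum
    defined when no type is left.\<close>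
  define \<alpha> where "\<alpha> = Min (insert 1 ((\<lambda>q. al q / 2) ` Q1))"
  have \<alpha>: "\<alpha> > 0" "\<And>q. q \<in> Q1 \<Longrightarrow> \<alpha> \<le> al q / 2"
    unfolding \<alpha>_def using finQ1 al(1) by (auto simp: Min_gr_iff simp del: divide_le_eq_numeral1 le_divide_eq_numeral1 intro!: Min_le)
  let ?P = "\<lambda>n A as. {bs \<in> tuples (Dm n) m. ct_sat N 0 p n A (as @ bs)}"
  let ?S = "\<lambda>n as. {bs \<in> tuples (Dm n) m. ct_sat N 0 (ct_tau p) n (B n) (as @ bs)}"
  define E where "E n A \<longleftrightarrow> (\<forall>as\<in>tuples (Dm n) k. ?P n A as \<noteq> {} \<longrightarrow> \<alpha> * real (card (?S n as)) \<le> real (card (?P n A as)))" for n A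
  have full: "whp N (\<sigma> - \<tau>) (\<lambda>n A. \<forall>q\<in>Q1. \<forall>as\<in>tuples (dom A) k. ct_sat N g q n A as \<longrightarrow>
      (al q - al q / 2) * real (card {bs \<in> tuples (dom A) m. ct_sat N 0 (ct_tau p) n A (as @ bs)}) \<le>
      real (card {bs \<in> tuples (dom A) m. ct_sat N 0 p n A (as @ bs)}))"
  proof (rule whp_ball[OF initial_full finQ1])
    fix q assume q: "q \<in> Q1"
    define Bq where "Bq n A \<longleftrightarrow> (\<forall>as \<in> tuples (dom A) k. ct_sat N g q n A as \<longrightarrow>
        (let P = {bs \<in> tuples (dom A) m. ct_sat N 0 p n A (as @ bs)};
             Q = {bs \<in> tuples (dom A) m. ct_sat N 0 (ct_tau p) n A (as @ bs)}
         in (al q - al q / 2) * real (card Q) \<le> real (card P) \<and> real (card P) \<le> (al q + al q / 2) * real (card Q)))" for n A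
    have "0 < al q / 2" using al(1)[OF q] by simp
    then have lim: "(\<lambda>n. prob N n (Bq n)) \<longlonglongrightarrow> 1"
      using al(2)[OF q] unfolding balanced_def Bq_def by blast
    have "whp N (\<sigma> - \<tau>) Bq" unfolding whp_def
    proof (intro allI impI)
      fix \<epsilon> :: real assume "\<epsilon> > 0"
      then have "\<forall>\<^sub>F n in sequentially. 1 - \<epsilon> < prob N n (Bq n)" using order_tendstoD(1)[OF lim, of "1 - \<epsilon>"] by simp
      then show "\<forall>\<^sub>F n in sequentially. prob (subnet N (\<sigma> - \<tau>)) n (\<lambda>A. \<not> Bq n A) \<le> \<epsilon>"
        using eventually_ge_at_top[of 1]
      proof eventually_elim
        case (elim n)
        then show ?case using prob_not[OF initial_full elim(2), of "Bq n"] by (simp add: subnet_full)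
      qed
    qed
    then show "whp N (\<sigma> - \<tau>) (\<lambda>n A. \<forall>as\<in>tuples (dom A) k. ct_sat N g q n A as \<longrightarrow>
      (al q - al q / 2) * real (card {bs \<in> tuples (dom A) m. ct_sat N 0 (ct_tau p) n A (as @ bs)}) \<le>
      real (card {bs \<in> tuples (dom A) m. ct_sat N 0 p n A (as @ bs)}))"
      by (rule whp_mono[OF initial_full]) (auto simp: Bq_def Let_def)
  qed
  \<comment> \<open>Each of these finitely many types is hit for finitely many n only.\<close>
  have nohit: "\<forall>\<^sub>F n in sequentially. \<forall>q\<in>Q - Q1. \<not> hit q n"
    using finQ by (intro eventually_ball_finite) (auto simp: Q1_def frequently_def)
  have fullE: "whp N (\<sigma> - \<tau>) E"
  proof (rule whp_mono[OF initial_full full])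
    show "\<forall>\<^sub>F n in sequentially. \<forall>A\<in>worlds (subnet N (\<sigma> - \<tau>)) n. (\<forall>q\<in>Q1. \<forall>as\<in>tuples (dom A) k. ct_sat N g q n A as \<longrightarrow>
      (al q - al q / 2) * real (card {bs \<in> tuples (dom A) m. ct_sat N 0 (ct_tau p) n A (as @ bs)}) \<le>
      real (card {bs \<in> tuples (dom A) m. ct_sat N 0 p n A (as @ bs)})) \<longrightarrow> E n A"
      using nohit eventually_ge_at_top[of 1]
    proof (eventually_elim, intro ballI impI)
      fix n A assume nh: "\<forall>q\<in>Q - Q1. \<not> hit q n" and n: "(1::nat) \<le> n" and A: "A \<in> worlds (subnet N (\<sigma> - \<tau>)) n"
        and H: "\<forall>q\<in>Q1. \<forall>as\<in>tuples (dom A) k. ct_sat N g q n A as \<longrightarrow>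
      (al q - al q / 2) * real (card {bs \<in> tuples (dom A) m. ct_sat N 0 (ct_tau p) n A (as @ bs)}) \<le>
      real (card {bs \<in> tuples (dom A) m. ct_sat N 0 p n A (as @ bs)})"
      have AN: "A \<in> worlds N n" using A by (simp add: subnet_full)
      have d: "dom A = Dm n" by (rule worldN(1)[OF AN])
      show "E n A" unfolding E_def
      proof (intro ballI impI)
        fix as assume as: "as \<in> tuples (Dm n) k" and ne: "?P n A as \<noteq> {}"
        obtain q where q: "is_complete_ctype N \<sigma> k q" "dom (ct_struc q) = {..<card (closure_set N g n as)}" "ct_sat N g q n A as"
          using complete_copy[OF n AN as] by metis
        have "card (closure_set N g n as) \<le> card (nbhd \<tau> (B n) g as) + card {b. rare N g n b}"
          unfolding closure_set_def by (rule card_Un_le)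
        also have "\<dots> \<le> k * (\<Delta> + 1) ^ g + Mg"
          using nbhd_card(2)[OF n, of g as] Mg[OF n] as by (simp add: tuples_def)
        finally have "q \<in> Q" using q by (auto simp: Q_def)
        moreover have "hit q n"
        proof -
          obtain bs where "bs \<in> tuples (Dm n) m" "ct_sat N 0 p n A (as @ bs)" using ne by blast
          then show ?thesis unfolding hit_def using AN as q(3) d
            by (intro bexI[of _ A] bexI[of _ as] bexI[of _ bs]) auto
        qed
        ultimately have qQ: "q \<in> Q1" using nh by blast
        have "\<alpha> * real (card (?S n as)) \<le> (al q - al q / 2) * real (card (?S n as))"
          using \<alpha>(2)[OF qQ] by (intro mult_right_mono) auto
        also have "\<dots> \<le> real (card (?P n A as))"
          using H qQ as q(3) unfolding d ct_tau_world[OF AN] by blast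
        finally show "\<alpha> * real (card (?S n as)) \<le> real (card (?P n A as))" .
      qed
    qed
  qed
  \<comment> \<open>Satisfaction of \<open>p\<close> can be read off from the value of \<kappa>,
    which does not see the relations removed by \<open>red\<close>.\<close>
  have inv: "E n A \<longleftrightarrow> E n (red (\<tau> \<union> L) A)" if n: "n \<ge> 1" and A: "A \<in> worlds (subnet N (\<sigma> - \<tau>)) n" for n A
  proof -
    have AN: "A \<in> worlds N n" using A by (simp add: subnet_full)
    have rN: "red (\<tau> \<union> L) A \<in> worlds N n"
      using world_N[OF red_world[OF A initialD(1)[OF L]]] initialD(1)[OF L] by blast
    have "ct_sat N 0 p n A (as @ bs) \<longleftrightarrow> ct_sat N 0 p n (red (\<tau> \<union> L) A) (as @ bs)"
      if "as \<in> tuples (Dm n) k" "bs \<in> tuples (Dm n) m" for as bs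
    proof -
      have t: "as @ bs \<in> tuples (Dm n) (length (ys @ zs))" using that vars by (auto simp: tuples_def)
      have "eval A \<kappa> (asg (ys @ zs) (as @ bs)) = eval (red (\<tau> \<union> L) A) \<kappa> (asg (ys @ zs) (as @ bs))"
        by (rule eval_reduct[OF \<kappa>]) auto
      then have "(of_bool (ct_sat N 0 p n A (as @ bs)) :: real) = of_bool (ct_sat N 0 p n (red (\<tau> \<union> L) A) (as @ bs))"
        using p(2) n AN rN t worldN(1)[OF AN] unfolding expresses_def by (metis red_simps(1))
      then show ?thesis by (simp only: of_bool_eq_iff)
    qed
    then have "?P n A as = ?P n (red (\<tau> \<union> L) A) as" if "as \<in> tuples (Dm n) k" for as using that by blast
    then show ?thesis unfolding E_def by (metis (no_types, lifting))
  qed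
  have "whp N L E" unfolding whp_def
  proof (intro allI impI)
    fix \<epsilon> :: real assume "\<epsilon> > 0"
    then have "\<forall>\<^sub>F n in sequentially. prob (subnet N (\<sigma> - \<tau>)) n (\<lambda>A. \<not> E n A) \<le> \<epsilon>" using fullE by (simp add: whp_def)
    then show "\<forall>\<^sub>F n in sequentially. prob (subnet N L) n (\<lambda>A. \<not> E n A) \<le> \<epsilon>"
      using eventually_ge_at_top[of 1]
    proof eventually_elim
      case (elim n)
      have "prob (subnet N L) n (\<lambda>A. \<not> E n A) = prob (subnet N (\<sigma> - \<tau>)) n (\<lambda>A. \<not> E n (red (\<tau> \<union> L) A))"
        using prob_red[OF initial_full L initialD(1)[OF L] elim(2), of "\<lambda>A. \<not> E n A"] by simp
      also have "\<dots> \<le> prob (subnet N (\<sigma> - \<tau>)) n (\<lambda>A. \<not> E n A)"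
        using inv[OF elim(2)] by (intro prob_mono[OF initial_full elim(2)]) auto
      finally show ?case using elim(1) by simp
    qed
  qed
  then show ?thesis using that[OF \<alpha>(1)] unfolding E_def by blast
qed

end

subsection \<open>One conditioning type of an aggregation\<close>

definition pos :: "'x list \<Rightarrow> 'x \<Rightarrow> nat" where
  "pos vs v = (LEAST j. j < length vs \<and> vs ! j = v)"

lemma pos: "v \<in> set vs \<Longrightarrow> pos vs v < length vs \<and> vs ! pos vs v = v"
  unfolding pos_def by (rule LeastI_ex) (auto simp: in_set_conv_nth)

text \<open>Connects the evaluation of an aggregation, which updates an assignment, with the
  hypothesis on its conditioning formulas, which is phrased for the list
  \<open>ys @ zs\<close>.\<close>

lemma upd_asg:
  assumes "distinct (ys @ zs)" "length bs = length zs" "v \<in> set (ys @ zs)"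
  shows "upd s zs bs v = asg (ys @ zs) (map s ys @ bs) v"
proof -
  let ?l = "ys @ zs"
  obtain j where j: "j < length ?l" "?l ! j = v" using assms(3) by (meson in_set_conv_nth)
  have a: "asg ?l (map s ys @ bs) v = (map s ys @ bs) ! j"
    using asg_nth[OF assms(1), of "map s ys @ bs" j] assms(2) j by simp
  show ?thesis
  proof (cases "j < length ys")
    case True
    then have "v = ys ! j" using j by (simp add: nth_append)
    moreover then have "v \<notin> set zs" using assms(1) nth_mem[OF True] by auto
    ultimately show ?thesis using a True by (simp add: upd_notin nth_append)
  next
    case False
    then have "j - length ys < length zs" "zs ! (j - length ys) = v" using j by (auto simp: nth_append)
    then show ?thesis using a False upd_nth[of zs bs "j - length ys" s] assms(1,2) by (simp add: nth_append)
  qed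
qed

text \<open>With the rare elements inserted between parameters and bound variables, the positions of
  the latter shift by \<open>r\<close>.\<close>

lemma asg_pos:
  assumes "distinct (ys @ zs)" "length as = length ys" "length bs = length zs" "v \<in> set (ys @ zs)" "length rs = r"
  shows "asg (ys @ zs) (as @ bs) v = (as @ rs @ bs) ! (if v \<in> set zs then length ys + r + pos zs v else pos ys v)"
proof (cases "v \<in> set zs")
  case True
  note p = pos[OF True]
  have "(ys @ zs) ! (length ys + pos zs v) = v" using p by simp
  then have "asg (ys @ zs) (as @ bs) v = (as @ bs) ! (length ys + pos zs v)"
    using asg_nth[OF assms(1), of "as @ bs" "length ys + pos zs v"] assms(2,3) p by simp
  then show ?thesis using True p assms by (simp add: nth_append)
next
  case False
  then have p: "pos ys v < length ys \<and> ys ! pos ys v = v" using assms(4) pos[of v ys] by simp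
  then have "(ys @ zs) ! pos ys v = v" by (simp add: nth_append)
  then have "asg (ys @ zs) (as @ bs) v = (as @ bs) ! pos ys v"
    using asg_nth[OF assms(1), of "as @ bs" "pos ys v"] assms(2,3) p by simp
  then show ?thesis using False p assms by (simp add: nth_append)
qed

text \<open>Respecting the arities makes this set finite, although index lists in a code may a
  priori have any length.\<close>

definition codes :: "('r \<Rightarrow> nat) \<Rightarrow> 'r set \<Rightarrow> nat \<Rightarrow> 'r code set" where
  "codes ar \<rho> n = Pow ({..<n} \<times> {..<n}) \<times> Pow (SIGMA R:\<rho>. tuples {..<n} (ar R))"

lemma finite_codes: "finite \<rho> \<Longrightarrow> finite (codes ar \<rho> n)"
  unfolding codes_def by (intro finite_cartesian_product finite_Pow_iff[THEN iffD2] finite_SigmaI finite_tuples) auto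

lemma tp_codes:
  assumes "\<And>R. R \<in> \<rho> \<Longrightarrow> rel A R \<subseteq> tuples X (ar R)"
  shows "tp \<rho> A us \<in> codes ar \<rho> (length us)"
proof -
  have "length is = ar R" if "R \<in> \<rho>" "map ((!) us) is \<in> rel A R" for R "is"
    using assms[OF that(1)] that(2) by (force simp: tuples_def)
  then show ?thesis by (auto simp: tp_def codes_def tuples_def)
qed

text \<open>After clearing denominators the error is at most \<open>2 * A * (\<eta> * S)\<close>,
  while \<open>T\<close> is at least \<open>A * S / 2\<close>.\<close>

lemma ratio_close:
  fixes S A b T c \<eta> \<delta> :: real
  assumes "S > 0" "A > 0" "0 \<le> b" "b \<le> A" "\<bar>c - b * S\<bar> \<le> \<eta> * S" "\<bar>T - A * S\<bar> \<le> \<eta> * S" "\<eta> \<le> A / 2" "4 * \<eta> / A \<le> \<delta>"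
  shows "\<bar>c / T - b / A\<bar> \<le> \<delta>"
proof -
  have "A * S / 2 \<ge> \<eta> * S" using assms(1,7) by (simp add: field_simps)
  then have T: "A * S / 2 \<le> T" using assms(6) by linarith
  have AS: "0 < A * S" using assms by simp
  then have T0: "T > 0" using T by linarith
  have "\<bar>c * A - b * T\<bar> \<le> 2 * A * (\<eta> * S)"
  proof -
    have "c * A - b * T = A * (c - b * S) - b * (T - A * S)" by (simp add: algebra_simps)
    then have "\<bar>c * A - b * T\<bar> \<le> A * \<bar>c - b * S\<bar> + b * \<bar>T - A * S\<bar>"
      using assms(2,3) abs_triangle_ineq4[of "A * (c - b * S)" "b * (T - A * S)"] by (simp add: abs_mult)
    also have "\<dots> \<le> A * (\<eta> * S) + A * (\<eta> * S)"
      using assms by (intro add_mono mult_mono) auto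
    finally show ?thesis by (simp add: mult_ac)
  qed
  moreover have "2 * A * (\<eta> * S) \<le> \<delta> * (T * A)"
  proof -
    have n4: "4 * \<eta> \<le> \<delta> * A" using assms(2,8) by (simp add: pos_divide_le_eq)
    have "0 \<le> \<eta>" using assms(1,5) by (smt (verit) mult_neg_pos)
    then have \<delta>0: "0 \<le> \<delta> * A" using n4 by linarith
    have "2 * A * (\<eta> * S) = 4 * \<eta> * (A * S / 2)" by simp
    also have "\<dots> \<le> (\<delta> * A) * (A * S / 2)" using n4 AS by (intro mult_right_mono) auto
    also have "\<dots> \<le> (\<delta> * A) * T" using T \<delta>0 by (rule mult_left_mono)
    finally show ?thesis by (simp add: mult_ac)
  qed
  ultimately have "\<bar>c * A - b * T\<bar> \<le> \<delta> * (T * A)" by linarith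
  moreover have "c / T - b / A = (c * A - b * T) / (T * A)" using T0 assms(2) by (simp add: field_simps)
  ultimately show ?thesis using T0 assms(2) by (simp add: pos_divide_le_eq)
qed

context base_seq
begin

lemma base_tp:
  assumes "A \<in> worlds (subnet N L) n"
  shows "tp \<tau> (B n) us = restr \<tau> (tp (\<tau> \<union> L) A us)"
  using restr_tp[of \<tau> "\<tau> \<union> L" A us] tp_Un_reduct[of \<tau> A "B n" us] world(2)[OF assms] by simp

text \<open>The realizations of the conditioning type split into classes by the code of the whole
  tuple. Class \<open>e\<close> has limit proportion \<open>al e\<close> among the free extensions
  and limit value \<open>c e\<close>. If the proportions sum to 0, positivity leaves only the empty
  set; otherwise the set is large and the value \<open>x\<close> has limit frequency
  \<open>wt x / A0\<close>.\<close>

lemma agg_part: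
  assumes L: "initial N L" and vars: "distinct (ys @ zs)" "length ys = k" "length zs = m" "m \<ge> 1"
    and \<phi>: "is_pla ar (\<tau> \<union> L) \<phi>" "fv \<phi> \<subseteq> set (ys @ zs)" "determined L \<phi>"
    and \<kappa>: "is_pla ar (\<tau> \<union> L) \<kappa>"
    and p: "is_ctype N \<sigma> (k + m) p" "expresses N 0 (ys @ zs) p \<kappa>" "strongly_unbounded N 0 k m (ct_tau p)" "positive N 0 k m p"
    and bal: "\<And>t. good m t \<Longrightarrow> balance L m t"
  defines "T \<equiv> \<lambda>n A as. {bs \<in> tuples (Dm n) m. ct_sat N 0 p n A (as @ bs)}"
  defines "val \<equiv> \<lambda>A as bs. eval A \<phi> (asg (ys @ zs) (as @ bs))"
  shows "whp N L (\<lambda>n A. \<forall>as\<in>tuples (Dm n) k. \<forall>rs\<in>tuples (Dm n) r. set rs = Rr n \<longrightarrow> tp (\<tau> \<union> L) A (as @ rs) = d \<longrightarrow> T n A as = {}) \<or>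
    (\<exists>ps. ct_params ps \<and> (\<forall>\<delta>>0. whp N L (\<lambda>n A. \<forall>as\<in>tuples (Dm n) k. \<forall>rs\<in>tuples (Dm n) r. set rs = Rr n \<longrightarrow>
      tp (\<tau> \<union> L) A (as @ rs) = d \<longrightarrow> T n A as \<noteq> {} \<and> ct_close \<delta> ps (image_mset (val A as) (mset_set (T n A as))))))"
proof (cases "\<exists>n1\<ge>1. \<exists>as1\<in>tuples (Dm n1) k. \<exists>bs1\<in>tuples (Dm n1) m. \<exists>rs1. set rs1 = Rr n1 \<and> length rs1 = r \<and>
    ct_sat N 0 (ct_tau p) n1 (B n1) (as1 @ bs1) \<and> tp \<tau> (B n1) (as1 @ rs1) = restr \<tau> d")
  case False
  have "whp N L (\<lambda>n A. \<forall>as\<in>tuples (Dm n) k. \<forall>rs\<in>tuples (Dm n) r. set rs = Rr n \<longrightarrow> tp (\<tau> \<union> L) A (as @ rs) = d \<longrightarrow> T n A as = {})"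
  proof (rule whp_always[OF L])
    show "\<forall>\<^sub>F n in sequentially. \<forall>A\<in>worlds (subnet N L) n. \<forall>as\<in>tuples (Dm n) k. \<forall>rs\<in>tuples (Dm n) r.
      set rs = Rr n \<longrightarrow> tp (\<tau> \<union> L) A (as @ rs) = d \<longrightarrow> T n A as = {}"
      using eventually_ge_at_top[of 1]
    proof (eventually_elim, intro ballI impI)
      fix n A as rs assume n: "(1::nat) \<le> n" and A: "A \<in> worlds (subnet N L) n" and as: "as \<in> tuples (Dm n) k"
        and rs: "rs \<in> tuples (Dm n) r" "set rs = Rr n" and d: "tp (\<tau> \<union> L) A (as @ rs) = d"
      have AN: "A \<in> worlds N n" using world_N[OF A initialD(1)[OF L]] .
      show "T n A as = {}"
      proof (rule ccontr)
        assume "T n A as \<noteq> {}"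
        then obtain bs where bs: "bs \<in> tuples (Dm n) m" "ct_sat N 0 p n A (as @ bs)" by (auto simp: T_def)
        have "ct_sat N 0 (ct_tau p) n (B n) (as @ bs)" using ct_sat_tau[OF bs(2)] ct_tau_world[OF AN] by simp
        moreover have "tp \<tau> (B n) (as @ rs) = restr \<tau> d" using base_tp[OF A] d by simp
        moreover have "length rs = r" using rs(1) by (simp add: tuples_def)
        ultimately show False using False n as bs(1) rs(2) by blast
      qed
    qed
  qed
  then show ?thesis by (rule disjI1)
next
  case True
  \<comment> \<open>One realization compatible with \<open>d\<close> over \<open>\<tau>\<close>
    fixes the type \<open>t\<close> of the bound variables for all n.\<close>
  then obtain n1 as1 bs1 rs1 where I: "n1 \<ge> 1" "as1 \<in> tuples (Dm n1) k" "bs1 \<in> tuples (Dm n1) m" "set rs1 = Rr n1" "length rs1 = r"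
    "ct_sat N 0 (ct_tau p) n1 (B n1) (as1 @ bs1)" "tp \<tau> (B n1) (as1 @ rs1) = restr \<tau> d" by blast
  define t where "t = tp \<tau> (B n1) bs1"
  have gt: "good m t" unfolding t_def by (rule strong_good[OF is_complete_ctype_tau[OF p(1)] p(3) I(1-3,6)])
  define EE where "EE = {e. \<exists>n\<ge>1. \<exists>A\<in>worlds (subnet N L) n. \<exists>as\<in>tuples (Dm n) k. \<exists>bs\<in>tuples (Dm n) m. \<exists>rs. set rs = Rr n \<and> length rs = r \<and>
     tp (\<tau> \<union> L) A (as @ rs @ bs) = e \<and> ct_sat N 0 p n A (as @ bs)}"
  have finEE: "finite EE"
  proof (rule finite_subset)
    show "finite (codes ar (\<tau> \<union> L) (k + r + m))"
      using finite_tau initialD(3)[OF L] by (intro finite_codes) auto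
    show "EE \<subseteq> codes ar (\<tau> \<union> L) (k + r + m)"
    proof
      fix e assume "e \<in> EE"
      then obtain n A as bs rs where E: "A \<in> worlds (subnet N L) n" "as \<in> tuples (Dm n) k" "bs \<in> tuples (Dm n) m" "length rs = r"
        "tp (\<tau> \<union> L) A (as @ rs @ bs) = e" unfolding EE_def by blast
      then have l: "length (as @ rs @ bs) = k + r + m" by (simp add: tuples_def)
      have "tp (\<tau> \<union> L) A (as @ rs @ bs) \<in> codes ar (\<tau> \<union> L) (length (as @ rs @ bs))"
        by (rule tp_codes) (rule world(4)[OF E(1)])
      then show "e \<in> codes ar (\<tau> \<union> L) (k + r + m)" unfolding l E(5) .
    qed
  qed
  define BA where "BA e x \<epsilon> \<longleftrightarrow> whp N L (\<lambda>n A. \<forall>us\<in>tuples (Dm n) (k + r). Rr n \<subseteq> set us \<longrightarrow> tp (\<tau> \<union> L) A us = d \<longrightarrow>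
     \<bar>real (card {bs \<in> Ext n m t us. tp (\<tau> \<union> L) A (us @ bs) = e}) - x * real (card (Ext n m t us))\<bar> \<le> \<epsilon> * real (card (Ext n m t us)))"
    for e and x \<epsilon> :: real
  have "\<forall>e. \<exists>x\<ge>0. \<forall>\<epsilon>>0. BA e x \<epsilon>" using bal[OF gt] unfolding balance_def BA_def by blast
  then obtain al where al: "\<And>e. 0 \<le> al e" "\<And>e \<epsilon>. \<epsilon> > 0 \<Longrightarrow> BA e (al e) \<epsilon>" by metis
  define \<iota> where "\<iota> v = (if v \<in> set zs then length ys + r + pos zs v else pos ys v)" for v
  define DE where "DE e x \<epsilon> \<longleftrightarrow> whp N L (\<lambda>n A. \<forall>V\<in>tuples (Dm n) (k + r + m). Rr n \<subseteq> set V \<longrightarrow> tp (\<tau> \<union> L) A V = e \<longrightarrow>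
    \<bar>eval A \<phi> (\<lambda>v. V ! \<iota> v) - x\<bar> \<le> \<epsilon>)" for e and x \<epsilon> :: real
  have "\<iota> v < k + r + m" if "v \<in> fv \<phi>" for v
    using that \<phi>(2) pos[of v zs] pos[of v ys] vars by (auto simp: \<iota>_def)
  then have "\<forall>e. \<exists>x\<in>{0..1}. \<forall>\<epsilon>>0. DE e x \<epsilon>" using \<phi>(3) unfolding determined_def DE_def by blast
  then obtain c where c: "\<And>e. c e \<in> {0..1}" "\<And>e \<epsilon>. \<epsilon> > 0 \<Longrightarrow> DE e (c e) \<epsilon>" by metis
  obtain ap where ap: "ap > 0" "whp N L (\<lambda>n A. \<forall>as\<in>tuples (Dm n) k. T n A as \<noteq> {} \<longrightarrow>
    ap * real (card {bs \<in> tuples (Dm n) m. ct_sat N 0 (ct_tau p) n (B n) (as @ bs)}) \<le> real (card (T n A as)))"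
    using positive_whp[OF L \<kappa> vars(2,3) p(1,2,4)] unfolding T_def by blast
  define A0 where "A0 = (\<Sum>e\<in>EE. al e)"
  define C where "C n A us e = {bs \<in> Ext n m t us. tp (\<tau> \<union> L) A (us @ bs) = e}" for n A us e
  have core: "T n A as = (\<Union>e\<in>EE. C n A (as @ rs) e)" "T n A as \<subseteq> Ext n m t (as @ rs)"
      "{bs \<in> tuples (Dm n) m. ct_sat N 0 (ct_tau p) n (B n) (as @ bs)} = Ext n m t (as @ rs)"
    if n: "n \<ge> 1" and A: "A \<in> worlds (subnet N L) n" and as: "as \<in> tuples (Dm n) k"
        and rs: "rs \<in> tuples (Dm n) r" "set rs = Rr n" and d: "tp (\<tau> \<union> L) A (as @ rs) = d" for n A as rs
  proof -
    have AN: "A \<in> worlds N n" using world_N[OF A initialD(1)[OF L]] .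
    have lr: "length rs = r" "length rs1 = length rs" using rs(1) I(5) by (simp_all add: tuples_def)
    show eq: "{bs \<in> tuples (Dm n) m. ct_sat N 0 (ct_tau p) n (B n) (as @ bs)} = Ext n m t (as @ rs)"
      unfolding t_def
    proof (rule Ext_eq[OF p(1,3) I(1-3,6,4) lr(2) n as rs(2)])
      show "tp \<tau> (B n) (as @ rs) = tp \<tau> (B n1) (as1 @ rs1)" using base_tp[OF A] d I(7) by simp
    qed
    have "T n A as \<subseteq> {bs \<in> tuples (Dm n) m. ct_sat N 0 (ct_tau p) n (B n) (as @ bs)}"
      unfolding T_def using ct_sat_tau ct_tau_world[OF AN] by blast
    then show sub: "T n A as \<subseteq> Ext n m t (as @ rs)" unfolding eq .
    show "T n A as = (\<Union>e\<in>EE. C n A (as @ rs) e)"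
    proof (intro set_eqI iffI)
      fix bs assume b: "bs \<in> T n A as"
      then have "tp (\<tau> \<union> L) A (as @ rs @ bs) \<in> EE"
        unfolding EE_def T_def using n A as rs lr by blast
      then show "bs \<in> (\<Union>e\<in>EE. C n A (as @ rs) e)" using sub b by (auto simp: C_def)
    next
      fix bs assume "bs \<in> (\<Union>e\<in>EE. C n A (as @ rs) e)"
      then have b: "bs \<in> Ext n m t (as @ rs)" "tp (\<tau> \<union> L) A (as @ rs @ bs) \<in> EE" by (auto simp: C_def)
      then have bt: "bs \<in> tuples (Dm n) m" by (simp add: Ext_def)
      obtain n2 A2 as2 bs2 rs2 where E: "n2 \<ge> 1" "A2 \<in> worlds (subnet N L) n2" "as2 \<in> tuples (Dm n2) k" "bs2 \<in> tuples (Dm n2) m"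
        "set rs2 = Rr n2" "length rs2 = r"
        "tp (\<tau> \<union> L) A2 (as2 @ rs2 @ bs2) = tp (\<tau> \<union> L) A (as @ rs @ bs)" "ct_sat N 0 p n2 A2 (as2 @ bs2)"
        using b(2) unfolding EE_def by blast
      have "length rs2 = length rs" using E(6) lr(1) by simp
      from ct_sat_tp[OF p(1) L E(2) A E(3) as E(4) bt E(5) rs(2) this E(7,8)]
      show "bs \<in> T n A as" using bt by (simp add: T_def)
    qed
  qed
  define W where "W \<eta> n A \<longleftrightarrow> (\<forall>e\<in>EE. \<forall>us\<in>tuples (Dm n) (k + r). Rr n \<subseteq> set us \<longrightarrow> tp (\<tau> \<union> L) A us = d \<longrightarrow>
     \<bar>real (card (C n A us e)) - al e * real (card (Ext n m t us))\<bar> \<le> \<eta> * real (card (Ext n m t us))) \<and>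
    (\<forall>e\<in>EE. \<forall>V\<in>tuples (Dm n) (k + r + m). Rr n \<subseteq> set V \<longrightarrow> tp (\<tau> \<union> L) A V = e \<longrightarrow> \<bar>eval A \<phi> (\<lambda>v. V ! \<iota> v) - c e\<bar> \<le> \<eta>) \<and>
    (\<forall>as\<in>tuples (Dm n) k. T n A as \<noteq> {} \<longrightarrow>
    ap * real (card {bs \<in> tuples (Dm n) m. ct_sat N 0 (ct_tau p) n (B n) (as @ bs)}) \<le> real (card (T n A as)))"
    for \<eta> :: real and n A
  have W: "whp N L (W \<eta>)" if "\<eta> > 0" for \<eta>
    unfolding W_def
  proof (intro whp_conj[OF L] whp_ball[OF L finEE] ap(2))
    show "whp N L (\<lambda>n A. \<forall>us\<in>tuples (Dm n) (k + r). Rr n \<subseteq> set us \<longrightarrow> tp (\<tau> \<union> L) A us = d \<longrightarrow>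
     \<bar>real (card (C n A us e)) - al e * real (card (Ext n m t us))\<bar> \<le> \<eta> * real (card (Ext n m t us)))" for e
      using al(2)[OF that, of e] unfolding BA_def C_def .
    show "whp N L (\<lambda>n A. \<forall>V\<in>tuples (Dm n) (k + r + m). Rr n \<subseteq> set V \<longrightarrow> tp (\<tau> \<union> L) A V = e \<longrightarrow> \<bar>eval A \<phi> (\<lambda>v. V ! \<iota> v) - c e\<bar> \<le> \<eta>)" for e
      using c(2)[OF that, of e] unfolding DE_def .
  qed
  have cnt: "\<bar>real (card (\<Union>e\<in>X. C n A (as @ rs) e)) - (\<Sum>e\<in>X. al e) * real (card (Ext n m t (as @ rs)))\<bar> \<le>
      card EE * \<eta> * real (card (Ext n m t (as @ rs)))"
    if n: "n \<ge> 1" and as: "as \<in> tuples (Dm n) k" and rs: "rs \<in> tuples (Dm n) r" "set rs = Rr n"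
      and d: "tp (\<tau> \<union> L) A (as @ rs) = d" and w: "W \<eta> n A" and X: "X \<subseteq> EE" and \<eta>: "\<eta> > 0" for n A as rs X and \<eta> :: real
  proof -
    let ?S = "real (card (Ext n m t (as @ rs)))"
    have finX: "finite X" using X finEE by (rule finite_subset)
    have "card (\<Union>e\<in>X. C n A (as @ rs) e) = (\<Sum>e\<in>X. card (C n A (as @ rs) e))"
      using finX finite_Ext[OF n] by (intro card_UN_disjoint) (auto simp: C_def)
    then have "real (card (\<Union>e\<in>X. C n A (as @ rs) e)) - (\<Sum>e\<in>X. al e) * ?S = (\<Sum>e\<in>X. real (card (C n A (as @ rs) e)) - al e * ?S)"
      by (simp add: sum_subtractf sum_distrib_right)
    also have "\<bar>\<dots>\<bar> \<le> (\<Sum>e\<in>X. \<bar>real (card (C n A (as @ rs) e)) - al e * ?S\<bar>)" by (rule sum_abs)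
    also have "\<dots> \<le> (\<Sum>e\<in>X. \<eta> * ?S)"
    proof (rule sum_mono)
      fix e assume "e \<in> X"
      moreover have "as @ rs \<in> tuples (Dm n) (k + r)" "Rr n \<subseteq> set (as @ rs)" using as rs by (auto simp: tuples_def)
      ultimately show "\<bar>real (card (C n A (as @ rs) e)) - al e * ?S\<bar> \<le> \<eta> * ?S" using w d X unfolding W_def by blast
    qed
    also have "\<dots> = card X * (\<eta> * ?S)" by simp
    also have "\<dots> \<le> card EE * (\<eta> * ?S)" using card_mono[OF finEE X] \<eta> by (intro mult_right_mono) auto
    finally show ?thesis by (simp add: mult.assoc)
  qed
  show ?thesis
  proof (cases "A0 > 0")
    case False
    have "A0 \<ge> 0" unfolding A0_def using al(1) by (simp add: sum_nonneg)
    then have A0: "A0 = 0" using False by simp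
    \<comment> \<open>Small enough that the accumulated error stays below the proportion
      \<open>ap\<close> which positivity grants to a nonempty set.\<close>
    define \<eta> where "\<eta> = ap / (2 * (card EE + 1))"
    have \<eta>: "\<eta> > 0" "card EE * \<eta> < ap" using ap(1) by (auto simp: \<eta>_def field_simps intro: add_nonneg_pos)
    have "whp N L (\<lambda>n A. \<forall>as\<in>tuples (Dm n) k. \<forall>rs\<in>tuples (Dm n) r. set rs = Rr n \<longrightarrow> tp (\<tau> \<union> L) A (as @ rs) = d \<longrightarrow> T n A as = {})"
    proof (rule whp_mono[OF L W[OF \<eta>(1)]])
      show "\<forall>\<^sub>F n in sequentially. \<forall>A\<in>worlds (subnet N L) n. W \<eta> n A \<longrightarrow> (\<forall>as\<in>tuples (Dm n) k. \<forall>rs\<in>tuples (Dm n) r.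
        set rs = Rr n \<longrightarrow> tp (\<tau> \<union> L) A (as @ rs) = d \<longrightarrow> T n A as = {})"
        using eventually_ge_at_top[of 1]
      proof (eventually_elim, intro ballI impI)
        fix n A as rs assume n: "(1::nat) \<le> n" and A: "A \<in> worlds (subnet N L) n" and w: "W \<eta> n A" and as: "as \<in> tuples (Dm n) k"
          and rs: "rs \<in> tuples (Dm n) r" "set rs = Rr n" and d: "tp (\<tau> \<union> L) A (as @ rs) = d"
        let ?S = "real (card (Ext n m t (as @ rs)))"
        note co = core[OF n A as rs d]
        have "real (card (T n A as)) \<le> card EE * \<eta> * ?S"
          using cnt[OF n as rs d w order_refl \<eta>(1)] unfolding co(1) A0_def[symmetric] A0 by simp
        moreover have "ap * ?S \<le> real (card (T n A as))" "?S > 0" if "T n A as \<noteq> {}"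
        proof -
          show "ap * ?S \<le> real (card (T n A as))" using w as that unfolding W_def co(3)[symmetric] by blast
          show "?S > 0" using co(2) that finite_Ext[OF n, of m t "as @ rs"] by (auto simp: card_gt_0_iff)
        qed
        moreover have "card EE * \<eta> * ?S < ap * ?S" if "?S > 0" using \<eta>(2) that by (intro mult_strict_right_mono)
        ultimately show "T n A as = {}" by (smt (verit))
      qed
    qed
    then show ?thesis by (rule disjI1)
  next
    case A0: True
    \<comment> \<open>Classes with the same limit value are merged, as parameter lists need distinct
      values.\<close>
    obtain cs where cs: "set cs = c ` EE" "distinct cs" using finite_distinct_list[of "c ` EE"] finEE by blast
    define wt where "wt x = (\<Sum>e\<in>{e\<in>EE. c e = x}. al e)" for x
    have wt: "0 \<le> wt x" "wt x \<le> A0" for x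
      unfolding wt_def A0_def using al(1) finEE by (auto intro!: sum_nonneg sum_mono2)
    define ps where "ps = map (\<lambda>x. (x, wt x / A0)) cs"
    have params: "ct_params ps"
    proof -
      have "EE \<noteq> {}" using A0 by (auto simp: A0_def)
      then have "cs \<noteq> []" using cs(1) by auto
      moreover have "map fst ps = cs" by (simp add: ps_def comp_def)
      moreover have "set ps \<subseteq> {0..1} \<times> {0..1}" using cs(1) c(1) wt A0 by (auto simp: ps_def)
      ultimately show ?thesis using cs(2) by (auto simp: ct_params_def ps_def)
    qed
    have "whp N L (\<lambda>n A. \<forall>as\<in>tuples (Dm n) k. \<forall>rs\<in>tuples (Dm n) r. set rs = Rr n \<longrightarrow>
      tp (\<tau> \<union> L) A (as @ rs) = d \<longrightarrow> T n A as \<noteq> {} \<and> ct_close \<delta> ps (image_mset (val A as) (mset_set (T n A as))))"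
      if \<delta>: "\<delta> > 0" for \<delta> :: real
    proof -
      \<comment> \<open>The bounds serve, in turn, the closeness of the values, a set of at least
        half its expected size, and the estimate \<open>ratio_close\<close>.\<close>
      define \<eta> where "\<eta> = min \<delta> (min (A0 / 2) (\<delta> * A0 / 4) / (card EE + 1))"
      have \<eta>: "\<eta> > 0" "\<eta> \<le> \<delta>" using \<delta> A0 by (auto simp: \<eta>_def)
      define m0 where "m0 = min (A0 / 2) (\<delta> * A0 / 4)"
      have "\<eta> \<le> m0 / (real (card EE) + 1)" by (simp add: \<eta>_def m0_def add.commute)
      then have "\<eta> * (real (card EE) + 1) \<le> m0" by (subst (asm) pos_le_divide_eq) auto
      moreover have "m0 \<le> A0 / 2" "m0 \<le> \<delta> * A0 / 4" by (auto simp: m0_def)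
      ultimately have \<eta>E: "card EE * \<eta> \<le> A0 / 2" "card EE * \<eta> \<le> \<delta> * A0 / 4" using \<eta>(1) by (auto simp: algebra_simps)
      have \<eta>4: "4 * (card EE * \<eta>) / A0 \<le> \<delta>" using \<eta>E(2) A0 by (simp add: pos_divide_le_eq)
      have lb: "length bs1 = m" using I(3) by (simp add: tuples_def)
      show ?thesis
      proof (rule whp_mono[OF L W[OF \<eta>(1)]])
        show "\<forall>\<^sub>F n in sequentially. \<forall>A\<in>worlds (subnet N L) n. W \<eta> n A \<longrightarrow> (\<forall>as\<in>tuples (Dm n) k. \<forall>rs\<in>tuples (Dm n) r.
          set rs = Rr n \<longrightarrow> tp (\<tau> \<union> L) A (as @ rs) = d \<longrightarrow> T n A as \<noteq> {} \<and> ct_close \<delta> ps (image_mset (val A as) (mset_set (T n A as))))"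
          \<comment> \<open>With this many extensions, \<open>A0 / 2\<close> times their number is
            at least 1 / \<delta>, the size that \<open>ct_close\<close> demands.\<close>
          using eventually_ge_at_top[of 1] Ext_large[OF gt vars(4) t_def[symmetric] lb, of "k + r" "1 + 2 / (\<delta> * A0)"]
        proof (eventually_elim, intro ballI impI)
          fix n A as rs assume n: "(1::nat) \<le> n" and large: "\<forall>us\<in>tuples (Dm n) (k + r). 1 + 2 / (\<delta> * A0) \<le> real (card (Ext n m t us))"
            and A: "A \<in> worlds (subnet N L) n" and w: "W \<eta> n A" and as: "as \<in> tuples (Dm n) k"
            and rs: "rs \<in> tuples (Dm n) r" "set rs = Rr n" and d: "tp (\<tau> \<union> L) A (as @ rs) = d"
          let ?S = "real (card (Ext n m t (as @ rs)))" and ?T = "T n A as"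
          note co = core[OF n A as rs d]
          have finT: "finite ?T" using co(2) finite_Ext[OF n] by (rule finite_subset)
          have ust: "as @ rs \<in> tuples (Dm n) (k + r)" "length as = length ys" "length rs = r" using as rs vars by (auto simp: tuples_def)
          have S: "1 + 2 / (\<delta> * A0) \<le> ?S" using large ust(1) by blast
          have pd: "0 < \<delta> * A0" using \<delta> A0 by simp
          then have S0: "?S > 0" using S by (smt (verit) divide_pos_pos)
          have cT: "\<bar>real (card ?T) - A0 * ?S\<bar> \<le> card EE * \<eta> * ?S"
            using cnt[OF n as rs d w order_refl \<eta>(1)] unfolding co(1) A0_def .
          have "card EE * \<eta> * ?S \<le> A0 / 2 * ?S" using \<eta>E(1) by (intro mult_right_mono) auto
          then have T2: "A0 / 2 * ?S \<le> real (card ?T)" using cT by linarith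
          have "0 < A0 / 2 * ?S" using A0 S0 by simp
          then have Tne: "?T \<noteq> {}" using T2 by auto
          have "2 / (\<delta> * A0) \<le> ?S" using S by simp
          then have "2 \<le> ?S * (\<delta> * A0)" using pd by (simp add: pos_divide_le_eq)
          then have "1 / \<delta> \<le> A0 / 2 * ?S" using \<delta> by (simp add: pos_divide_le_eq mult_ac)
          then have Tsz: "1 / \<delta> \<le> real (card ?T)" using T2 by linarith
          define cd where "cd bs = tp (\<tau> \<union> L) A (as @ rs @ bs)" for bs
          have cdE: "cd bs \<in> EE" if "bs \<in> ?T" for bs using that unfolding co(1) C_def cd_def by auto
          have pc: "pos cs (c (cd bs)) < length cs \<and> cs ! pos cs (c (cd bs)) = c (cd bs)" if "bs \<in> ?T" for bs
            using cdE[OF that] cs(1) by (intro pos) auto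
          \<comment> \<open>Each value is tagged with the limit value of its class, so the number of
            entries with a given tag is exactly the size of a union of classes.\<close>
          define M where "M = image_mset (\<lambda>bs. (val A as bs, pos cs (c (cd bs)))) (mset_set ?T)"
          have fM: "image_mset (val A as) (mset_set ?T) = image_mset fst M" by (simp add: M_def multiset.map_comp comp_def)
          have sM: "size M = card ?T" by (simp add: M_def)
          have fA: "finite (dom A)" using world(1)[OF A] finite_Dm[OF n] by simp
          have 1: "\<forall>(x, j)\<in>#M. j < length ps \<and> \<bar>x - fst (ps ! j)\<bar> \<le> \<delta> \<and> x \<in> {0..1}"
          proof -
            have "pos cs (c (cd bs)) < length ps \<and> \<bar>val A as bs - fst (ps ! pos cs (c (cd bs)))\<bar> \<le> \<delta> \<and> val A as bs \<in> {0..1}"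
              if b: "bs \<in> ?T" for bs
            proof -
              have bt: "bs \<in> tuples (Dm n) m" using b by (simp add: T_def)
              then have lb: "length bs = length zs" using vars by (simp add: tuples_def)
              have v: "val A as bs = eval A \<phi> (\<lambda>v. (as @ rs @ bs) ! \<iota> v)"
                unfolding val_def \<iota>_def using \<phi>(2) asg_pos[OF vars(1) ust(2) lb _ ust(3)] by (intro eval_fv) blast
              have "as @ rs @ bs \<in> tuples (Dm n) (k + r + m)" "Rr n \<subseteq> set (as @ rs @ bs)"
                using as rs bt by (auto simp: tuples_def)
              then have "\<bar>val A as bs - c (cd bs)\<bar> \<le> \<eta>" unfolding v using w cdE[OF b] unfolding W_def cd_def by blast
              then have "\<bar>val A as bs - c (cd bs)\<bar> \<le> \<delta>" using \<eta>(2) by linarith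
              then show ?thesis using pc[OF b] eval_range[OF \<phi>(1) fA] by (simp add: ps_def val_def)
            qed
            then show ?thesis using finT by (auto simp: M_def)
          qed
          have "\<bar>real (size (filter_mset (\<lambda>z. snd z = j) M)) / real (size M) - snd (ps ! j)\<bar> \<le> \<delta>" if j: "j < length ps" for j
          proof -
            have jc: "j < length cs" using j by (simp add: ps_def)
            have eqv: "pos cs (c (cd bs)) = j \<longleftrightarrow> c (cd bs) = cs ! j" if "bs \<in> ?T" for bs
              using pc[OF that] jc cs(2) nth_eq_iff_index_eq by metis
            have "size (filter_mset (\<lambda>z. snd z = j) M) = card {bs \<in> ?T. pos cs (c (cd bs)) = j}"
              by (simp add: M_def filter_mset_image_mset comp_def finT)
            also have "{bs \<in> ?T. pos cs (c (cd bs)) = j} = (\<Union>e\<in>{e\<in>EE. c e = cs ! j}. C n A (as @ rs) e)"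
            proof -
              have "{bs \<in> ?T. pos cs (c (cd bs)) = j} = {bs \<in> ?T. c (cd bs) = cs ! j}" using eqv by blast
              also have "\<dots> = (\<Union>e\<in>{e\<in>EE. c e = cs ! j}. C n A (as @ rs) e)"
                unfolding co(1) by (auto simp: C_def cd_def)
              finally show ?thesis .
            qed
            finally have sz: "size (filter_mset (\<lambda>z. snd z = j) M) = card (\<Union>e\<in>{e\<in>EE. c e = cs ! j}. C n A (as @ rs) e)" .
            have "\<bar>real (card (\<Union>e\<in>{e\<in>EE. c e = cs ! j}. C n A (as @ rs) e)) - wt (cs ! j) * ?S\<bar> \<le> card EE * \<eta> * ?S"
              unfolding wt_def by (rule cnt[OF n as rs d w _ \<eta>(1)]) auto
            from ratio_close[OF S0 A0 wt(1) wt(2) this cT \<eta>E(1) \<eta>4]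
            show ?thesis unfolding sz sM using jc by (simp add: ps_def)
          qed
          note 2 = this
          show "T n A as \<noteq> {} \<and> ct_close \<delta> ps (image_mset (val A as) (mset_set (T n A as)))"
          proof (intro conjI Tne)
            have "1 / \<delta> \<le> real (size (image_mset fst M))" using Tsz sM by simp
            then show "ct_close \<delta> ps (image_mset (val A as) (mset_set (T n A as)))"
              using 1 2 unfolding ct_close_def fM by blast
          qed
        qed
      qed
    qed
    then show ?thesis using params by blast
  qed
qed

end

subsection \<open>All formulas are determined\<close>

context network
begin

text \<open>Make exactly the asserted atoms true, transported along the isomorphism; its injectivity
  keeps the denied atoms false.\<close>

lemma world_of_ctype:
  assumes n: "n \<ge> 1" and p: "is_ctype N \<sigma> k p" and s: "ct_sat N l (ct_tau p) n (B n) as"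
  obtains A where "A \<in> worlds N n" "ct_sat N l p n A as"
proof -
  let ?D = "dom (ct_struc p)" and ?S = "closure_set N l n as"
  obtain f where f: "pointed_iso \<tau> f (ct_struc p) (ct_pts p) (induced (B n) ?S) as"
    using s by (auto simp: ct_sat_def ct_tau_def)
  have fD: "bij_betw f ?D (Dm n \<inter> ?S)" using f by (simp add: pointed_iso_def)
  have lit: "R \<in> \<sigma> - \<tau>" "xs \<in> tuples ?D (ar R)" if "(R, xs, b) \<in> ct_lits p" for R xs b
    using p that by (auto simp: is_ctype_def)
  define A where "A = \<lparr>dom = Dm n, rel = (\<lambda>R. if R \<in> \<tau> then rel (B n) R else {map f xs |xs. (R, xs, True) \<in> ct_lits p})\<rparr>"
  have "f x \<in> Dm n" if "x \<in> ?D" for x using fD that by (auto simp: bij_betw_def)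
  then have "map f xs \<in> tuples (Dm n) (ar R)" if "(R, xs, True) \<in> ct_lits p" for R xs
    using lit(2)[OF that] by (auto simp: tuples_def subset_iff)
  then have "rel A R \<subseteq> tuples (Dm n) (ar R)" for R
    using base_rel[OF n, of R] by (auto simp: A_def)
  then have w: "A \<in> worlds (subnet N (\<sigma> - \<tau>)) n"
    unfolding worlds_iff using finite_Dm[OF n] lit(1) by (auto simp: A_def)
  then have AN: "A \<in> worlds N n" by (simp add: subnet_full)
  have "(map f xs \<in> rel A R) = b" if l: "(R, xs, b) \<in> ct_lits p" for R xs b
  proof -
    have inj: "inj_on f ?D" using fD by (simp add: bij_betw_def)
    have "map f xs \<in> rel A R \<longleftrightarrow> (\<exists>xs'. map f xs = map f xs' \<and> (R, xs', True) \<in> ct_lits p)"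
      using lit(1)[OF l] by (auto simp: A_def)
    also have "\<dots> \<longleftrightarrow> (R, xs, True) \<in> ct_lits p"
    proof
      assume "\<exists>xs'. map f xs = map f xs' \<and> (R, xs', True) \<in> ct_lits p"
      then obtain xs' where x: "map f xs = map f xs'" "(R, xs', True) \<in> ct_lits p" by blast
      have "set xs \<subseteq> ?D" "set xs' \<subseteq> ?D" using lit(2)[OF l] lit(2)[OF x(2)] by (auto simp: tuples_def)
      then have "inj_on f (set xs \<union> set xs')" using inj by (auto intro: inj_on_subset)
      then have "xs = xs'" using x(1) by (rule map_inj_on[rotated])
      then show "(R, xs, True) \<in> ct_lits p" using x(2) by simp
    qed blast
    also have "\<dots> \<longleftrightarrow> b" using l p unfolding is_ctype_def by (metis (full_types))
    finally show ?thesis .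
  qed
  then have "\<forall>(R, xs, b) \<in> ct_lits p. (map f xs \<in> rel A R) = b" by blast
  then have "ct_sat N l p n A as" unfolding ct_sat_world_iff[OF AN] using f by (intro exI[of _ f] conjI)
  then show ?thesis using that AN by blast
qed

end

context base_seq
begin

text \<open>The type decides equalities between parameters and bound variables, so the value of \<open>\<kappa>\<close>
  changes with each parameter.\<close>

lemma params_in_fv:
  assumes p: "is_ctype N \<sigma> (length (ys @ zs)) p" "expresses N 0 (ys @ zs) p \<kappa>"
    and su: "strongly_unbounded N 0 (length ys) (length zs) (ct_tau p)"
    and d: "distinct (ys @ zs)" "zs \<noteq> []"
  shows "set ys \<subseteq> fv \<kappa>"
proof (rule ccontr)
  assume "\<not> set ys \<subseteq> fv \<kappa>"
  then obtain y where y: "y \<in> set ys" "y \<notin> fv \<kappa>" by blast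
  let ?l = "ys @ zs"
  have lp: "length (ct_pts (ct_tau p)) = length ?l" using ct_pts_length[OF p(1)] by (simp add: ct_tau_def)
  have "\<exists>\<^sub>F n in sequentially. \<exists>v\<in>tuples (Dm n) (length ?l). ct_sat N 0 (ct_tau p) n (B n) v"
    using su unfolding strongly_unbounded_def tau_cofinal_def lp by blast
  moreover have "\<forall>\<^sub>F n in sequentially. 2 \<le> card (Dm n) \<and> n \<ge> 1"
    using size eventually_ge_at_top[of 1] unfolding filterlim_at_top by (simp add: eventually_conj)
  ultimately have "\<exists>\<^sub>F n in sequentially. (\<exists>v\<in>tuples (Dm n) (length ?l). ct_sat N 0 (ct_tau p) n (B n) v) \<and> 2 \<le> card (Dm n) \<and> n \<ge> 1"
    by (rule frequently_eventually_frequently)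
  then obtain n v where n: "n \<ge> 1" "2 \<le> card (Dm n)" and v: "v \<in> tuples (Dm n) (length ?l)" "ct_sat N 0 (ct_tau p) n (B n) v"
    using frequently_ex by blast
  obtain A where A: "A \<in> worlds N n" "ct_sat N 0 p n A v" using world_of_ctype[OF n(1) p(1) v(2)] by blast
  obtain i where i: "i < length ys" "ys ! i = y" using y(1) by (auto simp: in_set_conv_nth)
  let ?k = "length ys"
  have lv: "length v = length ?l" "set v \<subseteq> Dm n" using v(1) by (auto simp: tuples_def)
  have k: "?k < length v" "i < length v" using lv d(2) i by auto
  have vk: "v ! ?k \<in> Dm n" using lv k nth_mem by blast
  \<comment> \<open>Replacing the parameter by \<open>x\<close> flips its equality with the first
    bound variable; a second element of the domain is available since n was chosen large.\<close>
  obtain x where x: "x \<in> Dm n" "x = v ! ?k \<longleftrightarrow> v ! i \<noteq> v ! ?k"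
  proof (cases "v ! i = v ! ?k")
    case False
    then show ?thesis using that[of "v ! ?k"] vk by blast
  next
    case True
    have "Dm n \<noteq> {v ! ?k}"
    proof
      assume "Dm n = {v ! ?k}"
      then show False using n(2) by simp
    qed
    then obtain x where "x \<in> Dm n" "x \<noteq> v ! ?k" using vk by blast
    then show ?thesis using that[of x] True by blast
  qed
  let ?v = "v[i := x]"
  have v': "?v \<in> tuples (Dm n) (length ?l)" using lv x(1) set_update_subset_insert[of v i x] by (auto simp: tuples_def)
  have "eval A \<kappa> (asg ?l v) = eval A \<kappa> (asg ?l ?v)"
  proof (rule eval_fv)
    fix w assume w: "w \<in> fv \<kappa>"
    show "asg ?l v w = asg ?l ?v w"
    proof (cases "w \<in> set ?l")
      case True
      then obtain j where j: "j < length ?l" "?l ! j = w" by (meson in_set_conv_nth)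
      have "j \<noteq> i" using w y(2) i j by (auto simp: nth_append)
      then show ?thesis using asg_nth[OF d(1), of v j] asg_nth[OF d(1), of ?v j] lv(1) j by simp
    next
      case False
      then show ?thesis by (simp add: asg_def upd_notin)
    qed
  qed
  then have "(of_bool (ct_sat N 0 p n A v) :: real) = of_bool (ct_sat N 0 p n A ?v)"
    using p(2) n(1) A(1) v(1) v' worldN(1)[OF A(1)] unfolding expresses_def by metis
  then have s': "ct_sat N 0 p n A ?v" using A(2) by (simp only: of_bool_eq_iff)
  have eqpts: "ct_pts p ! i = ct_pts p ! ?k \<longleftrightarrow> u ! i = u ! ?k" if s: "ct_sat N 0 p n A u" for u
  proof -
    obtain f where f: "bij_betw f (dom (ct_struc p)) (dom (induced A (closure_set N 0 n u)))" "map f (ct_pts p) = u"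
      using s by (auto simp: ct_sat_def pointed_iso_def)
    have l: "length (ct_pts p) = length ?l" by (rule ct_pts_length[OF p(1)])
    have ik: "i < length (ct_pts p)" "?k < length (ct_pts p)" using l k lv(1) by auto
    have "set (ct_pts p) \<subseteq> dom (ct_struc p)" using p(1) by (auto simp: is_ctype_def tuples_def)
    then have "ct_pts p ! i \<in> dom (ct_struc p)" "ct_pts p ! ?k \<in> dom (ct_struc p)" using nth_mem ik by blast+
    then have "f (ct_pts p ! i) = f (ct_pts p ! ?k) \<longleftrightarrow> ct_pts p ! i = ct_pts p ! ?k"
      using f(1) by (auto simp: bij_betw_def inj_on_def)
    then show ?thesis using f(2) ik by (metis nth_map)
  qed
  have "?v ! i = x" "?v ! ?k = v ! ?k" using k i by auto
  then show False using eqpts[OF A(2)] eqpts[OF s'] x(2) by (metis (no_types))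
qed

text \<open>\<open>V\<close> supplies the parameters, all of which are free variables by
  \<open>params_in_fv\<close>, and the rare elements, which are recognized by their codes. So
  \<open>e\<close> determines the code \<open>d\<close> of the parameters followed by the rare
  elements, and \<open>agg_part\<close> applies to each conditioning formula.\<close>

lemma determined_Agg:
  assumes L: "initial N L" and pla: "is_pla ar (\<tau> \<union> L) (Agg F \<phi>s zs \<kappa>s)"
    and good: "good_aggregations N (Agg F \<phi>s zs \<kappa>s)"
    and \<phi>s: "\<And>\<phi>. \<phi> \<in> set \<phi>s \<Longrightarrow> determined L \<phi>"
    and bal: "\<And>m t. m \<ge> 1 \<Longrightarrow> good m t \<Longrightarrow> balance L m t"
  shows "determined L (Agg F \<phi>s zs \<kappa>s)"
  unfolding determined_def
proof (intro allI impI)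
  fix K :: nat and \<iota> :: "nat \<Rightarrow> nat" and e
  assume \<iota>: "\<forall>v\<in>fv (Agg F \<phi>s zs \<kappa>s). \<iota> v < K"
  let ?\<psi> = "Agg F \<phi>s zs \<kappa>s"
  have agg: "is_aggregation (length \<phi>s) F" "length \<kappa>s = length \<phi>s" "distinct zs" "zs \<noteq> []"
    and pla': "\<And>\<phi>. \<phi> \<in> set \<phi>s \<Longrightarrow> is_pla ar (\<tau> \<union> L) \<phi>" "\<And>\<kappa>. \<kappa> \<in> set \<kappa>s \<Longrightarrow> is_pla ar (\<tau> \<union> L) \<kappa>"
    using pla unfolding is_pla_Agg by auto
  have mem: "?\<psi> \<in> subformulas ?\<psi>" by simp
  have cont: "continuous_aggregation (length \<phi>s) F" using good mem unfolding good_aggregations_def by blast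
  have "\<exists>ys. distinct (ys @ zs) \<and> (\<Union>\<psi> \<in> set \<phi>s \<union> set \<kappa>s. fv \<psi>) \<subseteq> set (ys @ zs) \<and>
        (\<forall>\<kappa> \<in> set \<kappa>s. \<exists>p. is_ctype N \<sigma> (length (ys @ zs)) p \<and>
           expresses N 0 (ys @ zs) p \<kappa> \<and>
           strongly_unbounded N 0 (length ys) (length zs) (ct_tau p) \<and>
           positive N 0 (length ys) (length zs) p)"
    using good mem unfolding good_aggregations_def by blast
  then obtain ys where ys: "distinct (ys @ zs)" "(\<Union>\<psi> \<in> set \<phi>s \<union> set \<kappa>s. fv \<psi>) \<subseteq> set (ys @ zs)"
    and ex: "\<forall>\<kappa> \<in> set \<kappa>s. \<exists>p. is_ctype N \<sigma> (length (ys @ zs)) p \<and> expresses N 0 (ys @ zs) p \<kappa> \<and>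
           strongly_unbounded N 0 (length ys) (length zs) (ct_tau p) \<and> positive N 0 (length ys) (length zs) p"
    by (elim exE conjE)
  obtain pp where pp: "\<And>\<kappa>. \<kappa> \<in> set \<kappa>s \<Longrightarrow> is_ctype N \<sigma> (length (ys @ zs)) (pp \<kappa>)"
    "\<And>\<kappa>. \<kappa> \<in> set \<kappa>s \<Longrightarrow> expresses N 0 (ys @ zs) (pp \<kappa>) \<kappa>"
    "\<And>\<kappa>. \<kappa> \<in> set \<kappa>s \<Longrightarrow> strongly_unbounded N 0 (length ys) (length zs) (ct_tau (pp \<kappa>))"
    "\<And>\<kappa>. \<kappa> \<in> set \<kappa>s \<Longrightarrow> positive N 0 (length ys) (length zs) (pp \<kappa>)"
    using ex by metis
  let ?M = "length \<phi>s"
  define k where "k = length ys"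
  define m where "m = length zs"
  have m1: "m \<ge> 1" using agg(4) by (cases zs) (auto simp: m_def)
  have "?M \<ge> 1" using agg(1) by (simp add: is_aggregation_def)
  then have \<kappa>0: "\<kappa>s ! 0 \<in> set \<kappa>s" using agg(2) by (intro nth_mem) linarith
  have ysfv: "set ys \<subseteq> fv ?\<psi>"
    using params_in_fv[OF pp(1-3)[OF \<kappa>0] ys(1) agg(4)] ys(1) \<kappa>0 by auto
  have fvys: "fv ?\<psi> \<subseteq> set ys" using ys(2) by auto
  \<comment> \<open>Rarity of an entry depends only on its code, so \<open>e\<close> decides which
    positions of \<open>V\<close> hold the rare elements, uniformly in n.\<close>
  define RC where "RC = {tp \<tau> (B n) [x] |n x. n \<ge> 1 \<and> x \<in> Rr n}"
  define jr where "jr = filter (\<lambda>j. sub (restr \<tau> e) [j] \<in> RC) [0..<K]"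
  define js where "js = map \<iota> ys @ jr"
  define d where "d = sub e js"
  define r where "r = length jr"
  have jsK: "set js \<subseteq> {..<K}" using \<iota> ysfv by (auto simp: js_def jr_def)
  define T where "T i n A as = {bs \<in> tuples (Dm n) m. ct_sat N 0 (pp (\<kappa>s ! i)) n A (as @ bs)}" for i n A as
  define val where "val i A as bs = eval A (\<phi>s ! i) (asg (ys @ zs) (as @ bs))" for i and A :: "('a, 'r) struc" and as bs :: "'a list"
  define ok where "ok n A as rs \<longleftrightarrow> as \<in> tuples (Dm n) k \<and> rs \<in> tuples (Dm n) r \<and> set rs = Rr n \<and> tp (\<tau> \<union> L) A (as @ rs) = d" for n A as rs
  define tups where "tups V = (map (\<lambda>v. V ! \<iota> v) ys, map ((!) V) jr)" for V :: "'a list"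
  have conv: "ok n A (map (\<lambda>v. V ! \<iota> v) ys) (map ((!) V) jr)"
    if n: "n \<ge> 1" and A: "A \<in> worlds (subnet N L) n" and V: "V \<in> tuples (Dm n) K" "Rr n \<subseteq> set V" "tp (\<tau> \<union> L) A V = e" for n A V
  proof -
    have lV: "length V = K" "set V \<subseteq> Dm n" using V by (auto simp: tuples_def)
    have inD: "V ! j \<in> Dm n" if "j < K" for j using that lV nth_mem by blast
    have e1: "tp \<tau> (B n) [V ! j] = sub (restr \<tau> e) [j]" if "j < K" for j
      using sub_tp[of "[j]" V \<tau> "B n"] that lV base_tp[OF A, of V] V(3) by simp
    have jrR: "sub (restr \<tau> e) [j] \<in> RC \<longleftrightarrow> V ! j \<in> Rr n" if j: "j < K" for j
    proof
      assume "V ! j \<in> Rr n"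
      then show "sub (restr \<tau> e) [j] \<in> RC" using n e1[OF j] unfolding RC_def by force
    next
      assume "sub (restr \<tau> e) [j] \<in> RC"
      then obtain n' x where "n' \<ge> 1" "x \<in> Rr n'" "tp \<tau> (B n') [x] = tp \<tau> (B n) [V ! j]" using e1[OF j] unfolding RC_def by auto
      then show "V ! j \<in> Rr n" using rare_tp[of n' x n "V ! j"] inD[OF j] by (simp add: Rr_def)
    qed
    have "set (map ((!) V) jr) = {V ! j |j. j < K \<and> V ! j \<in> Rr n}" using jrR by (auto simp: jr_def)
    also have "\<dots> = Rr n" using V(2) lV(1) by (auto simp: in_set_conv_nth[of _ V] subset_iff)
    finally have rs: "set (map ((!) V) jr) = Rr n" .
    have "map (\<lambda>v. V ! \<iota> v) ys @ map ((!) V) jr = map ((!) V) js" by (simp add: js_def)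
    then have "tp (\<tau> \<union> L) A (map (\<lambda>v. V ! \<iota> v) ys @ map ((!) V) jr) = d"
      using sub_tp[of js V "\<tau> \<union> L" A] jsK lV V(3) by (simp add: d_def)
    moreover have "set (map (\<lambda>v. V ! \<iota> v) ys) \<subseteq> Dm n"
      unfolding set_map by (intro image_subsetI inD) (use \<iota> ysfv in blast)
    moreover have "set (map ((!) V) jr) \<subseteq> Dm n" unfolding rs by (rule Rr_sub)
    ultimately show ?thesis using rs by (simp add: ok_def tuples_def k_def r_def)
  qed
  have evalA: "eval A ?\<psi> s = (if \<exists>i<?M. T i n A (map s ys) = {} then 0
     else F (map (\<lambda>i. image_mset (val i A (map s ys)) (mset_set (T i n A (map s ys)))) [0..<?M]))"
    if n: "n \<ge> 1" and A: "A \<in> worlds (subnet N L) n" and s: "set (map s ys) \<subseteq> Dm n" for n A s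
  proof -
    have AN: "A \<in> worlds N n" using world_N[OF A initialD(1)[OF L]] .
    have dA: "dom A = Dm n" by (rule worldN(1)[OF AN])
    have ev: "eval A \<psi> (upd s zs bs) = eval A \<psi> (asg (ys @ zs) (map s ys @ bs))"
      if "\<psi> \<in> set \<phi>s \<union> set \<kappa>s" "bs \<in> tuples (Dm n) m" for \<psi> bs
    proof (rule eval_fv)
      fix v assume "v \<in> fv \<psi>"
      then have "v \<in> set (ys @ zs)" using ys(2) that(1) by blast
      then show "upd s zs bs v = asg (ys @ zs) (map s ys @ bs) v"
        using that(2) by (intro upd_asg[OF ys(1)]) (auto simp: tuples_def m_def)
    qed
    have Ti: "{bs \<in> tuples (dom A) (length zs). eval A (\<kappa>s ! i) (upd s zs bs) = 1} = T i n A (map s ys)" if i: "i < ?M" for i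
    proof -
      have \<kappa>i: "\<kappa>s ! i \<in> set \<kappa>s" using i agg(2) by simp
      have "eval A (\<kappa>s ! i) (upd s zs bs) = of_bool (ct_sat N 0 (pp (\<kappa>s ! i)) n A (map s ys @ bs))"
        if b: "bs \<in> tuples (Dm n) m" for bs
      proof -
        have "map s ys @ bs \<in> tuples (dom A) (length (ys @ zs))" using b s by (auto simp: tuples_def dA m_def)
        then show ?thesis using pp(2)[OF \<kappa>i] n AN ev[of "\<kappa>s ! i" bs] \<kappa>i b unfolding expresses_def by auto
      qed
      then show ?thesis unfolding T_def dA m_def[symmetric] by (auto simp: of_bool_def split: if_splits)
    qed
    have Vi: "image_mset (\<lambda>bs. eval A (\<phi>s ! i) (upd s zs bs)) (mset_set (T i n A (map s ys))) =
      image_mset (val i A (map s ys)) (mset_set (T i n A (map s ys)))" if i: "i < ?M" for i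
    proof (rule image_mset_cong)
      fix bs assume "bs \<in># mset_set (T i n A (map s ys))"
      then have "bs \<in> tuples (Dm n) m" by (cases "finite (T i n A (map s ys))") (auto simp: T_def)
      then show "eval A (\<phi>s ! i) (upd s zs bs) = val i A (map s ys) bs"
        unfolding val_def using i by (intro ev) auto
    qed
    have "map (\<lambda>i. image_mset (\<lambda>bs. eval A (\<phi>s ! i) (upd s zs bs))
       (mset_set {bs \<in> tuples (dom A) (length zs). eval A (\<kappa>s ! i) (upd s zs bs) = 1})) [0..<?M] =
      map (\<lambda>i. image_mset (val i A (map s ys)) (mset_set (T i n A (map s ys)))) [0..<?M]"
      by (intro map_cong refl) (simp only: Ti Vi atLeastLessThan_iff set_upt)
    moreover have "(\<exists>i<?M. {bs \<in> tuples (dom A) (length zs). eval A (\<kappa>s ! i) (upd s zs bs) = 1} = {}) \<longleftrightarrow>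
      (\<exists>i<?M. T i n A (map s ys) = {})" using Ti by (metis (no_types, lifting))
    ultimately show ?thesis unfolding eval_Agg[OF agg(2)] by (simp only:)
  qed
  have part: "whp N L (\<lambda>n A. \<forall>as\<in>tuples (Dm n) k. \<forall>rs\<in>tuples (Dm n) r. set rs = Rr n \<longrightarrow> tp (\<tau> \<union> L) A (as @ rs) = d \<longrightarrow> T i n A as = {}) \<or>
    (\<exists>ps. ct_params ps \<and> (\<forall>\<delta>>0. whp N L (\<lambda>n A. \<forall>as\<in>tuples (Dm n) k. \<forall>rs\<in>tuples (Dm n) r. set rs = Rr n \<longrightarrow>
      tp (\<tau> \<union> L) A (as @ rs) = d \<longrightarrow> T i n A as \<noteq> {} \<and> ct_close \<delta> ps (image_mset (val i A as) (mset_set (T i n A as))))))"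
    if i: "i < ?M" for i
  proof -
    have mi: "\<phi>s ! i \<in> set \<phi>s" "\<kappa>s ! i \<in> set \<kappa>s" using i agg(2) by auto
    have fvi: "fv (\<phi>s ! i) \<subseteq> set (ys @ zs)" using ys(2) mi(1) by blast
    show ?thesis unfolding T_def val_def
      by (rule agg_part[OF L ys(1) k_def[symmetric] m_def[symmetric] m1 pla'(1)[OF mi(1)] fvi \<phi>s[OF mi(1)] pla'(2)[OF mi(2)]
         pp(1)[OF mi(2), unfolded length_append k_def[symmetric] m_def[symmetric]] pp(2)[OF mi(2)]
         pp(3)[OF mi(2), folded k_def m_def] pp(4)[OF mi(2), folded k_def m_def] bal[OF m1]])
  qed
  have sD: "set (map (\<lambda>v. V ! \<iota> v) ys) \<subseteq> Dm n" if "ok n A (map (\<lambda>v. V ! \<iota> v) ys) rs" for n A V rs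
    using that by (simp add: ok_def tuples_def)
  show "\<exists>c\<in>{0..1}. \<forall>\<epsilon>>0. whp N L (\<lambda>n A. \<forall>V\<in>tuples (Dm n) K. Rr n \<subseteq> set V \<longrightarrow> tp (\<tau> \<union> L) A V = e \<longrightarrow>
    \<bar>eval A ?\<psi> (\<lambda>v. V ! \<iota> v) - c\<bar> \<le> \<epsilon>)"
  \<comment> \<open>One conditioning set that is empty with high probability forces the default
    value 0; otherwise all multisets approach fixed distributions and \<open>ct_limit\<close> gives
    the constant.\<close>
  proof (cases "\<exists>i<?M. whp N L (\<lambda>n A. \<forall>as\<in>tuples (Dm n) k. \<forall>rs\<in>tuples (Dm n) r. set rs = Rr n \<longrightarrow>
      tp (\<tau> \<union> L) A (as @ rs) = d \<longrightarrow> T i n A as = {})")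
    case True
    then obtain i where i: "i < ?M" and W: "whp N L (\<lambda>n A. \<forall>as\<in>tuples (Dm n) k. \<forall>rs\<in>tuples (Dm n) r. set rs = Rr n \<longrightarrow>
      tp (\<tau> \<union> L) A (as @ rs) = d \<longrightarrow> T i n A as = {})" by blast
    show ?thesis
    proof (intro bexI[of _ 0] allI impI whp_mono[OF L W])
      fix \<epsilon> :: real assume \<epsilon>: "\<epsilon> > 0"
      show "\<forall>\<^sub>F n in sequentially. \<forall>A\<in>worlds (subnet N L) n.
        (\<forall>as\<in>tuples (Dm n) k. \<forall>rs\<in>tuples (Dm n) r. set rs = Rr n \<longrightarrow> tp (\<tau> \<union> L) A (as @ rs) = d \<longrightarrow> T i n A as = {}) \<longrightarrow>
        (\<forall>V\<in>tuples (Dm n) K. Rr n \<subseteq> set V \<longrightarrow> tp (\<tau> \<union> L) A V = e \<longrightarrow> \<bar>eval A ?\<psi> (\<lambda>v. V ! \<iota> v) - 0\<bar> \<le> \<epsilon>)"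
        using eventually_ge_at_top[of 1]
      proof (eventually_elim, intro ballI impI)
        fix n A V assume n: "(1::nat) \<le> n" and A: "A \<in> worlds (subnet N L) n"
          and H: "\<forall>as\<in>tuples (Dm n) k. \<forall>rs\<in>tuples (Dm n) r. set rs = Rr n \<longrightarrow> tp (\<tau> \<union> L) A (as @ rs) = d \<longrightarrow> T i n A as = {}"
          and V: "V \<in> tuples (Dm n) K" "Rr n \<subseteq> set V" "tp (\<tau> \<union> L) A V = e"
        note o = conv[OF n A V]
        have "T i n A (map (\<lambda>v. V ! \<iota> v) ys) = {}" using H o unfolding ok_def by blast
        then have "eval A ?\<psi> (\<lambda>v. V ! \<iota> v) = 0" unfolding evalA[OF n A sD[OF o]] using i by auto
        then show "\<bar>eval A ?\<psi> (\<lambda>v. V ! \<iota> v) - 0\<bar> \<le> \<epsilon>" using \<epsilon> by (simp del: eval.simps)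
      qed
    qed simp
  next
    case False
    define Q where "Q i ps \<delta> \<longleftrightarrow> whp N L (\<lambda>n A. \<forall>as\<in>tuples (Dm n) k. \<forall>rs\<in>tuples (Dm n) r. set rs = Rr n \<longrightarrow>
      tp (\<tau> \<union> L) A (as @ rs) = d \<longrightarrow> T i n A as \<noteq> {} \<and> ct_close \<delta> ps (image_mset (val i A as) (mset_set (T i n A as))))" for i ps \<delta>
    have "\<forall>i<?M. \<exists>ps. ct_params ps \<and> (\<forall>\<delta>>0. Q i ps \<delta>)" unfolding Q_def
      using part False by blast
    then obtain ps where ps: "\<And>i. i < ?M \<Longrightarrow> ct_params (ps i)"
      "\<And>i \<delta>. i < ?M \<Longrightarrow> \<delta> > 0 \<Longrightarrow> Q i (ps i) \<delta>"
      by metis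
    obtain c where c: "c \<in> {0..1}" "\<And>\<epsilon>. \<epsilon> > 0 \<Longrightarrow> \<exists>\<delta>>0. \<forall>rs. length rs = ?M \<and>
        (\<forall>i<?M. ct_close \<delta> (map ps [0..<?M] ! i) (rs ! i)) \<longrightarrow> \<bar>F rs - c\<bar> \<le> \<epsilon>"
    proof (rule ct_limit[OF agg(1) cont, of "map ps [0..<?M]"])
      show "ct_params q" if "q \<in> set (map ps [0..<?M])" for q using that ps(1) by auto
    qed simp_all
    show ?thesis
    proof (intro bexI[OF _ c(1)] allI impI)
      fix \<epsilon> :: real assume \<epsilon>: "\<epsilon> > 0"
      obtain \<delta> where \<delta>: "\<delta> > 0" "\<And>rs. length rs = ?M \<Longrightarrow>
        (\<And>i. i < ?M \<Longrightarrow> ct_close \<delta> (map ps [0..<?M] ! i) (rs ! i)) \<Longrightarrow> \<bar>F rs - c\<bar> \<le> \<epsilon>" using c(2)[OF \<epsilon>] by blast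
      have W: "whp N L (\<lambda>n A. \<forall>i\<in>{..<?M}. \<forall>as\<in>tuples (Dm n) k. \<forall>rs\<in>tuples (Dm n) r. set rs = Rr n \<longrightarrow>
        tp (\<tau> \<union> L) A (as @ rs) = d \<longrightarrow> T i n A as \<noteq> {} \<and> ct_close \<delta> (ps i) (image_mset (val i A as) (mset_set (T i n A as))))"
        using ps(2)[unfolded Q_def] \<delta>(1) by (intro whp_ball[OF L]) blast+
      show "whp N L (\<lambda>n A. \<forall>V\<in>tuples (Dm n) K. Rr n \<subseteq> set V \<longrightarrow> tp (\<tau> \<union> L) A V = e \<longrightarrow>
        \<bar>eval A ?\<psi> (\<lambda>v. V ! \<iota> v) - c\<bar> \<le> \<epsilon>)"
      proof (rule whp_mono[OF L W])
        show "\<forall>\<^sub>F n in sequentially. \<forall>A\<in>worlds (subnet N L) n.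
          (\<forall>i\<in>{..<?M}. \<forall>as\<in>tuples (Dm n) k. \<forall>rs\<in>tuples (Dm n) r. set rs = Rr n \<longrightarrow>
        tp (\<tau> \<union> L) A (as @ rs) = d \<longrightarrow> T i n A as \<noteq> {} \<and> ct_close \<delta> (ps i) (image_mset (val i A as) (mset_set (T i n A as)))) \<longrightarrow>
          (\<forall>V\<in>tuples (Dm n) K. Rr n \<subseteq> set V \<longrightarrow> tp (\<tau> \<union> L) A V = e \<longrightarrow> \<bar>eval A ?\<psi> (\<lambda>v. V ! \<iota> v) - c\<bar> \<le> \<epsilon>)"
          using eventually_ge_at_top[of 1]
        proof (eventually_elim, intro ballI impI)
          fix n A V assume n: "(1::nat) \<le> n" and A: "A \<in> worlds (subnet N L) n"
            and H: "\<forall>i\<in>{..<?M}. \<forall>as\<in>tuples (Dm n) k. \<forall>rs\<in>tuples (Dm n) r. set rs = Rr n \<longrightarrow>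
              tp (\<tau> \<union> L) A (as @ rs) = d \<longrightarrow> T i n A as \<noteq> {} \<and> ct_close \<delta> (ps i) (image_mset (val i A as) (mset_set (T i n A as)))"
            and V: "V \<in> tuples (Dm n) K" "Rr n \<subseteq> set V" "tp (\<tau> \<union> L) A V = e"
          note o = conv[OF n A V]
          let ?as = "map (\<lambda>v. V ! \<iota> v) ys"
          have cl: "T i n A ?as \<noteq> {} \<and> ct_close \<delta> (ps i) (image_mset (val i A ?as) (mset_set (T i n A ?as)))" if "i < ?M" for i
            using H o that unfolding ok_def by blast
          then have ne: "\<not> (\<exists>i<?M. T i n A ?as = {})" by blast
          have "eval A ?\<psi> (\<lambda>v. V ! \<iota> v) = F (map (\<lambda>i. image_mset (val i A ?as) (mset_set (T i n A ?as))) [0..<?M])"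
            unfolding evalA[OF n A sD[OF o]] by (rule if_not_P[OF ne])
          then show "\<bar>eval A ?\<psi> (\<lambda>v. V ! \<iota> v) - c\<bar> \<le> \<epsilon>"
            using cl by (simp only:) (intro \<delta>(2), simp_all)
        qed
      qed
    qed
  qed
qed

lemma good_aggregations_sub:
  "good_aggregations N (Conn C \<phi>s) \<Longrightarrow> \<phi> \<in> set \<phi>s \<Longrightarrow> good_aggregations N \<phi>"
  "good_aggregations N (Agg F \<phi>s zs \<kappa>s) \<Longrightarrow> \<phi> \<in> set \<phi>s \<Longrightarrow> good_aggregations N \<phi>"
proof -
  have *: "good_aggregations N \<phi>" if "good_aggregations N \<psi>" "subformulas \<phi> \<subseteq> subformulas \<psi>" for \<phi> \<psi>
    unfolding good_aggregations_def
  proof (intro allI impI)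
    fix F \<phi>s zs \<kappa>s assume "Agg F \<phi>s zs \<kappa>s \<in> subformulas \<phi>"
    then have "Agg F \<phi>s zs \<kappa>s \<in> subformulas \<psi>" using that(2) by blast
    from that(1)[unfolded good_aggregations_def, rule_format, OF this]
    show "continuous_aggregation (length \<phi>s) F \<and>
     (\<exists>ys. distinct (ys @ zs) \<and> (\<Union>\<psi> \<in> set \<phi>s \<union> set \<kappa>s. fv \<psi>) \<subseteq> set (ys @ zs) \<and>
        (\<forall>\<kappa> \<in> set \<kappa>s. \<exists>p. is_ctype N (sigma N) (length (ys @ zs)) p \<and>
           expresses N 0 (ys @ zs) p \<kappa> \<and>
           strongly_unbounded N 0 (length ys) (length zs) (ct_tau p) \<and>
           positive N 0 (length ys) (length zs) p))" .
  qed
  show "good_aggregations N (Conn C \<phi>s) \<Longrightarrow> \<phi> \<in> set \<phi>s \<Longrightarrow> good_aggregations N \<phi>"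
    by (rule *[of "Conn C \<phi>s"]) auto
  show "good_aggregations N (Agg F \<phi>s zs \<kappa>s) \<Longrightarrow> \<phi> \<in> set \<phi>s \<Longrightarrow> good_aggregations N \<phi>"
    by (rule *[of "Agg F \<phi>s zs \<kappa>s"]) auto
qed

lemma determined_pla:
  assumes L: "initial N L" and bal: "\<And>m t. m \<ge> 1 \<Longrightarrow> good m t \<Longrightarrow> balance L m t"
  shows "is_pla ar (\<tau> \<union> L) \<phi> \<Longrightarrow> good_aggregations N \<phi> \<Longrightarrow> determined L \<phi>"
proof (induction \<phi>)
  case (Const c)
  then show ?case using L by (intro determined_Const) auto
next
  case (Eq x y)
  then show ?case using L by (intro determined_Eq)
next
  case (Rel R xs)
  then show ?case using L by (intro determined_Rel) auto
next
  case (Conn C \<phi>s)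
  have "determined L \<phi>" if "\<phi> \<in> set \<phi>s" for \<phi>
    using Conn.IH[OF that] Conn.prems good_aggregations_sub(1)[OF Conn.prems(2) that] that unfolding is_pla_Conn by blast
  then show ?case using Conn.prems L unfolding is_pla_Conn by (intro determined_Conn) auto
next
  case (Agg F \<phi>s zs \<kappa>s)
  have "determined L \<phi>" if "\<phi> \<in> set \<phi>s" for \<phi>
    using Agg.IH(1)[OF that] Agg.prems good_aggregations_sub(2)[OF Agg.prems(2) that] that unfolding is_pla_Agg by blast
  then show ?case using Agg.prems L bal by (intro determined_Agg) auto
qed

lemma balance_all:
  assumes theta: "\<And>R. R \<in> \<sigma> - \<tau> \<Longrightarrow> good_aggregations N (theta N R)"
    and L: "initial N L" and t: "m \<ge> 1" "good m t"
  shows "balance L m t"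
proof -
  have "\<forall>m t. m \<ge> 1 \<longrightarrow> good m t \<longrightarrow> balance L m t"
    using L
  proof (induction rule: initial_induct)
    case empty
    then show ?case using balance_empty by blast
  next
    case (insert R L)
    have R: "R \<in> \<sigma> - \<tau>" using initialD(1)[OF insert(3)] by blast
    have "is_pla ar (\<tau> \<union> L) (theta N R)"
      using theta_pla[OF R] insert(4) is_pla_mono[of ar "par N R \<union> \<tau>" _ "\<tau> \<union> L"] by blast
    then have "determined L (theta N R)" using determined_pla[OF insert(2)] insert(5) theta[OF R] by blast
    then show ?case using balance_insert[OF insert(2,3,1,4)] insert(5) by blast
  qed
  then show ?thesis using t by blast
qed

end

subsection \<open>Limit probabilities of types\<close>

lemma bw_range:
  assumes "\<And>t. t \<in> T \<Longrightarrow> \<theta> t \<in> {0..1}" "finite T" "X \<subseteq> T"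
  shows "bw \<theta> T X \<in> {0..1}"
  unfolding bw_alt[OF assms(2,3)] using assms(1) by (auto intro!: prod_nonneg prod_le_1)

context base_seq
begin

text \<open>Adding \<open>R\<close> multiplies the limit by \<pi>: outside an event of small
  probability, the conditional probability of the prescribed pattern of \<open>R\<close> is within
  \<delta> of \<pi> whenever the old code is right.\<close>

lemma type_limit:
  assumes theta: "\<And>R. R \<in> \<sigma> - \<tau> \<Longrightarrow> good_aggregations N (theta N R)" and L: "initial N L"
  shows "\<exists>\<beta>\<in>{0..1}. \<forall>\<epsilon>>0. \<forall>\<^sub>F n in sequentially. \<forall>us\<in>tuples (Dm n) K. Rr n \<subseteq> set us \<longrightarrow>
    tp \<tau> (B n) us = restr \<tau> e \<longrightarrow> \<bar>prob (subnet N L) n (\<lambda>A. tp (\<tau> \<union> L) A us = e) - \<beta>\<bar> \<le> \<epsilon>"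
  using L
proof (induction arbitrary: e rule: initial_induct)
  case empty
  have pr: "prob (subnet N {}) n (\<lambda>A. tp (\<tau> \<union> {}) A us = e) = of_bool (tp \<tau> (B n) us = e)" if "n \<ge> 1" for n us
    using that by (simp add: prob_expect[OF initial_empty that] expect_def worlds_empty world_prob_def)
  show ?case
  proof (intro bexI[of _ "of_bool (restr \<tau> e = e)"] allI impI)
    fix \<epsilon> :: real assume \<epsilon>: "\<epsilon> > 0"
    show "\<forall>\<^sub>F n in sequentially. \<forall>us\<in>tuples (Dm n) K. Rr n \<subseteq> set us \<longrightarrow> tp \<tau> (B n) us = restr \<tau> e \<longrightarrow>
      \<bar>prob (subnet N {}) n (\<lambda>A. tp (\<tau> \<union> {}) A us = e) - of_bool (restr \<tau> e = e)\<bar> \<le> \<epsilon>"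
      using eventually_ge_at_top[of 1] by eventually_elim (use pr \<epsilon> in auto)
  qed auto
next
  case (insert R L)
  let ?\<rho> = "\<tau> \<union> L" and ?\<rho>' = "\<tau> \<union> insert R L"
  have R: "R \<in> \<sigma> - \<tau>" "R \<notin> ?\<rho>" using initialD(1)[OF insert(3)] insert(1) by auto
  show ?case
  proof (cases "\<exists>n A us. A \<in> worlds (subnet N (insert R L)) n \<and> us \<in> tuples (Dm n) K \<and> tp ?\<rho>' A us = e")
    case False
    have pr: "prob (subnet N (insert R L)) n (\<lambda>A. tp ?\<rho>' A us = e) = 0" if "us \<in> tuples (Dm n) K" for n us
    proof -
      have "{A \<in> worlds (subnet N (insert R L)) n. tp ?\<rho>' A us = e} = {}" using that False by blast
      then show ?thesis unfolding prob_def by (simp only: sum.empty)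
    qed
    show ?thesis by (rule bexI[of _ 0]) (use pr in auto)
  next
    case True
    then obtain n1 A1 V1 where I: "A1 \<in> worlds (subnet N (insert R L)) n1" "V1 \<in> tuples (Dm n1) K" "tp ?\<rho>' A1 V1 = e" by blast
    have l1: "length V1 = K" using I by (simp add: tuples_def)
    \<comment> \<open>In contrast to \<open>balance_insert\<close>, no part of the pattern is fixed
      in advance, so all index tuples are included.\<close>
    define Pos where "Pos = {is. set is \<subseteq> {..<K} \<and> length is = ar R}"
    define E where "E = {is \<in> Pos. (R, is) \<in> snd e}"
    have det: "determined L (theta N R)"
    proof (rule determined_pla[OF insert(2)])
      show "is_pla ar (\<tau> \<union> L) (theta N R)"
        using theta_pla[OF R(1)] insert(4) is_pla_mono[of ar "par N R \<union> \<tau>" _ "\<tau> \<union> L"] by blast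
    qed (use balance_all[OF theta insert(2)] theta[OF R(1)] in auto)
    have Ecl: "is' \<in> E" if "is \<in> E" "is' \<in> Pos" "map ((!) V1) is = map ((!) V1) is'" for "is" is'
      using that l1 unfolding E_def I(3)[symmetric] Pos_def by (simp add: in_tp_rel del: map_eq_conv)
    have fe: "fst (tp ?\<rho>' A1 V1) = fst (restr ?\<rho> e)" unfolding I(3) by (simp add: restr_def)
    obtain \<pi> where \<pi>: "\<pi> \<in> {0..1}" "\<And>\<epsilon>. \<epsilon> > 0 \<Longrightarrow> whp N L (\<lambda>n A. \<forall>V\<in>tuples (Dm n) K. Rr n \<subseteq> set V \<longrightarrow>
      tp ?\<rho> A V = restr ?\<rho> e \<longrightarrow> \<bar>bw (th N A R) ((\<lambda>is. map ((!) V) is) ` Pos) ((\<lambda>is. map ((!) V) is) ` E) - \<pi>\<bar> \<le> \<epsilon>)"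
    proof (rule pattern_weight[OF insert(2) R(1) det l1 _ _ _ fe])
      show "Pos \<subseteq> {is. set is \<subseteq> {..<K} \<and> length is = ar R}" by (simp add: Pos_def)
      show "E \<subseteq> Pos" by (auto simp: E_def)
    qed (use Ecl in blast)+
    obtain \<beta> where \<beta>: "\<beta> \<in> {0..1}" "\<And>\<epsilon>. \<epsilon> > 0 \<Longrightarrow> \<forall>\<^sub>F n in sequentially. \<forall>us\<in>tuples (Dm n) K. Rr n \<subseteq> set us \<longrightarrow>
      tp \<tau> (B n) us = restr \<tau> (restr ?\<rho> e) \<longrightarrow> \<bar>prob (subnet N L) n (\<lambda>A. tp ?\<rho> A us = restr ?\<rho> e) - \<beta>\<bar> \<le> \<epsilon>"
      using insert(5)[of "restr ?\<rho> e"] by blast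
    have rr: "restr \<tau> (restr ?\<rho> e) = restr \<tau> e" by (auto simp: restr_def)
    show ?thesis
    proof (intro bexI[of _ "\<pi> * \<beta>"] allI impI)
      show "\<pi> * \<beta> \<in> {0..1}" using \<pi>(1) \<beta>(1) by (auto intro: mult_le_one)
      fix \<epsilon> :: real assume \<epsilon>: "\<epsilon> > 0"
      \<comment> \<open>One third each for the deviation of the conditional probability, for the
        exceptional event and for the induction hypothesis.\<close>
      define \<delta> where "\<delta> = \<epsilon> / 3"
      have \<delta>: "\<delta> > 0" using \<epsilon> by (simp add: \<delta>_def)
      define H where "H n A \<longleftrightarrow> (\<forall>V\<in>tuples (Dm n) K. Rr n \<subseteq> set V \<longrightarrow> tp ?\<rho> A V = restr ?\<rho> e \<longrightarrow>
        \<bar>bw (th N A R) ((\<lambda>is. map ((!) V) is) ` Pos) ((\<lambda>is. map ((!) V) is) ` E) - \<pi>\<bar> \<le> \<delta>)" for n A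
      have WH: "whp N L H" using \<pi>(2)[OF \<delta>] unfolding H_def .
      show "\<forall>\<^sub>F n in sequentially. \<forall>us\<in>tuples (Dm n) K. Rr n \<subseteq> set us \<longrightarrow> tp \<tau> (B n) us = restr \<tau> e \<longrightarrow>
        \<bar>prob (subnet N (insert R L)) n (\<lambda>A. tp ?\<rho>' A us = e) - \<pi> * \<beta>\<bar> \<le> \<epsilon>"
        using \<beta>(2)[OF \<delta>] WH[unfolded whp_def, rule_format, OF \<delta>] eventually_ge_at_top[of 1]
      proof (eventually_elim, intro ballI impI)
        fix n us assume b: "\<forall>us\<in>tuples (Dm n) K. Rr n \<subseteq> set us \<longrightarrow> tp \<tau> (B n) us = restr \<tau> (restr ?\<rho> e) \<longrightarrow>
            \<bar>prob (subnet N L) n (\<lambda>A. tp ?\<rho> A us = restr ?\<rho> e) - \<beta>\<bar> \<le> \<delta>"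
          and h: "prob (subnet N L) n (\<lambda>A. \<not> H n A) \<le> \<delta>" and n: "(1::nat) \<le> n"
          and us: "us \<in> tuples (Dm n) K" "Rr n \<subseteq> set us" "tp \<tau> (B n) us = restr \<tau> e"
        let ?T = "tuples (Dm n) (ar R)" and ?NT = "(\<lambda>is. map ((!) us) is) ` Pos" and ?Y = "(\<lambda>is. map ((!) us) is) ` E"
        have lus: "length us = K" "set us \<subseteq> Dm n" using us by (auto simp: tuples_def)
        have finT: "finite ?T" using finite_tuples finite_Dm[OF n] by blast
        have "set (map ((!) us) is) \<subseteq> Dm n" if "is \<in> Pos" for "is"
        proof -
          have "set (map ((!) us) is) \<subseteq> set us" unfolding set_map using that lus(1) by (intro image_subsetI nth_mem) (auto simp: Pos_def)
          then show ?thesis using lus(2) by blast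
        qed
        then have "map ((!) us) is \<in> ?T" if "is \<in> Pos" for "is" using that unfolding tuples_def Pos_def mem_Collect_eq by simp
        then have NT: "?NT \<subseteq> ?T" by blast
        have finNT: "finite ?NT" using NT finT by (rule finite_subset)
        have YNT: "?Y \<subseteq> ?NT" by (auto simp: E_def)
        have ieq: "tp ?\<rho>' (ins A R X) us = e \<longleftrightarrow> tp ?\<rho> A us = restr ?\<rho> e \<and> X \<inter> ?NT = ?Y"
          if A: "A \<in> worlds (subnet N L) n" and X: "X \<subseteq> ?T" for A X
        proof -
          have "tp ?\<rho>' (ins A R X) us = e \<longleftrightarrow> tp ?\<rho> (ins A R X) us = restr ?\<rho> e \<and> rel (ins A R X) R \<inter> ?NT = ?Y"
            unfolding E_def
            by (rule tp_insert_iff[OF I(3)[symmetric] _ world(4)[OF I(1)] _ _ _ R(2)])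
              (use lus l1 X in \<open>auto simp: Pos_def\<close>)
          moreover have "tp ?\<rho> (ins A R X) us = tp ?\<rho> A us" using R(2) by (intro tp_Un_reduct) auto
          ultimately show ?thesis by simp
        qed
        have "prob (subnet N (insert R L)) n (\<lambda>A. tp ?\<rho>' A us = e) =
            expect (subnet N L) n (\<lambda>A. of_bool (tp ?\<rho> A us = restr ?\<rho> e) * bw (th N A R) ?NT ?Y)"
          unfolding prob_expect[OF insert(3) n] expect_insert[OF insert(2,3,1,4) n]
        proof (rule expect_cong)
          fix A assume A: "A \<in> worlds (subnet N L) n"
          have "bex (th N A R) ?T (\<lambda>X. of_bool (tp ?\<rho>' (ins A R X) us = e)) =
              bex (th N A R) ?T (\<lambda>X. of_bool (tp ?\<rho> A us = restr ?\<rho> e) * of_bool (X \<inter> ?NT = ?Y))"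
          proof (rule bex_cong)
            fix X assume "X \<subseteq> ?T"
            from ieq[OF A this] show "(of_bool (tp ?\<rho>' (ins A R X) us = e) :: real) =
                of_bool (tp ?\<rho> A us = restr ?\<rho> e) * of_bool (X \<inter> ?NT = ?Y)"
              by (simp only: of_bool_conj)
          qed
          also have "\<dots> = of_bool (tp ?\<rho> A us = restr ?\<rho> e) * bex (th N A R) ?NT (\<lambda>X. of_bool (X = ?Y))"
            by (simp only: bex_cmult bex_local[OF finT NT, of _ "\<lambda>X. of_bool (X = ?Y)"])
          finally show "bex (th N A R) ?T (\<lambda>X. of_bool (tp ?\<rho>' (ins A R X) us = e)) =
              of_bool (tp ?\<rho> A us = restr ?\<rho> e) * bw (th N A R) ?NT ?Y"
            unfolding bex_single[OF finNT YNT] .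
        qed
        moreover have "\<bar>expect (subnet N L) n (\<lambda>A. of_bool (tp ?\<rho> A us = restr ?\<rho> e) * bw (th N A R) ?NT ?Y) -
            \<pi> * prob (subnet N L) n (\<lambda>A. tp ?\<rho> A us = restr ?\<rho> e)\<bar> \<le> \<delta> + \<delta>"
        proof -
          let ?t = "\<lambda>A. of_bool (tp ?\<rho> A us = restr ?\<rho> e) :: real"
          have pt: "\<bar>?t A * bw (th N A R) ?NT ?Y - \<pi> * ?t A\<bar> \<le> \<delta> + of_bool (\<not> H n A)" if A: "A \<in> worlds (subnet N L) n" for A
          proof (cases "tp ?\<rho> A us = restr ?\<rho> e")
            case True
            have th01: "th N A R t \<in> {0..1}" for t using th_range[OF R(1)] world(1)[OF A] finite_Dm[OF n] by simp
            then have "bw (th N A R) ?NT ?Y \<in> {0..1}" using finNT YNT by (intro bw_range)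
            then have "\<bar>bw (th N A R) ?NT ?Y - \<pi>\<bar> \<le> 1" using \<pi>(1) by auto
            moreover have "\<bar>bw (th N A R) ?NT ?Y - \<pi>\<bar> \<le> \<delta>" if "H n A" using that us True unfolding H_def by blast
            ultimately show ?thesis using True \<delta> by (cases "H n A") auto
          qed (use \<delta> in simp)
          let ?g = "\<lambda>A. ?t A * bw (th N A R) ?NT ?Y + (- 1) * (\<pi> * ?t A)"
          have e1: "expect (subnet N L) n ?g = expect (subnet N L) n (\<lambda>A. ?t A * bw (th N A R) ?NT ?Y) -
              \<pi> * prob (subnet N L) n (\<lambda>A. tp ?\<rho> A us = restr ?\<rho> e)"
            unfolding expect_add expect_cmult prob_expect[OF insert(2) n] by simp
          have e2: "expect (subnet N L) n (\<lambda>A. \<delta> + of_bool (\<not> H n A)) = \<delta> + prob (subnet N L) n (\<lambda>A. \<not> H n A)"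
            unfolding expect_add prob_expect[OF insert(2) n] expect_one[OF insert(2) n] ..
          have "expect (subnet N L) n ?g \<le> expect (subnet N L) n (\<lambda>A. \<delta> + of_bool (\<not> H n A))"
          proof (rule expect_mono[OF insert(2) n])
            fix A assume "A \<in> worlds (subnet N L) n"
            from pt[OF this] show "?g A \<le> \<delta> + of_bool (\<not> H n A)" by (simp only: abs_le_iff) argo
          qed
          moreover have "expect (subnet N L) n (\<lambda>A. (- 1) * (\<delta> + of_bool (\<not> H n A))) \<le> expect (subnet N L) n ?g"
          proof (rule expect_mono[OF insert(2) n])
            fix A assume "A \<in> worlds (subnet N L) n"
            from pt[OF this] show "(- 1) * (\<delta> + of_bool (\<not> H n A)) \<le> ?g A" by (simp only: abs_le_iff) argo
          qed
          ultimately show ?thesis using h unfolding e1 expect_cmult e2 abs_le_iff by argo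
        qed
        moreover have "\<bar>\<pi> * prob (subnet N L) n (\<lambda>A. tp ?\<rho> A us = restr ?\<rho> e) - \<pi> * \<beta>\<bar> \<le> \<delta>"
        proof -
          have "\<bar>prob (subnet N L) n (\<lambda>A. tp ?\<rho> A us = restr ?\<rho> e) - \<beta>\<bar> \<le> \<delta>" using b us rr by simp
          moreover have "\<bar>\<pi> * prob (subnet N L) n (\<lambda>A. tp ?\<rho> A us = restr ?\<rho> e) - \<pi> * \<beta>\<bar> =
              \<pi> * \<bar>prob (subnet N L) n (\<lambda>A. tp ?\<rho> A us = restr ?\<rho> e) - \<beta>\<bar>"
            using \<pi>(1) by (simp add: right_diff_distrib[symmetric] abs_mult)
          moreover have "\<dots> \<le> 1 * \<bar>prob (subnet N L) n (\<lambda>A. tp ?\<rho> A us = restr ?\<rho> e) - \<beta>\<bar>"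
            using \<pi>(1) by (intro mult_right_mono) auto
          ultimately show ?thesis by argo
        qed
        ultimately show "\<bar>prob (subnet N (insert R L)) n (\<lambda>A. tp ?\<rho>' A us = e) - \<pi> * \<beta>\<bar> \<le> \<epsilon>"
          unfolding \<delta>_def by linarith
      qed
    qed
  qed
qed

end

subsection \<open>Closure types as formulas\<close>

definition notf :: "'r pla \<Rightarrow> 'r pla" where
  "notf \<phi> = Conn (\<lambda>vs. 1 - vs ! 0) [\<phi>]"

text \<open>The constant 1 makes the empty conjunction legitimate, as connectives have arity at
  least 1.\<close>

definition conjf :: "'r pla list \<Rightarrow> 'r pla" where
  "conjf \<phi>s = Conn (\<lambda>vs. Min (set vs)) (Const 1 # \<phi>s)"

text \<open>Existential quantification as a maximum over all tuples; the condition
  \<open>Const 1\<close> selects everything. An aggregation binds a nonempty list of variables,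
  hence the case distinction.\<close>

definition exf :: "nat list \<Rightarrow> 'r pla \<Rightarrow> 'r pla" where
  "exf zs \<phi> = (if zs = [] then \<phi> else Agg (\<lambda>rs. Max (set_mset (rs ! 0))) [\<phi>] zs [Const 1])"

definition litf :: "bool \<Rightarrow> 'r pla \<Rightarrow> 'r pla" where
  "litf b \<phi> = (if b then \<phi> else notf \<phi>)"

definition code_lits :: "('r \<Rightarrow> nat) \<Rightarrow> 'r set \<Rightarrow> nat list \<Rightarrow> 'r code \<Rightarrow> 'r pla set" where
  "code_lits ar \<rho> vs e = (\<lambda>(i, j). litf ((i, j) \<in> fst e) (Eq (vs ! i) (vs ! j))) ` ({..<length vs} \<times> {..<length vs}) \<union>
     (\<lambda>(R, is). litf ((R, is) \<in> snd e) (Rel R (map ((!) vs) is))) ` (SIGMA R:\<rho>. tuples {..<length vs} (ar R))"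

definition codef :: "('r \<Rightarrow> nat) \<Rightarrow> 'r set \<Rightarrow> nat list \<Rightarrow> 'r code \<Rightarrow> 'r pla" where
  "codef ar \<rho> vs e = conjf (SOME l. set l = code_lits ar \<rho> vs e)"

text \<open>Values are real numbers; for formulas with values 0 and 1 only, truth may be identified
  with the value 1.\<close>

definition twoval :: "('a, 'r) struc \<Rightarrow> 'r pla \<Rightarrow> bool" where
  "twoval A \<phi> \<longleftrightarrow> (\<forall>s. eval A \<phi> s \<in> {0, 1})"

lemma twovalD: "twoval A \<phi> \<Longrightarrow> eval A \<phi> s = of_bool (eval A \<phi> s = 1)"
  by (auto simp: twoval_def)

lemma fv_notf [simp]: "fv (notf \<phi>) = fv \<phi>" and fv_conjf [simp]: "fv (conjf \<phi>s) = (\<Union>\<phi>\<in>set \<phi>s. fv \<phi>)"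
  and fv_exf [simp]: "fv (exf zs \<phi>) = fv \<phi> - set zs" and fv_litf [simp]: "fv (litf b \<phi>) = fv \<phi>"
  by (auto simp: notf_def conjf_def exf_def litf_def)

lemma eval_notf: "eval A (notf \<phi>) s = 1 - eval A \<phi> s"
  by (simp add: notf_def)

lemma twoval_notf: "twoval A \<phi> \<Longrightarrow> twoval A (notf \<phi>)"
  unfolding twoval_def eval_notf by (metis cancel_comm_monoid_add_class.diff_cancel diff_zero insert_iff singletonD)

lemma eval_notf_1: "twoval A \<phi> \<Longrightarrow> eval A (notf \<phi>) s = 1 \<longleftrightarrow> eval A \<phi> s \<noteq> 1"
  using twovalD[of A \<phi> s] by (cases "eval A \<phi> s = 1") (auto simp: eval_notf)

lemma eval_conjf:
  assumes "\<And>\<phi>. \<phi> \<in> set \<phi>s \<Longrightarrow> twoval A \<phi>"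
  shows "eval A (conjf \<phi>s) s = of_bool (\<forall>\<phi>\<in>set \<phi>s. eval A \<phi> s = 1)"
proof -
  let ?S = "insert 1 ((\<lambda>\<phi>. eval A \<phi> s) ` set \<phi>s)"
  have e: "eval A (conjf \<phi>s) s = Min ?S" by (simp add: conjf_def image_image)
  show ?thesis
  proof (cases "\<forall>\<phi>\<in>set \<phi>s. eval A \<phi> s = 1")
    case True
    then have "?S = {1}" by auto
    then have "Min ?S = 1" by (simp only: Min_singleton)
    then show ?thesis using True e by simp
  next
    case False
    then obtain \<phi> where \<phi>: "\<phi> \<in> set \<phi>s" "eval A \<phi> s \<noteq> 1" by blast
    then have z: "eval A \<phi> s = 0" using assms by (auto simp: twoval_def)
    have "Min ?S = 0"
    proof (rule Min_eqI)
      show "0 \<in> ?S" using z \<phi>(1) by force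
      show "0 \<le> y" if "y \<in> ?S" for y
      proof -
        have "y = 1 \<or> (\<exists>\<psi>\<in>set \<phi>s. y = eval A \<psi> s)" using that by blast
        then show ?thesis using twovalD[OF assms] by (metis of_bool_def order.refl zero_le_one)
      qed
    qed simp
    then show ?thesis unfolding e using False by simp
  qed
qed

lemma twoval_conjf: "(\<And>\<phi>. \<phi> \<in> set \<phi>s \<Longrightarrow> twoval A \<phi>) \<Longrightarrow> twoval A (conjf \<phi>s)"
  using eval_conjf[of \<phi>s A] by (auto simp: twoval_def)

lemma eval_exf:
  assumes \<phi>: "twoval A \<phi>" and fin: "finite (dom A)"
  shows "eval A (exf zs \<phi>) s = of_bool (\<exists>bs\<in>tuples (dom A) (length zs). eval A \<phi> (upd s zs bs) = 1)"
proof (cases "zs = []")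
  case True
  have "tuples (dom A) 0 = {[]}" by (auto simp: tuples_def)
  moreover have "upd s [] [] = s" by (rule ext) (simp add: upd_def)
  ultimately show ?thesis using True twovalD[OF \<phi>, of s] by (simp add: exf_def)
next
  case False
  let ?X = "tuples (dom A) (length zs)"
  let ?S = "(\<lambda>bs. eval A \<phi> (upd s zs bs)) ` ?X"
  have finX: "finite ?X" using fin by (rule finite_tuples)
  have e: "eval A (exf zs \<phi>) s = (if ?X = {} then 0 else Max ?S)"
    using False finX by (simp add: exf_def eval_Agg)
  show ?thesis
  proof (cases "\<exists>bs\<in>?X. eval A \<phi> (upd s zs bs) = 1")
    case True
    then have "?X \<noteq> {}" "1 \<in> ?S" by force+
    moreover have "Max ?S = 1"
    proof (rule Max_eqI)
      show "y \<le> 1" if "y \<in> ?S" for y using that twovalD[OF \<phi>] by (metis (no_types, lifting) imageE of_bool_def order.refl zero_le_one)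
    qed (use finX \<open>1 \<in> ?S\<close> in auto)
    ultimately show ?thesis unfolding e using True by simp
  next
    case False
    then have "eval A \<phi> (upd s zs bs) = 0" if "bs \<in> ?X" for bs using \<phi> that unfolding twoval_def by blast
    then have "?S = {0}" if "?X \<noteq> {}" using that by force
    then show ?thesis unfolding e using False by auto
  qed
qed

lemma twoval_exf: "twoval A \<phi> \<Longrightarrow> finite (dom A) \<Longrightarrow> twoval A (exf zs \<phi>)"
  using eval_exf[of A \<phi> zs] by (auto simp: twoval_def)

lemma continuous_Min_coords:
  "n \<ge> 1 \<Longrightarrow> continuous_on S (\<lambda>x :: nat \<Rightarrow> real. Min (set (map x [0..<n])))"
proof (induction n rule: nat_induct_at_least)
  case base
  then show ?case by (simp add: continuous_on_subset[OF continuous_on_product_coordinates])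
next
  case (Suc n)
  have "Min (set (map x [0..<Suc n])) = min (x n) (Min (set (map x [0..<n])))" for x :: "nat \<Rightarrow> real"
    using Suc(1) by (simp add: Min_insert image_is_empty)
  then show ?case using Suc(2)
    by (simp only:) (intro continuous_on_min continuous_on_subset[OF continuous_on_product_coordinates] subset_UNIV)
qed

lemma is_pla_notf: "is_pla ar \<rho> \<phi> \<Longrightarrow> is_pla ar \<rho> (notf \<phi>)"
proof -
  have "is_connective 1 (\<lambda>vs. 1 - vs ! 0)"
    unfolding is_connective_def
    by (auto simp: Pi_iff intro!: continuous_intros continuous_on_subset[OF continuous_on_product_coordinates])
  then show "is_pla ar \<rho> \<phi> \<Longrightarrow> is_pla ar \<rho> (notf \<phi>)" by (simp add: notf_def)
qed

lemma is_pla_conjf: "(\<And>\<phi>. \<phi> \<in> set \<phi>s \<Longrightarrow> is_pla ar \<rho> \<phi>) \<Longrightarrow> is_pla ar \<rho> (conjf \<phi>s)"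
proof -
  have "is_connective (Suc n) (\<lambda>vs. Min (set vs))" for n
    unfolding is_connective_def
  proof (intro conjI ballI)
    fix x :: "nat \<Rightarrow> real" assume x: "x \<in> {..<Suc n} \<rightarrow> {0..1}"
    have "Min (set (map x [0..<Suc n])) \<in> set (map x [0..<Suc n])" by (intro Min_in) auto
    then have "Min (set (map x [0..<Suc n])) \<in> x ` {..<Suc n}" by (simp only: set_map set_upt atLeast0LessThan)
    then obtain i where "i < Suc n" "Min (set (map x [0..<Suc n])) = x i" by blast
    then show "Min (set (map x [0..<Suc n])) \<in> {0..1}" using x by (simp only: Pi_iff lessThan_iff)
  qed (use continuous_Min_coords[of "Suc n"] in simp_all)
  then show "(\<And>\<phi>. \<phi> \<in> set \<phi>s \<Longrightarrow> is_pla ar \<rho> \<phi>) \<Longrightarrow> is_pla ar \<rho> (conjf \<phi>s)"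
    unfolding conjf_def is_pla_Conn by auto
qed

lemma is_pla_exf: "is_pla ar \<rho> \<phi> \<Longrightarrow> distinct zs \<Longrightarrow> is_pla ar \<rho> (exf zs \<phi>)"
proof -
  have "is_aggregation 1 (\<lambda>rs. Max (set_mset (rs ! 0)))"
    unfolding is_aggregation_def
  proof (intro conjI allI impI)
    fix rs :: "real multiset list" assume r: "length rs = 1 \<and> (\<forall>r\<in>set rs. r \<noteq> {#} \<and> set_mset r \<subseteq> {0..1})"
    then have "rs ! 0 \<in> set rs" by simp
    then have "rs ! 0 \<noteq> {#}" "set_mset (rs ! 0) \<subseteq> {0..1}" using r by blast+
    moreover then have "Max (set_mset (rs ! 0)) \<in> set_mset (rs ! 0)" by (intro Max_in) auto
    ultimately show "Max (set_mset (rs ! 0)) \<in> {0..1}" by blast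
  qed simp
  then show "is_pla ar \<rho> \<phi> \<Longrightarrow> distinct zs \<Longrightarrow> is_pla ar \<rho> (exf zs \<phi>)" by (simp add: exf_def)
qed

context
  fixes ar :: "'r \<Rightarrow> nat" and \<rho> :: "'r set"
  assumes fin: "finite \<rho>"
begin

lemma finite_code_lits: "finite (code_lits ar \<rho> vs e)"
  unfolding code_lits_def using fin
  by (intro finite_UnI finite_imageI finite_SigmaI finite_tuples) auto

lemma codef_list: obtains l where "set l = code_lits ar \<rho> vs e" "codef ar \<rho> vs e = conjf l"
  using that someI_ex[OF finite_list[OF finite_code_lits]] unfolding codef_def by blast

lemma fv_codef: "fv (codef ar \<rho> vs e) \<subseteq> set vs"
proof -
  obtain l where l: "set l = code_lits ar \<rho> vs e" "codef ar \<rho> vs e = conjf l" by (rule codef_list)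
  have "fv \<phi> \<subseteq> set vs" if "\<phi> \<in> code_lits ar \<rho> vs e" for \<phi>
    using that by (auto simp: code_lits_def tuples_def subset_iff)
  then show ?thesis unfolding l(2) fv_conjf l(1) by blast
qed

lemma is_pla_codef:
  assumes "\<rho> \<subseteq> \<rho>'"
  shows "is_pla ar \<rho>' (codef ar \<rho> vs e)"
proof -
  obtain l where l: "set l = code_lits ar \<rho> vs e" "codef ar \<rho> vs e = conjf l" by (rule codef_list)
  have "is_pla ar \<rho>' \<phi>" if "\<phi> \<in> code_lits ar \<rho> vs e" for \<phi>
    using that in_mono[OF assms, THEN mp] unfolding code_lits_def litf_def tuples_def
    by (auto simp del: is_pla.simps(4) intro!: is_pla_notf)
  then show ?thesis unfolding l(2) using l(1) by (intro is_pla_conjf) auto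
qed

text \<open>The literals range over index tuples of the right length only, so they could not detect
  a part of \<open>e\<close> outside \<open>codes\<close>; hence the first assumption.\<close>

lemma codef_sat:
  assumes e: "e \<in> codes ar \<rho> (length vs)" and A: "\<And>R. R \<in> \<rho> \<Longrightarrow> rel A R \<subseteq> tuples X (ar R)"
  shows "twoval A (codef ar \<rho> vs e)" "eval A (codef ar \<rho> vs e) s = 1 \<longleftrightarrow> tp \<rho> A (map s vs) = e"
proof -
  obtain l where l: "set l = code_lits ar \<rho> vs e" "codef ar \<rho> vs e = conjf l" by (rule codef_list)
  have at: "twoval A (Eq x y)" "twoval A (Rel R xs)" for x y R xs by (auto simp: twoval_def)
  have lit: "twoval A (litf b \<phi>)" "eval A (litf b \<phi>) s = 1 \<longleftrightarrow> (eval A \<phi> s = 1 \<longleftrightarrow> b)" if "twoval A \<phi>" for b \<phi> s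
    using that twoval_notf[OF that] eval_notf_1[OF that, of s] by (auto simp: litf_def)
  have tl: "twoval A \<phi>" if "\<phi> \<in> set l" for \<phi> using that unfolding l(1) code_lits_def by (auto intro!: lit(1) at)
  then show "twoval A (codef ar \<rho> vs e)" unfolding l(2) by (rule twoval_conjf)
  let ?n = "length vs" and ?t = "tp \<rho> A (map s vs)"
  have tc: "?t \<in> codes ar \<rho> ?n" using tp_codes[of \<rho> A X ar "map s vs"] A by simp
  have "eval A (codef ar \<rho> vs e) s = 1 \<longleftrightarrow> (\<forall>\<phi>\<in>code_lits ar \<rho> vs e. eval A \<phi> s = 1)"
    using eval_conjf[of l A s] tl l by simp
  also have "\<dots> \<longleftrightarrow> (\<forall>i<?n. \<forall>j<?n. (i, j) \<in> fst ?t \<longleftrightarrow> (i, j) \<in> fst e) \<and>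
      (\<forall>R\<in>\<rho>. \<forall>is\<in>tuples {..<?n} (ar R). (R, is) \<in> snd ?t \<longleftrightarrow> (R, is) \<in> snd e)"
  proof -
    have m: "map s (map ((!) vs) is) = map ((!) (map s vs)) is" if "is \<in> tuples {..<?n} k" for "is" k
      using that by (intro map_nth_map[symmetric]) (simp add: tuples_def)
    have 1: "eval A (Eq (vs ! i) (vs ! j)) s = 1 \<longleftrightarrow> (i, j) \<in> fst ?t" if "i < ?n" "j < ?n" for i j
      using that by (simp add: in_tp_eq)
    have 2: "eval A (Rel R (map ((!) vs) is)) s = 1 \<longleftrightarrow> (R, is) \<in> snd ?t" if "R \<in> \<rho>" "is \<in> tuples {..<?n} (ar R)" for R "is"
      using that(1) that(2) unfolding eval.simps m[OF that(2)] in_tp_rel by (simp add: tuples_def)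
    show ?thesis unfolding code_lits_def ball_Un using 1 2 lit(2)[OF at(1)] lit(2)[OF at(2)]
      by (auto simp del: eval.simps)
  qed
  also have "\<dots> \<longleftrightarrow> ?t = e"
  proof
    assume H: "(\<forall>i<?n. \<forall>j<?n. (i, j) \<in> fst ?t \<longleftrightarrow> (i, j) \<in> fst e) \<and>
      (\<forall>R\<in>\<rho>. \<forall>is\<in>tuples {..<?n} (ar R). (R, is) \<in> snd ?t \<longleftrightarrow> (R, is) \<in> snd e)"
    have c: "fst ?t \<subseteq> {..<?n} \<times> {..<?n}" "fst e \<subseteq> {..<?n} \<times> {..<?n}"
      "snd ?t \<subseteq> (SIGMA R:\<rho>. tuples {..<?n} (ar R))" "snd e \<subseteq> (SIGMA R:\<rho>. tuples {..<?n} (ar R))"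
      using tc e by (auto simp: codes_def)
    have "fst ?t = fst e" using H c(1,2) by auto
    moreover have "snd ?t = snd e" using H c(3,4) by auto
    ultimately show "?t = e" by (rule prod_eqI)
  qed auto
  finally show "eval A (codef ar \<rho> vs e) s = 1 \<longleftrightarrow> ?t = e" .
qed

end

subsection \<open>Basic formulas and limit distributions\<close>

text \<open>One extra factor n absorbs the sum of the absolute values of the coefficients.\<close>

lemma poly_le_power:
  fixes P :: "real poly"
  shows "\<forall>\<^sub>F n :: nat in sequentially. poly P (real n) \<le> real n ^ (degree P + 1)"
proof -
  let ?C = "\<Sum>i\<le>degree P. \<bar>coeff P i\<bar>"
  have "\<forall>\<^sub>F n :: nat in sequentially. ?C \<le> real n"
    using filterlim_real_sequentially unfolding filterlim_at_top by blast
  then show ?thesis using eventually_ge_at_top[of 1]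
  proof eventually_elim
    fix n :: nat assume C: "?C \<le> real n" and n: "1 \<le> n"
    have "poly P (real n) = (\<Sum>i\<le>degree P. coeff P i * real n ^ i)" by (rule poly_altdef)
    also have "\<dots> \<le> (\<Sum>i\<le>degree P. \<bar>coeff P i\<bar> * real n ^ degree P)"
      using n by (intro sum_mono mult_mono power_increasing) auto
    also have "\<dots> = ?C * real n ^ degree P" by (simp add: sum_distrib_right)
    also have "\<dots> \<le> real n * real n ^ degree P" using C by (intro mult_right_mono) auto
    finally show "poly P (real n) \<le> real n ^ (degree P + 1)" by simp
  qed
qed

lemma eval_pos_asg:
  assumes "fv \<phi> \<subseteq> set xs" "distinct xs" "length as = length xs"
  shows "eval A \<phi> (\<lambda>v. (as @ rs) ! pos xs v) = eval A \<phi> (asg xs as)"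
proof (rule eval_fv)
  fix v assume "v \<in> fv \<phi>"
  then have v: "pos xs v < length xs" "xs ! pos xs v = v" using pos[of v xs] assms(1) by auto
  then show "(as @ rs) ! pos xs v = asg xs as v"
    using asg_nth[OF assms(2,3) v(1)] assms(3) by (simp add: nth_append)
qed

context network
begin

section \<open>Rarity and closure types expressed in the logic\<close>

lemma tau_Un_diff: "\<tau> \<union> (\<sigma> - \<tau>) = \<sigma>"
  using tau_sub by blast

lemma world_tp_tau: "A \<in> worlds N n \<Longrightarrow> tp \<tau> A us = tp \<tau> (B n) us"
  using worldN(2)[of A n] by (auto simp: tp_def)

lemma world_tp_codes: "A \<in> worlds N n \<Longrightarrow> tp \<rho> A us \<in> codes ar \<rho> (length us)"
  using worldN(4) by (rule tp_codes)

text \<open>Length and code are taken from one realization; by \<open>ct_codes\<close> every other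
  realization has an enumeration of its rare elements that yields the same code.\<close>

lemma ctype_code:
  assumes p: "is_complete_ctype N \<rho> k p" "\<tau> \<subseteq> \<rho>"
    and I: "n1 \<ge> 1" "A1 \<in> worlds N n1" "as1 \<in> tuples (Dm n1) k" "ct_sat N 0 p n1 A1 as1"
  shows "\<exists>r e. \<forall>n. \<forall>A\<in>worlds N n. \<forall>as\<in>tuples (Dm n) k. ct_sat N 0 p n A as \<longrightarrow>
    (\<exists>rs\<in>tuples (Dm n) r. set rs = Rr n \<and> tp \<rho> A (as @ rs) = e)"
proof -
  obtain rs1 where rs1: "set rs1 = Rr n1" using finite_list finite_subset[OF Rr_sub finite_Dm[OF I(1)]] by blast
  show ?thesis
  proof (rule exI[of _ "length rs1"], rule exI[of _ "tp \<rho> A1 (as1 @ rs1)"], intro allI ballI impI)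
    fix n A as assume H: "A \<in> worlds N n" "as \<in> tuples (Dm n) k" "ct_sat N 0 p n A as"
    obtain rs where rs: "set rs = Rr n" "length rs = length rs1" "tp \<rho> A1 (as1 @ rs1) = tp \<rho> A (as @ rs)"
      by (rule ct_codes[OF I(4) H(3) p I(2) H(1) I(3) H(2) rs1])
    then have "rs \<in> tuples (Dm n) (length rs1)" using Rr_sub by (simp add: tuples_def)
    then show "\<exists>rs\<in>tuples (Dm n) (length rs1). set rs = Rr n \<and> tp \<rho> A (as @ rs) = tp \<rho> A1 (as1 @ rs1)"
      using rs by metis
  qed
qed

definition rare_codes :: "'r code set" where
  "rare_codes = {tp \<tau> (B n) [x] |n x. n \<ge> 1 \<and> x \<in> Rr n}"

lemma rare_codes_sub: "rare_codes \<subseteq> codes ar \<tau> 1"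
proof
  fix e assume "e \<in> rare_codes"
  then obtain n x where "n \<ge> 1" "e = tp \<tau> (B n) [x]" unfolding rare_codes_def by blast
  then show "e \<in> codes ar \<tau> 1" using tp_codes[of \<tau> "B n" "Dm n" ar "[x]"] base_rel[of n] by simp
qed

lemma rare_code:
  assumes "n \<ge> 1" "x \<in> Dm n"
  shows "tp \<tau> (B n) [x] \<in> rare_codes \<longleftrightarrow> x \<in> Rr n"
proof
  assume "tp \<tau> (B n) [x] \<in> rare_codes"
  then obtain n' y where y: "y \<in> Rr n'" "tp \<tau> (B n') [y] = tp \<tau> (B n) [x]" unfolding rare_codes_def by auto
  show "x \<in> Rr n" using rare_tp[of n' y n x] y assms(2) by (simp add: Rr_def)
qed (use assms in \<open>auto simp: rare_codes_def\<close>)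

text \<open>A disjunction over the finitely many codes of rare elements, written with
  negations.\<close>

definition raref :: "nat \<Rightarrow> 'r pla" where
  "raref v = notf (conjf (map (\<lambda>c. notf (codef ar \<tau> [v] c)) (SOME l. set l = rare_codes)))"

lemma set_some_rare: "set (SOME l. set l = rare_codes) = rare_codes"
  by (rule someI_ex[OF finite_list[OF finite_subset[OF rare_codes_sub finite_codes[OF finite_tau]]]])

lemma raref_sat:
  assumes n: "n \<ge> 1" and A: "A \<in> worlds N n"
  shows "twoval A (raref v)" "s v \<in> Dm n \<Longrightarrow> eval A (raref v) s = 1 \<longleftrightarrow> s v \<in> Rr n"
proof -
  let ?l = "SOME l. set l = rare_codes"
  let ?fs = "map (\<lambda>c. notf (codef ar \<tau> [v] c)) ?l"
  have c: "twoval A (codef ar \<tau> [v] c)" "eval A (codef ar \<tau> [v] c) s = 1 \<longleftrightarrow> tp \<tau> A [s v] = c"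
    if "c \<in> rare_codes" for c s
  proof -
    have "c \<in> codes ar \<tau> (length [v])" using that rare_codes_sub by auto
    from codef_sat[OF finite_tau this worldN(4)[OF A]]
    show "twoval A (codef ar \<tau> [v] c)" "eval A (codef ar \<tau> [v] c) s = 1 \<longleftrightarrow> tp \<tau> A [s v] = c" by simp_all
  qed
  have tv: "twoval A \<phi>" if "\<phi> \<in> set ?fs" for \<phi>
    using that c(1) unfolding set_map set_some_rare by (auto intro: twoval_notf)
  have tc: "twoval A (conjf ?fs)" using tv by (rule twoval_conjf)
  then show "twoval A (raref v)" unfolding raref_def by (rule twoval_notf)
  assume sv: "s v \<in> Dm n"
  have "eval A (raref v) s = 1 \<longleftrightarrow> \<not> (\<forall>\<phi>\<in>set ?fs. eval A \<phi> s = 1)"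
    unfolding raref_def eval_notf_1[OF tc] using eval_conjf[of ?fs A s] tv by simp
  also have "\<dots> \<longleftrightarrow> (\<exists>c\<in>rare_codes. tp \<tau> A [s v] = c)"
    unfolding set_map set_some_rare using eval_notf_1[OF c(1)] c(2) by simp
  also have "\<dots> \<longleftrightarrow> s v \<in> Rr n" using rare_code[OF n sv] world_tp_tau[OF A] by simp
  finally show "eval A (raref v) s = 1 \<longleftrightarrow> s v \<in> Rr n" .
qed

lemma fv_raref: "fv (raref v) \<subseteq> {v}"
  using fv_codef[OF finite_tau, of ar "[v]"] by (auto simp: raref_def)

lemma is_pla_raref: "is_pla ar \<sigma> (raref v)"
  unfolding raref_def using is_pla_codef[OF finite_tau tau_sub] by (intro is_pla_notf is_pla_conjf) (auto intro: is_pla_notf)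

text \<open>Completeness of the list \<open>zs\<close>: together with \<open>raref\<close> of its
  members it says that \<open>zs\<close> enumerates the rare elements.\<close>

definition allraref :: "nat \<Rightarrow> nat list \<Rightarrow> 'r pla" where
  "allraref w zs = notf (exf [w] (conjf (raref w # map (\<lambda>z. notf (Eq w z)) zs)))"

lemma allraref_sat:
  assumes n: "n \<ge> 1" and A: "A \<in> worlds N n" and w: "w \<notin> set zs"
  shows "twoval A (allraref w zs)" "eval A (allraref w zs) s = 1 \<longleftrightarrow> Rr n \<subseteq> s ` set zs"
proof -
  let ?fs = "raref w # map (\<lambda>z. notf (Eq w z)) zs"
  have eq: "twoval A (Eq w z)" for z by (auto simp: twoval_def)
  have tv: "twoval A \<phi>" if "\<phi> \<in> set ?fs" for \<phi>
    using that raref_sat(1)[OF n A] twoval_notf[OF eq] by auto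
  have tc: "twoval A (conjf ?fs)" using tv by (rule twoval_conjf)
  have fin: "finite (dom A)" using finite_Dm[OF n] worldN(1)[OF A] by simp
  note te = twoval_exf[OF tc fin, of "[w]"]
  show "twoval A (allraref w zs)" unfolding allraref_def using te by (rule twoval_notf)
  have "eval A (conjf ?fs) (upd s [w] [b]) = 1 \<longleftrightarrow> b \<in> Rr n \<and> b \<notin> s ` set zs" if b: "b \<in> Dm n" for b
  proof -
    have u: "upd s [w] [b] w = b" "upd s [w] [b] z = s z" if "z \<noteq> w" for z using that by (simp_all add: upd_def)
    have uw: "upd s [w] [b] w = b" by (simp add: upd_def)
    have "eval A (conjf ?fs) (upd s [w] [b]) = 1 \<longleftrightarrow> (\<forall>\<phi>\<in>set ?fs. eval A \<phi> (upd s [w] [b]) = 1)"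
      using eval_conjf[of ?fs A "upd s [w] [b]"] tv by simp
    also have "\<dots> \<longleftrightarrow> b \<in> Rr n \<and> (\<forall>z\<in>set zs. eval A (notf (Eq w z)) (upd s [w] [b]) = 1)"
      using raref_sat(2)[OF n A, of "upd s [w] [b]" w] b uw by simp
    also have "\<dots> \<longleftrightarrow> b \<in> Rr n \<and> (\<forall>z\<in>set zs. b \<noteq> s z)"
      unfolding eval_notf_1[OF eq] using u(2) uw w by (metis (mono_tags, lifting) eval.simps(2) of_bool_eq_1_iff)
    finally show ?thesis by blast
  qed
  moreover have "tuples (dom A) (length [w]) = (\<lambda>b. [b]) ` Dm n"
    unfolding worldN(1)[OF A] by (auto simp: tuples_def length_Suc_conv)
  ultimately have "eval A (exf [w] (conjf ?fs)) s = of_bool (\<exists>b\<in>Dm n. b \<in> Rr n \<and> b \<notin> s ` set zs)"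
    unfolding eval_exf[OF tc fin] by simp
  then show "eval A (allraref w zs) s = 1 \<longleftrightarrow> Rr n \<subseteq> s ` set zs"
    unfolding allraref_def eval_notf_1[OF te] using Rr_sub[of n] by auto
qed

text \<open>The formula asserts that some enumeration of the rare elements has, together with
  \<open>xs\<close>, the code of the type. A type that is never realized is expressed by
  \<open>Const 0\<close>.\<close>

lemma expressible:
  assumes p: "is_complete_ctype N \<sigma> (length xs) p" and xs: "distinct xs"
  shows "\<exists>\<kappa>. is_pla ar \<sigma> \<kappa> \<and> fv \<kappa> \<subseteq> set xs \<and> expresses N 0 xs p \<kappa>"
proof (cases "\<exists>n\<ge>1. \<exists>A\<in>worlds N n. \<exists>as\<in>tuples (Dm n) (length xs). ct_sat N 0 p n A as")
  case False
  then have "expresses N 0 xs p (Const 0)" unfolding expresses_def using worldN(1) by fastforce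
  then show ?thesis by (intro exI[of _ "Const 0"]) simp
next
  case True
  let ?k = "length xs"
  obtain n1 A1 as1 where I: "n1 \<ge> 1" "A1 \<in> worlds N n1" "as1 \<in> tuples (Dm n1) ?k" "ct_sat N 0 p n1 A1 as1"
    using True by blast
  obtain r e where re: "\<forall>n. \<forall>A\<in>worlds N n. \<forall>as\<in>tuples (Dm n) ?k. ct_sat N 0 p n A as \<longrightarrow>
      (\<exists>rs\<in>tuples (Dm n) r. set rs = Rr n \<and> tp \<sigma> A (as @ rs) = e)"
    using ctype_code[OF p tau_sub I] by blast
  obtain rs1 where rs1: "rs1 \<in> tuples (Dm n1) r" "set rs1 = Rr n1" "tp \<sigma> A1 (as1 @ rs1) = e" using re[rule_format, OF I(2-4)] by blast
  have key: "ct_sat N 0 p n A as \<longleftrightarrow> (\<exists>rs\<in>tuples (Dm n) r. set rs = Rr n \<and> tp \<sigma> A (as @ rs) = e)"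
    if A: "A \<in> worlds N n" and as: "as \<in> tuples (Dm n) ?k" for n A as
  proof
    assume "\<exists>rs\<in>tuples (Dm n) r. set rs = Rr n \<and> tp \<sigma> A (as @ rs) = e"
    then obtain rs where rs: "rs \<in> tuples (Dm n) r" "set rs = Rr n" "tp \<sigma> A (as @ rs) = e" by blast
    have len: "length as1 = ?k" "length as = ?k" using I(3) as by (auto simp: tuples_def)
    show "ct_sat N 0 p n A as"
    proof (rule ct_sat_code[where k = ?k and V = "as1 @ rs1" and V' = "as @ rs" and js = "[0..<?k]", OF I(4) _ _ I(2) A])
      show "is_ctype N \<sigma> ?k p" using p by (simp add: is_complete_ctype_def)
      show "tp \<sigma> A1 (as1 @ rs1) = tp \<sigma> A (as @ rs)" using rs(3) rs1(3) by simp
      show "set (as1 @ rs1) \<subseteq> Dm n1" "set (as @ rs) \<subseteq> Dm n" using I(3) as rs(1) rs1(1) by (auto simp: tuples_def)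
      show "as1 = map ((!) (as1 @ rs1)) [0..<?k]" "as = map ((!) (as @ rs)) [0..<?k]"
        using len by (auto intro!: nth_equalityI simp: nth_append)
    qed (use len rs(2) rs1(2) in auto)
  qed (rule re[rule_format, OF A as])
  have ec: "e \<in> codes ar \<sigma> (?k + r)"
    using world_tp_codes[OF I(2), of \<sigma> "as1 @ rs1"] rs1 I(3) by (simp add: tuples_def)
  obtain m where m: "\<And>x. x \<in> set xs \<Longrightarrow> x < m" using finite_nat_set_iff_bounded[of "set xs"] by auto
  \<comment> \<open>Fresh variables above all of \<open>xs\<close>; \<open>m + r\<close> is one more
    fresh variable, to be quantified in \<open>allraref\<close>.\<close>
  define zs where "zs = [m..<m + r]"
  have zs: "distinct zs" "length zs = r" "set xs \<inter> set zs = {}" "m + r \<notin> set zs"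
    using m unfolding zs_def by fastforce+
  define fs where "fs = codef ar \<sigma> (xs @ zs) e # map raref zs @ [allraref (m + r) zs]"
  have "is_pla ar \<sigma> (exf zs (conjf fs))"
  proof (intro is_pla_exf is_pla_conjf zs(1))
    fix \<phi> assume "\<phi> \<in> set fs"
    moreover have "is_pla ar \<sigma> (allraref (m + r) zs)" unfolding allraref_def
      by (intro is_pla_notf is_pla_exf is_pla_conjf) (auto intro: is_pla_raref is_pla_notf)
    ultimately show "is_pla ar \<sigma> \<phi>"
      unfolding fs_def using is_pla_codef[OF finite_sigma subset_refl, of ar "xs @ zs" e] is_pla_raref by auto
  qed
  moreover have "fv (exf zs (conjf fs)) \<subseteq> set xs"
  proof -
    have "fv (allraref (m + r) zs) \<subseteq> set zs" using fv_raref[of "m + r"] by (auto simp: allraref_def)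
    then have "fv \<phi> \<subseteq> set xs \<union> set zs" if "\<phi> \<in> set fs" for \<phi>
      using that fv_raref fv_codef[OF finite_sigma, of ar "xs @ zs" e] unfolding fs_def by fastforce
    then show ?thesis by auto
  qed
  moreover have "expresses N 0 xs p (exf zs (conjf fs))"
    unfolding expresses_def
  proof (intro allI impI ballI)
    fix n A as assume n: "1 \<le> n" and A: "A \<in> worlds N n" and as': "as \<in> tuples (dom A) ?k"
    have as: "as \<in> tuples (Dm n) ?k" using as' worldN(1)[OF A] by simp
    have cs: "twoval A (codef ar \<sigma> (xs @ zs) e)"
       "eval A (codef ar \<sigma> (xs @ zs) e) s = 1 \<longleftrightarrow> tp \<sigma> A (map s (xs @ zs)) = e" for s
      using codef_sat[OF finite_sigma _ worldN(4)[OF A], of e "xs @ zs"] ec zs(2) by simp_all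
    have tv: "twoval A \<phi>" if "\<phi> \<in> set fs" for \<phi>
      using that cs(1) raref_sat(1)[OF n A] allraref_sat(1)[OF n A zs(4)] unfolding fs_def by auto
    have fin: "finite (dom A)" using finite_Dm[OF n] worldN(1)[OF A] by simp
    let ?s = "\<lambda>rs. upd (asg xs as) zs rs"
    have "eval A (conjf fs) (?s rs) = 1 \<longleftrightarrow> set rs = Rr n \<and> tp \<sigma> A (as @ rs) = e" if rs: "rs \<in> tuples (Dm n) r" for rs
    proof -
      have l: "length rs = r" "set rs \<subseteq> Dm n" "length as = ?k" using rs as by (auto simp: tuples_def)
      have m1: "map (?s rs) xs = as"
      proof (rule nth_equalityI)
        fix i assume "i < length (map (?s rs) xs)"
        then have i: "i < ?k" by simp
        then have "xs ! i \<notin> set zs" using zs(3) nth_mem by blast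
        then show "map (?s rs) xs ! i = as ! i" using i asg_nth[OF xs l(3) i] by (simp add: upd_notin)
      qed (use l in simp)
      have m2: "map (?s rs) zs = rs"
        by (rule nth_equalityI) (use l zs upd_nth[OF zs(1), of rs] in auto)
      have im: "?s rs ` set zs = set rs" using arg_cong[OF m2, of set] by (simp only: set_map)
      have "eval A (conjf fs) (?s rs) = 1 \<longleftrightarrow> (\<forall>\<phi>\<in>set fs. eval A \<phi> (?s rs) = 1)"
        using eval_conjf[of fs A "?s rs"] tv by simp
      also have "\<dots> \<longleftrightarrow> tp \<sigma> A (as @ rs) = e \<and> (\<forall>z\<in>set zs. eval A (raref z) (?s rs) = 1) \<and> Rr n \<subseteq> set rs"
        unfolding fs_def using cs(2)[of "?s rs"] allraref_sat(2)[OF n A zs(4), of "?s rs"] im m1 m2 by auto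
      also have "(\<forall>z\<in>set zs. eval A (raref z) (?s rs) = 1) \<longleftrightarrow> (\<forall>z\<in>set zs. ?s rs z \<in> Rr n)"
        using raref_sat(2)[OF n A, of "?s rs"] im l(2) by blast
      also have "\<dots> \<longleftrightarrow> set rs \<subseteq> Rr n" unfolding im[symmetric] by (rule image_subset_iff[symmetric])
      finally show ?thesis by blast
    qed
    then have "(\<exists>rs\<in>tuples (Dm n) r. eval A (conjf fs) (?s rs) = 1) \<longleftrightarrow> ct_sat N 0 p n A as"
      unfolding key[OF A as] by blast
    moreover have "twoval A (conjf fs)" using tv by (rule twoval_conjf)
    ultimately show "eval A (exf zs (conjf fs)) (asg xs as) = of_bool (ct_sat N 0 p n A as)"
      using eval_exf[OF _ fin, of "conjf fs" zs "asg xs as"] unfolding zs(2) worldN(1)[OF A] by simp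
  qed
  ultimately show ?thesis by blast
qed

end

section \<open>Asymptotic equivalence and limit distribution\<close>

context base_seq
begin

text \<open>Moves from codes, which require the rare elements to be listed, to closure types of the
  bare tuple.\<close>

lemma determined_ctype:
  assumes det: "determined (\<sigma> - \<tau>) \<phi>" and xs: "fv \<phi> \<subseteq> set xs" "distinct xs"
    and p: "is_complete_ctype N \<sigma> (length xs) p"
  shows "\<exists>c\<in>{0..1}. \<forall>\<epsilon>>0. whp N (\<sigma> - \<tau>) (\<lambda>n A. \<forall>as\<in>tuples (Dm n) (length xs).
    ct_sat N 0 p n A as \<longrightarrow> \<bar>eval A \<phi> (asg xs as) - c\<bar> \<le> \<epsilon>)"
proof (cases "\<exists>n\<ge>1. \<exists>A\<in>worlds N n. \<exists>as\<in>tuples (Dm n) (length xs). ct_sat N 0 p n A as")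
  case False
  have "whp N (\<sigma> - \<tau>) (\<lambda>n A. \<forall>as\<in>tuples (Dm n) (length xs).
    ct_sat N 0 p n A as \<longrightarrow> \<bar>eval A \<phi> (asg xs as) - 0\<bar> \<le> \<epsilon>)" for \<epsilon> :: real
    by (rule whp_always[OF initial_full], rule eventually_mono[OF eventually_ge_at_top[of 1]]) (use False in \<open>auto simp: subnet_full\<close>)
  then show ?thesis by (intro bexI[of _ 0]) auto
next
  case True
  let ?k = "length xs"
  obtain n1 A1 as1 where I: "n1 \<ge> 1" "A1 \<in> worlds N n1" "as1 \<in> tuples (Dm n1) ?k" "ct_sat N 0 p n1 A1 as1"
    using True by blast
  obtain r e where re: "\<forall>n. \<forall>A\<in>worlds N n. \<forall>as\<in>tuples (Dm n) ?k. ct_sat N 0 p n A as \<longrightarrow>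
      (\<exists>rs\<in>tuples (Dm n) r. set rs = Rr n \<and> tp \<sigma> A (as @ rs) = e)"
    using ctype_code[OF p tau_sub I] by blast
  have "\<forall>v\<in>fv \<phi>. pos xs v < ?k + r" using pos[of _ xs] xs(1) by fastforce
  then obtain c where c: "c \<in> {0..1}" "\<And>\<epsilon>. \<epsilon> > 0 \<Longrightarrow> whp N (\<sigma> - \<tau>) (\<lambda>n A. \<forall>V\<in>tuples (Dm n) (?k + r).
      Rr n \<subseteq> set V \<longrightarrow> tp \<sigma> A V = e \<longrightarrow> \<bar>eval A \<phi> (\<lambda>v. V ! pos xs v) - c\<bar> \<le> \<epsilon>)"
    using det[unfolded determined_def tau_Un_diff, rule_format, of "pos xs" "?k + r" e] by blast
  show ?thesis
  proof (intro bexI[OF _ c(1)] allI impI)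
    fix \<epsilon> :: real assume "\<epsilon> > 0"
    from c(2)[OF this] show "whp N (\<sigma> - \<tau>) (\<lambda>n A. \<forall>as\<in>tuples (Dm n) ?k.
      ct_sat N 0 p n A as \<longrightarrow> \<bar>eval A \<phi> (asg xs as) - c\<bar> \<le> \<epsilon>)"
    proof (rule whp_mono[OF initial_full], intro always_eventually allI ballI impI)
      fix n A as
      assume A: "A \<in> worlds (subnet N (\<sigma> - \<tau>)) n" and as: "as \<in> tuples (Dm n) ?k" and s: "ct_sat N 0 p n A as"
        and H: "\<forall>V\<in>tuples (Dm n) (?k + r). Rr n \<subseteq> set V \<longrightarrow> tp \<sigma> A V = e \<longrightarrow> \<bar>eval A \<phi> (\<lambda>v. V ! pos xs v) - c\<bar> \<le> \<epsilon>"
      obtain rs where rs: "rs \<in> tuples (Dm n) r" "set rs = Rr n" "tp \<sigma> A (as @ rs) = e"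
        using re[rule_format, OF A[unfolded subnet_full] as s] by blast
      have "as @ rs \<in> tuples (Dm n) (?k + r)" "Rr n \<subseteq> set (as @ rs)" using rs(1,2) as by (auto simp: tuples_def)
      then have "\<bar>eval A \<phi> (\<lambda>v. (as @ rs) ! pos xs v) - c\<bar> \<le> \<epsilon>" using H rs(3) by blast
      moreover have "length as = ?k" using as by (simp add: tuples_def)
      ultimately show "\<bar>eval A \<phi> (asg xs as) - c\<bar> \<le> \<epsilon>" by (simp only: eval_pos_asg[OF xs])
    qed
  qed
qed

text \<open>The basic formula has one implication for each of finitely many types that cover all
  tuples, which exist because closures are bounded. The constant is the limit value from
  \<open>determined_ctype\<close>; an implication with false premise has value 1 and does not lower
  the minimum.\<close>

lemma asymptotically_basic:
  assumes det: "determined (\<sigma> - \<tau>) \<phi>" and xs: "fv \<phi> \<subseteq> set xs" "distinct xs"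
  shows "\<exists>\<psi>. is_basic N 0 xs \<psi> \<and> asymp_equiv N xs \<phi> \<psi>"
proof -
  let ?k = "length xs"
  obtain M where M: "\<And>n. n \<ge> 1 \<Longrightarrow> card {b. rare N 0 n b} \<le> M" using rare_bounded by blast
  define P where "P = {q. is_complete_ctype N \<sigma> ?k q \<and> dom (ct_struc q) \<subseteq> {..<?k + M}}"
  have finP: "finite P" unfolding P_def by (rule finite_complete_ctypes)
  have cov: "\<exists>q\<in>P. ct_sat N 0 q n A as" if n: "n \<ge> 1" and A: "A \<in> worlds N n" and as: "as \<in> tuples (Dm n) ?k" for n A as
  proof -
    obtain q where q: "is_complete_ctype N \<sigma> ?k q" "dom (ct_struc q) = {..<card (closure_set N 0 n as)}" "ct_sat N 0 q n A as"
      by (rule complete_copy[OF n A as])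
    have "card (closure_set N 0 n as) \<le> card (set as) + card (Rr n)" unfolding closure_0[OF as] by (rule card_Un_le)
    also have "\<dots> \<le> ?k + M" using card_length[of as] M[OF n] as by (simp add: tuples_def Rr_def)
    finally show ?thesis using q unfolding P_def by fastforce
  qed
  have "\<forall>\<^sub>F n in sequentially. 1 \<le> card (Dm n)" using size unfolding filterlim_at_top by blast
  then have "\<forall>\<^sub>F n in sequentially. 1 \<le> card (Dm n) \<and> 1 \<le> n" using eventually_ge_at_top[of 1] by (rule eventually_conj)
  then obtain n where n: "1 \<le> card (Dm n)" "1 \<le> n" using eventually_happens' sequentially_bot by blast
  then have "Dm n \<noteq> {}" by auto
  then obtain x where "x \<in> Dm n" by blast
  then have "replicate ?k x \<in> tuples (Dm n) ?k" by (auto simp: tuples_def)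
  \<comment> \<open>The conjunction must not be empty; some tuple exists because base structures are
    eventually nonempty.\<close>
  then have P0: "P \<noteq> {}" using cov[OF n(2) base_world_N[OF n(2)]] by blast
  have "\<forall>q\<in>P. \<exists>\<kappa>. is_pla ar \<sigma> \<kappa> \<and> fv \<kappa> \<subseteq> set xs \<and> expresses N 0 xs q \<kappa>"
    using expressible[OF _ xs(2)] unfolding P_def by blast
  then obtain \<kappa> where \<kappa>: "\<forall>q\<in>P. is_pla ar \<sigma> (\<kappa> q) \<and> fv (\<kappa> q) \<subseteq> set xs \<and> expresses N 0 xs q (\<kappa> q)" by metis
  define W where "W q x \<epsilon> = whp N (\<sigma> - \<tau>) (\<lambda>n A. \<forall>as\<in>tuples (Dm n) ?k. ct_sat N 0 q n A as \<longrightarrow> \<bar>eval A \<phi> (asg xs as) - x\<bar> \<le> \<epsilon>)" for q x \<epsilon>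
  have "\<forall>q\<in>P. \<exists>c\<in>{0..1}. \<forall>\<epsilon>>0. W q c \<epsilon>" using determined_ctype[OF det xs] unfolding P_def W_def by blast
  then obtain c where c: "\<And>q. q \<in> P \<Longrightarrow> c q \<in> {0..1}" "\<And>q \<epsilon>. q \<in> P \<Longrightarrow> \<epsilon> > 0 \<Longrightarrow> W q (c q) \<epsilon>" by metis
  obtain ps where ps: "set ps = P" using finite_list[OF finP] by blast
  define imp where "imp = (\<lambda>(\<kappa> :: 'r pla, c). Conn (\<lambda>vs. min 1 (1 - vs ! 0 + vs ! 1)) [\<kappa>, Const c])"
  define cs where "cs = map (\<lambda>q. (\<kappa> q, c q)) ps"
  define \<psi> where "\<psi> = Conn (\<lambda>vs. Min (set vs)) (map imp cs)"
  have b: "is_basic N 0 xs \<psi>" unfolding is_basic_def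
  proof (intro exI[of _ cs] conjI)
    show "cs \<noteq> []" using ps P0 by (auto simp: cs_def)
    show "\<psi> = Conn (\<lambda>vs. Min (set vs)) (map (\<lambda>(\<kappa>, c). Conn (\<lambda>vs. min 1 (1 - vs ! 0 + vs ! 1)) [\<kappa>, Const c]) cs)"
      by (simp add: \<psi>_def imp_def)
    have "\<exists>p. is_complete_ctype N \<sigma> ?k p \<and> expresses N 0 xs p (\<kappa> q)" if "q \<in> P" for q
      using \<kappa> that unfolding P_def by blast
    then show "\<forall>(\<kappa>, c)\<in>set cs. c \<in> {0..1} \<and> is_pla ar \<sigma> \<kappa> \<and> fv \<kappa> \<subseteq> set xs \<and>
        (\<exists>l'\<le>0. \<exists>p. is_complete_ctype N \<sigma> ?k p \<and> expresses N l' xs p \<kappa>)"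
      unfolding cs_def set_map ps using \<kappa> c(1) by auto
  qed
  \<comment> \<open>\<open>P\<close> may contain isomorphic copies of a type, so a tuple may satisfy
    several members; each of their constants is within \<epsilon> of the value, and so is the
    minimum.\<close>
  have close: "\<bar>eval A \<phi> (asg xs as) - eval A \<psi> (asg xs as)\<bar> \<le> \<epsilon>"
    if n: "n \<ge> 1" and A: "A \<in> worlds N n" and as: "as \<in> tuples (Dm n) ?k"
      and H: "\<And>q. q \<in> P \<Longrightarrow> ct_sat N 0 q n A as \<Longrightarrow> \<bar>eval A \<phi> (asg xs as) - c q\<bar> \<le> \<epsilon>" for n A as and \<epsilon> :: real
  proof -
    let ?f = "\<lambda>q. min 1 (1 - of_bool (ct_sat N 0 q n A as) + c q)"
    have "eval A (imp (\<kappa> q, c q)) (asg xs as) = ?f q" if "q \<in> P" for q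
      using \<kappa> that n A as worldN(1)[OF A] unfolding imp_def expresses_def by simp
    then have "(\<lambda>q. eval A (imp (\<kappa> q, c q)) (asg xs as)) ` P = ?f ` P" by (rule image_cong[OF refl])
    then have e: "eval A \<psi> (asg xs as) = Min (?f ` P)" unfolding \<psi>_def cs_def ps[symmetric] by (simp add: image_image)
    obtain q0 where q0: "q0 \<in> P" "ct_sat N 0 q0 n A as" using cov[OF n A as] by blast
    have f0: "?f q0 \<le> c q0" using q0(2) by simp
    have "Min (?f ` P) \<le> ?f q0" using finP q0(1) by (intro Min_le) auto
    then have 1: "Min (?f ` P) \<le> eval A \<phi> (asg xs as) + \<epsilon>" using f0 H[OF q0] by linarith
    have "Min (?f ` P) \<in> ?f ` P" using finP P0 by (intro Min_in) auto
    then obtain q where q: "q \<in> P" "Min (?f ` P) = ?f q" by blast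
    have "eval A \<phi> (asg xs as) - \<epsilon> \<le> ?f q"
    proof (cases "ct_sat N 0 q n A as")
      case True
      then show ?thesis using H[OF q(1) True] c(1)[OF q(1)] by auto
    next
      case False
      then have "?f q = 1" using c(1)[OF q(1)] by auto
      then show ?thesis using H[OF q0] c(1)[OF q0(1)] by auto
    qed
    then show ?thesis using 1 unfolding e q(2) by linarith
  qed
  have "asymp_equiv N xs \<phi> \<psi>" unfolding asymp_equiv_def
  proof (intro allI impI tendstoI)
    fix \<epsilon> \<eta> :: real assume \<epsilon>: "\<epsilon> > 0" and \<eta>: "\<eta> > 0"
    have "whp N (\<sigma> - \<tau>) (\<lambda>n A. \<forall>q\<in>P. \<forall>as\<in>tuples (Dm n) ?k. ct_sat N 0 q n A as \<longrightarrow> \<bar>eval A \<phi> (asg xs as) - c q\<bar> \<le> \<epsilon>)"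
      using c(2)[OF _ \<epsilon>] unfolding W_def by (intro whp_ball[OF initial_full finP])
    from this[unfolded whp_def subnet_full, rule_format, of "\<eta> / 2"] \<eta>
    have "\<forall>\<^sub>F n in sequentially. prob N n (\<lambda>A. \<not> (\<forall>q\<in>P. \<forall>as\<in>tuples (Dm n) ?k. ct_sat N 0 q n A as \<longrightarrow> \<bar>eval A \<phi> (asg xs as) - c q\<bar> \<le> \<epsilon>)) \<le> \<eta> / 2"
      by simp
    then show "\<forall>\<^sub>F n in sequentially. dist (prob N n (\<lambda>A. \<exists>as \<in> tuples (dom A) ?k.
         \<bar>eval A \<phi> (asg xs as) - eval A \<psi> (asg xs as)\<bar> > \<epsilon>)) 0 < \<eta>"
      using eventually_ge_at_top[of 1]
    proof eventually_elim
      fix n assume pr: "prob N n (\<lambda>A. \<not> (\<forall>q\<in>P. \<forall>as\<in>tuples (Dm n) ?k. ct_sat N 0 q n A as \<longrightarrow> \<bar>eval A \<phi> (asg xs as) - c q\<bar> \<le> \<epsilon>)) \<le> \<eta> / 2"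
        and n: "(1::nat) \<le> n"
      let ?E = "\<lambda>A. \<exists>as \<in> tuples (dom A) ?k. \<bar>eval A \<phi> (asg xs as) - eval A \<psi> (asg xs as)\<bar> > \<epsilon>"
      have "prob N n ?E \<le> prob N n (\<lambda>A. \<not> (\<forall>q\<in>P. \<forall>as\<in>tuples (Dm n) ?k. ct_sat N 0 q n A as \<longrightarrow> \<bar>eval A \<phi> (asg xs as) - c q\<bar> \<le> \<epsilon>))"
      proof (rule prob_mono[OF initial_full n, unfolded subnet_full], rule notI)
        fix A assume A: "A \<in> worlds N n" and "?E A"
          and H: "\<forall>q\<in>P. \<forall>as\<in>tuples (Dm n) ?k. ct_sat N 0 q n A as \<longrightarrow> \<bar>eval A \<phi> (asg xs as) - c q\<bar> \<le> \<epsilon>"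
        then obtain as where as: "as \<in> tuples (Dm n) ?k" "\<bar>eval A \<phi> (asg xs as) - eval A \<psi> (asg xs as)\<bar> > \<epsilon>"
          using worldN(1)[OF A] by auto
        have "\<bar>eval A \<phi> (asg xs as) - eval A \<psi> (asg xs as)\<bar> \<le> \<epsilon>" using close[OF n A as(1)] H as(1) by blast
        then show False using as(2) by simp
      qed
      then show "dist (prob N n ?E) 0 < \<eta>"
        using pr \<eta> prob_nonneg[OF initial_full n, unfolded subnet_full, of ?E] unfolding dist_real_def by auto
    qed
  qed
  then show ?thesis using b by blast
qed

lemma prob_in_finite:
  assumes n: "n \<ge> 1" and X: "finite X"
  shows "prob N n (\<lambda>A. f A \<in> X) = (\<Sum>e\<in>X. prob N n (\<lambda>A. f A = e))"
proof -
  have "of_bool (f A \<in> X) = (\<Sum>e\<in>X. of_bool (f A = e) :: real)" for A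
    using X by (simp add: of_bool_def sum.delta)
  then show ?thesis
    unfolding prob_expect[OF initial_full n, unfolded subnet_full] by (simp only: expect_sum)
qed

text \<open>Given the type over \<open>\<tau>\<close>, the value is close to \<open>ce e\<close> for
  the full code \<open>e\<close>, whose limit probability is known from \<open>type_limit\<close>;
  codes with the same limit value are merged. The threshold is there because a wider interval may
  contain several limit values, and its probability is then close to the sum of several
  \<beta>.\<close>

lemma type_distribution:
  assumes det: "determined (\<sigma> - \<tau>) \<phi>" and xs: "fv \<phi> \<subseteq> set xs" "distinct xs"
    and theta: "\<And>R. R \<in> \<sigma> - \<tau> \<Longrightarrow> good_aggregations N (theta N R)"
    and p: "is_complete_ctype N \<tau> (length xs) p"
  shows "\<exists>k\<ge>1. \<exists>c \<beta> :: nat \<Rightarrow> real. (\<forall>i\<in>{1..k}. c i \<in> {0..1} \<and> \<beta> i \<in> {0..1}) \<and>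
    (\<exists>\<epsilon>\<^sub>0>0. \<forall>\<epsilon>>0. \<exists>n\<^sub>0\<ge>1. \<forall>n\<ge>n\<^sub>0. \<forall>as \<in> tuples (Dm n) (length xs).
       ct_sat N 0 p n (B n) as \<longrightarrow>
         prob N n (\<lambda>A. eval A \<phi> (asg xs as) \<in> (\<Union>i\<in>{1..k}. {c i - \<epsilon>..c i + \<epsilon>})) \<ge> 1 - \<epsilon> \<and>
         (\<epsilon> < \<epsilon>\<^sub>0 \<longrightarrow> (\<forall>i\<in>{1..k}.
           prob N n (\<lambda>A. eval A \<phi> (asg xs as) \<in> {c i - \<epsilon>..c i + \<epsilon>}) \<in> {\<beta> i - \<epsilon>..\<beta> i + \<epsilon>})))"
proof (cases "\<exists>n\<ge>1. \<exists>as\<in>tuples (Dm n) (length xs). ct_sat N 0 p n (B n) as")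
  case False
  show ?thesis
    by (rule exI[of _ 1], intro conjI exI[of _ "\<lambda>_. 0"] exI[of _ 1] allI impI) (use False in auto)
next
  case True
  let ?k = "length xs"
  note pmono = prob_mono[OF initial_full, unfolded subnet_full]
  obtain n1 as1 where I: "n1 \<ge> 1" "as1 \<in> tuples (Dm n1) ?k" "ct_sat N 0 p n1 (B n1) as1" using True by blast
  obtain r d where rd: "\<forall>n. \<forall>A\<in>worlds N n. \<forall>as\<in>tuples (Dm n) ?k. ct_sat N 0 p n A as \<longrightarrow>
      (\<exists>rs\<in>tuples (Dm n) r. set rs = Rr n \<and> tp \<tau> A (as @ rs) = d)"
    using ctype_code[OF p subset_refl I(1) base_world_N[OF I(1)] I(2,3)] by blast
  let ?K = "?k + r"
  define EE where "EE = {e \<in> codes ar \<sigma> ?K. restr \<tau> e = d}"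
  have finE: "finite EE" unfolding EE_def using finite_codes[OF finite_sigma] by simp
  have inEE: "tp \<sigma> A (as @ rs) \<in> EE"
    if "A \<in> worlds N n" "as \<in> tuples (Dm n) ?k" "rs \<in> tuples (Dm n) r" "tp \<tau> (B n) (as @ rs) = d" for n A as rs
    using world_tp_codes[OF that(1), of \<sigma> "as @ rs"] world_tp_tau[OF that(1), of "as @ rs"]
      restr_tp[OF tau_sub, of A "as @ rs"] that(2-4) unfolding EE_def by (simp add: tuples_def)
  have E0: "EE \<noteq> {}" using rd[rule_format, OF base_world_N[OF I(1)] I(2,3)] inEE[OF base_world_N[OF I(1)] I(2)] by blast
  have ip: "\<forall>v\<in>fv \<phi>. pos xs v < ?K" using pos[of _ xs] xs(1) by fastforce
  define W where "W e x \<epsilon> = whp N (\<sigma> - \<tau>) (\<lambda>n A. \<forall>V\<in>tuples (Dm n) ?K.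
      Rr n \<subseteq> set V \<longrightarrow> tp \<sigma> A V = e \<longrightarrow> \<bar>eval A \<phi> (\<lambda>v. V ! pos xs v) - x\<bar> \<le> \<epsilon>)" for e x \<epsilon>
  have "\<forall>e. \<exists>c\<in>{0..1}. \<forall>\<epsilon>>0. W e c \<epsilon>"
    using det[unfolded determined_def tau_Un_diff, rule_format, of "pos xs" ?K] ip unfolding W_def by blast
  then obtain ce where ce: "\<And>e. ce e \<in> {0..1}" "\<And>e \<epsilon>. \<epsilon> > 0 \<Longrightarrow> W e (ce e) \<epsilon>" by metis
  define T where "T e b \<epsilon> \<longleftrightarrow> (\<forall>\<^sub>F n in sequentially. \<forall>us\<in>tuples (Dm n) ?K. Rr n \<subseteq> set us \<longrightarrow>
      tp \<tau> (B n) us = restr \<tau> e \<longrightarrow> \<bar>prob N n (\<lambda>A. tp \<sigma> A us = e) - b\<bar> \<le> \<epsilon>)" for e b and \<epsilon> :: real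
  have "\<forall>e. \<exists>b\<in>{0..1}. \<forall>\<epsilon>>0. T e b \<epsilon>"
    using type_limit[OF theta initial_full, unfolded subnet_full tau_Un_diff, of ?K] unfolding T_def by blast
  then obtain be where be: "\<And>e. be e \<in> {0..1}" "\<And>e \<epsilon>. \<epsilon> > 0 \<Longrightarrow> T e (be e) \<epsilon>" by metis
  obtain cs where cs: "set cs = ce ` EE" using finite_list[OF finite_imageI[OF finE, of ce]] by metis
  define kk where "kk = length cs"
  define X where "X x = {e \<in> EE. ce e = x}" for x
  define c where "c i = cs ! (i - 1)" for i :: nat
  \<comment> \<open>If \<open>d\<close> stops occurring, the numbers \<open>be e\<close> are
    arbitrary and their sum may exceed 1; as probabilities do not, cutting it off is
    harmless.\<close>
  define \<beta> where "\<beta> i = min 1 (\<Sum>e\<in>X (c i). be e)" for i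
  have "cs \<noteq> []" using cs E0 by auto
  then have kk: "kk \<ge> 1" unfolding kk_def by (cases cs) auto
  have c_in: "c i \<in> ce ` EE" if "i \<in> {1..kk}" for i
    unfolding cs[symmetric] c_def using that by (intro nth_mem) (auto simp: kk_def)
  have c_ex: "\<exists>i\<in>{1..kk}. c i = x" if x: "x \<in> ce ` EE" for x
  proof -
    obtain j where "j < kk" "cs ! j = x" using x[folded cs] by (metis in_set_conv_nth kk_def)
    then show ?thesis by (intro bexI[of _ "Suc j"]) (auto simp: c_def)
  qed
  \<comment> \<open>Half the least gap between distinct limit values: for smaller \<epsilon>, a
    value in the interval about \<open>c i\<close> cannot be \<epsilon>-close to another limit
    value. The 1 covers the case of a single limit value.\<close>
  define \<epsilon>0 where "\<epsilon>0 = Min (insert 1 ((\<lambda>(x, y). \<bar>x - y\<bar> / 2) ` {(x, y) \<in> ce ` EE \<times> ce ` EE. x \<noteq> y}))"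
  have finG: "finite (insert 1 ((\<lambda>(x, y). \<bar>x - y\<bar> / 2) ` {(x, y) \<in> ce ` EE \<times> ce ` EE. x \<noteq> y}))"
    using finE by (intro finite.insertI finite_imageI finite_subset[OF _ finite_cartesian_product[of "ce ` EE" "ce ` EE"]]) auto
  have \<epsilon>0: "\<epsilon>0 > 0" unfolding \<epsilon>0_def using finG by (subst Min_gr_iff) auto
  have gap: "\<epsilon>0 \<le> \<bar>x - y\<bar> / 2" if "x \<in> ce ` EE" "y \<in> ce ` EE" "x \<noteq> y" for x y
    unfolding \<epsilon>0_def using finG by (rule Min_le) (use that in force)
  show ?thesis
  proof (rule exI[of _ kk], intro conjI kk, rule exI[of _ c], rule exI[of _ \<beta>], intro conjI ballI)
    fix i assume i: "i \<in> {1..kk}"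
    show "c i \<in> {0..1}" using c_in[OF i] ce(1) by auto
    have "0 \<le> (\<Sum>e\<in>X (c i). be e)" using be(1) by (intro sum_nonneg) auto
    then show "\<beta> i \<in> {0..1}" unfolding \<beta>_def by simp
  next
    show "\<exists>\<epsilon>\<^sub>0>0. \<forall>\<epsilon>>0. \<exists>n\<^sub>0\<ge>1. \<forall>n\<ge>n\<^sub>0. \<forall>as \<in> tuples (Dm n) ?k.
       ct_sat N 0 p n (B n) as \<longrightarrow>
         prob N n (\<lambda>A. eval A \<phi> (asg xs as) \<in> (\<Union>i\<in>{1..kk}. {c i - \<epsilon>..c i + \<epsilon>})) \<ge> 1 - \<epsilon> \<and>
         (\<epsilon> < \<epsilon>\<^sub>0 \<longrightarrow> (\<forall>i\<in>{1..kk}.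
           prob N n (\<lambda>A. eval A \<phi> (asg xs as) \<in> {c i - \<epsilon>..c i + \<epsilon>}) \<in> {\<beta> i - \<epsilon>..\<beta> i + \<epsilon>}))"
    proof (intro exI[of _ \<epsilon>0] conjI \<epsilon>0 allI impI)
      fix \<epsilon> :: real assume \<epsilon>: "\<epsilon> > 0"
      \<comment> \<open>Summed over at most \<open>card EE\<close> codes this error is at most
        \<open>\<epsilon> / 2\<close>; the other half is left for the exceptional event.\<close>
      define \<delta> where "\<delta> = \<epsilon> / (2 * (real (card EE) + 1))"
      have \<delta>: "\<delta> > 0" using \<epsilon> by (simp add: \<delta>_def)
      define H where "H n A \<longleftrightarrow> (\<forall>e\<in>EE. \<forall>V\<in>tuples (Dm n) ?K.
        Rr n \<subseteq> set V \<longrightarrow> tp \<sigma> A V = e \<longrightarrow> \<bar>eval A \<phi> (\<lambda>v. V ! pos xs v) - ce e\<bar> \<le> \<epsilon>)" for n A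
      have "whp N (\<sigma> - \<tau>) H" unfolding H_def
        using ce(2)[OF \<epsilon>] unfolding W_def by (intro whp_ball[OF initial_full finE])
      from this[unfolded whp_def subnet_full, rule_format, of "\<epsilon> / 2"] \<epsilon>
      have ev1: "\<forall>\<^sub>F n in sequentially. prob N n (\<lambda>A. \<not> H n A) \<le> \<epsilon> / 2" by simp
      have ev2: "\<forall>\<^sub>F n in sequentially. \<forall>e\<in>EE. \<forall>us\<in>tuples (Dm n) ?K. Rr n \<subseteq> set us \<longrightarrow>
          tp \<tau> (B n) us = restr \<tau> e \<longrightarrow> \<bar>prob N n (\<lambda>A. tp \<sigma> A us = e) - be e\<bar> \<le> \<delta>"
        using be(2)[OF \<delta>] unfolding T_def by (intro eventually_ball_finite finE) blast
      obtain m where m: "\<And>n. n \<ge> m \<Longrightarrow> prob N n (\<lambda>A. \<not> H n A) \<le> \<epsilon> / 2"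
        "\<And>n. n \<ge> m \<Longrightarrow> \<forall>e\<in>EE. \<forall>us\<in>tuples (Dm n) ?K. Rr n \<subseteq> set us \<longrightarrow>
          tp \<tau> (B n) us = restr \<tau> e \<longrightarrow> \<bar>prob N n (\<lambda>A. tp \<sigma> A us = e) - be e\<bar> \<le> \<delta>"
        using eventually_conj[OF ev1 ev2] unfolding eventually_sequentially by blast
      have main: "prob N n (\<lambda>A. eval A \<phi> (asg xs as) \<in> (\<Union>i\<in>{1..kk}. {c i - \<epsilon>..c i + \<epsilon>})) \<ge> 1 - \<epsilon> \<and>
         (\<epsilon> < \<epsilon>0 \<longrightarrow> (\<forall>i\<in>{1..kk}.
           prob N n (\<lambda>A. eval A \<phi> (asg xs as) \<in> {c i - \<epsilon>..c i + \<epsilon>}) \<in> {\<beta> i - \<epsilon>..\<beta> i + \<epsilon>}))"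
        if n': "n \<ge> max 1 m" and as: "as \<in> tuples (Dm n) ?k" and sat: "ct_sat N 0 p n (B n) as" for n as
      proof -
        have n: "n \<ge> 1" "n \<ge> m" using n' by auto
        let ?v = "\<lambda>A. eval A \<phi> (asg xs as)"
        obtain rs where rs: "rs \<in> tuples (Dm n) r" "set rs = Rr n" "tp \<tau> (B n) (as @ rs) = d"
          using rd[rule_format, OF base_world_N[OF n(1)] as sat] by blast
        let ?V = "as @ rs"
        have V: "?V \<in> tuples (Dm n) ?K" "Rr n \<subseteq> set ?V" using rs as by (auto simp: tuples_def)
        have las: "length as = ?k" using as by (simp add: tuples_def)
        note iE = inEE[OF _ as rs(1,3)]
        have hv: "\<bar>?v A - ce (tp \<sigma> A ?V)\<bar> \<le> \<epsilon>" if A: "A \<in> worlds N n" and h: "H n A" for A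
          using h[unfolded H_def, rule_format, OF iE[OF A] V refl] unfolding eval_pos_asg[OF xs las] .
        have pH: "prob N n (\<lambda>A. \<not> H n A) \<le> \<epsilon> / 2" by (rule m(1)[OF n(2)])
        have "1 - \<epsilon> \<le> prob N n (H n)"
          using prob_not[OF initial_full n(1), unfolded subnet_full, of "H n"] pH \<epsilon> by linarith
        also have "\<dots> \<le> prob N n (\<lambda>A. ?v A \<in> (\<Union>i\<in>{1..kk}. {c i - \<epsilon>..c i + \<epsilon>}))"
        proof (rule pmono[OF n(1)])
          fix A assume A: "A \<in> worlds N n" and h: "H n A"
          obtain i where "i \<in> {1..kk}" "c i = ce (tp \<sigma> A ?V)" using c_ex iE[OF A] by blast
          moreover have "?v A \<in> {c i - \<epsilon>..c i + \<epsilon>}" if "c i = ce (tp \<sigma> A ?V)" for i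
            using hv[OF A h] unfolding that abs_le_iff by simp
          ultimately show "?v A \<in> (\<Union>i\<in>{1..kk}. {c i - \<epsilon>..c i + \<epsilon>})" by blast
        qed
        finally have first: "1 - \<epsilon> \<le> prob N n (\<lambda>A. ?v A \<in> (\<Union>i\<in>{1..kk}. {c i - \<epsilon>..c i + \<epsilon>}))" .
        have second: "prob N n (\<lambda>A. ?v A \<in> {c i - \<epsilon>..c i + \<epsilon>}) \<in> {\<beta> i - \<epsilon>..\<beta> i + \<epsilon>}"
          if i: "i \<in> {1..kk}" and e0: "\<epsilon> < \<epsilon>0" for i
        proof -
          let ?P = "prob N n (\<lambda>A. ?v A \<in> {c i - \<epsilon>..c i + \<epsilon>})" and ?Q = "prob N n (\<lambda>A. tp \<sigma> A ?V \<in> X (c i))"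
          let ?S = "\<Sum>e\<in>X (c i). be e"
          have iff: "?v A \<in> {c i - \<epsilon>..c i + \<epsilon>} \<longleftrightarrow> tp \<sigma> A ?V \<in> X (c i)" if A: "A \<in> worlds N n" and h: "H n A" for A
          proof
            assume "tp \<sigma> A ?V \<in> X (c i)"
            then have "ce (tp \<sigma> A ?V) = c i" by (simp add: X_def)
            then show "?v A \<in> {c i - \<epsilon>..c i + \<epsilon>}" using hv[OF A h] unfolding abs_le_iff by simp
          next
            assume v: "?v A \<in> {c i - \<epsilon>..c i + \<epsilon>}"
            have "ce (tp \<sigma> A ?V) = c i"
            proof (rule ccontr)
              assume "ce (tp \<sigma> A ?V) \<noteq> c i"
              then have "\<epsilon>0 \<le> \<bar>ce (tp \<sigma> A ?V) - c i\<bar> / 2" using gap c_in[OF i] iE[OF A] by blast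
              moreover have "c i - \<epsilon> \<le> ?v A" "?v A \<le> c i + \<epsilon>" using v by auto
              ultimately show False using hv[OF A h] e0 by argo
            qed
            then show "tp \<sigma> A ?V \<in> X (c i)" using iE[OF A] by (simp add: X_def)
          qed
          have q1: "?P \<le> ?Q + \<epsilon> / 2"
          proof -
            have "?P \<le> prob N n (\<lambda>A. tp \<sigma> A ?V \<in> X (c i) \<or> \<not> H n A)" using iff by (intro pmono[OF n(1)]) blast
            also have "\<dots> \<le> ?Q + prob N n (\<lambda>A. \<not> H n A)" by (rule prob_disj_le[OF initial_full n(1), unfolded subnet_full])
            finally show ?thesis using pH by linarith
          qed
          have q2: "?Q \<le> ?P + \<epsilon> / 2"
          proof -
            have "?Q \<le> prob N n (\<lambda>A. ?v A \<in> {c i - \<epsilon>..c i + \<epsilon>} \<or> \<not> H n A)" using iff by (intro pmono[OF n(1)]) blast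
            also have "\<dots> \<le> ?P + prob N n (\<lambda>A. \<not> H n A)" by (rule prob_disj_le[OF initial_full n(1), unfolded subnet_full])
            finally show ?thesis using pH by linarith
          qed
          have XE: "X (c i) \<subseteq> EE" by (auto simp: X_def)
          have "\<bar>?Q - ?S\<bar> = \<bar>\<Sum>e\<in>X (c i). prob N n (\<lambda>A. tp \<sigma> A ?V = e) - be e\<bar>"
            by (simp only: prob_in_finite[OF n(1) finite_subset[OF XE finE]] sum_subtractf)
          also have "\<dots> \<le> (\<Sum>e\<in>X (c i). \<delta>)"
          proof (rule order_trans[OF sum_abs sum_mono])
            fix e assume "e \<in> X (c i)"
            then have e: "e \<in> EE" using XE by blast
            then have "tp \<tau> (B n) ?V = restr \<tau> e" using rs(3) by (simp add: EE_def)
            then show "\<bar>prob N n (\<lambda>A. tp \<sigma> A ?V = e) - be e\<bar> \<le> \<delta>" using m(2)[OF n(2)] e V by blast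
          qed
          also have "\<dots> \<le> real (card EE) * \<delta>" using \<delta> card_mono[OF finE XE] by (simp add: mult_right_mono)
          also have "\<dots> \<le> \<epsilon> / 2" using \<epsilon> by (simp add: \<delta>_def field_simps)
          finally have q3: "\<bar>?Q - ?S\<bar> \<le> \<epsilon> / 2" .
          have q4: "?P \<le> 1" by (rule prob_le_1[OF initial_full n(1), unfolded subnet_full])
          have "?P \<le> ?S + \<epsilon>" "?S - \<epsilon> \<le> ?P" using q1 q2 q3 by argo+
          then show ?thesis using q4 \<epsilon> unfolding \<beta>_def atLeastAtMost_iff min_def by (simp split: if_split)
        qed
        show ?thesis using first second by blast
      qed
      show "\<exists>n\<^sub>0\<ge>1. \<forall>n\<ge>n\<^sub>0. \<forall>as \<in> tuples (Dm n) ?k. ct_sat N 0 p n (B n) as \<longrightarrow>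
         prob N n (\<lambda>A. eval A \<phi> (asg xs as) \<in> (\<Union>i\<in>{1..kk}. {c i - \<epsilon>..c i + \<epsilon>})) \<ge> 1 - \<epsilon> \<and>
         (\<epsilon> < \<epsilon>0 \<longrightarrow> (\<forall>i\<in>{1..kk}.
           prob N n (\<lambda>A. eval A \<phi> (asg xs as) \<in> {c i - \<epsilon>..c i + \<epsilon>}) \<in> {\<beta> i - \<epsilon>..\<beta> i + \<epsilon>}))"
        using main by (intro exI[of _ "max 1 m"] conjI allI ballI impI) auto
    qed
  qed
qed

end

theorem theorem12p6:
  fixes N :: "('a, 'r) net" and \<phi> :: "'r pla" and xs :: "nat list"
  assumes net: "is_net N"
    and size: "filterlim (\<lambda>n. card (dom (base N n))) at_top sequentially"
    and degree: "\<exists>\<Delta>. \<forall>n\<ge>1. \<forall>a \<in> dom (base N n). card {b. (a, b) \<in> gaifman (tau N) (base N n)} \<le> \<Delta>"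
    and poly: "\<exists>P :: real poly. \<forall>n\<ge>1. real (card (dom (base N n))) \<le> poly P (real n)"
    and types: "\<And>l k p. k \<ge> 1 \<Longrightarrow> is_ntype N k p \<Longrightarrow> one_class N l p \<Longrightarrow>
        bounded_ntype N l p \<or>
        (\<exists>f. superlog f \<and> (\<forall>\<^sub>F n in sequentially. f n \<le> real (card (ntype_set N l p n))))"
    and theta: "\<And>R. R \<in> sigma N - tau N \<Longrightarrow> good_aggregations N (theta N R)"
    and phi: "is_pla (arity N) (sigma N) \<phi>" "distinct xs" "fv \<phi> \<subseteq> set xs"
    and phi_agg: "good_aggregations N \<phi>"
  shows "(\<exists>\<psi>. is_basic N 0 xs \<psi> \<and> asymp_equiv N xs \<phi> \<psi>) \<and>
    (\<forall>p. is_complete_ctype N (tau N) (length xs) p \<longrightarrow>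
      (\<exists>k\<ge>1. \<exists>c \<beta> :: nat \<Rightarrow> real. (\<forall>i\<in>{1..k}. c i \<in> {0..1} \<and> \<beta> i \<in> {0..1}) \<and>
        (\<exists>\<epsilon>\<^sub>0>0. \<forall>\<epsilon>>0. \<exists>n\<^sub>0\<ge>1. \<forall>n\<ge>n\<^sub>0. \<forall>as \<in> tuples (dom (base N n)) (length xs).
           ct_sat N 0 p n (base N n) as \<longrightarrow>
             prob N n (\<lambda>A. eval A \<phi> (asg xs as) \<in> (\<Union>i\<in>{1..k}. {c i - \<epsilon>..c i + \<epsilon>})) \<ge> 1 - \<epsilon> \<and>
             (\<epsilon> < \<epsilon>\<^sub>0 \<longrightarrow> (\<forall>i\<in>{1..k}.
               prob N n (\<lambda>A. eval A \<phi> (asg xs as) \<in> {c i - \<epsilon>..c i + \<epsilon>}) \<in> {\<beta> i - \<epsilon>..\<beta> i + \<epsilon>})))))"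
proof -
  obtain \<Delta> where \<Delta>: "\<And>n x. n \<ge> 1 \<Longrightarrow> x \<in> dom (base N n) \<Longrightarrow> card {b. (x, b) \<in> gaifman (tau N) (base N n)} \<le> \<Delta>"
    using degree by blast
  obtain P :: "real poly" where P: "\<And>n. n \<ge> 1 \<Longrightarrow> real (card (dom (base N n))) \<le> poly P (real n)" using poly by blast
  have ev: "\<forall>\<^sub>F n in sequentially. card (dom (base N n)) \<le> n ^ (degree P + 1)"
    using poly_le_power[of P] eventually_ge_at_top[of 1]
  proof eventually_elim
    fix n :: nat assume a: "poly P (real n) \<le> real n ^ (degree P + 1)" "1 \<le> n"
    have "real (card (dom (base N n))) \<le> real (n ^ (degree P + 1))" using P[OF a(2)] a(1) by simp
    then show "card (dom (base N n)) \<le> n ^ (degree P + 1)" by (simp only: of_nat_le_iff)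
  qed
  interpret base_seq N \<Delta> "degree P + 1"
    using net size \<Delta> ev types by unfold_locales
  have det: "determined (\<sigma> - \<tau>) \<phi>"
  proof (rule determined_pla[OF initial_full])
    show "balance (\<sigma> - \<tau>) m t" if "m \<ge> 1" "good m t" for m t using theta initial_full that by (rule balance_all)
    show "is_pla ar (\<tau> \<union> (\<sigma> - \<tau>)) \<phi>" using phi(1) by (simp only: tau_Un_diff)
  qed (rule phi_agg)
  show ?thesis
    using asymptotically_basic[OF det phi(3,2)] type_distribution[OF det phi(3,2) theta] by blast
qed

end
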